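(* Let $3<q<\infty$, let $\varphi\in W^{2-2/q}_q(\Omega)$ with $\partial_x\varphi(0)=\partial_x\varphi(1)=0$, and let an initial phase distribution be given for which the phase changes at exactly one point $b\in(0,1)$: the process is in phase I for $x<b$ and in phase II for $x>b$ (so $\varphi<\beta$ on $[0,b)$ and $\varphi>\alpha$ on $(b,1]$). Assume that $\varphi(b)=\alpha$ and $\partial_x\varphi(b)>0$. Then there exists $T>0$, depending on $q$ and $\varphi$, such that the hysteresis problem $$\partial_t u-\Delta u=\mathcal H(u)\ \text{ in } Q_T,\qquad \partial_x u=0\ \text{ on } S_T,\qquad u(x,0)=\varphi(x)\ \text{ in }\Omega$$ has a solution $u\in W^{2,1}_q(Q_T)$ whose interphase boundary for $t\in[0,T]$ is described by the equation $x=s(t)$, where $s:[0,T]\to(0,1)$ is a nondecreasing function that is Hölder continuous with exponent $1/2$.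
   Context: $\Omega=(0,1)$, $Q_T=\Omega\times(0,T]$, $S_T=\partial\Omega\times(0,T]$, $\Delta=\partial_x^2$; $\alpha<0<\beta$ are fixed thresholds. $W^{2,1}_q(Q_T)$ is the parabolic Sobolev space with norm $\|\partial_t v\|_{q}+\|\Delta v\|_{q}+\|v\|_{q}$ (norms in $L^q(Q_T)$), and $W^{2-2/q}_q(\Omega)$ is its trace space at $t=0$; for $q>3$ elements of $W^{2,1}_q(Q_T)$ are, together with $\partial_x v$, continuous on $\overline Q_T$, and $W^{2-2/q}_q(\Omega)\subset C^1(\overline\Omega)$. Initial phase distribution: a function $p:\Omega\to\{1,-1\}$, with $p(x)=1$ meaning phase I and $p(x)=-1$ meaning phase II at $x$, such that $p(x)=1$ whenever $\varphi(x)\le\alpha$ and $p(x)=-1$ whenever $\varphi(x)\ge\beta$; where $\alpha<\varphi(x)<\beta$ the phase may be prescribed arbitrarily. Hysteresis operator: for $u$ continuous on $\overline Q_T$ with $u(\cdot,0)=\varphi$, put $\mathcal H(u(x,0))=p(x)$; $\mathcal H(u(x,t))=1$ if $u(x,t)\le\alpha$; $\mathcal H(u(x,t))=-1$ if $u(x,t)\ge\beta$. Let $E=\{(x,t)\in Q_T:u\le\alpha\}\cup\{(x,t)\in Q_T:u\ge\beta\}\cup(\Omega\times\{0\})$. If $(x,t)\notin E$, put $\mathcal H(u(x,t))=\mathcal H(u(x,\tau(x)))$ with $\tau(x)=\max\{s\le t:(x,s)\in E\}$. The solution is in phase I at $(x,t)$ if $\mathcal H(u(x,t))=1$ and in phase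 II if $\mathcal H(u(x,t))=-1$. The equation is understood almost everywhere. "The interphase boundary is described by $x=s(t)$" means that $s(0)=b$ and, for $t\in[0,T]$, $\mathcal H(u(x,t))=1$ for $0<x<s(t)$ and $\mathcal H(u(x,t))=-1$ for $s(t)<x<1$. *)

theory Defs
  imports "HOL-Analysis.Analysis"
begin

section \<open>Parabolic cylinder and Lebesgue spaces\<close>

text \<open>Points of the plane are pairs \<open>(x, t)\<close>: space first, time second.\<close>

definition Omega :: "real set" where
  "Omega = {0<..<1}"

definition cylinder :: "real \<Rightarrow> (real \<times> real) set" where
  "cylinder T = Omega \<times> {0<..T}"

definition Lq_space :: "real \<Rightarrow> (real \<times> real) set \<Rightarrow> (real \<times> real \<Rightarrow> real) set" where
  "Lq_space q S = {f. f \<in> borel_measurable (lebesgue_on S) \<and>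
     integrable (lebesgue_on S) (\<lambda>z. \<bar>f z\<bar> powr q)}"


section \<open>Weak derivatives\<close>

definition partial_x :: "(real \<times> real \<Rightarrow> real) \<Rightarrow> real \<times> real \<Rightarrow> real" where
  "partial_x f = (\<lambda>(x, t). deriv (\<lambda>y. f (y, t)) x)"

definition partial_t :: "(real \<times> real \<Rightarrow> real) \<Rightarrow> real \<times> real \<Rightarrow> real" where
  "partial_t f = (\<lambda>(x, t). deriv (\<lambda>s. f (x, s)) t)"

primrec times_cont_diff :: "nat \<Rightarrow> (real \<times> real \<Rightarrow> real) \<Rightarrow> bool" where
  "times_cont_diff 0 f \<longleftrightarrow> continuous_on UNIV f"
| "times_cont_diff (Suc k) f \<longleftrightarrow> f differentiable_on UNIV \<and>
     times_cont_diff k (partial_x f) \<and> times_cont_diff k (partial_t f)"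

definition test_functions :: "(real \<times> real) set \<Rightarrow> (real \<times> real \<Rightarrow> real) set" where
  "test_functions G = {\<psi>. (\<forall>k. times_cont_diff k \<psi>) \<and>
     compact (closure {z. \<psi> z \<noteq> 0}) \<and> closure {z. \<psi> z \<noteq> 0} \<subseteq> G}"

text \<open>\<open>w\<close> is the weak derivative of \<open>v\<close> on the interior of \<open>S\<close> for the operator \<open>D\<close>, a composition of
  \<open>m\<close> first-order partial derivatives.  It is only meant for locally integrable \<open>v\<close>, \<open>w\<close>; below
  both are always required to be in \<open>L\<^sup>q\<close>.\<close>

definition is_weak_deriv ::
  "((real \<times> real \<Rightarrow> real) \<Rightarrow> real \<times> real \<Rightarrow> real) \<Rightarrow> nat \<Rightarrow> (real \<times> real) set \<Rightarrow>
   (real \<times> real \<Rightarrow> real) \<Rightarrow> (real \<times> real \<Rightarrow> real) \<Rightarrow> bool" where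
  "is_weak_deriv D m S v w \<longleftrightarrow> (\<forall>\<psi> \<in> test_functions (interior S).
     (LINT z|lebesgue_on S. v z * D \<psi> z) = (-1) ^ m * (LINT z|lebesgue_on S. w z * \<psi> z))"

abbreviation weak_t where
  "weak_t \<equiv> is_weak_deriv partial_t 1"

abbreviation weak_x where
  "weak_x \<equiv> is_weak_deriv partial_x 1"

abbreviation weak_xx where
  "weak_xx \<equiv> is_weak_deriv (\<lambda>\<psi>. partial_x (partial_x \<psi>)) 2"


section \<open>The parabolic Sobolev space and its trace space\<close>

definition W21 :: "real \<Rightarrow> real \<Rightarrow> (real \<times> real \<Rightarrow> real) set" where
  "W21 q T = {v \<in> Lq_space q (cylinder T).
     (\<exists>vt \<in> Lq_space q (cylinder T). weak_t (cylinder T) v vt) \<and>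
     (\<exists>vx \<in> Lq_space q (cylinder T). weak_x (cylinder T) v vx) \<and>
     (\<exists>vxx \<in> Lq_space q (cylinder T). weak_xx (cylinder T) v vxx)}"

text \<open>The space \<open>W\<^sup>2\<^sup>-\<^sup>2\<^sup>/\<^sup>q\<close> over \<open>L\<^sup>q\<close>, as the space of traces at \<open>t = 0\<close>, for the range \<open>q > 3\<close> where the
  elements of \<^const>\<open>W21\<close> have representatives continuous on the closed cylinder.  Its elements are
  identified with their continuous representatives on \<open>[0, 1]\<close>.  The height \<open>T\<close> of the cylinder is
  immaterial.\<close>

definition trace_space :: "real \<Rightarrow> (real \<Rightarrow> real) set" where
  "trace_space q = {\<phi>. \<exists>T>0. \<exists>v \<in> W21 q T.
     continuous_on (closure (cylinder T)) v \<and> (\<forall>x \<in> closure Omega. v (x, 0) = \<phi> x)}"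


section \<open>Hysteresis\<close>

definition initial_phase :: "real \<Rightarrow> real \<Rightarrow> (real \<Rightarrow> real) \<Rightarrow> (real \<Rightarrow> real) \<Rightarrow> bool" where
  "initial_phase \<alpha> \<beta> \<phi> p \<longleftrightarrow> (\<forall>x \<in> Omega. p x \<in> {1, -1} \<and>
     (\<phi> x \<le> \<alpha> \<longrightarrow> p x = 1) \<and> (\<phi> x \<ge> \<beta> \<longrightarrow> p x = -1))"

definition switching_set ::
  "real \<Rightarrow> real \<Rightarrow> real \<Rightarrow> (real \<times> real \<Rightarrow> real) \<Rightarrow> (real \<times> real) set" where
  "switching_set \<alpha> \<beta> T u =
     {z \<in> cylinder T. u z \<le> \<alpha>} \<union> {z \<in> cylinder T. u z \<ge> \<beta>} \<union> Omega \<times> {0}"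

text \<open>The values of the hysteresis operator on the switching set.\<close>

definition switching_value ::
  "real \<Rightarrow> (real \<Rightarrow> real) \<Rightarrow> (real \<times> real \<Rightarrow> real) \<Rightarrow> real \<times> real \<Rightarrow> real" where
  "switching_value \<alpha> p u = (\<lambda>(x, t). if t = 0 then p x else if u (x, t) \<le> \<alpha> then 1 else -1)"

text \<open>For \<open>u\<close> continuous on the closed cylinder and \<open>(x, t)\<close> in the cylinder, the greatest element
  below exists.\<close>

definition last_switch ::
  "real \<Rightarrow> real \<Rightarrow> real \<Rightarrow> (real \<times> real \<Rightarrow> real) \<Rightarrow> real \<times> real \<Rightarrow> real" where
  "last_switch \<alpha> \<beta> T u = (\<lambda>(x, t). GREATEST s. s \<le> t \<and> (x, s) \<in> switching_set \<alpha> \<beta> T u)"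

definition hysteresis ::
  "real \<Rightarrow> real \<Rightarrow> real \<Rightarrow> (real \<Rightarrow> real) \<Rightarrow> (real \<times> real \<Rightarrow> real) \<Rightarrow> real \<times> real \<Rightarrow> real" where
  "hysteresis \<alpha> \<beta> T p u = (\<lambda>(x, t).
     if (x, t) \<in> switching_set \<alpha> \<beta> T u then switching_value \<alpha> p u (x, t)
     else switching_value \<alpha> p u (x, last_switch \<alpha> \<beta> T u (x, t)))"


section \<open>Solutions and the interphase boundary\<close>

text \<open>The solution is its continuous representative, so that the initial condition, the boundary
  condition (with one-sided derivatives) and the hysteresis operator have pointwise meaning.\<close>

definition hysteresis_solution ::
  "real \<Rightarrow> real \<Rightarrow> real \<Rightarrow> real \<Rightarrow> (real \<Rightarrow> real) \<Rightarrow> (real \<Rightarrow> real) \<Rightarrow> (real \<times> real \<Rightarrow> real) \<Rightarrow> bool"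
where
  "hysteresis_solution q \<alpha> \<beta> T \<phi> p u \<longleftrightarrow>
     u \<in> W21 q T \<and>
     continuous_on (closure (cylinder T)) u \<and>
     (\<exists>ut \<in> Lq_space q (cylinder T). \<exists>uxx \<in> Lq_space q (cylinder T).
        weak_t (cylinder T) u ut \<and> weak_xx (cylinder T) u uxx \<and>
        (AE z in lebesgue_on (cylinder T). ut z - uxx z = hysteresis \<alpha> \<beta> T p u z)) \<and>
     (\<forall>x \<in> frontier Omega. \<forall>t \<in> {0<..T}.
        ((\<lambda>y. u (y, t)) has_real_derivative 0) (at x within closure Omega)) \<and>
     (\<forall>x \<in> Omega. u (x, 0) = \<phi> x)"

definition interphase_boundary ::
  "real \<Rightarrow> real \<Rightarrow> real \<Rightarrow> (real \<Rightarrow> real) \<Rightarrow> (real \<times> real \<Rightarrow> real) \<Rightarrow> real \<Rightarrow> (real \<Rightarrow> real) \<Rightarrow> bool"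
where
  "interphase_boundary \<alpha> \<beta> T p u b s \<longleftrightarrow> s 0 = b \<and>
     (\<forall>t \<in> {0..T}.
        (\<forall>x. 0 < x \<and> x < s t \<longrightarrow> hysteresis \<alpha> \<beta> T p u (x, t) = 1) \<and>
        (\<forall>x. s t < x \<and> x < 1 \<longrightarrow> hysteresis \<alpha> \<beta> T p u (x, t) = -1))"

definition holder_on :: "real \<Rightarrow> real set \<Rightarrow> (real \<Rightarrow> real) \<Rightarrow> bool" where
  "holder_on \<gamma> S f \<longleftrightarrow> (\<exists>C. \<forall>x \<in> S. \<forall>y \<in> S. \<bar>f x - f y\<bar> \<le> C * \<bar>x - y\<bar> powr \<gamma>)"

end

theory Submission
  imports Defs "HOL-Probability.Probability"
begin

text \<open>The free boundary is found as the fixed point of a contraction.  Extend the initial state evenly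
about \<open>0\<close> and \<open>1\<close> to a function \<open>\<psi>\<close> on the line.  For a given curve \<open>s\<close> the candidate solution is
\<open>u = w + U\<close>, where \<open>w\<close> is the heat flow of \<open>\<psi>\<close> and \<open>U\<close> the Duhamel integral of the source which is \<open>1\<close> to
the left of \<open>s\<close> and \<open>-1\<close> to the right, reflected in the same way; evenness yields the Neumann condition.

Near \<open>b\<close> the trace \<open>\<phi>\<close> grows with slope at least \<open>d / 2\<close> (\<open>slope_near\<close>), and for short times \<open>u\<close>
grows with slope at least \<open>d / 4\<close>.  Hence the largest \<open>x\<close> near \<open>b\<close> at which \<open>u\<close> has reached \<open>\<alpha>\<close> up to time \<open>t\<close> is a nondecreasing
function of \<open>t\<close> (\<open>front\<close>) that depends Lipschitz continuously on \<open>u\<close>.  As \<open>u\<close> is \<open>1/2\<close>-Hoelder in time, so is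
this curve (\<open>F_increment\<close>); as two sources differ on a strip of width \<open>\<delta>\<close> only, \<open>U\<close> changes by
\<open>O(\<delta> sqrt T)\<close> (\<open>heat_step_difference\<close>), and Banach's theorem applies for small \<open>T\<close> (\<open>F_fixed_point\<close>).
At the fixed point the points passed by the curve have hit \<open>\<alpha>\<close> without ever reaching \<open>\<beta>\<close>, and those ahead have
stayed above \<open>\<alpha>\<close>, so that the source is the hysteresis term (\<open>v_hysteresis\<close>).

It remains to see that \<open>u\<close> lies in the parabolic Sobolev space.  All that is used of the trace space is
\<open>trace_bound\<close>: combinations of point values of \<open>\<phi>\<close> that annihilate affine
functions are controlled by integrals of \<open>|v_t| + |v_xx|\<close> for an extension \<open>v\<close> of \<open>\<phi>\<close>.  It gives Lipschitz continuity, the slope near \<open>b\<close>, and finiteness of the Besov integral of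
second differences of \<open>\<psi>\<close> (\<open>besov\<close>), whence \<open>w_xx\<close> is in \<open>L^q\<close> (\<open>heat_xx_Lq\<close>).  For \<open>U_xx\<close> a pointwise bound
by \<open>|x - s(t)| powr (-1/(2q))\<close> suffices (\<open>heat_xx_near_constant\<close>).  The weak equations are
checked by duality (\<open>weak_solution\<close>).\<close>

abbreviation nn_lborel :: "('a::euclidean_space \<Rightarrow> ennreal) \<Rightarrow> ennreal" (binder "NN " 10)
 where "nn_lborel f \<equiv> integral\<^sup>N lborel f"
abbreviation "BM \<equiv> borel_measurable borel"
abbreviation "Lint \<equiv> integrable lborel"
abbreviation "ind \<equiv> indicator"
abbreviation "en \<equiv> ennreal"
type_synonym pt = "real \<times> real"
lemmas iadd = Bochner_Integration.integrable_add and idiff = Bochner_Integration.integrable_diff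
 and imultr = Bochner_Integration.integrable_mult_right and imultl = Bochner_Integration.integrable_mult_left
 and ibound = Bochner_Integration.integrable_bound and inonneg = Bochner_Integration.integral_nonneg
 and intdiff = Bochner_Integration.integral_diff and intadd = Bochner_Integration.integral_add
 and intminus = Bochner_Integration.integral_minus and icong = Bochner_Integration.integral_cong
 and integral_cong_refl = Bochner_Integration.integral_cong[OF refl]

section \<open>A weighted power mean inequality\<close>

text \<open>Young's inequality replaces integrability here: the mean may be infinite, and the bound is wanted in the
extended reals.\<close>
lemma weighted_jensen:
 fixes F :: "'a => real" and k :: "'a => ennreal"
 assumes [measurable]: "k \<in> borel_measurable M" "F \<in> borel_measurable M"
  and F: "!!x. 0 <= F x" and q: "1 < q"
  and c: "(\<integral>\<^sup>+x. k x \<partial>M) <= en c" "0 < c"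
  and A: "0 <= A" "en A <= (\<integral>\<^sup>+x. k x * en (F x) \<partial>M)"
 shows "en (A powr q) <= en (c powr (q - 1)) * (\<integral>\<^sup>+x. k x * en (F x powr q) \<partial>M)"
proof (cases "A = 0 \<or> (\<integral>\<^sup>+x. k x * en (F x powr q) \<partial>M) = \<infinity>")
 case True
 thus ?thesis using q c by (auto simp: ennreal_mult_top ennreal_mult_eq_top_iff)
next
 case False
 define I where "I = enn2real (\<integral>\<^sup>+x. k x * en (F x powr q) \<partial>M)"
 have I: "(\<integral>\<^sup>+x. k x * en (F x powr q) \<partial>M) = en I" "0 <= I"
  using False unfolding I_def by (auto simp: less_top)
 have A0: "0 < A" using False A by simp
 define a where "a = A / c"
 have a: "0 < a" using A0 c by (simp add: a_def)
 have young: "q * a powr (q-1) * F x <= F x powr q + (q-1) * a powr q" for x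
 proof -
  have "F x * a powr (q-1) <= F x powr q / q + (a powr (q-1)) powr (q/(q-1)) / (q/(q-1))"
   by (rule Youngs_inequality) (use q F in \<open>auto simp: field_simps\<close>)
  also have "(a powr (q-1)) powr (q/(q-1)) = a powr q"
   using q by (simp add: powr_powr)
  finally have "F x * a powr (q-1) <= F x powr q / q + a powr q / (q/(q-1))" .
  hence "q * (F x * a powr (q-1)) <= q * (F x powr q / q + a powr q / (q/(q-1)))"
   using q by (intro mult_left_mono) auto
  also have "... = F x powr q + (q-1) * a powr q" using q by (simp add: field_simps)
  finally show ?thesis by (simp add: mult_ac)
 qed
 have "en (q * a powr (q-1) * A) = en (q * a powr (q-1)) * en A"
  using q a A0 by (simp add: ennreal_mult)
 also have "... <= en (q * a powr (q-1)) * (\<integral>\<^sup>+x. k x * en (F x) \<partial>M)"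
  using A by (intro mult_left_mono) auto
 also have "... = (\<integral>\<^sup>+x. k x * en (q * a powr (q-1) * F x) \<partial>M)"
  using q a F by (subst nn_integral_cmult[symmetric]) (auto simp: ennreal_mult mult_ac)
 also have "... <= (\<integral>\<^sup>+x. k x * en (F x powr q) + en ((q-1) * a powr q) * k x \<partial>M)"
 proof (intro nn_integral_mono)
  fix x
  have "k x * en (q * a powr (q-1) * F x) <= k x * en (F x powr q + (q-1) * a powr q)"
   by (intro mult_left_mono ennreal_leI young) auto
  then show "k x * en (q * a powr (q-1) * F x)
    <= k x * en (F x powr q) + en ((q-1) * a powr q) * k x"
   using q by (subst (asm) ennreal_plus) (auto simp: distrib_left mult_ac)
 qed
 also have "... = en I + en ((q-1) * a powr q) * (\<integral>\<^sup>+x. k x \<partial>M)"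
  by (subst nn_integral_add) (auto simp: I nn_integral_cmult)
 also have "... <= en I + en ((q-1) * a powr q) * en c"
  using c by (intro add_left_mono mult_left_mono) auto
 also have "... = en (I + (q-1) * a powr q * c)"
  using I q c by (simp add: ennreal_mult)
 finally have "q * a powr (q-1) * A <= I + (q-1) * a powr q * c"
  using I q c a by (subst (asm) ennreal_le_iff) auto
 moreover have "a powr q * c = a powr (q-1) * A"
 proof -
  have "a powr q = a powr (q-1) * a" using a by (simp add: powr_diff)
  thus ?thesis using c by (simp add: a_def)
 qed
 ultimately have "q * (a powr (q-1) * A) <= I + (q-1) * (a powr (q-1) * A)"
  by (simp only: mult.assoc)
 hence *: "a powr (q-1) * A <= I" by (simp add: algebra_simps)
 have "A powr q = c powr (q-1) * (a powr (q-1) * A)"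
  using A0 c by (simp add: a_def powr_divide powr_diff)
 also have "... <= c powr (q-1) * I" using * by (intro mult_left_mono) auto
 finally show ?thesis using I c by (simp add: ennreal_mult[symmetric])
qed

section \<open>Smooth cut-offs\<close>

primrec smooth_upto :: "nat => (real => real) => bool" where
 "smooth_upto 0 f \<longleftrightarrow> continuous_on UNIV f"
| "smooth_upto (Suc k) f \<longleftrightarrow> (\<forall>x. f differentiable (at x)) \<and> smooth_upto k (deriv f)"

definition smooth :: "(real => real) => bool" where
 "smooth f \<longleftrightarrow> (\<forall>k. smooth_upto k f)"

lemma smooth_upto_continuous: "smooth_upto k f ==> continuous_on UNIV f"
 by (cases k) (auto intro!: continuous_at_imp_continuous_on differentiable_imp_continuous_within)

lemma smooth_upto_Suc: "smooth_upto (Suc k) f ==> smooth_upto k f"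
proof (induction k arbitrary: f)
 case 0
 then show ?case using smooth_upto_continuous[OF 0] by simp
next
 case (Suc k)
 have "smooth_upto k (deriv f)" using Suc.prems by (intro Suc.IH) simp
 then show ?case using Suc.prems by simp
qed

lemma smooth_upto_derivI:
 assumes "!!x. (f has_real_derivative f' x) (at x)" "smooth_upto k f'"
 shows "smooth_upto (Suc k) f"
proof -
 have "deriv f = f'" using assms(1) by (auto intro: DERIV_imp_deriv)
 thus ?thesis using assms by (auto simp: real_differentiable_def)
qed

lemma smooth_upto_SucD:
 "smooth_upto (Suc k) f ==> (f has_real_derivative deriv f x) (at x)"
 by (auto simp: DERIV_deriv_iff_real_differentiable)

lemma smooth_upto_add: "smooth_upto k f ==> smooth_upto k g ==> smooth_upto k (%x. f x + g x)"
proof (induction k arbitrary: f g)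
 case (Suc k)
 show ?case
  by (rule smooth_upto_derivI[where f' = "%x. deriv f x + deriv g x"])
   (use Suc in \<open>auto intro!: DERIV_add smooth_upto_SucD\<close>)
qed (auto intro: continuous_intros)

lemma smooth_upto_mult: "smooth_upto k f ==> smooth_upto k g ==> smooth_upto k (%x. f x * g x)"
proof (induction k arbitrary: f g)
 case (Suc k)
 show ?case
 proof (rule smooth_upto_derivI[where f' = "%x. deriv f x * g x + deriv g x * f x"])
  show "((%x. f x * g x) has_real_derivative deriv f x * g x + deriv g x * f x) (at x)" for x
   using Suc.prems by (intro DERIV_mult smooth_upto_SucD)
  show "smooth_upto k (%x. deriv f x * g x + deriv g x * f x)"
   using Suc.prems smooth_upto_Suc[OF Suc.prems(1)] smooth_upto_Suc[OF Suc.prems(2)]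
   by (intro smooth_upto_add Suc.IH) auto
 qed
qed (auto intro: continuous_intros)

lemma smooth_upto_const: "smooth_upto k (%x. c)"
proof (induction k arbitrary: c)
 case (Suc k)
 show ?case by (rule smooth_upto_derivI[where f' = "%x. 0"]) (use Suc in auto)
qed auto

lemma smooth_upto_affine: "smooth_upto k f ==> smooth_upto k (%x. f (a * x + c))"
proof (induction k arbitrary: f)
 case 0
 then show ?case
  by (auto intro!: continuous_intros continuous_on_compose2[of UNIV f])
next
 case (Suc k)
 show ?case
 proof (rule smooth_upto_derivI[where f' = "%x. a * deriv f (a * x + c)"])
  show "((%x. f (a * x + c)) has_real_derivative a * deriv f (a * x + c)) (at x)" for x
   by (subst mult.commute, rule DERIV_chain2[of f], rule smooth_upto_SucD[OF Suc.prems])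
    (auto intro!: derivative_eq_intros)
  show "smooth_upto k (%x. a * deriv f (a * x + c))"
   using Suc by (intro smooth_upto_mult smooth_upto_const) auto
 qed
qed

lemma smooth_add: "smooth f ==> smooth g ==> smooth (%x. f x + g x)"
 and smooth_mult: "smooth f ==> smooth g ==> smooth (%x. f x * g x)"
 and smooth_const: "smooth (%x. c)"
 and smooth_affine: "smooth f ==> smooth (%x. f (a * x + c))"
 by (simp_all add: smooth_def smooth_upto_add smooth_upto_mult smooth_upto_const smooth_upto_affine)

lemma smooth_sum: "(!!i. i \<in> I ==> smooth (f i)) ==> smooth (%x. \<Sum>i\<in>I. f i x)"
 by (induction I rule: infinite_finite_induct) (auto intro: smooth_add smooth_const)

lemma smooth_derivI:
 assumes "!!x. (f has_real_derivative f' x) (at x)" "smooth f'"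
 shows "smooth f"
 unfolding smooth_def
proof
 fix k show "smooth_upto k f"
  using smooth_upto_derivI[OF assms(1), of k] assms(2) smooth_upto_Suc[of k f]
  by (auto simp: smooth_def)
qed

lemma smooth_deriv: "smooth f ==> smooth (deriv f)"
 unfolding smooth_def by (metis smooth_upto.simps(2))

lemma smooth_DERIV: "smooth f ==> (f has_real_derivative deriv f x) (at x)"
 unfolding smooth_def by (blast intro: smooth_upto_SucD)

lemma smooth_continuous: "smooth f ==> continuous_on UNIV f"
 unfolding smooth_def by (blast intro: smooth_upto_continuous)

definition flat_exp :: "real poly => real => real" where
 "flat_exp P x = (if x <= 0 then 0 else poly P (inverse x) * exp (- inverse x))"

lemma flat_exp_limit: "((%x. poly P (inverse x) * exp (- inverse x)) \<longlongrightarrow> 0) (at_right (0::real))"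
proof -
 have "((%y. \<Sum>i\<le>degree P. coeff P i * (y ^ i / exp y)) \<longlongrightarrow> (\<Sum>i\<le>degree P. coeff P i * 0)) at_top"
  by (intro tendsto_sum tendsto_mult tendsto_const tendsto_power_div_exp_0)
 hence "((%y. poly P y * exp (- y)) \<longlongrightarrow> 0) at_top"
  by (simp add: poly_altdef sum_distrib_right sum_distrib_left exp_minus divide_inverse mult_ac)
 thus ?thesis by (rule filterlim_compose) (rule filterlim_inverse_at_top_right)
qed

lemma flat_exp_DERIV:
 "(flat_exp P has_real_derivative flat_exp (monom 1 2 * (P - pderiv P)) x) (at x)"
proof -
 consider "x < 0" | "x > 0" | "x = 0" by linarith
 thus ?thesis
 proof cases
  case 1
  have "((%x. 0) has_real_derivative 0) (at x)" by simp
  hence "(flat_exp P has_real_derivative 0) (at x)"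
   by (rule has_field_derivative_transform_within_open[where S = "{..<0}"])
    (use 1 in \<open>auto simp: flat_exp_def\<close>)
  thus ?thesis using 1 by (simp add: flat_exp_def)
 next
  case 2
  have "((%x. poly P (inverse x) * exp (- inverse x)) has_real_derivative
    poly (monom 1 2 * (P - pderiv P)) (inverse x) * exp (- inverse x)) (at x)"
   using 2 by (auto intro!: derivative_eq_intros DERIV_chain2[OF poly_DERIV]
    simp: poly_monom power2_eq_square algebra_simps)
  hence "(flat_exp P has_real_derivative
    poly (monom 1 2 * (P - pderiv P)) (inverse x) * exp (- inverse x)) (at x)"
   by (rule has_field_derivative_transform_within_open[where S = "{0<..}"])
    (use 2 in \<open>auto simp: flat_exp_def\<close>)
  thus ?thesis using 2 by (simp add: flat_exp_def)
 next
  case 3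
  have "((%h. flat_exp P h / h) \<longlongrightarrow> 0) (at_right 0)"
  proof (rule Lim_transform_eventually[OF flat_exp_limit[of "monom 1 1 * P"]])
   show "\<forall>\<^sub>F x in at_right 0. poly (monom 1 1 * P) (inverse x) * exp (- inverse x) = flat_exp P x / x"
    by (rule eventually_at_rightI[of 0 1]) (auto simp: flat_exp_def poly_monom divide_inverse)
  qed
  moreover have "((%h. flat_exp P h / h) \<longlongrightarrow> 0) (at_left 0)"
   by (rule Lim_transform_eventually[OF tendsto_const], rule eventually_at_leftI[of "-1" 0])
    (auto simp: flat_exp_def)
  ultimately have "((%h. flat_exp P h / h) \<longlongrightarrow> 0) (at 0)"
   by (simp add: filterlim_at_split)
  thus ?thesis using 3 by (simp add: DERIV_def flat_exp_def)
 qed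
qed

lemma smooth_flat_exp: "smooth (flat_exp P)"
proof -
 have "smooth_upto k (flat_exp P)" for k
 proof (induction k arbitrary: P)
  case 0
  show ?case using flat_exp_DERIV[of P]
   by (auto intro!: continuous_at_imp_continuous_on DERIV_isCont)
 next
  case (Suc k)
  show ?case by (rule smooth_upto_derivI[OF flat_exp_DERIV Suc])
 qed
 thus ?thesis by (simp add: smooth_def)
qed

lemma antiderivative_zero_left:
 fixes f :: "real => real"
 assumes f: "continuous_on UNIV f" "!!x. x <= 0 ==> f x = 0"
 obtains G where "!!x. (G has_real_derivative f x) (at x)" "!!x. x <= 0 ==> G x = 0"
proof
 let ?G = "%x. integral {-1..x} f"
 show z: "?G x = 0" if "x <= 0" for x
  using f(2) that by (intro integral_unique has_integral_is_0) auto
 show "(?G has_real_derivative f x) (at x)" for x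
 proof (cases "x < 0")
  case True
  have "((%x. 0) has_real_derivative 0) (at x)" by simp
  hence "(?G has_real_derivative 0) (at x)"
   by (rule has_field_derivative_transform_within_open[where S = "{..<0}"]) (use True z in auto)
  thus ?thesis using True f by simp
 next
  case False
  have "(?G has_real_derivative f x) (at x within {-1..x+1})"
   using False f by (intro integral_has_real_derivative) (auto intro: continuous_on_subset)
  thus ?thesis using False
   by (subst (asm) at_within_interior) auto
 qed
qed

text \<open>The bump exp (-1/x) exp (-1/(1-x)), normalised and integrated twice. Rescaled, S approximates a Heaviside
function and R the positive part, so that translates of R are smooth second primitives of point masses.\<close>
lemma ramp_exists:
 obtains R S rh :: "real => real" and ka where
  "smooth rh" "!!x. (S has_real_derivative rh x) (at x)" "!!x. (R has_real_derivative S x) (at x)"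
  "!!x. 0 <= rh x" "!!x. x <= 0 \<or> 1 <= x ==> rh x = 0"
  "!!x. x <= 0 ==> S x = 0" "!!x. 1 <= x ==> S x = 1" "!!x. 0 <= S x" "!!x. S x <= 1"
  "!!x. x <= 0 ==> R x = 0" "!!x. 1 <= x ==> R x = x - ka" "!!x. abs(R x) <= abs(x)"
proof -
 define e where "e = flat_exp 1"
 define \<beta> where "\<beta> x = e x * e (1 - x)" for x
 have e: "smooth e" "!!x. 0 <= e x" "!!x. x <= 0 ==> e x = 0" "!!x. 0 < x ==> 0 < e x"
  by (auto simp: e_def smooth_flat_exp flat_exp_def)
 have sb: "smooth \<beta>"
  unfolding \<beta>_def using smooth_affine[OF e(1), of "-1" 1] by (intro smooth_mult e) simp
 have b: "!!x. 0 <= \<beta> x" "!!x. x <= 0 \<or> 1 <= x ==> \<beta> x = 0"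
  using e by (auto simp: \<beta>_def)
 obtain B where B: "!!x. (B has_real_derivative \<beta> x) (at x)" "!!x. x <= 0 ==> B x = 0"
  using antiderivative_zero_left[OF smooth_continuous[OF sb]] b by blast
 have mono: "B x <= B y" if "x <= y" for x y
  using that B b by (intro DERIV_nonneg_imp_nondecreasing[of x y B]) auto
 have B1: "B x = B 1" if "1 <= x" for x
 proof (cases "x = 1")
  case False
  show ?thesis
  proof (rule DERIV_isconst_end[of 1 x B])
   show "1 < x" using False that by simp
   show "continuous_on {1..x} B"
    using B(1) by (auto intro!: continuous_at_imp_continuous_on DERIV_isCont)
   show "(B has_real_derivative 0) (at y)" if "1 < y" "y < x" for y
    using B(1)[of y] b(2)[of y] that by simp
  qed
 qed simp
 have B1pos: "0 < B 1"
 proof -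
  obtain z where z: "0 < z" "z < 1" "B 1 - B 0 = (1 - 0) * \<beta> z"
   using MVT2[of 0 1 B \<beta>] B(1) by auto
  have "0 < \<beta> z" using z e by (auto simp: \<beta>_def)
  thus ?thesis using z B by simp
 qed
 define rh where "rh x = inverse (B 1) * \<beta> x" for x
 define S where "S x = inverse (B 1) * B x" for x
 have S: "!!x. (S has_real_derivative rh x) (at x)" "!!x. x <= 0 ==> S x = 0" "!!x. 1 <= x ==> S x = 1"
  unfolding S_def rh_def using B B1 B1pos by (auto intro!: DERIV_cmult simp: B1[symmetric])
 have S01: "0 <= S x" "S x <= 1" for x
 proof -
  have "0 <= B x" using mono[of 0 x] B(2)[of x] B(2)[of 0] by (cases "x <= 0") auto
  then show "0 <= S x" using B1pos by (simp add: S_def)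
  have "B x <= B 1" using mono[of x 1] B1[of x] by (cases "x <= 1") auto
  then show "S x <= 1" using B1pos by (simp add: S_def field_simps)
 qed
 have contS: "continuous_on UNIV S"
  using S(1) by (auto intro!: continuous_at_imp_continuous_on DERIV_isCont)
 obtain R where R: "!!x. (R has_real_derivative S x) (at x)" "!!x. x <= 0 ==> R x = 0"
  using antiderivative_zero_left[OF contS S(2)] by blast
 have R1: "R x = x - (1 - R 1)" if "1 <= x" for x
 proof (cases "x = 1")
  case False
  have "(%y. R y - y) x = (%y. R y - y) 1"
  proof (rule DERIV_isconst_end[of 1 x])
   show "1 < x" using False that by simp
   show "continuous_on {1..x} (%y. R y - y)"
    by (rule continuous_on_diff[OF _ continuous_on_id])
    (use R(1) in \<open>auto intro!: continuous_at_imp_continuous_on DERIV_isCont\<close>)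
   show "((%y. R y - y) has_real_derivative 0) (at y)" if "1 < y" "y < x" for y
    using R(1)[of y] S(3)[of y] that by (auto intro!: derivative_eq_intros)
  qed
  thus ?thesis by simp
 qed simp
 have Rb: "abs(R x) <= abs(x)" for x
 proof (cases "x <= 0")
  case False
  obtain z where z: "R x - R 0 = (x - 0) * S z"
   using MVT2[of 0 x R S] R(1) False by auto
  have "x * S z <= x * 1" "0 <= x * S z" using S01[of z] False by (auto intro!: mult_left_mono)
  thus ?thesis using z R(2)[of 0] False by simp
 qed (use R in simp)
 show ?thesis
 proof (rule that[of rh S R "1 - R 1"])
  show "smooth rh" unfolding rh_def by (intro smooth_mult smooth_const sb)
  show "0 <= rh x" for x using b B1pos by (simp add: rh_def)
  show "x <= 0 \<or> 1 <= x ==> rh x = 0" for x using b by (simp add: rh_def)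
 qed (fact S S01 R R1 Rb)+
qed

section \<open>Tensor products as test functions\<close>

lemma partial_tensor:
 assumes "smooth M" "smooth th"
 shows "partial_x (%(x, t). M x * th t) = (%(x, t). deriv M x * th t)"
  and "partial_t (%(x, t). M x * th t) = (%(x, t). M x * deriv th t)"
proof -
 show "partial_x (%(x, t). M x * th t) = (%(x, t). deriv M x * th t)"
  by (auto simp: partial_x_def fun_eq_iff intro!: DERIV_imp_deriv DERIV_cmult_right smooth_DERIV assms)
 show "partial_t (%(x, t). M x * th t) = (%(x, t). M x * deriv th t)"
  by (auto simp: partial_t_def fun_eq_iff intro!: DERIV_imp_deriv DERIV_cmult smooth_DERIV assms)
qed

lemma times_cont_diff_tensor:
 "smooth M ==> smooth th ==> times_cont_diff k (%(x, t). M x * th t)"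
proof (induction k arbitrary: M th)
 case 0
 have "continuous_on UNIV (%z::pt. M (fst z) * th (snd z))"
  by (intro continuous_intros continuous_on_compose2[OF smooth_continuous[OF 0(1)]]
    continuous_on_compose2[OF smooth_continuous[OF 0(2)]]) auto
 then show ?case by (simp add: case_prod_beta')
next
 case (Suc k)
 have "(%z::pt. M (fst z) * th (snd z)) differentiable_on UNIV"
 proof (unfold differentiable_on_def, intro ballI)
  fix z :: "pt"
  have 1: "M differentiable at (fst z)" "th differentiable at (snd z)"
   using smooth_DERIV Suc.prems real_differentiable_def by blast+
  have "(M \<circ> fst) differentiable at z" "(th \<circ> snd) differentiable at z"
   by (rule differentiable_chain_at; use 1 in \<open>auto intro: bounded_linear_imp_differentiable bounded_linear_fst bounded_linear_snd\<close>)+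
  then show "(%z. M (fst z) * th (snd z)) differentiable (at z)"
   by (intro differentiable_mult) (simp_all add: o_def)
 qed
 hence "(%(x, t). M x * th t) differentiable_on UNIV" by (simp add: case_prod_beta')
 then show ?case using Suc
  by (simp add: partial_tensor smooth_deriv)
qed

lemma tensor_test_function:
 assumes "smooth M" "smooth th" "!!x. x < l \<or> r < x ==> M x = 0"
  "!!t. t < t1 \<or> t2 < t ==> th t = 0" "0 < l" "r < 1" "0 < t1" "t2 < T"
 shows "(%(x, t). M x * th t) \<in> test_functions (interior (cylinder T))"
proof -
 have sub: "closure {z. (%(x, t). M x * th t) z ~= 0} \<subseteq> {l..r} \<times> {t1..t2}"
  using assms(3,4) by (intro closure_minimal closed_Times) (auto simp: not_less[symmetric])
 have "{0<..<1} \<times> {0<..<T} \<subseteq> interior (cylinder T)"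
  by (intro interior_maximal open_Times) (auto simp: cylinder_def Omega_def)
 moreover have "{l..r} \<times> {t1..t2} \<subseteq> {0<..<1} \<times> {0<..<T}" using assms by auto
 moreover have "compact (closure {z. (%(x, t). M x * th t) z ~= 0})"
  using bounded_subset[OF compact_imp_bounded[OF compact_Times[OF compact_Icc compact_Icc]] sub]
  by (simp add: compact_eq_bounded_closed)
 ultimately show ?thesis using sub times_cont_diff_tensor[OF assms(1,2)]
  by (auto simp: test_functions_def)
qed

section \<open>Consequences of weak differentiability\<close>

lemma cylinder_sets: "cylinder T \<in> sets borel"
 unfolding cylinder_def Omega_def by (intro borel_Times) auto

lemma emeasure_cylinder_finite: "emeasure lborel (cylinder T) < \<infinity>"
proof -
 have "cylinder T \<subseteq> {0..1} \<times> {0..T}" by (auto simp: cylinder_def Omega_def)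
 hence "bounded (cylinder T)"
  by (rule bounded_subset[rotated]) (intro compact_imp_bounded compact_Times compact_Icc)
 thus ?thesis by (rule emeasure_bounded_finite)
qed

lemma integral_lebesgue_on_borel:
 fixes f :: "pt => real"
 assumes "S \<in> sets borel" "f \<in> BM"
 shows "(LINT z|lebesgue_on S. f z) = (LINT z|lborel. ind S z * f z)"
proof -
 have S: "S \<in> sets lebesgue" using assms(1) by simp
 have "(LINT z|lebesgue_on S. f z) = (LINT z|lebesgue. ind S z *\<^sub>R f z)"
  using S by (intro integral_restrict_space) auto
 also have "... = (LINT z|lborel. ind S z *\<^sub>R f z)"
  using assms by (intro integral_completion) auto
 finally show ?thesis by simp
qed

lemma Lq_borel_version:
 assumes f: "f \<in> Lq_space q S" and S: "S \<in> sets borel" and q: "0 < q"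
 obtains g where "g \<in> BM" "!!z. z \<notin> S ==> g z = 0"
  "(NN z. en (abs(g z) powr q)) < \<infinity>"
  "!!h. h \<in> BM ==> (LINT z|lebesgue_on S. f z * h z) = (LINT z|lborel. g z * h z)"
proof -
 have SL: "S \<in> sets lebesgue" using S by simp
 have fm: "f \<in> borel_measurable (lebesgue_on S)" and fi: "integrable (lebesgue_on S) (%z. abs(f z) powr q)"
  using f by (auto simp: Lq_space_def)
 have "(%z. ind S z *\<^sub>R f z) \<in> borel_measurable lebesgue"
  using fm SL borel_measurable_restrict_space_iff[of S lebesgue f] by simp
 then obtain g' where g': "g' \<in> borel_measurable lborel" "AE z in lborel. ind S z *\<^sub>R f z = g' z"
  using completion_ex_borel_measurable_real by blast
 define g where "g z = ind S z * g' z" for z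
 have gm: "g \<in> BM" using g'(1) S unfolding g_def by simp
 have ae: "AE z in lebesgue. ind S z *\<^sub>R f z = g z"
  using AE_completion[OF g'(2)] by eventually_elim (auto simp: g_def indicator_def split: if_splits)
 show ?thesis
 proof (rule that[OF gm])
  show "g z = 0" if "z \<notin> S" for z using that by (simp add: g_def)
  have "integrable lebesgue (%z. ind S z *\<^sub>R (abs(f z)) powr q)"
   using fi SL by (subst (asm) integrable_restrict_space) auto
  hence "(\<integral>\<^sup>+z. en (norm (ind S z *\<^sub>R (abs(f z)) powr q)) \<partial>lebesgue) < \<infinity>"
   by (simp add: integrable_iff_bounded)
  also have "(\<integral>\<^sup>+z. en (norm (ind S z *\<^sub>R (abs(f z)) powr q)) \<partial>lebesgue)
   = (\<integral>\<^sup>+z. en (abs(g z) powr q) \<partial>lebesgue)"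
   using ae by (intro nn_integral_cong_AE, eventually_elim) (use q in \<open>auto simp: indicator_def split: if_splits\<close>)
  also have "... = (NN z. en (abs(g z) powr q))"
   using gm by (intro nn_integral_completion)
  finally show "(NN z. en (abs(g z) powr q)) < \<infinity>" .
  fix h :: "pt => real" assume h: "h \<in> BM"
  have "(LINT z|lebesgue_on S. f z * h z) = (LINT z|lebesgue. ind S z *\<^sub>R (f z * h z))"
   using SL by (intro integral_restrict_space) auto
  also have "... = (LINT z|lebesgue. g z * h z)"
  proof (rule integral_cong_AE)
   have "(%z. (ind S z *\<^sub>R f z) * h z) \<in> borel_measurable lebesgue"
    using \<open>(%z. ind S z *\<^sub>R f z) \<in> borel_measurable lebesgue\<close> h
    by (intro borel_measurable_times) (auto intro: measurable_completion)
   then show "(%z. ind S z *\<^sub>R (f z * h z)) \<in> borel_measurable lebesgue" by (simp add: mult_ac)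
   show "(%z. g z * h z) \<in> borel_measurable lebesgue"
    using gm h by (intro measurable_completion) auto
   show "AE z in lebesgue. ind S z *\<^sub>R (f z * h z) = g z * h z"
    using ae by eventually_elim auto
  qed
  also have "... = (LINT z|lborel. g z * h z)"
   using gm h by (intro integral_completion) auto
  finally show "(LINT z|lebesgue_on S. f z * h z) = (LINT z|lborel. g z * h z)" .
 qed
qed

lemma Lq_integrable:
 fixes g :: "pt => real"
 assumes "g \<in> BM" "!!z. z \<notin> S ==> g z = 0" "S \<in> sets borel"
  "emeasure lborel S < \<infinity>" "(NN z. en (abs(g z) powr q)) < \<infinity>" "1 <= q"
 shows "Lint g"
proof (rule integrableI_bounded)
 have "(NN z. en (norm (g z))) <= (NN z. ind S z + en (abs(g z) powr q))"
 proof (rule nn_integral_mono)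
  fix z
  show "en (norm (g z)) <= ind S z + en (abs(g z) powr q)"
  proof (cases "z \<in> S")
   case True
   have "abs(g z) <= 1 + abs(g z) powr q"
   proof (cases "abs(g z) <= 1")
    case False
    hence "abs(g z) powr 1 <= abs(g z) powr q" using assms by (intro powr_mono) auto
    thus ?thesis using False by simp
   qed (simp add: add_increasing2)
   hence "en (norm (g z)) <= en (1 + abs(g z) powr q)" by (intro ennreal_leI) simp
   thus ?thesis using True by (simp add: ennreal_plus)
  qed (use assms in auto)
 qed
 also have "... = emeasure lborel S + (NN z. en (abs(g z) powr q))"
  using assms by (subst nn_integral_add) auto
 also have "... < \<infinity>" using assms by simp
 finally show "(NN z. en (norm (g z))) < \<infinity>" .
qed (use assms in simp)

lemma tensor_fubini:
 fixes f :: "pt => real"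
 assumes f: "continuous_on UNIV f" and M: "continuous_on UNIV M" "!!x. x \<notin> {a..b} ==> M x = 0"
  and th: "continuous_on UNIV th" "!!t. t \<notin> {c..d} ==> th t = 0"
 shows "(LINT z|lborel. f z * (case z of (x, t) => M x * th t)) = (LBINT x. M x * (LBINT t. th t * f (x, t)))"
  and "(LINT z|lborel. f z * (case z of (x, t) => M x * th t)) = (LBINT t. th t * (LBINT x. M x * f (x, t)))"
proof -
 let ?F = "%z::pt. f z * (M (fst z) * th (snd z))"
 have "continuous_on ({a..b} \<times> {c..d}) ?F"
  by (intro continuous_intros continuous_on_subset[OF f] continuous_on_compose2[OF M(1)]
    continuous_on_compose2[OF th(1)]) auto
 hence "Lint (%z. ind ({a..b} \<times> {c..d}) z *\<^sub>R ?F z)"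
  by (intro borel_integrable_compact compact_Times compact_Icc)
 also have "(%z. ind ({a..b} \<times> {c..d}) z *\<^sub>R ?F z) = ?F"
  using M(2) th(2) by (fastforce simp: fun_eq_iff indicator_def)
 finally have int: "integrable (lborel \<Otimes>\<^sub>M lborel) (%(x, t). f (x, t) * (M x * th t))"
  by (simp add: lborel_prod case_prod_beta')
 have eq: "(LINT z|lborel. f z * (case z of (x, t) => M x * th t))
   = (LINT (x, t)|(lborel \<Otimes>\<^sub>M lborel). f (x, t) * (M x * th t))"
  by (simp add: lborel_prod case_prod_beta')
 show "(LINT z|lborel. f z * (case z of (x, t) => M x * th t)) = (LBINT x. M x * (LBINT t. th t * f (x, t)))"
  unfolding eq lborel_pair.integral_fst[OF int, symmetric]
  by (rule integral_cong_refl, subst integral_mult_right_zero[symmetric],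
    rule icong) (auto simp: mult_ac)
 show "(LINT z|lborel. f z * (case z of (x, t) => M x * th t)) = (LBINT t. th t * (LBINT x. M x * f (x, t)))"
  unfolding eq lborel_pair.integral_snd[OF int, symmetric]
  by (rule integral_cong_refl, subst integral_mult_right_zero[symmetric],
    rule icong) (auto simp: mult_ac)
qed

lemma mollifier_limit:
 fixes V rh :: "real => real"
 assumes V: "continuous_on UNIV V" "!!x. abs(V x) <= B"
  and rh: "Lint rh" "(LBINT y. rh y) = 1" "!!y. 0 <= rh y"
 shows "(%n. LBINT s. (real (Suc n) * rh (real (Suc n) * (s - ta))) * V s) \<longlonglongrightarrow> V ta"
  and "abs(LBINT s. (real (Suc n) * rh (real (Suc n) * (s - ta))) * V s) <= B"
proof -
 have [measurable]: "V \<in> BM" "rh \<in> BM"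
  using V rh(1) by (auto intro: borel_measurable_continuous_onI)
 have eq: "(LBINT s. (real (Suc n) * rh (real (Suc n) * (s - ta))) * V s)
   = (LBINT y. rh y * V (ta + y / real (Suc n)))" for n
 proof -
  define N where "N = real (Suc n)"
  have N: "0 < N" by (simp add: N_def)
  have "(LBINT s. (N * rh (N * (s - ta))) * V s)
    = abs(1/N) *\<^sub>R (LBINT y. (N * rh (N * ((ta + 1/N * y) - ta))) * V (ta + 1/N * y))"
   using N by (intro lborel_integral_real_affine) auto
  also have "... = (LBINT y. 1/N * ((N * rh (N * ((ta + 1/N * y) - ta))) * V (ta + 1/N * y)))"
   using N by (subst integral_mult_right_zero) simp
  also have "... = (LBINT y. rh y * V (ta + y / N))"
   using N by (intro icong) auto
  finally show ?thesis by (simp add: N_def)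
 qed
 show "(%n. LBINT s. (real (Suc n) * rh (real (Suc n) * (s - ta))) * V s) \<longlonglongrightarrow> V ta"
 proof -
  have "(%n. LBINT y. rh y * V (ta + y / real (Suc n))) \<longlonglongrightarrow> (LBINT y. rh y * V ta)"
  proof (rule integral_dominated_convergence[where w = "%y. B * rh y"])
   show "AE y in lborel. (%n. rh y * V (ta + y / real (Suc n))) \<longlonglongrightarrow> rh y * V ta"
   proof (rule AE_I2, rule tendsto_mult[OF tendsto_const])
    fix y
    have "(%n. ta + y * inverse (real (Suc n))) \<longlonglongrightarrow> ta + y * 0"
    by (rule tendsto_add[OF tendsto_const tendsto_mult[OF tendsto_const LIMSEQ_inverse_real_of_nat]])
    hence "(%n. ta + y / real (Suc n)) \<longlonglongrightarrow> ta" by (simp add: divide_inverse)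
    moreover have "isCont V ta" using V(1) by (simp add: continuous_on_eq_continuous_at)
    ultimately show "(%n. V (ta + y / real (Suc n))) \<longlonglongrightarrow> V ta"
    using isCont_tendsto_compose by blast
   qed
   show "AE y in lborel. norm (rh y * V (ta + y / real (Suc n))) <= B * rh y" for n
    using V(2) rh(3) by (auto simp: abs_mult mult.commute[of B] intro!: mult_left_mono)
  qed (use rh in auto)
  thus ?thesis unfolding eq using rh by simp
 qed
 have bd: "norm (rh y * V (ta + y / real (Suc n))) <= norm (B * rh y)" "norm (rh y * V (ta + y / real (Suc n))) <= B * rh y" for y
  using V(2)[of "ta + y / real (Suc n)"] rh(3)[of y]
  by (auto simp: abs_mult mult.commute[of B] intro!: mult_left_mono)
 have "norm (LBINT y. rh y * V (ta + y / real (Suc n))) <= (LBINT y. B * rh y)"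
 proof (rule order_trans[OF integral_norm_bound integral_mono])
  have "Lint (%y. rh y * V (ta + y / real (Suc n)))"
   by (rule ibound[where f = "%y. B * rh y"]) (use rh bd in auto)
  then show "Lint (%y. norm (rh y * V (ta + y / real (Suc n))))"
   by (rule integrable_norm)
 qed (use rh bd in auto)
 then show "abs(LBINT s. (real (Suc n) * rh (real (Suc n) * (s - ta))) * V s) <= B"
  unfolding eq using rh by simp
qed

lemma enn2real_cancel: "enn2real x = enn2real y ==> x ~= \<top> ==> y ~= \<top> ==> x = y"
 by (cases x; cases y) auto

lemma AE_zero_of_interval_integrals:
 fixes G :: "real => real"
 assumes int: "Lint G" and z: "!!a b. a < b ==> (LBINT x. ind {a<..<b} x * G x) = 0"
 shows "AE x in lborel. G x = 0"
proof -
 have [measurable]: "G \<in> BM" using int by auto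
 have half: "(LBINT x. ind {a<..} x * G x) = 0" for a
 proof -
  have "(%n. LBINT x. ind {a<..<a + real (Suc n)} x * G x) \<longlonglongrightarrow> (LBINT x. ind {a<..} x * G x)"
  proof (rule integral_dominated_convergence[where w = "%x. norm (G x)"])
   show "AE x in lborel. (%n. ind {a<..<a + real (Suc n)} x * G x) \<longlonglongrightarrow> ind {a<..} x * G x"
   proof (rule AE_I2)
    fix x
    obtain m :: nat where m: "x - a < real m" using reals_Archimedean2 by blast
    have "eventually (%n. ind {a<..} x * G x = ind {a<..<a + real (Suc n)} x * G x) sequentially"
    using eventually_ge_at_top[of m] by eventually_elim (use m in \<open>auto simp: indicator_def\<close>)
    then show "(%n. ind {a<..<a + real (Suc n)} x * G x) \<longlonglongrightarrow> ind {a<..} x * G x"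
    by (rule Lim_transform_eventually[OF tendsto_const])
   qed
  qed (use int in \<open>auto simp: indicator_def\<close>)
  moreover have "(LBINT x. ind {a<..<a + real (Suc n)} x * G x) = 0" for n
   using z[of a "a + real (Suc n)"] by simp
  ultimately show ?thesis by (simp add: LIMSEQ_const_iff)
 qed
 let ?P = "%x. en (G x)" and ?N = "%x. en (- G x)"
 have fin: "(NN x. en (s * G x) * ind A x) < \<infinity>" if "abs(s) <= 1" for s A
 proof -
  have "(NN x. en (s * G x) * ind A x) <= (NN x. en (norm (G x)))"
  proof (intro nn_integral_mono)
   fix x
   have "s * G x <= abs(s) * abs(G x)" by (metis abs_ge_self abs_mult)
   also have "... <= 1 * abs(G x)" using that by (intro mult_right_mono) auto
   finally show "en (s * G x) * ind A x <= en (norm (G x))"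
    by (auto simp: indicator_def intro: ennreal_leI)
  qed
  also have "... < \<infinity>" using int by (simp add: integrable_iff_bounded)
  finally show ?thesis .
 qed
 have "density lborel ?P = density lborel ?N"
 proof (rule measure_eqI_lessThan)
  fix a
  show "emeasure (density lborel ?P) {a<..} < \<infinity>" using fin[of 1 "{a<..}"] by (simp add: emeasure_density)
  have i: "Lint (%x. ind {a<..} x * G x)"
   using int by (rule ibound) (auto simp: indicator_def)
  have "enn2real (NN x. en (ind {a<..} x * G x))
    = enn2real (NN x. en (- (ind {a<..} x * G x)))"
   using real_lebesgue_integral_def[OF i] half[of a] by simp
  moreover have "(NN x. en (ind {a<..} x * G x)) = (NN x. ?P x * ind {a<..} x)"
   by (intro nn_integral_cong) (auto simp: indicator_def)
  moreover have "(NN x. en (- (ind {a<..} x * G x))) = (NN x. ?N x * ind {a<..} x)"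
   by (intro nn_integral_cong) (auto simp: indicator_def)
  ultimately have "enn2real (NN x. ?P x * ind {a<..} x) = enn2real (NN x. ?N x * ind {a<..} x)"
   by simp
  moreover have "(NN x. ?P x * ind {a<..} x) ~= \<top>" "(NN x. ?N x * ind {a<..} x) ~= \<top>"
   using fin[of 1 "{a<..}"] fin[of "-1" "{a<..}"] by auto
  ultimately have "(NN x. ?P x * ind {a<..} x) = (NN x. ?N x * ind {a<..} x)"
   by (rule enn2real_cancel)
  then show "emeasure (density lborel ?P) {a<..} = emeasure (density lborel ?N) {a<..}"
   by (simp add: emeasure_density)
 qed auto
 hence "AE x in lborel. ?P x = ?N x"
  using fin[of 1 UNIV] by (subst (asm) finite_density_unique) auto
 thus ?thesis
 proof eventually_elim
  case (elim x)
  then show ?case by (cases "0 <= G x") (auto simp: ennreal_neg ennreal_eq_0_iff)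
 qed
qed

lemma measurable_fst_borel [measurable]: "fst \<in> (borel :: ('a::second_countable_topology \<times> 'b::second_countable_topology) measure) \<rightarrow>\<^sub>M borel"
 and measurable_snd_borel [measurable]: "snd \<in> (borel :: ('a \<times> 'b) measure) \<rightarrow>\<^sub>M borel"
 by (simp_all add: borel_prod[symmetric])

lemma derivative_bump_integral:
 assumes "!!x. (S has_real_derivative rh x) (at x)" "continuous_on UNIV rh" "!!y. 0 <= rh y"
  "!!x. x <= 0 \<or> 1 <= x ==> rh x = (0::real)" "S 0 = 0" "S 1 = 1"
 shows "Lint rh" "(LBINT y. rh y) = 1"
proof -
 have "has_bochner_integral lborel (%x. rh x * ind {0..1} x) (S 1 - S 0)"
  using assms by (intro has_bochner_integral_FTC_Icc_nonneg)
   (auto simp: continuous_on_eq_continuous_at intro: has_field_derivative_at_within borel_measurable_continuous_onI)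
 also have "(%x. rh x * ind {0..1} x) = rh"
  using assms(4) by (auto simp: fun_eq_iff indicator_def) (meson linear)+
 finally show "Lint rh" "(LBINT y. rh y) = 1"
  using assms by (auto simp: has_bochner_integral_iff)
qed

text \<open>Rescaled copies of S approximate the indicators of a time interval and of an interval in space. In the limit
the identity holds integrated over every interval in space, hence almost everywhere.\<close>
lemma weak_t_increment:
 fixes vb g :: "pt => real"
 assumes vb: "continuous_on UNIV vb" "!!z. abs(vb z) <= B"
  and g: "Lint g"
  and weak: "!!M th a b c d. smooth M ==> smooth th ==> (!!x. x < a \<or> b < x ==> M x = 0) ==>
   (!!t. t < c \<or> d < t ==> th t = 0) ==> 0 < a ==> b < 1 ==> 0 < c ==> d < T ==>
   (LINT z|lborel. vb z * (case z of (x, t) => M x * deriv th t))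
    = - (LINT z|lborel. g z * (case z of (x, t) => M x * th t))"
  and t: "0 < ta" "ta < t" "t < T"
 shows "AE x in lborel. 0 < x \<and> x < 1 \<longrightarrow> vb (x, t) - vb (x, ta) = (LBINT s. ind {ta<..t} s * g (x, s))"
proof -
 obtain R S rh :: "real => real" and ka where rs: "smooth rh" "!!x. (S has_real_derivative rh x) (at x)"
  "!!x. 0 <= rh x" "!!x. x <= 0 \<or> 1 <= x ==> rh x = 0"
  "!!x. x <= 0 ==> S x = 0" "!!x. 1 <= x ==> S x = 1" "!!x. 0 <= S x" "!!x. S x <= 1"
  using ramp_exists by metis
 have rhi: "Lint rh" "(LBINT y. rh y) = 1"
  by (rule derivative_bump_integral[of S rh]; use rs smooth_continuous in auto)+
 have sS: "smooth S" by (rule smooth_derivI[OF rs(2,1)])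
 have S01: "abs(S x) <= 1" for x using rs(7,8)[of x] by simp
 have [measurable]: "vb \<in> BM" "g \<in> BM" "S \<in> BM"
  using vb g smooth_continuous[OF sS] by (auto intro: borel_measurable_continuous_onI)
 have B0: "0 <= B" using vb(2)[of 0] by simp
 have vbc: "continuous_on UNIV (%s. vb (x, s))" for x
  by (rule continuous_on_compose2[OF vb(1)]) (auto intro!: continuous_intros)
 have gi: "integrable (lborel \<Otimes>\<^sub>M lborel) (%(x, s). ind {ta<..t} s * g (x, s))"
  unfolding lborel_prod case_prod_beta' prod.collapse
  using integrable_mult_indicator[OF _ g, of "UNIV \<times> {ta<..t}"]
  by (simp add: indicator_def mem_Times_iff borel_Times)
 define H where "H x = (LBINT s. ind {ta<..t} s * g (x, s))" for x
 have Hi: "Lint H" unfolding H_def using lborel_pair.integrable_fst[OF gi] by simp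
 define N where "N n = real (Suc n)" for n
 have N: "0 < N n" for n by (simp add: N_def)
 define e where "e n = 1 / N n" for n
 have e: "0 < e n" for n using N by (simp add: e_def)
 have Nlim: "filterlim N at_top sequentially"
  unfolding N_def by (rule filterlim_compose[OF filterlim_real_sequentially filterlim_Suc])
 have Nlarge: "\<forall>\<^sub>F n in sequentially. K < N n * c" if "0 < c" for K c
 proof -
  have "\<forall>\<^sub>F n in sequentially. K / c < N n" using Nlim by (simp add: filterlim_at_top_dense)
  thus ?thesis by eventually_elim (use that in \<open>simp add: e_def field_simps\<close>)
 qed
 have core: "(LBINT x. ind {a<..<b} x * (vb (x, ta) - vb (x, t))) = - (LBINT x. ind {a<..<b} x * H x)"
  if ab: "0 <= a" "a < b" "b <= 1" for a b
 proof -
  define M where "M n x = S (N n * (x - a) - 1) * S (N n * (b - x) - 1)" for n x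
  define th where "th n s = S (N n * (s - ta)) - S (N n * (s - t))" for n s
  have sM: "smooth (M n)" for n
   unfolding M_def using smooth_affine[OF sS, of "N n" "- N n * a - 1"] smooth_affine[OF sS, of "- N n" "N n * b - 1"]
   by (intro smooth_mult) (simp_all add: algebra_simps)
  have sth: "smooth (th n)" for n
   unfolding th_def using smooth_add[OF smooth_affine[OF sS, of "N n" "- N n * ta"]
    smooth_mult[OF smooth_const[of "-1"] smooth_affine[OF sS, of "N n" "- N n * t"]]]
   by (simp add: algebra_simps)
  have M0: "M n x = 0" if "x < a + e n \<or> b - e n < x" for n x
  proof -
   have "N n * (x - a) - 1 <= 0 \<or> N n * (b - x) - 1 <= 0"
    using that N[of n] by (auto simp: e_def field_simps)
   thus ?thesis using rs(5) by (auto simp: M_def)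
  qed
  have M1: "abs(M n x) <= ind {0..1} x" for n x
  proof (cases "x \<in> {0..1}")
   case True
   thus ?thesis using S01 by (auto simp: M_def abs_mult intro!: mult_le_one)
  next
   case False
   have "0 < e n" by (rule e)
   hence "x < a + e n \<or> b - e n < x" using False ab by auto
   thus ?thesis using False by (simp add: M0)
  qed
  have th0: "th n s = 0" if "s < ta \<or> t + e n < s" for n s
  proof -
   consider "s < ta" | "t + e n < s" using \<open>s < ta \<or> t + e n < s\<close> by blast
   thus ?thesis
   proof cases
    case 1
    have "N n * (s - ta) <= 0" "N n * (s - t) <= 0" using 1 t N[of n] by (auto intro!: mult_nonneg_nonpos)
    thus ?thesis using rs(5) by (simp add: th_def)
   next
    case 2
    have "1 <= N n * (s - t)" using 2 N[of n] by (simp add: e_def field_simps)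
    moreover have "N n * (s - t) <= N n * (s - ta)" using N[of n] t by (intro mult_left_mono) auto
    ultimately show ?thesis using rs(6) by (simp add: th_def)
   qed
  qed
  have th1: "abs(th n s) <= 1" for n s
   using rs(7,8)[of "N n * (s - ta)"] rs(7,8)[of "N n * (s - t)"] by (auto simp: th_def)
  have thd: "deriv (th n) s = N n * rh (N n * (s - ta)) - N n * rh (N n * (s - t))" for n s
   unfolding th_def
   by (rule DERIV_imp_deriv) (auto intro!: derivative_eq_intros DERIV_chain2[OF rs(2)] simp: algebra_simps)
  have Mlim: "(%n. M n x) \<longlonglongrightarrow> ind {a<..<b} x" for x
  proof (cases "a < x \<and> x < b")
   case True
   have "\<forall>\<^sub>F n in sequentially. 2 < N n * (x - a)" "\<forall>\<^sub>F n in sequentially. 2 < N n * (b - x)"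
    using True by (auto intro!: Nlarge)
   hence "\<forall>\<^sub>F n in sequentially. 1 = M n x"
    by eventually_elim (simp add: M_def rs)
   thus ?thesis using True by (auto intro: Lim_transform_eventually[OF tendsto_const])
  next
   case False
   have "M n x = 0" for n
   proof -
    have "0 < e n" by (rule e)
    hence "x < a + e n \<or> b - e n < x" using False by auto
    thus ?thesis by (rule M0)
   qed
   thus ?thesis using False by (auto simp: indicator_def)
  qed
  have thlim: "(%n. th n s) \<longlonglongrightarrow> ind {ta<..t} s" for s
  proof -
   have *: "(%n. S (N n * (s - c))) \<longlonglongrightarrow> ind {c<..} s" for c
   proof (cases "c < s")
    case True
    have "\<forall>\<^sub>F n in sequentially. 1 < N n * (s - c)" using True by (intro Nlarge) auto
    hence "\<forall>\<^sub>F n in sequentially. 1 = S (N n * (s - c))" by eventually_elim (simp add: rs)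
    thus ?thesis using True by (auto intro: Lim_transform_eventually[OF tendsto_const])
   next
    case False
    have "N n * (s - c) <= 0" for n using False N[of n] by (auto intro!: mult_nonneg_nonpos)
    thus ?thesis using False rs by simp
   qed
   have "(%n. th n s) \<longlonglongrightarrow> ind {ta<..} s - ind {t<..} s"
    unfolding th_def by (intro tendsto_diff *)
   also have "ind {ta<..} s - ind {t<..} s = (ind {ta<..t} s :: real)"
    using t by (auto simp: indicator_def)
   finally show ?thesis .
  qed
  have [measurable]: "M n \<in> BM" "th n \<in> BM" for n
   unfolding M_def th_def by measurable
  define J where "J n x = (LBINT s. deriv (th n) s * vb (x, s))" for n x
  have Jeq: "J n x = (LBINT s. (N n * rh (N n * (s - ta))) * vb (x, s)) - (LBINT s. (N n * rh (N n * (s - t))) * vb (x, s))" for n x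
  proof -
   have i: "Lint (%s. (N n * rh (N n * (s - c))) * vb (x, s))" for c
   proof (rule ibound[where f = "%s. B * N n * rh (- N n * c + N n * s)"])
    show "Lint (%s. B * N n * rh (- N n * c + N n * s))"
    using lborel_integrable_real_affine[OF rhi(1), of "N n" "- N n * c"] N[of n] by auto
    show "AE s in lborel. norm (N n * rh (N n * (s - c)) * vb (x, s)) <= norm (B * N n * rh (- N n * c + N n * s))"
    using N[of n] vb(2) rs(3) B0 by (auto simp: abs_mult algebra_simps intro!: mult_right_mono)
    show "(%s. N n * rh (N n * (s - c)) * vb (x, s)) \<in> borel_measurable lborel"
    using rhi(1) by (auto intro!: borel_measurable_times measurable_compose[of _ lborel borel rh])
   qed
   show ?thesis unfolding J_def thd left_diff_distrib by (rule intdiff[OF i i])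
  qed
  have Jlim: "(%n. J n x) \<longlonglongrightarrow> vb (x, ta) - vb (x, t)" for x
   unfolding Jeq N_def by (intro tendsto_diff mollifier_limit(1)[where B = B, OF vbc _ rhi rs(3)] vb(2))
  have Jbd: "abs(J n x) <= 2 * B" for n x
   unfolding Jeq N_def
   using mollifier_limit(2)[OF vbc[of x] vb(2) rhi rs(3), of n ta] mollifier_limit(2)[OF vbc[of x] vb(2) rhi rs(3), of n t]
   by simp
  have vbm: "vb \<in> borel_measurable (borel \<Otimes>\<^sub>M lborel)"
   by (subst measurable_cong_sets[OF sets_pair_measure_cong[OF refl sets_lborel] refl]) (simp add: borel_prod)
  have [measurable]: "J n \<in> BM" for n
   unfolding J_def using smooth_continuous[OF smooth_deriv[OF sth[of n]]]
   by (intro lborel.borel_measurable_lebesgue_integral)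
    (auto intro!: vbm borel_measurable_times measurable_compose[OF measurable_snd, where g = "deriv (th n)"] borel_measurable_continuous_onI
    simp: case_prod_beta' borel_prod)
  have L: "(%n. LBINT x. M n x * J n x) \<longlonglongrightarrow> (LBINT x. ind {a<..<b} x * (vb (x, ta) - vb (x, t)))"
  proof (rule integral_dominated_convergence[where w = "%x. 2 * B * ind {0..1} x"])
   show "AE x in lborel. (%n. M n x * J n x) \<longlonglongrightarrow> ind {a<..<b} x * (vb (x, ta) - vb (x, t))"
    by (intro AE_I2 tendsto_mult Mlim Jlim)
   show "AE x in lborel. norm (M n x * J n x) <= 2 * B * ind {0..1} x" for n
   proof (rule AE_I2)
    fix x
    have "abs(M n x) * abs(J n x) <= ind {0..1} x * (2 * B)" by (intro mult_mono M1 Jbd) auto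
    then show "norm (M n x * J n x) <= 2 * B * ind {0..1} x" by (simp add: abs_mult mult_ac)
   qed
  qed auto
  have Rl: "(%n. LINT z|lborel. g z * (case z of (x, s) => M n x * th n s)) \<longlonglongrightarrow>
    (LINT z|lborel. g z * (case z of (x, s) => ind {a<..<b} x * ind {ta<..t} s))"
  proof (rule integral_dominated_convergence[where w = "%z. norm (g z)"])
   show "AE z in lborel. (%n. g z * (case z of (x, s) => M n x * th n s)) \<longlonglongrightarrow>
    g z * (case z of (x, s) => ind {a<..<b} x * ind {ta<..t} s)"
    by (intro AE_I2) (auto intro!: tendsto_mult Mlim thlim split: prod.split)
   show "AE z in lborel. norm (g z * (case z of (x, s) => M n x * th n s)) <= norm (g z)" for n
   proof (rule AE_I2)
    fix z :: "pt"
    have "abs(M n (fst z)) * abs(th n (snd z)) <= 1 * 1"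
    using order_trans[OF M1[of n "fst z"] indicator_le_1] by (intro mult_mono th1) auto
    then show "norm (g z * (case z of (x, s) => M n x * th n s)) <= norm (g z)"
    by (auto simp: abs_mult case_prod_beta' intro!: mult_left_le)
   qed
  qed (use g in \<open>auto simp: case_prod_beta'\<close>)
  have "\<forall>\<^sub>F n in sequentially. 1 < N n * (T - t)" using t by (intro Nlarge) auto
  hence ev: "\<forall>\<^sub>F n in sequentially. (LBINT x. M n x * J n x) = - (LINT z|lborel. g z * (case z of (x, s) => M n x * th n s))"
  proof eventually_elim
   case (elim n)
   have d: "t + e n < T" using elim N[of n] by (simp add: e_def field_simps)
   have Nn: "0 < e n" by (rule e)
   have "(LINT z|lborel. vb z * (case z of (x, s) => M n x * deriv (th n) s)) = (LBINT x. M n x * J n x)"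
    unfolding J_def
   proof (rule tensor_fubini(1)[OF vb(1) smooth_continuous[OF sM] _ smooth_continuous[OF smooth_deriv[OF sth]]])
    show "M n x = 0" if "x \<notin> {0..1}" for x using M1[of n x] that by simp
    show "deriv (th n) s = 0" if "s \<notin> {ta..t + e n}" for s
    proof -
    have "rh (N n * (s - c)) = 0" if "c \<in> {ta, t}" for c
    proof (rule rs(4))
    have "s <= c \<or> c + e n <= s"
    using that \<open>s \<notin> {ta..t + e n}\<close> t(2) by auto
    then show "N n * (s - c) <= 0 \<or> 1 <= N n * (s - c)"
    using N[of n] by (auto simp: e_def field_simps)
    qed
    thus ?thesis unfolding thd by simp
    qed
   qed
   moreover have "(LINT z|lborel. vb z * (case z of (x, s) => M n x * deriv (th n) s))
    = - (LINT z|lborel. g z * (case z of (x, s) => M n x * th n s))"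
    by (rule weak[OF sM sth, of "a + e n" "b - e n" n ta "t + e n" n]) (use M0 th0 ab t d Nn in auto)
   ultimately show ?case by simp
  qed
  have "(LBINT x. ind {a<..<b} x * (vb (x, ta) - vb (x, t)))
   = - (LINT z|lborel. g z * (case z of (x, s) => ind {a<..<b} x * ind {ta<..t} s))"
   by (rule LIMSEQ_unique[OF L]) (rule Lim_transform_eventually[OF tendsto_minus[OF Rl]], use ev in eventually_elim, simp)
  also have "(LINT z|lborel. g z * (case z of (x, s) => ind {a<..<b} x * ind {ta<..t} s))
   = (LBINT x. ind {a<..<b} x * H x)"
  proof -
   have i: "integrable (lborel \<Otimes>\<^sub>M lborel) (%(x, s). g (x, s) * (ind {a<..<b} x * ind {ta<..t} s))"
    unfolding lborel_prod
    by (rule ibound[OF g]) (auto simp: indicator_def case_prod_beta')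
   have "(LINT z|lborel. g z * (case z of (x, s) => ind {a<..<b} x * ind {ta<..t} s))
    = (LINT (x, s)|(lborel \<Otimes>\<^sub>M lborel). g (x, s) * (ind {a<..<b} x * ind {ta<..t} s))"
    by (simp add: lborel_prod case_prod_beta')
   also have "... = (LBINT x. LBINT s. g (x, s) * (ind {a<..<b} x * ind {ta<..t} s))"
    by (rule lborel_pair.integral_fst[OF i, symmetric])
   also have "... = (LBINT x. ind {a<..<b} x * H x)"
    unfolding H_def
    by (rule integral_cong_refl, subst integral_mult_right_zero[symmetric],
    rule icong) (auto simp: mult_ac)
   finally show ?thesis .
  qed
  finally show ?thesis .
 qed
 define G where "G x = ind {0<..<1} x * (vb (x, t) - vb (x, ta) - H x)" for x
 have vi: "Lint (%x. ind {a<..<b} x * vb (x, c))" for a b c :: real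
 proof (rule ibound[where f = "%x. B * ind {a<..<b} x"])
  show "Lint (%x. B * ind {a<..<b} x)"
   by (cases "a <= b") (auto intro!: integrable_mult_right simp: integrable_indicator_iff)
  show "AE x in lborel. norm (ind {a<..<b} x * vb (x, c)) <= norm (B * ind {a<..<b} x)"
   using vb(2) B0 by (auto simp: indicator_def)
 qed simp
 have Hi': "Lint (%x. ind {a<..<b} x * H x)" for a b :: real
  by (rule ibound[OF Hi]) (use borel_measurable_integrable[OF Hi] in \<open>auto simp: indicator_def\<close>)
 have Gi: "Lint G"
  unfolding G_def right_diff_distrib by (intro idiff vi Hi')
 have "AE x in lborel. G x = 0"
 proof (rule AE_zero_of_interval_integrals[OF Gi])
  fix a b :: real assume "a < b"
  define a' where "a' = max a 0" define b' where "b' = min b 1"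
  have "(%x. ind {a<..<b} x * G x) = (%x. ind {a'<..<b'} x * (vb (x, t) - vb (x, ta) - H x))"
   by (auto simp: G_def a'_def b'_def indicator_def fun_eq_iff)
  moreover have "(LBINT x. ind {a'<..<b'} x * (vb (x, t) - vb (x, ta) - H x)) = 0"
  proof (cases "a' < b'")
   case True
   have "(LBINT x. ind {a'<..<b'} x * (vb (x, t) - vb (x, ta) - H x))
    = - (LBINT x. ind {a'<..<b'} x * (vb (x, ta) - vb (x, t))) - (LBINT x. ind {a'<..<b'} x * H x)"
    unfolding right_diff_distrib using vi Hi' by simp
   thus ?thesis using core[of a' b'] True by (simp add: a'_def b'_def)
  qed simp
  ultimately show "(LBINT x. ind {a<..<b} x * G x) = 0" by simp
 qed
 thus ?thesis by eventually_elim (auto simp: G_def H_def)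
qed

text \<open>The sum of c i times the positive part of x - xi i is a second primitive of the point masses. Its support lies
in (l, r) because both moments vanish, and it is bounded by r - l times the total weight; smoothed, it is
tested against the weak derivative.\<close>
lemma weak_xx_bound:
 fixes vb f :: "pt => real" and c xi :: "nat => real"
 assumes vb: "continuous_on UNIV vb" "!!z. abs(vb z) <= B"
  and f: "Lint f"
  and weak: "!!M th a b c d. smooth M ==> smooth th ==> (!!x. x < a \<or> b < x ==> M x = 0) ==>
   (!!t. t < c \<or> d < t ==> th t = 0) ==> 0 < a ==> b < 1 ==> 0 < c ==> d < T ==>
   (LINT z|lborel. vb z * (case z of (x, t) => deriv (deriv M) x * th t))
    = (LINT z|lborel. f z * (case z of (x, t) => M x * th t))"
  and xi: "!!i. i < k ==> l < xi i \<and> xi i < r" and lr: "0 < l" "l < r" "r < 1"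
  and t: "0 < t1" "t1 < t2" "t2 < T"
  and c: "(\<Sum>i<k. c i) = 0" "(\<Sum>i<k. c i * xi i) = 0"
 shows "abs(LBINT t. ind {t1<..<t2} t * (\<Sum>i<k. c i * vb (xi i, t)))
  <= (\<Sum>i<k. abs(c i)) * (r - l) * (LINT z|lborel. ind ({l<..<r} \<times> {t1<..<t2}) z * abs(f z))"
proof -
 obtain R S rh :: "real => real" and ka where rs: "smooth rh" "!!x. (S has_real_derivative rh x) (at x)"
  "!!x. (R has_real_derivative S x) (at x)"
  "!!x. 0 <= rh x" "!!x. x <= 0 \<or> 1 <= x ==> rh x = 0"
  "!!x. x <= 0 ==> S x = 0" "!!x. 1 <= x ==> S x = 1" "!!x. 0 <= S x" "!!x. S x <= 1"
  "!!x. x <= 0 ==> R x = 0" "!!x. 1 <= x ==> R x = x - ka" "!!x. abs(R x) <= abs(x)"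
  by (rule ramp_exists) blast
 have rhi: "Lint rh" "(LBINT y. rh y) = 1"
  by (rule derivative_bump_integral[of S rh]; use rs smooth_continuous in auto)+
 have sS: "smooth S" by (rule smooth_derivI[OF rs(2,1)])
 have sR: "smooth R" by (rule smooth_derivI[OF rs(3) sS])
 have S01: "abs(S x) <= 1" for x using rs(8,9)[of x] by simp
 have [measurable]: "vb \<in> BM" "f \<in> BM" "S \<in> BM"
   "R \<in> BM"
  using vb f smooth_continuous[OF sS] smooth_continuous[OF sR] by (auto intro: borel_measurable_continuous_onI)
 have B0: "0 <= B" using vb(2)[of 0] by simp
 have vbc: "continuous_on UNIV (%x. vb (x, s))" for s
  by (rule continuous_on_compose2[OF vb(1)]) (auto intro!: continuous_intros)
 define N where "N n = real (Suc n)" for n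
 have N: "0 < N n" for n by (simp add: N_def)
 define e where "e n = 1 / N n" for n
 have e: "0 < e n" for n using N by (simp add: e_def)
 have Nlim: "filterlim N at_top sequentially"
  unfolding N_def by (rule filterlim_compose[OF filterlim_real_sequentially filterlim_Suc])
 have Nlarge: "\<forall>\<^sub>F n in sequentially. K < N n * c" if "0 < c" for K c
 proof -
  have "\<forall>\<^sub>F n in sequentially. K / c < N n" using Nlim by (simp add: filterlim_at_top_dense)
  thus ?thesis by eventually_elim (use that in \<open>simp add: field_simps\<close>)
 qed
 define C where "C = (\<Sum>i<k. abs(c i))"
 have C: "0 <= C" by (simp add: C_def sum_nonneg)
 define M where "M n x = (\<Sum>i<k. c i * (e n * R (N n * (x - xi i))))" for n x
 define M2 where "M2 n x = (\<Sum>i<k. c i * (N n * rh (N n * (x - xi i))))" for n x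
 define th where "th n s = S (N n * (s - t1) - 1) * S (N n * (t2 - s) - 1)" for n s
 have sM: "smooth (M n)" for n
  unfolding M_def
 proof (intro smooth_sum smooth_mult smooth_const)
  fix i show "smooth (%x. R (N n * (x - xi i)))"
   using smooth_affine[OF sR, of "N n" "- N n * xi i"] by (simp add: algebra_simps)
 qed
 have dM: "deriv (deriv (M n)) = M2 n" for n
 proof -
  have 1: "(M n has_real_derivative (\<Sum>i<k. c i * S (N n * (x - xi i)))) (at x)" for x
   unfolding M_def using N[of n]
   by (auto intro!: derivative_eq_intros DERIV_chain2[OF rs(3)] sum.cong simp: e_def)
  have 2: "deriv (M n) = (%x. \<Sum>i<k. c i * S (N n * (x - xi i)))"
   using DERIV_imp_deriv[OF 1] by auto
  have 3: "((%x. \<Sum>i<k. c i * S (N n * (x - xi i))) has_real_derivative M2 n x) (at x)" for x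
   unfolding M2_def by (auto intro!: derivative_eq_intros DERIV_chain2[OF rs(2)] sum.cong)
  show ?thesis unfolding 2 using DERIV_imp_deriv[OF 3] by auto
 qed
 have sth: "smooth (th n)" for n
  unfolding th_def using smooth_affine[OF sS, of "N n" "- N n * t1 - 1"] smooth_affine[OF sS, of "- N n" "N n * t2 - 1"]
  by (intro smooth_mult) (simp_all add: algebra_simps)
 have th0: "th n s = 0" if "s < t1 + e n \<or> t2 - e n < s" for n s
 proof -
  have "N n * (s - t1) - 1 <= 0 \<or> N n * (t2 - s) - 1 <= 0"
   using that N[of n] by (auto simp: e_def field_simps)
  thus ?thesis using rs(6) by (auto simp: th_def)
 qed
 have th1: "abs(th n s) <= ind {t1<..<t2} s" for n s
 proof (cases "s \<in> {t1<..<t2}")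
  case True
  thus ?thesis using S01 by (auto simp: th_def abs_mult intro!: mult_le_one)
 next
  case False
  hence "s < t1 + e n \<or> t2 - e n < s" using e[of n] by auto
  thus ?thesis using False by (simp add: th0)
 qed
 have thlim: "(%n. th n x) \<longlonglongrightarrow> ind {t1<..<t2} x" for x
 proof (cases "t1 < x \<and> x < t2")
  case True
  have "\<forall>\<^sub>F n in sequentially. 2 < N n * (x - t1)" "\<forall>\<^sub>F n in sequentially. 2 < N n * (t2 - x)"
   using True by (auto intro!: Nlarge)
  hence "\<forall>\<^sub>F n in sequentially. 1 = th n x"
   by eventually_elim (simp add: th_def rs)
  thus ?thesis using True by (auto intro: Lim_transform_eventually[OF tendsto_const])
 next
  case False
  have "th n x = 0" for n
   by (rule th0) (use False e[of n] in auto)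
  thus ?thesis using False by (auto simp: indicator_def)
 qed
 have [measurable]: "M n \<in> BM" "th n \<in> BM" for n
  unfolding M_def th_def by measurable
 define J where "J n s = (LBINT x. M2 n x * vb (x, s))" for n s
 have Jeq: "J n s = (\<Sum>i<k. c i * (LBINT x. (N n * rh (N n * (x - xi i))) * vb (x, s)))" for n s
 proof -
  have i: "Lint (%x. (N n * rh (N n * (x - d))) * vb (x, s))" for d
  proof (rule ibound[where f = "%x. B * N n * rh (- N n * d + N n * x)"])
   show "Lint (%x. B * N n * rh (- N n * d + N n * x))"
    using lborel_integrable_real_affine[OF rhi(1), of "N n" "- N n * d"] N[of n] by auto
   show "AE x in lborel. norm (N n * rh (N n * (x - d)) * vb (x, s)) <= norm (B * N n * rh (- N n * d + N n * x))"
    using N[of n] vb(2) rs(4) B0 by (auto simp: abs_mult algebra_simps intro!: mult_right_mono)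
   show "(%x. N n * rh (N n * (x - d)) * vb (x, s)) \<in> borel_measurable lborel"
    using rhi(1) by (auto intro!: borel_measurable_times measurable_compose[of _ lborel borel rh])
  qed
  have "J n s = (LBINT x. \<Sum>i<k. c i * ((N n * rh (N n * (x - xi i))) * vb (x, s)))"
   unfolding J_def M2_def sum_distrib_right by (simp add: mult_ac)
  also have "... = (\<Sum>i<k. LBINT x. c i * ((N n * rh (N n * (x - xi i))) * vb (x, s)))"
   by (intro Bochner_Integration.integral_sum integrable_mult_right i)
  finally show ?thesis by simp
 qed
 have Jlim: "(%n. J n s) \<longlonglongrightarrow> (\<Sum>i<k. c i * vb (xi i, s))" for s
  unfolding Jeq N_def
  by (intro tendsto_sum tendsto_mult tendsto_const mollifier_limit(1)[where B = B, OF vbc _ rhi rs(4)] vb(2))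
 have Jbd: "abs(J n s) <= C * B" for n s
 proof -
  have "abs(J n s) <= (\<Sum>i<k. abs(c i * (LBINT x. (N n * rh (N n * (x - xi i))) * vb (x, s))))"
   unfolding Jeq by (rule sum_abs)
  also have "... <= (\<Sum>i<k. abs(c i) * B)"
   unfolding abs_mult N_def
   by (intro sum_mono mult_left_mono mollifier_limit(2)[OF vbc vb(2) rhi rs(4)]) auto
  finally show ?thesis by (simp add: C_def sum_distrib_right)
 qed
 have M2c: "continuous_on UNIV (M2 n)" for n
  using smooth_continuous[OF smooth_deriv[OF smooth_deriv[OF sM[of n]]]] by (simp add: dM)
 have [measurable]: "J n \<in> BM" for n
 proof -
  have "J n = (%s. \<Sum>i<k. c i * (LBINT x. (N n * rh (N n * (x - xi i))) * vb (x, s)))" using Jeq by auto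
  have vbm: "(%p. vb (snd p, fst p)) \<in> borel_measurable (borel \<Otimes>\<^sub>M lborel)"
   by (subst measurable_cong_sets[OF sets_pair_measure_cong[OF refl sets_lborel] refl])
    (auto simp: borel_prod intro!: borel_measurable_continuous_onI continuous_on_compose2[OF vb(1)] continuous_intros)
  show ?thesis unfolding J_def using M2c[of n]
   by (intro lborel.borel_measurable_lebesgue_integral)
    (auto intro!: vbm borel_measurable_times measurable_compose[OF measurable_snd, where g = "M2 n"] borel_measurable_continuous_onI
    simp: case_prod_beta' borel_prod)
 qed
 have L: "(%n. LBINT s. th n s * J n s) \<longlonglongrightarrow> (LBINT s. ind {t1<..<t2} s * (\<Sum>i<k. c i * vb (xi i, s)))"
 proof (rule integral_dominated_convergence[where w = "%s. C * B * ind {t1<..<t2} s"])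
  show "AE s in lborel. (%n. th n s * J n s) \<longlonglongrightarrow> ind {t1<..<t2} s * (\<Sum>i<k. c i * vb (xi i, s))"
   by (intro AE_I2 tendsto_mult thlim Jlim)
  show "AE s in lborel. norm (th n s * J n s) <= C * B * ind {t1<..<t2} s" for n
  proof (rule AE_I2)
   fix s
   have "abs(th n s) * abs(J n s) <= ind {t1<..<t2} s * (C * B)" by (intro mult_mono th1 Jbd) auto
   then show "norm (th n s * J n s) <= C * B * ind {t1<..<t2} s" by (simp add: abs_mult mult_ac)
  qed
 qed (use t in auto)
 define K where "K = C * (r - l) * (LINT z|lborel. ind ({l<..<r} \<times> {t1<..<t2}) z * abs(f z))"
 have box: "{l<..<r} \<times> {t1<..<t2} \<in> sets borel" by (intro borel_Times) auto
 have "\<forall>\<^sub>F n in sequentially. \<forall>i\<in>{..<k}. 1 < N n * (r - xi i)"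
  using xi by (subst eventually_ball_finite_distrib) (auto intro!: Nlarge)
 hence ev: "\<forall>\<^sub>F n in sequentially. abs(LBINT s. th n s * J n s) <= K"
 proof eventually_elim
  case (elim n)
  have Mbd: "abs(M n x) <= C * (r - l) * ind {l<..<r} x" for x
  proof -
   consider "x <= l" | "r <= x" | "l < x" "x < r" by linarith
   thus ?thesis
   proof cases
    case 1
    have "R (N n * (x - xi i)) = 0" if "i < k" for i
    using 1 xi[OF that] N[of n] by (intro rs(10) mult_nonneg_nonpos) auto
    hence "M n x = 0" by (simp add: M_def)
    thus ?thesis using C lr by (simp add: indicator_def)
   next
    case 2
    have "e n * R (N n * (x - xi i)) = x - xi i - e n * ka" if "i < k" for i
    proof -
    have "N n * (r - xi i) <= N n * (x - xi i)" using 2 N[of n] by (intro mult_left_mono) auto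
    hence "1 <= N n * (x - xi i)" using elim that by force
    hence "R (N n * (x - xi i)) = N n * (x - xi i) - ka" by (rule rs(11))
    thus ?thesis using N[of n] by (simp add: e_def diff_divide_distrib)
    qed
    hence "M n x = (\<Sum>i<k. c i * (x - xi i - e n * ka))" by (simp add: M_def)
    also have "... = (x - e n * ka) * (\<Sum>i<k. c i) - (\<Sum>i<k. c i * xi i)"
    by (simp add: sum_distrib_left sum_subtractf[symmetric] algebra_simps)
    finally have "M n x = 0" using c by simp
    thus ?thesis using C lr by (simp add: indicator_def)
   next
    case 3
    have "abs(M n x) <= (\<Sum>i<k. abs(c i * (e n * R (N n * (x - xi i)))))" unfolding M_def by (rule sum_abs)
    also have "... <= (\<Sum>i<k. abs(c i) * (r - l))"
    proof (rule sum_mono)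
    fix i assume "i \<in> {..<k}"
    hence i: "abs(x - xi i) <= r - l" using 3 xi[of i] by auto
    have "e n * abs(R (N n * (x - xi i))) <= e n * abs(N n * (x - xi i))" using rs(12) e[of n] by (intro mult_left_mono) auto
    also have "... = abs(x - xi i)" using N[of n] by (simp add: e_def abs_mult)
    finally have "e n * abs(R (N n * (x - xi i))) <= r - l" using i by simp
    then show "abs(c i * (e n * R (N n * (x - xi i)))) <= abs(c i) * (r - l)"
    using e[of n] by (simp add: abs_mult mult_left_mono)
    qed
    finally show ?thesis using 3 by (simp add: C_def sum_distrib_right)
   qed
  qed
  have M0: "M n x = 0" if "x < l \<or> r < x" for x
   using Mbd[of x] that by (auto simp: indicator_def split: if_splits)
  have M20: "M2 n x = 0" if "x \<notin> {l..r}" for x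
  proof -
   have "rh (N n * (x - xi i)) = 0" if "i < k" for i
   proof (rule rs(5))
    have "x <= xi i \<or> r <= x" using \<open>x \<notin> {l..r}\<close> xi[OF that] by auto
    then show "N n * (x - xi i) <= 0 \<or> 1 <= N n * (x - xi i)"
    proof
    assume "r <= x"
    hence "N n * (r - xi i) <= N n * (x - xi i)" using N[of n] by (intro mult_left_mono) auto
    thus ?thesis using elim that by force
    qed (use N[of n] in \<open>auto intro!: mult_nonneg_nonpos\<close>)
   qed
   thus ?thesis by (simp add: M2_def)
  qed
  have "(LINT z|lborel. vb z * (case z of (x, s) => M2 n x * th n s)) = (LBINT s. th n s * J n s)"
   unfolding J_def
  proof (rule tensor_fubini(2)[OF vb(1) M2c M20 smooth_continuous[OF sth]])
   show "th n s = 0" if "s \<notin> {t1..t2}" for s using th1[of n s] that by (auto simp: indicator_def split: if_splits)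
  qed auto
  moreover have "(LINT z|lborel. vb z * (case z of (x, s) => deriv (deriv (M n)) x * th n s))
    = (LINT z|lborel. f z * (case z of (x, s) => M n x * th n s))"
   by (rule weak[OF sM sth, of l r n "t1 + e n" "t2 - e n" n]) (use M0 th0 lr t e[of n] in auto)
  ultimately have "(LBINT s. th n s * J n s) = (LINT z|lborel. f z * (case z of (x, s) => M n x * th n s))"
   by (simp add: dM)
  also have "abs(...) <= (LINT z|lborel. C * (r - l) * (ind ({l<..<r} \<times> {t1<..<t2}) z * abs(f z)))"
  proof -
   have bd: "abs(f z * (case z of (x, s) => M n x * th n s)) <= C * (r - l) * (ind ({l<..<r} \<times> {t1<..<t2}) z * abs(f z))" for z
   proof -
    have "abs(M n (fst z)) * abs(th n (snd z)) <= (C * (r - l) * ind {l<..<r} (fst z)) * ind {t1<..<t2} (snd z)"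
    using C lr by (intro mult_mono Mbd th1) auto
    hence "abs(f z) * (abs(M n (fst z)) * abs(th n (snd z))) <= abs(f z) * ((C * (r - l) * ind {l<..<r} (fst z)) * ind {t1<..<t2} (snd z))"
    by (intro mult_left_mono) auto
    thus ?thesis by (auto simp: abs_mult case_prod_beta' indicator_def mem_Times_iff mult_ac split: if_splits)
   qed
   have i: "Lint (%z. C * (r - l) * (ind ({l<..<r} \<times> {t1<..<t2}) z * abs(f z)))"
    using integrable_mult_indicator[OF _ integrable_abs[OF f], of "{l<..<r} \<times> {t1<..<t2}"] box by simp
   hence "Lint (%z. f z * (case z of (x, s) => M n x * th n s))"
   proof (rule ibound)
    show "AE z in lborel. norm (f z * (case z of (x, s) => M n x * th n s)) <= norm (C * (r - l) * (ind ({l<..<r} \<times> {t1<..<t2}) z * abs(f z)))"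
    using bd by (intro AE_I2) (smt (verit) real_norm_def)
   qed (simp add: case_prod_beta')
   thus ?thesis using i bd by (intro integral_abs_bound_integral) auto
  qed
  finally show ?case by (simp add: K_def)
 qed
 have "abs(LBINT s. ind {t1<..<t2} s * (\<Sum>i<k. c i * vb (xi i, s))) <= K"
  by (rule tendsto_upperbound[OF tendsto_rabs[OF L] ev]) simp
 thus ?thesis by (simp add: K_def C_def)
qed

section \<open>The trace estimate\<close>

lemma deriv_zero_outside:
 fixes th :: "real => real"
 assumes "!!t. t < c \<or> d < t ==> th t = 0" "t < c \<or> d < t"
 shows "deriv th t = 0"
proof (rule DERIV_imp_deriv)
 have "((%_. 0) has_real_derivative 0) (at t)" by simp
 then show "(th has_real_derivative 0) (at t)"
  by (rule has_field_derivative_transform_within_open[where S = "{..<c} \<union> {d<..}"]) (use assms in auto)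
qed

lemma powr_add_le:
 fixes a b q :: real
 assumes "0 <= a" "0 <= b" "0 <= q"
 shows "(a + b) powr q <= 2 powr q * (a powr q + b powr q)"
proof -
 have "(a + b) powr q <= (2 * max a b) powr q" using assms by (intro powr_mono2) auto
 also have "... = 2 powr q * max a b powr q" using assms by (simp add: powr_mult)
 also have "... <= 2 powr q * (a powr q + b powr q)" by (intro mult_left_mono) (auto simp: max_def)
 finally show ?thesis .
qed

lemma closure_cylinder: "0 < T ==> closure (cylinder T) = {0..1} \<times> {0..T}"
 by (simp add: cylinder_def Omega_def closure_Times closure_greaterThanLessThan)

text \<open>Write the combination at time 0 as its average over (t1, t2) plus increments in time; the average is
controlled by the second space derivative because the weights annihilate affine functions.\<close>
lemma trace_bound:
 assumes phi: "\<phi> \<in> trace_space q" and q: "1 < q"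
 obtains T F N where "0 < T" "F \<in> BM" "!!z. 0 <= F z"
  "(NN z. en (F z powr q)) < \<infinity>" "N \<in> null_sets lborel" "continuous_on {0..1} \<phi>"
  "!!k c xi l r t1 t2. (!!i. i < (k::nat) ==> 0 < xi i \<and> xi i < 1 \<and> xi i \<notin> N \<and> l < xi i \<and> xi i < r) ==>
   (\<Sum>i<k. c i) = 0 ==> (\<Sum>i<k. c i * xi i) = 0 ==> 0 < t1 ==> t1 < t2 ==> t2 < T ==>
   en (abs(\<Sum>i<k. c i * \<phi> (xi i))) <=
    en ((\<Sum>i<k. abs(c i)) * (r - l) / (t2 - t1)) * (NN z. ind ({l<..<r} \<times> {t1<..<t2}) z * en (F z))
    + (\<Sum>i<k. en (abs(c i)) * (NN s. ind {0<..<t2} s * en (F (xi i, s))))"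
proof -
 obtain T v where T: "0 < T" and v: "v \<in> W21 q T" "continuous_on (closure (cylinder T)) v"
  "\<forall>x\<in>closure Omega. v (x, 0) = \<phi> x"
  using phi by (auto simp: trace_space_def)
 obtain vt vxx where vt: "vt \<in> Lq_space q (cylinder T)" "weak_t (cylinder T) v vt"
  and vxx: "vxx \<in> Lq_space q (cylinder T)" "weak_xx (cylinder T) v vxx"
  using v(1) by (auto simp: W21_def)
 have q0: "0 < q" using q by simp
 obtain g where g: "g \<in> BM" "!!z. z \<notin> cylinder T ==> g z = 0"
  "(NN z. en (abs(g z) powr q)) < \<infinity>"
  "!!h. h \<in> BM ==> (LINT z|lebesgue_on (cylinder T). vt z * h z) = (LINT z|lborel. g z * h z)"
  by (rule Lq_borel_version[OF vt(1) cylinder_sets q0]) (rule that)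
 obtain f where f: "f \<in> BM" "!!z. z \<notin> cylinder T ==> f z = 0"
  "(NN z. en (abs(f z) powr q)) < \<infinity>"
  "!!h. h \<in> BM ==> (LINT z|lebesgue_on (cylinder T). vxx z * h z) = (LINT z|lborel. f z * h z)"
  by (rule Lq_borel_version[OF vxx(1) cylinder_sets q0]) (rule that)
 have gi: "Lint g" and fi: "Lint f"
  using Lq_integrable[OF g(1,2) cylinder_sets emeasure_cylinder_finite g(3)]
   Lq_integrable[OF f(1,2) cylinder_sets emeasure_cylinder_finite f(3)] q by auto
 define vb where "vb z = v (max 0 (min 1 (fst z)), max 0 (min T (snd z)))" for z
 have cl: "closure (cylinder T) = {0..1} \<times> {0..T}" by (rule closure_cylinder[OF T])
 have vbc: "continuous_on UNIV vb"
  unfolding vb_def using T by (intro continuous_on_compose2[OF v(2)] continuous_intros) (auto simp: cl)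
 have vbv: "vb z = v z" if "z \<in> {0..1} \<times> {0..T}" for z
  using that by (cases z) (auto simp: vb_def max_def min_def)
 have "compact (v ` ({0..1} \<times> {0..T}))"
  using v(2) cl by (intro compact_continuous_image compact_Times) auto
 then obtain B where B: "!!z. z \<in> {0..1} \<times> {0..T} ==> abs(v z) <= B"
  by (metis compact_imp_bounded bounded_iff imageI real_norm_def)
 have vbB: "abs(vb z) <= B" for z
  unfolding vb_def using T by (intro B) auto
 have phi_vb: "vb (x, 0) = \<phi> x" if "0 <= x" "x <= 1" for x
  using that v(3) T vbv[of "(x, 0)"] by (auto simp: Omega_def)
 have cphi: "continuous_on {0..1} \<phi>"
 proof -
  have "continuous_on {0..1} (%x. vb (x, 0))"
   by (rule continuous_on_compose2[OF vbc]) (auto intro!: continuous_intros)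
  thus ?thesis by (rule continuous_on_eq) (simp add: phi_vb)
 qed
 have cylb: "(x, t) \<in> cylinder T ==> (x, t) \<in> {0..1} \<times> {0..T}" for x t by (auto simp: cylinder_def Omega_def)
 have tensor_left: "(LINT z|lebesgue_on (cylinder T). v z * (case z of (x, t) => M x * th t))
   = (LINT z|lborel. vb z * (case z of (x, t) => M x * th t))"
  if "smooth M" "smooth th" "!!x. x < a \<or> b < x ==> M x = 0" "!!t. t < c \<or> d < t ==> th t = 0"
   "0 < a" "b < 1" "0 < c" "d < T" for M th a b c d
 proof -
  have [measurable]: "M \<in> BM" "th \<in> BM" "vb \<in> BM"
   using that smooth_continuous vbc by (auto intro: borel_measurable_continuous_onI)
  have "(LINT z|lebesgue_on (cylinder T). v z * (case z of (x, t) => M x * th t))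
   = (LINT z|lebesgue_on (cylinder T). vb z * (case z of (x, t) => M x * th t))"
   by (intro icong) (auto simp: vbv[OF cylb])
  also have "... = (LINT z|lborel. ind (cylinder T) z * (vb z * (case z of (x, t) => M x * th t)))"
   by (rule integral_lebesgue_on_borel[OF cylinder_sets]) (simp add: case_prod_beta')
  also have "... = (LINT z|lborel. vb z * (case z of (x, t) => M x * th t))"
  proof (intro icong refl)
   fix z :: "pt"
   obtain x t where z: "z = (x, t)" by (cases z)
   show "ind (cylinder T) z * (vb z * (case z of (x, t) => M x * th t)) = vb z * (case z of (x, t) => M x * th t)"
   proof (cases "z \<in> cylinder T")
    case False
    hence "(x < a \<or> b < x) \<or> (t < c \<or> d < t)"
    using z that(5-8) by (auto simp: cylinder_def Omega_def)
    thus ?thesis using that(3)[of x] that(4)[of t] z by auto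
   qed simp
  qed
  finally show ?thesis .
 qed
 have weakt: "(LINT z|lborel. vb z * (case z of (x, t) => M x * deriv th t))
    = - (LINT z|lborel. g z * (case z of (x, t) => M x * th t))"
  if as: "smooth M" "smooth th" "!!x. x < a \<or> b < x ==> M x = 0" "!!t. t < c \<or> d < t ==> th t = 0"
   "0 < a" "b < 1" "0 < c" "d < T" for M th a b c d
 proof -
  have "(%(x, t). M x * th t) \<in> test_functions (interior (cylinder T))"
   by (rule tensor_test_function[OF as])
  hence "(LINT z|lebesgue_on (cylinder T). v z * partial_t (%(x, t). M x * th t) z)
   = (-1) ^ 1 * (LINT z|lebesgue_on (cylinder T). vt z * (case z of (x, t) => M x * th t))"
   using vt(2) unfolding is_weak_deriv_def by blast
  also have "(LINT z|lebesgue_on (cylinder T). vt z * (case z of (x, t) => M x * th t))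
   = (LINT z|lborel. g z * (case z of (x, t) => M x * th t))"
   using smooth_continuous[OF as(1)] smooth_continuous[OF as(2)]
   by (intro g(4)) (auto simp: case_prod_beta' intro!: borel_measurable_continuous_onI continuous_intros
    continuous_on_compose2[of UNIV M] continuous_on_compose2[of UNIV th])
  finally show ?thesis
   unfolding partial_tensor(2)[OF as(1,2)]
   using tensor_left[OF as(1) smooth_deriv[OF as(2)] as(3) deriv_zero_outside[OF as(4)] as(5-8)] by simp
 qed
 have weakxx: "(LINT z|lborel. vb z * (case z of (x, t) => deriv (deriv M) x * th t))
    = (LINT z|lborel. f z * (case z of (x, t) => M x * th t))"
  if as: "smooth M" "smooth th" "!!x. x < a \<or> b < x ==> M x = 0" "!!t. t < c \<or> d < t ==> th t = 0"
   "0 < a" "b < 1" "0 < c" "d < T" for M th a b c d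
 proof -
  have "(%(x, t). M x * th t) \<in> test_functions (interior (cylinder T))"
   by (rule tensor_test_function[OF as])
  hence "(LINT z|lebesgue_on (cylinder T). v z * partial_x (partial_x (%(x, t). M x * th t)) z)
   = (-1) ^ 2 * (LINT z|lebesgue_on (cylinder T). vxx z * (case z of (x, t) => M x * th t))"
   using vxx(2) unfolding is_weak_deriv_def by blast
  also have "(LINT z|lebesgue_on (cylinder T). vxx z * (case z of (x, t) => M x * th t))
   = (LINT z|lborel. f z * (case z of (x, t) => M x * th t))"
   using smooth_continuous[OF as(1)] smooth_continuous[OF as(2)]
   by (intro f(4)) (auto simp: case_prod_beta' intro!: borel_measurable_continuous_onI continuous_intros
    continuous_on_compose2[of UNIV M] continuous_on_compose2[of UNIV th])
  finally show ?thesis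
   unfolding partial_tensor(1)[OF as(1,2)] partial_tensor(1)[OF smooth_deriv[OF as(1)] as(2)]
   using tensor_left[OF smooth_deriv[OF smooth_deriv[OF as(1)]] as(2) deriv_zero_outside[OF deriv_zero_outside[OF as(3)]] as(4-8)]
   by simp
 qed
 define F where "F z = abs(f z) + abs(g z)" for z
 have F: "F \<in> BM" "!!z. 0 <= F z"
  unfolding F_def using f(1) g(1) by auto
 have Fq: "(NN z. en (F z powr q)) < \<infinity>"
 proof -
  have "(NN z. en (F z powr q))
    <= (NN z. en (2 powr q) * (en (abs(f z) powr q) + en (abs(g z) powr q)))"
   unfolding F_def
  proof (intro nn_integral_mono)
   fix z
   have "en ((abs(f z) + abs(g z)) powr q) <= en (2 powr q * (abs(f z) powr q + abs(g z) powr q))"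
    using q by (intro ennreal_leI powr_add_le) auto
   then show "en ((abs(f z) + abs(g z)) powr q) <= en (2 powr q) * (en (abs(f z) powr q) + en (abs(g z) powr q))"
    by (simp add: ennreal_mult)
  qed
  also have "... = en (2 powr q) * ((NN z. en (abs(f z) powr q)) + (NN z. en (abs(g z) powr q)))"
   using f(1) g(1) by (subst nn_integral_cmult, simp, subst nn_integral_add) auto
  also have "... < \<infinity>" using f(3) g(3) by (simp add: ennreal_mult_less_top)
  finally show ?thesis .
 qed
 have inc: "AE x in lborel. \<forall>ta\<in>\<rat>. \<forall>t\<in>\<rat>. 0 < ta \<longrightarrow> ta < t \<longrightarrow> t < T \<longrightarrow> 0 < x \<and> x < 1 \<longrightarrow>
   vb (x, t) - vb (x, ta) = (LBINT s. ind {ta<..t} s * g (x, s))"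
  by (intro AE_ball_countable[THEN iffD2] countable_rat ballI AE_impI weak_t_increment[OF vbc vbB gi weakt])
 have gx: "AE x in lborel. Lint (%s. g (x, s))"
  using lborel_pair.AE_integrable_fst[of "%x s. g (x, s)"] gi by (simp add: lborel_prod)
 from AE_E[OF AE_conjI[OF inc gx]] obtain N where N0: "emeasure lborel N = 0" "N \<in> sets lborel"
  and N1: "{x \<in> space lborel. \<not> ((\<forall>ta\<in>\<rat>. \<forall>t\<in>\<rat>. 0 < ta \<longrightarrow> ta < t \<longrightarrow> t < T \<longrightarrow> 0 < x \<and> x < 1 \<longrightarrow>
   vb (x, t) - vb (x, ta) = (LBINT s. ind {ta<..t} s * g (x, s))) \<and> Lint (%s. g (x, s)))} \<subseteq> N" by blast
 have N: "N \<in> null_sets lborel" using N0 by auto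
 have NI: "vb (x, t) - vb (x, ta) = (LBINT s. ind {ta<..t} s * g (x, s))" "Lint (%s. g (x, s))"
  if "x \<notin> N" "0 < x" "x < 1" "ta \<in> \<rat>" "t \<in> \<rat>" "0 < ta" "ta < t" "t < T" for x ta t
  using N1 that by auto
 have S1: "en (abs(vb (x, t) - vb (x, 0))) <= (NN s. ind {0<..<t2} s * en (F (x, s)))"
  if x: "x \<notin> N" "0 < x" "x < 1" and t: "0 < t" "t < t2" "t2 < T" for x t t2
 proof (cases "(NN s. ind {0<..<t2} s * en (F (x, s)))")
  case (real A)
  have "abs(vb (x, t) - vb (x, 0)) <= A + \<epsilon>" if eps: "0 < \<epsilon>" for \<epsilon>
  proof -
   have c: "continuous_on UNIV (%s. vb (x, s))"
    by (rule continuous_on_compose2[OF vbc]) (auto intro!: continuous_intros)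
   obtain d1 where d1: "0 < d1" "!!s. abs(s - t) < d1 ==> abs(vb (x, s) - vb (x, t)) < \<epsilon> / 2"
    using c[unfolded continuous_on_iff, rule_format, of t "\<epsilon> / 2"] eps by (auto simp: dist_real_def)
   obtain d2 where d2: "0 < d2" "!!s. abs(s - 0) < d2 ==> abs(vb (x, s) - vb (x, 0)) < \<epsilon> / 2"
    using c[unfolded continuous_on_iff, rule_format, of 0 "\<epsilon> / 2"] eps by (auto simp: dist_real_def)
   obtain t' where t': "t' \<in> \<rat>" "t < t'" "t' < min t2 (t + d1)"
    using Rats_dense_in_real[of t "min t2 (t + d1)"] t d1 by auto
   obtain ta' where ta': "ta' \<in> \<rat>" "0 < ta'" "ta' < min t d2"
    using Rats_dense_in_real[of 0 "min t d2"] t d2 by auto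
   have gi': "Lint (%s. ind {ta'<..t'} s * g (x, s))"
    using integrable_mult_indicator[OF _ NI(2)[OF x ta'(1) t'(1)], of "{ta'<..t'}"] t t' ta' by auto
   have "en (abs(vb (x, t') - vb (x, ta'))) = en (norm (LBINT s. ind {ta'<..t'} s * g (x, s)))"
    using NI(1)[OF x ta'(1) t'(1)] t t' ta' by auto
   also have "... <= (NN s. en (norm (ind {ta'<..t'} s * g (x, s))))"
    by (rule integral_norm_bound_ennreal[OF gi'])
   also have "... <= (NN s. ind {0<..<t2} s * en (F (x, s)))"
    using t t' ta' by (intro nn_integral_mono) (auto simp: indicator_def F_def intro!: ennreal_leI)
   finally have "abs(vb (x, t') - vb (x, ta')) <= A" using real by simp
   thus ?thesis using d1(2)[of t'] d2(2)[of ta'] t' ta' by (auto simp: abs_if split: if_splits)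
  qed
  hence "abs(vb (x, t) - vb (x, 0)) <= A" by (rule field_le_epsilon)
  thus ?thesis using real by (auto intro: ennreal_leI)
 qed simp
 show ?thesis
 proof (rule that[OF T F Fq N cphi])
  fix k :: nat and c xi and l r t1 t2 :: real
  assume xi: "!!i. i < k ==> 0 < xi i \<and> xi i < 1 \<and> xi i \<notin> N \<and> l < xi i \<and> xi i < r"
   and c: "(\<Sum>i<k. c i) = 0" "(\<Sum>i<k. c i * xi i) = 0" and t: "0 < t1" "t1 < t2" "t2 < T"
  let ?C = "\<Sum>i<k. abs(c i)"
  let ?I = "NN z. ind ({l<..<r} \<times> {t1<..<t2}) z * en (F z)"
  let ?G = "%i. NN s. ind {0<..<t2} s * en (F (xi i, s))"
  show "en (abs(\<Sum>i<k. c i * \<phi> (xi i))) <= en (?C * (r - l) / (t2 - t1)) * ?I + (\<Sum>i<k. en (abs(c i)) * ?G i)"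
  proof (cases "k = 0")
   case False
   define l' where "l' = Min ((%i. max l (xi i / 2)) ` {..<k})"
   define r' where "r' = Max ((%i. min r ((xi i + 1) / 2)) ` {..<k})"
   have l': "l' <= max l (xi i / 2)" "min r ((xi i + 1) / 2) <= r'" if "i < k" for i
    using that by (auto simp: l'_def r'_def intro!: Min_le Max_ge)
   have "l' \<in> (%i. max l (xi i / 2)) ` {..<k}" unfolding l'_def using False by (intro Min_in) auto
   then obtain j where j: "j < k" "l' = max l (xi j / 2)" by auto
   have l2: "l <= l'" "0 < l'" using j(2) xi[OF j(1)] by auto
   have "r' \<in> (%i. min r ((xi i + 1) / 2)) ` {..<k}" unfolding r'_def using False by (intro Max_in) auto
   then obtain j where j: "j < k" "r' = min r ((xi j + 1) / 2)" by auto
   have r2: "r' <= r" "r' < 1" using j(2) xi[OF j(1)] by (auto simp: min_def)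
   have xi': "l' < xi i \<and> xi i < r'" if "i < k" for i
    using l'[OF that] xi[OF that] by (auto simp: max_def min_def split: if_splits)
   have lr': "l' < r'" using xi'[of 0] False by auto
   let ?S = "%t. \<Sum>i<k. c i * vb (xi i, t)"
   have cS: "continuous_on UNIV ?S"
    by (intro continuous_intros continuous_on_compose2[OF vbc]) auto
   have iS: "Lint (%t. ind {t1<..<t2} t * ?S t)"
    and i\<phi>: "Lint (%t. ind {t1<..<t2} t * (a::real))"
    and iv: "Lint (%t. ind {t1<..<t2} t * (vb (xi i, t) - vb (xi i, 0)))" for a i
   proof -
    have i: "Lint (%t. ind {t1<..<t2} t * h t)" if "continuous_on UNIV h" for h :: "real => real"
    proof -
    have "Lint (%t. ind {t1..t2} t *\<^sub>R h t)"
    using that by (intro borel_integrable_compact) (auto intro: continuous_on_subset)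
    from integrable_mult_indicator[OF _ this, of "{t1<..<t2}"] show ?thesis
    by (rule Bochner_Integration.integrable_cong[THEN iffD1, rotated -1]) (auto simp: indicator_def)
    qed
    show "Lint (%t. ind {t1<..<t2} t * ?S t)" by (rule i[OF cS])
    show "Lint (%t. ind {t1<..<t2} t * (a::real))" by (rule i) simp
    show "Lint (%t. ind {t1<..<t2} t * (vb (xi i, t) - vb (xi i, 0)))"
    by (rule i) (auto intro!: continuous_intros continuous_on_compose2[OF vbc])
   qed
   let ?D = "%i. LBINT t. ind {t1<..<t2} t * (vb (xi i, t) - vb (xi i, 0))"
   have "(LBINT t. ind {t1<..<t2} t * (\<Sum>i<k. c i * \<phi> (xi i)))
    = (LBINT t. ind {t1<..<t2} t * ?S t - (\<Sum>i<k. c i * (ind {t1<..<t2} t * (vb (xi i, t) - vb (xi i, 0)))))"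
   proof (intro icong refl)
    fix t
    have "(\<Sum>i<k. c i * \<phi> (xi i)) = (\<Sum>i<k. c i * vb (xi i, 0))"
    using xi by (intro sum.cong) (auto simp: phi_vb less_imp_le)
    then show "ind {t1<..<t2} t * (\<Sum>i<k. c i * \<phi> (xi i))
    = ind {t1<..<t2} t * ?S t - (\<Sum>i<k. c i * (ind {t1<..<t2} t * (vb (xi i, t) - vb (xi i, 0))))"
    by (simp add: sum_distrib_left sum_subtractf[symmetric] algebra_simps)
   qed
   also have "... = (LBINT t. ind {t1<..<t2} t * ?S t) - (\<Sum>i<k. c i * ?D i)"
    by (subst intdiff[OF iS], intro Bochner_Integration.integrable_sum integrable_mult_right iv,
    subst Bochner_Integration.integral_sum, intro integrable_mult_right iv, simp)
   finally have eq: "(t2 - t1) * (\<Sum>i<k. c i * \<phi> (xi i)) = (LBINT t. ind {t1<..<t2} t * ?S t) - (\<Sum>i<k. c i * ?D i)"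
    using t by simp
   have a: "en (abs(LBINT t. ind {t1<..<t2} t * ?S t)) <= en (?C * (r - l)) * ?I"
   proof -
    have box: "{l'<..<r'} \<times> {t1<..<t2} \<in> sets borel" by (intro borel_Times) auto
    have i: "Lint (%z. ind ({l'<..<r'} \<times> {t1<..<t2}) z * abs(f z))"
    using integrable_mult_indicator[OF _ integrable_abs[OF fi], of "{l'<..<r'} \<times> {t1<..<t2}"] box by simp
    have "en (abs(LBINT t. ind {t1<..<t2} t * ?S t))
    <= en (?C * (r' - l') * (LINT z|lborel. ind ({l'<..<r'} \<times> {t1<..<t2}) z * abs(f z)))"
    by (intro ennreal_leI weak_xx_bound[OF vbc vbB fi weakxx xi' l2(2) lr' r2(2) t c])
    also have "... = en (?C * (r' - l')) * en (LINT z|lborel. ind ({l'<..<r'} \<times> {t1<..<t2}) z * abs(f z))"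
    using lr' by (intro ennreal_mult) (auto intro!: mult_nonneg_nonneg sum_nonneg inonneg)
    also have "en (LINT z|lborel. ind ({l'<..<r'} \<times> {t1<..<t2}) z * abs(f z))
    = (NN z. en (ind ({l'<..<r'} \<times> {t1<..<t2}) z * abs(f z)))"
    by (intro nn_integral_eq_integral[symmetric] i) auto
    also have "en (?C * (r' - l')) * ... <= en (?C * (r - l)) * ?I"
    using l2 r2 by (intro mult_mono ennreal_leI mult_left_mono nn_integral_mono sum_nonneg)
    (auto simp: F_def indicator_def intro!: ennreal_leI)
    finally show ?thesis .
   qed
   have b: "en (abs(?D i)) <= en (t2 - t1) * ?G i" if "i < k" for i
   proof -
    have "en (norm (?D i)) <= (NN t. en (norm (ind {t1<..<t2} t * (vb (xi i, t) - vb (xi i, 0)))))"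
    by (rule integral_norm_bound_ennreal[OF iv])
    also have "... <= (NN t. ?G i * ind {t1<..<t2} t)"
    using t xi[OF that] S1[of "xi i" _ t2] by (intro nn_integral_mono) (auto simp: indicator_def)
    also have "... = ?G i * en (t2 - t1)"
    using t by (subst nn_integral_cmult_indicator) auto
    finally show ?thesis by (simp add: mult.commute)
   qed
   have "en (t2 - t1) * en (abs(\<Sum>i<k. c i * \<phi> (xi i))) = en (abs((t2 - t1) * (\<Sum>i<k. c i * \<phi> (xi i))))"
    using t by (simp add: abs_mult ennreal_mult)
   also have "... <= en (abs(LBINT t. ind {t1<..<t2} t * ?S t) + (\<Sum>i<k. abs(c i) * abs(?D i)))"
    unfolding eq by (intro ennreal_leI order_trans[OF abs_triangle_ineq4] add_left_mono order_trans[OF sum_abs]) (simp add: abs_mult)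
   also have "... = en (abs(LBINT t. ind {t1<..<t2} t * ?S t)) + (\<Sum>i<k. en (abs(c i)) * en (abs(?D i)))"
    by (simp add: ennreal_plus sum_nonneg ennreal_mult[symmetric] sum_ennreal)
   also have "... <= en (?C * (r - l)) * ?I + (\<Sum>i<k. en (abs(c i)) * (en (t2 - t1) * ?G i))"
    by (intro add_mono a sum_mono mult_left_mono b) auto
   also have "... = en (t2 - t1) * (en (?C * (r - l) / (t2 - t1)) * ?I + (\<Sum>i<k. en (abs(c i)) * ?G i))"
   proof -
    have "en (?C * (r - l)) = en (t2 - t1) * en (?C * (r - l) / (t2 - t1))"
    using t lr' l2 r2 by (subst ennreal_mult[symmetric]) (auto intro!: divide_nonneg_nonneg mult_nonneg_nonneg sum_nonneg)
    thus ?thesis by (simp add: distrib_left sum_distrib_left mult_ac)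
   qed
   finally show ?thesis
    using t by (simp add: ennreal_mult_le_mult_iff)
  qed simp
 qed
qed

section \<open>First order regularity of traces\<close>

lemma nn_integral_swap:
 fixes f :: "'a::euclidean_space => 'b::euclidean_space => ennreal"
 assumes "(%p. f (fst p) (snd p)) \<in> BM"
 shows "(NN y. NN x. f x y) = (NN x. NN y. f x y)"
proof (rule lborel_pair.Fubini')
 have "sets (lborel \<Otimes>\<^sub>M lborel :: ('a \<times> 'b) measure) = sets borel"
  by (simp only: lborel_prod sets_lborel)
 then show "case_prod f \<in> borel_measurable (lborel \<Otimes>\<^sub>M lborel)"
  using assms by (subst measurable_cong_sets) (auto simp: case_prod_beta')
qed

lemma nn_integral_plane:
 fixes f :: "pt => ennreal"
 assumes [measurable]: "f \<in> BM"
 shows "(NN z. f z) = (NN x. NN s. f (x, s))"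
proof -
 have "f \<in> borel_measurable (lborel \<Otimes>\<^sub>M lborel)" by (simp add: lborel_prod)
 from lborel.nn_integral_fst[OF this] show ?thesis by (simp add: lborel_prod)
qed

lemma emeasure_rectangle:
 "l <= r ==> a <= b ==> emeasure lborel ({l<..<r::real} \<times> {a<..<b::real}) = en ((r - l) * (b - a))"
 unfolding lborel_prod[symmetric] by (subst lborel.emeasure_pair_measure_Times) (auto simp: ennreal_mult)

lemma AE_not_null_affine:
 fixes N :: "real set"
 assumes "N \<in> null_sets lborel" "c ~= 0"
 shows "AE y in lborel. a + c * y \<notin> N"
proof -
 have [measurable]: "N \<in> sets borel" using assms by auto
 have "0 = (NN y. ind N y)" using assms by auto
 also have "... = en (abs(c)) * (NN y. ind N (a + c * y))"
  using assms by (intro nn_integral_real_affine) auto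
 finally have "(NN y. ind N (a + c * y) :: ennreal) = 0" using assms by auto
 hence "AE y in lborel. ind N (a + c * y) = (0::ennreal)"
  by (subst (asm) nn_integral_0_iff_AE) auto
 thus ?thesis by eventually_elim (auto simp: indicator_def split: if_splits)
qed

locale trace_control =
 fixes \<phi> :: "real => real" and q T :: real and F :: "pt => real" and N :: "real set"
 assumes T: "0 < T" and Fm [measurable]: "F \<in> BM" and F0: "!!z. 0 <= F z"
  and Fq: "(NN z. en (F z powr q)) < \<infinity>" and N: "N \<in> null_sets lborel"
  and cphi: "continuous_on {0..1} \<phi>" and q: "3 < q"
  and bound: "!!k c xi l r t1 t2. (!!i. i < (k::nat) ==> 0 < xi i \<and> xi i < 1 \<and> xi i \<notin> N \<and> l < xi i \<and> xi i < r) ==>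
   (\<Sum>i<k. c i) = 0 ==> (\<Sum>i<k. c i * xi i) = 0 ==> 0 < t1 ==> t1 < t2 ==> t2 < T ==>
   en (abs(\<Sum>i<k. c i * \<phi> (xi i))) <=
    en ((\<Sum>i<k. abs(c i)) * (r - l) / (t2 - t1)) * (NN z. ind ({l<..<r} \<times> {t1<..<t2}) z * en (F z))
    + (\<Sum>i<k. en (abs(c i)) * (NN s. ind {0<..<t2} s * en (F (xi i, s))))"
begin

definition Fnorm :: real where "Fnorm = enn2real (NN z. en (F z powr q))"

lemma Fnorm: "(NN z. en (F z powr q)) = en Fnorm" "0 <= Fnorm"
 using Fq by (auto simp: Fnorm_def less_top)

lemma box_power:
 assumes "0 <= A" "en A <= (NN z. ind ({l<..<r} \<times> {a<..<b}) z * en (F z))" "l < r" "a < b"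
 shows "en (A powr q) <= en (((r - l) * (b - a)) powr (q - 1)) *
  (NN z. ind ({l<..<r} \<times> {a<..<b}) z * en (F z powr q))"
proof -
 have [measurable]: "{l<..<r} \<times> {a<..<b} \<in> sets borel" by (intro borel_Times) auto
 show ?thesis
  using assms F0 q by (intro weighted_jensen) (auto simp: emeasure_rectangle)
qed

definition \<phi>c :: "real => real" where "\<phi>c y = \<phi> (max 0 (min 1 y))"

lemma \<phi>c: "continuous_on UNIV \<phi>c" "!!y. 0 <= y ==> y <= 1 ==> \<phi>c y = \<phi> y"
proof -
 show "continuous_on UNIV \<phi>c"
  unfolding \<phi>c_def by (intro continuous_on_compose2[OF cphi] continuous_intros) auto
qed (simp add: \<phi>c_def)

lemma \<phi>c_bounded: obtains B where "!!y. abs(\<phi>c y) <= B"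
proof -
 have "compact (\<phi> ` {0..1})" using cphi by (intro compact_continuous_image) auto
 then obtain B where "!!y. y \<in> {0..1} ==> abs(\<phi> y) <= B"
  by (metis compact_imp_bounded bounded_iff imageI real_norm_def)
 hence "abs(\<phi>c y) <= B" for y unfolding \<phi>c_def by auto
 thus ?thesis using that by blast
qed

lemma \<phi>c_measurable [measurable]: "\<phi>c \<in> BM"
 by (rule borel_measurable_continuous_onI[OF \<phi>c(1)])

definition avg :: "real => real => real" where
 "avg h z = (LBINT y. ind {0<..<h} y * \<phi>c (z + y)) / h"

definition slope :: "real => real => real" where
 "slope h z = (LBINT y. ind {0<..<h} y * (\<phi>c (z + h + y) - \<phi>c (z + y))) / h\<^sup>2"

lemma window_integrable:
 fixes g :: "real => real"
 assumes "continuous_on UNIV g"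
 shows "Lint (%y. ind {0<..<h} y * g y)"
proof -
 have "Lint (%y. ind {0..h} y *\<^sub>R g y)"
  using assms by (intro borel_integrable_compact) (auto intro: continuous_on_subset)
 from integrable_mult_indicator[OF _ this, of "{0<..<h}"] show ?thesis
  by (rule Bochner_Integration.integrable_cong[THEN iffD1, rotated -1]) (auto simp: indicator_def)
qed

lemma \<phi>c_shift: "continuous_on UNIV (%y. \<phi>c (a + c * y))"
 by (rule continuous_on_compose2[OF \<phi>c(1)]) (auto intro!: continuous_intros)

lemma avg_slope:
 assumes "0 < h"
 shows "avg h (z + h) - avg h z = h * slope h z"
proof -
 have "(LBINT y. ind {0<..<h} y * (\<phi>c (z + h + y) - \<phi>c (z + y)))
  = (LBINT y. ind {0<..<h} y * \<phi>c (z + h + y)) - (LBINT y. ind {0<..<h} y * \<phi>c (z + y))"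
  using window_integrable[OF \<phi>c_shift[of "z + h" 1]] window_integrable[OF \<phi>c_shift[of z 1]]
  by (simp add: right_diff_distrib)
 thus ?thesis using assms by (simp add: avg_def slope_def power2_eq_square diff_divide_distrib right_diff_distrib)
qed

text \<open>Slopes of averages at scales h and h/2 differ by a combination of four point values with vanishing moments;
choosing the times of order h^2 in the trace bound gives the exponent 1 - 3/q, which is summable as q > 3.\<close>
lemma slope_halving:
 assumes h: "0 < h" "h\<^sup>2 < T" and z: "0 <= z" "z + 2 * h <= 1"
 shows "abs(slope h z - slope (h / 2) z) <= 72 * Fnorm powr (1 / q) * h powr (1 - 3 / q)"
proof -
 define D where "D y = \<phi>c (z + h + y) - \<phi>c (z + y) - 2 * \<phi>c (z + h / 2 + y / 2) + 2 * \<phi>c (z + y / 2)" for y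
 have Dm [measurable]: "D \<in> BM" unfolding D_def by measurable
 have cD: "continuous_on UNIV D"
  unfolding D_def by (intro continuous_intros continuous_on_compose2[OF \<phi>c(1)]) auto
 have eq: "h\<^sup>2 * (slope h z - slope (h / 2) z) = (LBINT y. ind {0<..<h} y * D y)"
 proof -
  have "(LBINT y. ind {0<..<h/2} y * (\<phi>c (z + h/2 + y) - \<phi>c (z + y)))
   = abs(1/2) *\<^sub>R (LBINT y. ind {0<..<h/2} (0 + 1/2 * y) * (\<phi>c (z + h/2 + (0 + 1/2 * y)) - \<phi>c (z + (0 + 1/2 * y))))"
   by (rule lborel_integral_real_affine) simp
  also have "... = (LBINT y. ind {0<..<h} y * (\<phi>c (z + h/2 + y/2) - \<phi>c (z + y/2))) / 2"
   by (auto simp: indicator_def intro!: icong)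
  finally have 1: "h\<^sup>2 * slope (h / 2) z = 2 * (LBINT y. ind {0<..<h} y * (\<phi>c (z + h/2 + y/2) - \<phi>c (z + y/2)))"
   using h by (simp add: slope_def power2_eq_square field_simps)
  have 2: "h\<^sup>2 * slope h z = (LBINT y. ind {0<..<h} y * (\<phi>c (z + h + y) - \<phi>c (z + y)))"
   using h by (simp add: slope_def)
  have i1: "Lint (%y. ind {0<..<h} y * (\<phi>c (z + h + y) - \<phi>c (z + y)))"
   by (intro window_integrable continuous_intros continuous_on_compose2[OF \<phi>c(1)]) auto
  have i2: "Lint (%y. ind {0<..<h} y * (\<phi>c (z + h/2 + y/2) - \<phi>c (z + y/2)))"
   by (intro window_integrable continuous_intros continuous_on_compose2[OF \<phi>c(1)]) auto
  show ?thesis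
   unfolding right_diff_distrib[of "h\<^sup>2"] 1 2 integral_mult_right_zero[symmetric, of 2]
   by (subst intdiff[symmetric, OF i1 integrable_mult_right[OF i2]])
    (auto simp: D_def algebra_simps intro!: icong)
 qed
 let ?J = "NN p. ind ({z<..<z+2*h} \<times> {0<..<h\<^sup>2}) p * en (F p)"
 have box [measurable]: "{z<..<z+2*h} \<times> {a<..<b} \<in> sets borel" for a b :: real by (intro borel_Times) auto
 define xi where "xi y i = (if i = 0 then z + h + y else if i = 1 then z + y else if i = 2 then z + h / 2 + y / 2 else z + y / 2)"
  for y and i :: nat
 define c where "c i = (if i = 0 then 1 else if i = 1 then - 1 else if i = 2 then - 2 else 2 :: real)" for i :: nat
 let ?P = "%i y. ind {0<..<h} y * (NN s. ind {0<..<h\<^sup>2} s * en (F (xi y i, s)))"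
 have nums: "4 = Suc (Suc (Suc (Suc 0)))" by simp
 have half: "1 / 2 ~= (0::real)" by simp
 have pt: "AE y in lborel. en (norm (ind {0<..<h} y * D y)) <=
   en (24 / h) * ?J * ind {0<..<h} y + (\<Sum>i<4. en (abs(c i)) * ?P i y)"
  using AE_not_null_affine[OF N one_neq_zero, of "z + h"] AE_not_null_affine[OF N one_neq_zero, of z]
   AE_not_null_affine[OF N half, of "z + h/2"] AE_not_null_affine[OF N half, of z]
 proof eventually_elim
  case (elim y)
  show ?case
  proof (cases "0 < y \<and> y < h")
   case True
   have "en (abs(\<Sum>i<4. c i * \<phi> (xi y i))) <=
    en ((\<Sum>i<4. abs(c i)) * ((z + 2 * h) - z) / (h\<^sup>2 - h\<^sup>2 / 2)) * (NN p. ind ({z<..<z+2*h} \<times> {h\<^sup>2/2<..<h\<^sup>2}) p * en (F p))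
    + (\<Sum>i<4. en (abs(c i)) * (NN s. ind {0<..<h\<^sup>2} s * en (F (xi y i, s))))"
   proof (rule bound)
    fix i :: nat assume "i < 4"
    show "0 < xi y i \<and> xi y i < 1 \<and> xi y i \<notin> N \<and> z < xi y i \<and> xi y i < z + 2 * h"
    using elim True h z by (auto simp: xi_def)
   next
    show "(\<Sum>i<4. c i) = 0" "(\<Sum>i<4. c i * xi y i) = 0"
    by (simp_all add: nums c_def xi_def field_simps)
   qed (use h in auto)
   also have "(\<Sum>i<4. c i * \<phi> (xi y i)) = D y"
    using True h z by (simp add: nums c_def xi_def D_def \<phi>c(2))
   also have "(\<Sum>i<4. abs(c i)) * ((z + 2 * h) - z) / (h\<^sup>2 - h\<^sup>2 / 2) = 24 / h"
    using h by (simp add: nums c_def power2_eq_square field_simps)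
   finally have "en (abs(D y)) <= en (24 / h) * (NN p. ind ({z<..<z+2*h} \<times> {h\<^sup>2/2<..<h\<^sup>2}) p * en (F p))
    + (\<Sum>i<4. en (abs(c i)) * (NN s. ind {0<..<h\<^sup>2} s * en (F (xi y i, s))))" .
   also have "... <= en (24 / h) * ?J
    + (\<Sum>i<4. en (abs(c i)) * (NN s. ind {0<..<h\<^sup>2} s * en (F (xi y i, s))))"
    using h zero_le_power2[of h] by (intro add_mono mult_left_mono nn_integral_mono) (auto simp: indicator_def)
   finally show ?thesis using True by simp
  qed simp
 qed
 have P: "(NN y. ?P i y) <= 2 * ?J" for i
 proof -
  obtain a ka where a: "!!y. xi y i = a + ka * y" "ka = 1 \<or> ka = 1/2"
   and az: "!!y. 0 < y ==> y < h ==> z < a + ka * y \<and> a + ka * y < z + 2 * h"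
  proof -
   consider "i = 0" | "i = 1" | "i = 2" | "i ~= 0" "i ~= 1" "i ~= 2" by blast
   thus ?thesis
   proof cases
    case 1 show ?thesis by (rule that[of "z + h" 1]) (use 1 h in \<open>auto simp: xi_def\<close>)
   next
    case 2 show ?thesis by (rule that[of "z" 1]) (use 2 h in \<open>auto simp: xi_def\<close>)
   next
    case 3 show ?thesis by (rule that[of "z + h/2" "1/2"]) (use 3 h in \<open>auto simp: xi_def\<close>)
   next
    case 4 show ?thesis by (rule that[of "z" "1/2"]) (use 4 h in \<open>auto simp: xi_def\<close>)
   qed
  qed
  let ?H = "%x. NN s. ind ({z<..<z+2*h} \<times> {0<..<h\<^sup>2}) (x, s) * en (F (x, s))"
  have [measurable]: "?H \<in> BM"
  proof (rule lborel.borel_measurable_nn_integral)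
   have "(%p. ind ({z<..<z+2*h} \<times> {0<..<h\<^sup>2}) p * en (F p)) \<in> borel_measurable (borel \<Otimes>\<^sub>M lborel)"
    by (subst measurable_cong_sets[OF sets_pair_measure_cong[OF refl sets_lborel] refl]) (simp add: borel_prod)
   then show "(%(x, s). ind ({z<..<z+2*h} \<times> {0<..<h\<^sup>2}) (x, s) * en (F (x, s))) \<in> borel_measurable (borel \<Otimes>\<^sub>M lborel)"
    by (simp add: case_prod_beta')
  qed
  have "(NN y. ?P i y) <= (NN y. ?H (a + ka * y))"
  proof (rule nn_integral_mono)
   fix y
   show "?P i y <= ?H (a + ka * y)"
    using az[of y] by (auto simp: a(1) indicator_def intro!: nn_integral_mono)
  qed
  also have "... <= 2 * (en (abs(ka)) * (NN y. ?H (a + ka * y)))"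
  proof -
   have "1 <= 2 * en (abs(ka))"
   proof -
    have "2 * en (abs(ka)) = en (2 * abs(ka))" by (simp add: ennreal_mult)
    also have "en 1 <= en (2 * abs(ka))" using a(2) by (intro ennreal_leI) auto
    finally show ?thesis by (simp add: \<open>2 * en (abs(ka)) = en (2 * abs(ka))\<close>)
   qed
   from mult_right_mono[OF this, of "NN y. ?H (a + ka * y)"] show ?thesis by (simp add: mult_ac)
  qed
  also have "en (abs(ka)) * (NN y. ?H (a + ka * y)) = (NN x. ?H x)"
   using a(2) by (intro nn_integral_real_affine[symmetric]) auto
  also have "... = ?J" by (rule nn_integral_plane[symmetric]) measurable
  finally show ?thesis .
 qed
 have Pm [measurable]: "(%y. ?P i y) \<in> BM" for i
 proof -
  have "(%y. NN s. ind {0<..<h\<^sup>2} s * en (F (xi y i, s))) \<in> BM"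
  proof (rule lborel.borel_measurable_nn_integral)
   have "(%p. ind {0<..<h\<^sup>2} (snd p) * en (F (xi (fst p) i, snd p))) \<in> borel_measurable (borel \<Otimes>\<^sub>M lborel)"
    unfolding xi_def by (subst measurable_cong_sets[OF sets_pair_measure_cong[OF refl sets_lborel] refl]) (simp add: borel_prod)
   then show "(%(y, s). ind {0<..<h\<^sup>2} s * en (F (xi y i, s))) \<in> borel_measurable (borel \<Otimes>\<^sub>M lborel)"
    by (simp add: case_prod_beta')
  qed
  thus ?thesis by measurable
 qed
 have "en (norm (LBINT y. ind {0<..<h} y * D y)) <= (NN y. en (norm (ind {0<..<h} y * D y)))"
  by (intro integral_norm_bound_ennreal window_integrable cD)
 also have "... <= (NN y. en (24 / h) * ?J * ind {0<..<h} y + (\<Sum>i<4. en (abs(c i)) * ?P i y))"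
  by (rule nn_integral_mono_AE[OF pt])
 also have "... = en (24 / h) * ?J * en h + (\<Sum>i<4. en (abs(c i)) * (NN y. ?P i y))"
  using h by (subst nn_integral_add, simp, simp, subst nn_integral_cmult_indicator, simp, subst nn_integral_sum, simp, subst nn_integral_cmult) auto
 also have "... <= en (24 / h) * ?J * en h + (\<Sum>i<4. en (abs(c i)) * (2 * ?J))"
  by (intro add_left_mono sum_mono mult_left_mono P) auto
 also have "... = 36 * ?J"
 proof -
  have "en (24 / h) * ?J * en h = en (24 / h * h) * ?J"
   using h by (subst ennreal_mult) (auto simp: mult_ac)
  also have "... = 24 * ?J" using h by simp
  finally show ?thesis by (simp add: nums c_def distrib_right[symmetric] mult.assoc[symmetric])
 qed
 finally have main: "en (abs(h\<^sup>2 * (slope h z - slope (h / 2) z))) <= 36 * ?J" by (simp add: eq)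
 define A where "A = abs(h\<^sup>2 * (slope h z - slope (h / 2) z)) / 36"
 have A0: "0 <= A" by (simp add: A_def)
 have "36 * en A = en (36 * A)" using A0 by (simp add: ennreal_mult)
 also have "... <= 36 * ?J" using main by (simp add: A_def)
 finally have "36 * en A <= 36 * ?J" .
 hence AJ: "en A <= ?J" by (subst (asm) ennreal_mult_le_mult_iff) auto
 have "en (A powr q) <= en ((((z+2*h) - z) * (h\<^sup>2 - 0)) powr (q - 1)) *
   (NN p. ind ({z<..<z+2*h} \<times> {0<..<h\<^sup>2}) p * en (F p powr q))"
  by (rule box_power[OF _ AJ]) (use h in \<open>auto simp: A_def\<close>)
 also have "... <= en ((2 * h ^ 3) powr (q - 1)) * en Fnorm"
  unfolding Fnorm(1)[symmetric]
  by (intro mult_mono nn_integral_mono) (auto simp: indicator_def power2_eq_square power3_eq_cube mult_ac)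
 finally have "A powr q <= (2 * h ^ 3) powr (q - 1) * Fnorm"
  using Fnorm(2) by (simp add: ennreal_mult[symmetric])
 hence "(A powr q) powr (1/q) <= ((2 * h ^ 3) powr (q - 1) * Fnorm) powr (1/q)"
  using q by (intro powr_mono2) auto
 hence "A <= (2 * h ^ 3) powr ((q - 1) / q) * Fnorm powr (1/q)"
  using q h Fnorm(2) by (simp add: powr_powr powr_mult A_def)
 also have "(2 * h ^ 3) powr ((q - 1) / q) = 2 powr ((q - 1) / q) * h powr (3 - 3 / q)"
 proof -
  have "(h ^ 3) powr ((q - 1) / q) = (h powr 3) powr ((q - 1) / q)" using h by simp
  also have "... = h powr (3 - 3 / q)" unfolding powr_powr using q by (simp add: field_simps)
  finally show ?thesis using h by (simp add: powr_mult)
 qed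
 also have "2 powr ((q - 1) / q) <= 2 powr 1" using q by (intro powr_mono) auto
 finally have A2: "A <= 2 * h powr (3 - 3 / q) * Fnorm powr (1/q)"
  by (simp add: mult_right_mono)
 have "h powr (3 - 3 / q) = h\<^sup>2 * h powr (1 - 3 / q)"
 proof -
  have "h\<^sup>2 = h powr 2" using h by simp
  thus ?thesis by (simp add: powr_add[symmetric])
 qed
 hence "h\<^sup>2 * abs(slope h z - slope (h / 2) z) <= h\<^sup>2 * (72 * Fnorm powr (1 / q) * h powr (1 - 3 / q))"
  using A2 by (simp add: A_def abs_mult mult_ac)
 thus ?thesis using h by simp
qed

definition slope_const :: real where
 "slope_const = 72 * Fnorm powr (1 / q) / (1 - 2 powr (3 / q - 1))"

lemma slope_dyadic:
 assumes h: "0 < h" "h\<^sup>2 < T" and z: "0 <= z" "z + 2 * h <= 1"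
 shows "abs(slope h z - slope (h / 2 ^ n) z) <= slope_const * h powr (1 - 3 / q)"
proof -
 define a where "a = 2 powr (3 / q - 1)"
 define c where "c = 72 * Fnorm powr (1 / q) * h powr (1 - 3 / q)"
 have "a < 2 powr 0" unfolding a_def using q by (intro powr_less_mono) (auto simp: field_simps)
 hence a: "0 < a" "a < 1" by (auto simp: a_def)
 have c: "0 <= c" by (simp add: c_def)
 have "abs(slope h z - slope (h / 2 ^ n) z) <= c * (\<Sum>k<n. a ^ k)"
 proof (induction n)
  case (Suc n)
  have p: "(h / 2 ^ n) powr (1 - 3 / q) = h powr (1 - 3 / q) * a ^ n"
  proof -
   have "(2 ^ n) powr (1 - 3 / q) = (2 powr real n) powr (1 - 3 / q)" by (simp add: powr_realpow)
   also have "... = inverse ((2 powr (3 / q - 1)) powr real n)"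
    unfolding powr_powr by (subst powr_minus[symmetric]) (simp add: algebra_simps)
   finally have "(2 ^ n) powr (1 - 3 / q) = inverse (a ^ n)" using a by (simp add: a_def powr_realpow)
   moreover have "(h / 2 ^ n) powr (1 - 3 / q) = h powr (1 - 3 / q) / (2 ^ n) powr (1 - 3 / q)"
    using h by (simp add: powr_divide)
   ultimately show ?thesis by (metis divide_inverse inverse_inverse_eq)
  qed
  have h2: "h / 2 ^ n <= h" using h by (simp add: divide_le_eq)
  have "abs(slope (h / 2 ^ n) z - slope ((h / 2 ^ n) / 2) z) <= 72 * Fnorm powr (1 / q) * (h / 2 ^ n) powr (1 - 3 / q)"
  proof (rule slope_halving)
   show "(h / 2 ^ n)\<^sup>2 < T" by (rule le_less_trans[OF power_mono[OF h2] h(2)]) (use h in simp)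
  qed (use h z h2 in auto)
  hence "abs(slope (h / 2 ^ n) z - slope (h / 2 ^ Suc n) z) <= c * a ^ n"
   by (simp add: p c_def mult_ac)
  then show ?case using Suc by (simp add: distrib_left)
 qed simp
 also have "... <= c * (1 / (1 - a))"
 proof (intro mult_left_mono c)
  have "(\<Sum>k<n. a ^ k) = (1 - a ^ n) / (1 - a)" using a by (simp add: sum_gp_strict)
  also have "... <= 1 / (1 - a)" using a by (intro divide_right_mono) auto
  finally show "(\<Sum>k<n. a ^ k) <= 1 / (1 - a)" .
 qed
 finally show ?thesis by (simp add: c_def slope_const_def a_def)
qed

lemma slope_comparison:
 assumes h: "0 < h" "h <= h1" "h1\<^sup>2 < T" and z: "0 <= z" "z + 2 * h1 <= 1"
 obtains h' where "h1 / 2 < h'" "h' <= h1" "abs(slope h z - slope h' z) <= slope_const * h1 powr (1 - 3 / q)"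
proof -
 have h10: "0 < h1" using h by simp
 obtain n0 where "h1 / 2 / h < 2 ^ n0" using real_arch_pow[of 2 "h1/2/h"] by auto
 hence ex: "h1 / 2 < h * 2 ^ n0" using h by (simp add: field_simps)
 define n where "n = (LEAST n. h1 / 2 < h * 2 ^ n)"
 have n: "h1 / 2 < h * 2 ^ n" unfolding n_def by (rule LeastI[of _ n0]) (rule ex)
 have n2: "h * 2 ^ n <= h1"
 proof (cases n)
  case (Suc m)
  have "\<not> h1 / 2 < h * 2 ^ m" using not_less_Least[of m "%n. h1 / 2 < h * 2 ^ n"] Suc by (simp add: n_def)
  thus ?thesis by (simp add: Suc)
 qed (use h in simp)
 have c0: "0 <= slope_const"
 proof -
  have "2 powr (3 / q - 1) <= 2 powr 0" using q by (intro powr_mono) (auto simp: field_simps)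
  thus ?thesis by (simp add: slope_const_def)
 qed
 have "(h * 2 ^ n)\<^sup>2 <= h1\<^sup>2" using n2 h by (intro power_mono) auto
 hence T': "(h * 2 ^ n)\<^sup>2 < T" using h(3) by linarith
 have "abs(slope (h * 2 ^ n) z - slope (h * 2 ^ n / 2 ^ n) z) <= slope_const * (h * 2 ^ n) powr (1 - 3 / q)"
  by (rule slope_dyadic[OF _ T' z(1)]) (use h n2 z in auto)
 also have "... <= slope_const * h1 powr (1 - 3 / q)"
  using n2 h q c0 by (intro mult_left_mono powr_mono2) (auto simp: field_simps)
 finally show ?thesis using n n2 by (intro that[of "h * 2 ^ n"]) (auto simp: abs_minus_commute)
qed

lemma avg_near:
 assumes "0 < h" "!!y. 0 < y ==> y < h ==> abs(\<phi>c (z + y) - a) <= e"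
 shows "abs(avg h z - a) <= e"
proof -
 have i: "Lint (%y. ind {0<..<h} y * (\<phi>c (z + y) - a))" "Lint (%y. ind {0<..<h} y * e)"
  "Lint (%y. ind {0<..<h} y * \<phi>c (z + y))" "Lint (%y. ind {0<..<h} y * a)"
  by (intro window_integrable continuous_intros continuous_on_compose2[OF \<phi>c(1)]; simp)+
 have "(LBINT y. ind {0<..<h} y * (\<phi>c (z + y) - a)) = (LBINT y. ind {0<..<h} y * \<phi>c (z + y)) - h * a"
  using i assms by (simp add: right_diff_distrib)
 hence "h * (avg h z - a) = (LBINT y. ind {0<..<h} y * (\<phi>c (z + y) - a))"
  using assms by (simp add: avg_def right_diff_distrib)
 also have "abs(...) <= (LBINT y. ind {0<..<h} y * e)"
  using i assms by (intro integral_abs_bound_integral) (auto simp: indicator_def abs_mult)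
 finally have "h * abs(avg h z - a) <= h * e" using assms by (simp add: abs_mult)
 thus ?thesis using assms by simp
qed

lemma avg_limit:
 assumes "0 < d" shows "(%k. avg (d / real (Suc k)) z) \<longlonglongrightarrow> \<phi>c z"
proof (rule LIMSEQ_I)
 fix r :: real assume r: "0 < r"
 have "isCont \<phi>c z" using \<phi>c(1) by (simp add: continuous_on_eq_continuous_at)
 hence "\<forall>e>0. \<exists>s>0. \<forall>y. abs(y - z) < s \<longrightarrow> abs(\<phi>c y - \<phi>c z) < e"
  by (simp add: continuous_at_eps_delta dist_real_def)
 from this[rule_format, of "r / 2"] r
 obtain s where s: "0 < s" "!!y. abs(y - z) < s ==> abs(\<phi>c y - \<phi>c z) < r / 2" by auto
 obtain k0 :: nat where k0: "d / s < real k0" using reals_Archimedean2 by blast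
 show "\<exists>no. \<forall>n\<ge>no. norm (avg (d / real (Suc n)) z - \<phi>c z) < r"
 proof (intro exI allI impI)
  fix n assume "k0 <= n"
  hence "d / s < real (Suc n)" using k0 by simp
  hence "d / real (Suc n) < s" using s assms by (simp add: field_simps)
  hence "abs(avg (d / real (Suc n)) z - \<phi>c z) <= r / 2"
   using s assms by (intro avg_near) (auto intro!: less_imp_le)
  then show "norm (avg (d / real (Suc n)) z - \<phi>c z) < r" using r by simp
 qed
qed

lemma increment_bounds:
 assumes xy: "x < y" and h1: "0 < h1"
  and sl: "!!h z. 0 < h ==> h <= h1 ==> x <= z ==> z <= y ==> m <= slope h z \<and> slope h z <= M"
 shows "m * (y - x) <= \<phi>c y - \<phi>c x" "\<phi>c y - \<phi>c x <= M * (y - x)"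
proof -
 have tele: "avg h (x + real k * h) - avg h x = (\<Sum>j<k. h * slope h (x + real j * h))" if "0 < h" for h k
 proof (induction k)
  case (Suc k)
  then show ?case using avg_slope[OF that, of "x + real k * h"] by (simp add: algebra_simps)
 qed simp
 have L: "(%k. avg ((y-x) / real (Suc k)) y - avg ((y-x) / real (Suc k)) x) \<longlonglongrightarrow> \<phi>c y - \<phi>c x"
  using xy by (intro tendsto_diff avg_limit) auto
 obtain k0 :: nat where k0: "(y - x) / h1 < real k0" using reals_Archimedean2 by blast
 have b: "m * (y - x) <= avg ((y-x) / real (Suc k)) y - avg ((y-x) / real (Suc k)) x \<and>
   avg ((y-x) / real (Suc k)) y - avg ((y-x) / real (Suc k)) x <= M * (y - x)" if "k0 <= k" for k
 proof -
  define h where "h = (y - x) / real (Suc k)"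
  have h: "0 < h" using xy by (simp add: h_def)
  have "(y - x) / h1 < real (Suc k)" using k0 that by simp
  hence hh1: "h <= h1" using h1 by (simp add: h_def field_simps)
  have hk: "real (Suc k) * h = y - x" by (simp add: h_def)
  have "m <= slope h (x + real j * h) \<and> slope h (x + real j * h) <= M" if "j < Suc k" for j
  proof (rule sl[OF h hh1])
   have "real j * h <= real (Suc k) * h" using that h by (intro mult_right_mono) auto
   then show "x + real j * h <= y" using hk by simp
  qed (use h in simp)
  hence "(\<Sum>j<Suc k. h * m) <= (\<Sum>j<Suc k. h * slope h (x + real j * h))"
   "(\<Sum>j<Suc k. h * slope h (x + real j * h)) <= (\<Sum>j<Suc k. h * M)"
   using h by (intro sum_mono mult_left_mono; simp)+
  moreover have "(\<Sum>j<Suc k. h * c) = c * (y - x)" for c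
   using hk by (simp add: mult_ac del: sum.lessThan_Suc of_nat_Suc)
  ultimately show ?thesis using tele[OF h, of "Suc k"] by (simp only: hk) (simp add: h_def)
 qed
 show "m * (y - x) <= \<phi>c y - \<phi>c x" by (rule LIMSEQ_le_const[OF L]) (use b in blast)
 show "\<phi>c y - \<phi>c x <= M * (y - x)" by (rule LIMSEQ_le_const2[OF L]) (use b in blast)
qed

lemma slope_bounded:
 assumes h1: "0 < h1" "h1\<^sup>2 < T"
 obtains L where "!!h z. 0 < h ==> h <= h1 ==> 0 <= z ==> z + 2 * h1 <= 1 ==> abs(slope h z) <= L"
proof -
 obtain B where B: "!!y. abs(\<phi>c y) <= B" by (rule \<phi>c_bounded) (rule that)
 have av: "abs(avg h z) <= B" if "0 < h" for h z
  using avg_near[OF that, of z 0 B] B by simp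
 have "abs(slope h z) <= 4 * B / h1 + slope_const * h1 powr (1 - 3 / q)"
  if hz: "0 < h" "h <= h1" "0 <= z" "z + 2 * h1 <= 1" for h z
 proof -
  obtain h' where h': "h1 / 2 < h'" "h' <= h1" "abs(slope h z - slope h' z) <= slope_const * h1 powr (1 - 3 / q)"
   by (rule slope_comparison[OF hz(1,2) h1(2) hz(3,4)])
  have h'0: "0 < h'" using h' h1 by simp
  have "h' * abs(slope h' z) = abs(avg h' (z + h') - avg h' z)"
   using avg_slope[OF h'0, of z] h'0 by (simp add: abs_mult)
  also have "... <= 2 * B" using av[OF h'0, of z] av[OF h'0, of "z + h'"] by simp
  finally have "abs(slope h' z) <= 2 * B / h'" using h'0 by (simp add: field_simps)
  also have "... <= 2 * B / (h1 / 2)"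
   using h' h1 B[of 0] by (intro divide_left_mono) auto
  finally show ?thesis using h'(3) by simp
 qed
 thus ?thesis by (rule that)
qed

lemma lipschitz_left:
 obtains L where "!!x y. 0 <= x ==> x <= y ==> y <= 3/4 ==> abs(\<phi> x - \<phi> y) <= L * abs(x - y)"
proof -
 define h1 where "h1 = min (1/8) (sqrt T / 2)"
 have h1: "0 < h1" "h1 <= 1/8" using T by (auto simp: h1_def)
 have "h1\<^sup>2 <= (sqrt T / 2)\<^sup>2" using h1 by (intro power_mono) (auto simp: h1_def)
 hence h12: "h1\<^sup>2 < T" using T by (simp add: power_divide)
 obtain L where L: "!!h z. 0 < h ==> h <= h1 ==> 0 <= z ==> z + 2 * h1 <= 1 ==> abs(slope h z) <= L"
  by (rule slope_bounded[OF h1(1) h12]) (rule that)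
 show ?thesis
 proof (rule that)
  fix x y :: real assume xy: "0 <= x" "x <= y" "y <= 3/4"
  show "abs(\<phi> x - \<phi> y) <= L * abs(x - y)"
  proof (cases "x = y")
   case False
   have sl: "- L <= slope h z \<and> slope h z <= L" if "0 < h" "h <= h1" "x <= z" "z <= y" for h z
    using L[of h z] that xy h1 by auto
   have "- L * (y - x) <= \<phi>c y - \<phi>c x" "\<phi>c y - \<phi>c x <= L * (y - x)"
    by (rule increment_bounds[OF _ h1(1) sl]; use xy False in auto)+
   thus ?thesis using xy by (simp add: \<phi>c(2) abs_if algebra_simps)
  qed simp
 qed
qed

end

context trace_control begin

lemma window_const: "0 < h ==> (LBINT y. ind {0<..<h} y * c) = h * (c::real)"
 by simp

text \<open>At a fixed small scale the averaged slope depends continuously on the base point and is close to d at b; the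
summable halving estimate carries this down to all smaller scales, uniformly near b.\<close>
lemma slope_near:
 assumes b: "0 < b" "b < 1" and d: "0 < d" "(\<phi> has_real_derivative d) (at b)"
 obtains rh where "0 < rh" "0 < b - rh" "b + rh < 1"
  "!!x y. b - rh <= x ==> x <= y ==> y <= b + rh ==> d / 2 * (y - x) <= \<phi> y - \<phi> x"
proof -
 have c0: "0 <= slope_const"
 proof -
  have "2 powr (3 / q - 1) <= 2 powr 0" using q by (intro powr_mono) (auto simp: field_simps)
  thus ?thesis by (simp add: slope_const_def)
 qed
 have "((%h. slope_const * h powr (1 - 3 / q)) \<longlongrightarrow> slope_const * 0 powr (1 - 3 / q)) (at_right 0)"
  using q by (intro tendsto_intros) (auto simp: eventually_at_filter field_simps)
 hence "((%h. slope_const * h powr (1 - 3 / q)) \<longlongrightarrow> 0) (at_right 0)" using q by simp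
 hence "\<forall>\<^sub>F h in at_right 0. slope_const * h powr (1 - 3 / q) < d / 8"
  using d by (intro order_tendstoD) auto
 then obtain e1 where e1: "0 < e1" "!!h. 0 < h ==> h < e1 ==> slope_const * h powr (1 - 3 / q) < d / 8"
  by (auto simp: eventually_at_right_field)
 have "\<forall>e>0. \<exists>s>0. \<forall>y. abs(y - b) < s \<longrightarrow> abs(\<phi> y - \<phi> b - d * (y - b)) <= e * abs(y - b)"
  using d(2) unfolding has_field_derivative_def has_derivative_at_alt by (auto simp: mult.commute)
 from this[rule_format, of "d / 24"] d(1)
 obtain e2 where e2: "0 < e2" "!!y. abs(y - b) < e2 ==> abs(\<phi> y - \<phi> b - d * (y - b)) <= d / 24 * abs(y - b)"
  by (auto simp del: times_divide_eq_left)
 define h1 where "h1 = Min {e1 / 2, e2 / 4, (1 - b) / 4, sqrt T / 2}"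
 have h1: "0 < h1" "h1 < e1" "2 * h1 < e2" "3 * h1 < 1 - b" "h1\<^sup>2 < T"
 proof -
  show p: "0 < h1" using e1 e2 b T by (auto simp: h1_def)
  have le: "h1 <= e1 / 2" "h1 <= e2 / 4" "h1 <= (1 - b) / 4" "h1 <= sqrt T / 2" unfolding h1_def by (intro Min_le; simp)+
  then show "h1 < e1" "2 * h1 < e2" "3 * h1 < 1 - b" using e1 e2 b by auto
  have "h1 < sqrt T" using le T by (smt (verit) real_sqrt_gt_zero field_sum_of_halves)
  hence "h1\<^sup>2 < (sqrt T)\<^sup>2" using p by (intro power_strict_mono) auto
  then show "h1\<^sup>2 < T" using T by simp
 qed
 have sb: "abs(slope h b - d) <= d / 8" if h: "0 < h" "h <= h1" for h
 proof -
  have "abs(\<phi>c (b + h + y) - \<phi>c (b + y) - d * h) <= d / 8 * h" if y: "0 < y" "y < h" for y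
  proof -
   have "\<phi>c (b + h + y) = \<phi> (b + h + y)" "\<phi>c (b + y) = \<phi> (b + y)"
    using y h h1 b by (auto intro!: \<phi>c(2))
   moreover have "abs(\<phi> (b + h + y) - \<phi> b - d * (h + y)) <= d / 24 * (h + y)"
    using e2(2)[of "b + h + y"] y h h1 by (simp add: add.assoc)
   moreover have "abs(\<phi> (b + y) - \<phi> b - d * y) <= d / 24 * y"
    using e2(2)[of "b + y"] y h h1 by simp
   moreover have "d / 24 * (h + y) + d / 24 * y <= d / 8 * h"
    using y d by (simp add: field_simps)
   moreover have "d * (h + y) - d * y = d * h" by (simp add: algebra_simps)
   ultimately show ?thesis by linarith
  qed note pt = this
  have i: "Lint (%y. ind {0<..<h} y * (\<phi>c (b + h + y) - \<phi>c (b + y)))"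
   "Lint (%y. ind {0<..<h} y * (\<phi>c (b + h + y) - \<phi>c (b + y) - d * h))"
   "Lint (%y. ind {0<..<h} y * (d / 8 * h))" "Lint (%y. ind {0<..<h} y * (d * h))"
   by (intro window_integrable continuous_intros continuous_on_compose2[OF \<phi>c(1)]; simp)+
  have "(LBINT y. ind {0<..<h} y * (\<phi>c (b + h + y) - \<phi>c (b + y) - d * h))
   = (LBINT y. ind {0<..<h} y * (\<phi>c (b + h + y) - \<phi>c (b + y))) - (LBINT y. ind {0<..<h} y * (d * h))"
   unfolding right_diff_distrib[of _ _ "d * h"] using i by (intro intdiff) auto
  also have "... = h\<^sup>2 * (slope h b - d)"
   using h by (simp add: slope_def right_diff_distrib power2_eq_square)
  finally have eq: "h\<^sup>2 * (slope h b - d) = (LBINT y. ind {0<..<h} y * (\<phi>c (b + h + y) - \<phi>c (b + y) - d * h))" ..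
  have "abs(h\<^sup>2 * (slope h b - d)) <= (LBINT y. ind {0<..<h} y * (d / 8 * h))"
   unfolding eq
   using i pt by (intro integral_abs_bound_integral) (auto simp: indicator_def)
  also have "... = h\<^sup>2 * (d / 8)" unfolding window_const[OF h(1)] by (simp add: power2_eq_square)
  finally have "h\<^sup>2 * abs(slope h b - d) <= h\<^sup>2 * (d / 8)" by (simp add: abs_mult)
  thus ?thesis using h by simp
 qed
 have "uniformly_continuous_on {0..1} \<phi>c"
  by (intro compact_uniformly_continuous continuous_on_subset[OF \<phi>c(1)]) auto
 hence "\<forall>e>0. \<exists>s>0. \<forall>y\<in>{0..1}. \<forall>x\<in>{0..1}. abs(x - y) < s \<longrightarrow> abs(\<phi>c x - \<phi>c y) < e"
  unfolding uniformly_continuous_on_def dist_real_def .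
 from this[rule_format, of "d * h1 / 32"] d h1(1)
 obtain s where s: "0 < s" "!!x y. x \<in> {0..1} ==> y \<in> {0..1} ==> abs(x - y) < s ==> abs(\<phi>c x - \<phi>c y) < d * h1 / 32"
  by (auto simp del: atLeastAtMost_iff)
 define rh where "rh = Min {s / 2, h1 / 2, b / 2}"
 have r: "0 < rh" "rh < s" "rh < h1" "rh < b"
  using s h1 b by (auto simp: rh_def)
 have low: "d / 2 <= slope h z" if h: "0 < h" "h <= h1" and z: "abs(z - b) <= rh" for h z
 proof -
  have z0: "0 <= z" "z + 2 * h1 <= 1" using z r h1 by auto
  obtain h' where h': "h1 / 2 < h'" "h' <= h1" "abs(slope h z - slope h' z) <= slope_const * h1 powr (1 - 3 / q)"
   by (rule slope_comparison[OF h h1(5) z0])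
  have h'0: "0 < h'" using h' h1 by simp
  have av: "abs(avg h' (z + a) - avg h' (b + a)) <= d * h1 / 32" if a: "0 <= a" "a <= h1" for a
  proof -
   have i: "Lint (%y. ind {0<..<h'} y * \<phi>c (z + a + y))" "Lint (%y. ind {0<..<h'} y * \<phi>c (b + a + y))"
    "Lint (%y. ind {0<..<h'} y * (d * h1 / 32))"
    "Lint (%y. ind {0<..<h'} y * (\<phi>c (z + a + y) - \<phi>c (b + a + y)))"
    by (intro window_integrable continuous_intros continuous_on_compose2[OF \<phi>c(1)]; simp)+
   have eq: "h' * (avg h' (z + a) - avg h' (b + a)) = (LBINT y. ind {0<..<h'} y * (\<phi>c (z + a + y) - \<phi>c (b + a + y)))"
    using i h'0 by (simp add: avg_def right_diff_distrib)
   have "abs(h' * (avg h' (z + a) - avg h' (b + a))) <= (LBINT y. ind {0<..<h'} y * (d * h1 / 32))"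
    unfolding eq
   proof (intro integral_abs_bound_integral i)
    fix y
    show "abs(ind {0<..<h'} y * (\<phi>c (z + a + y) - \<phi>c (b + a + y))) <= ind {0<..<h'} y * (d * h1 / 32)"
    proof (cases "0 < y \<and> y < h'")
    case True
    have "abs(\<phi>c (z + a + y) - \<phi>c (b + a + y)) < d * h1 / 32"
    by (rule s(2)) (use True a z z0 r h' h1 b in auto)
    thus ?thesis by (simp add: indicator_def)
    qed auto
   qed
   also have "... = h' * (d * h1 / 32)" by (rule window_const[OF h'0])
   finally have "abs(h' * (avg h' (z + a) - avg h' (b + a))) <= h' * (d * h1 / 32)" .
   moreover have "abs(h' * (avg h' (z + a) - avg h' (b + a))) = h' * abs(avg h' (z + a) - avg h' (b + a))"
    using h'0 by (simp add: abs_mult)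
   ultimately show ?thesis using h'0 by (simp only: mult_le_cancel_left_pos)
  qed
  have "h' * abs(slope h' z - slope h' b) = abs((avg h' (z + h') - avg h' z) - (avg h' (b + h') - avg h' b))"
   unfolding avg_slope[OF h'0] right_diff_distrib[symmetric] using h'0 by (simp add: abs_mult)
  also have "... <= abs(avg h' (z + h') - avg h' (b + h')) + abs(avg h' z - avg h' b)" by arith
  also have "... <= d * h1 / 16" using av[of 0] av[of h'] h'(2) h'0 h1(1) by simp
  also have "... <= h' * (d / 8)" using h' d by (simp add: field_simps)
  finally have "abs(slope h' z - slope h' b) <= d / 8" using h'0 by simp
  thus ?thesis
   using abs_le_D2[OF h'(3)] abs_le_D2[OF sb[OF h'0 h'(2)]] e1(2)[OF h1(1,2)] abs_le_D2[of "slope h' z - slope h' b" "d / 8"]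
   by linarith
 qed
 obtain L where L: "!!h z. 0 < h ==> h <= h1 ==> 0 <= z ==> z + 2 * h1 <= 1 ==> abs(slope h z) <= L"
  by (rule slope_bounded[OF h1(1,5)]) (rule that)
 show ?thesis
 proof (rule that[OF r(1)])
  show "0 < b - rh" "b + rh < 1" using r h1 by auto
  fix x y assume xy: "b - rh <= x" "x <= y" "y <= b + rh"
  show "d / 2 * (y - x) <= \<phi> y - \<phi> x"
  proof (cases "x = y")
   case False
   have "d / 2 * (y - x) <= \<phi>c y - \<phi>c x"
   proof (rule increment_bounds(1)[where M = L, OF _ h1(1)])
    fix h z assume "0 < h" "h <= h1" "x <= z" "z <= y"
    then show "d / 2 <= slope h z \<and> slope h z <= L"
    using low[of h z] L[of h z] xy r h1 by auto
   qed (use xy False h1 in auto)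
   thus ?thesis using xy r h1 by (simp add: \<phi>c(2))
  qed simp
 qed
qed

text \<open>The reflected state satisfies the same bound, so estimates at the right end follow from those at the left.\<close>
lemma mirror: "trace_control (%x. \<phi> (1 - x)) q T (%z. F (1 - fst z, snd z)) ((%x. 1 - x) ` N)"
proof
 show Fm': "(%z. F (1 - fst z, snd z)) \<in> BM" by measurable
 have refl: "(NN z. f (1 - fst z, snd z)) = (NN z. f z)"
  if [measurable]: "f \<in> BM" for f :: "pt => ennreal"
 proof -
  have [measurable]: "(%x. NN s. f (x, s)) \<in> BM"
  proof (rule lborel.borel_measurable_nn_integral)
   have "f \<in> borel_measurable (borel \<Otimes>\<^sub>M lborel)"
    by (subst measurable_cong_sets[OF sets_pair_measure_cong[OF refl sets_lborel] refl]) (simp add: borel_prod)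
   then show "(%(x, s). f (x, s)) \<in> borel_measurable (borel \<Otimes>\<^sub>M lborel)" by simp
  qed
  have "(NN z. f z) = (NN x. NN s. f (x, s))" by (rule nn_integral_plane) measurable
  also have "... = en (abs(-1)) * (NN x. NN s. f (1 + (-1) * x, s))"
   by (rule nn_integral_real_affine) auto
  also have "... = (NN z. f (1 - fst z, snd z))"
  proof -
   have "(%z. f (1 - fst z, snd z)) \<in> BM" by measurable
   from nn_integral_plane[OF this] show ?thesis by simp
  qed
  finally show ?thesis ..
 qed
 show "(NN z. en (F (1 - fst z, snd z) powr q)) < \<infinity>"
  using Fq refl[of "%z. en (F z powr q)"] by simp
 have im: "(%x. 1 - x) ` N = {x. 1 + (-1) * x \<in> N}" by (force simp: image_iff)
 have Nb: "N \<in> sets borel" using N by auto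
 show "(%x. 1 - x) ` N \<in> null_sets lborel"
 proof -
  have s: "{x. 1 + (-1) * x \<in> N} \<in> sets borel"
   using measurable_sets[of "%x::real. 1 + (-1) * x" borel borel N] Nb by (auto simp: vimage_def)
  have "(AE x in lborel. 1 + (-1) * x \<notin> N) \<longleftrightarrow> emeasure lborel {x. 1 + (-1) * x \<in> N} = 0"
   by (rule AE_iff_measurable) (use s in auto)
  hence "emeasure lborel {x. 1 + (-1) * x \<in> N} = 0"
   using AE_not_null_affine[OF N, of "-1" 1] by simp
  thus ?thesis using s unfolding im by (auto simp: null_sets_def)
 qed
 show "continuous_on {0..1} (%x. \<phi> (1 - x))"
  by (rule continuous_on_compose2[OF cphi]) (auto intro!: continuous_intros)
 fix k :: nat and c xi and l r t1 t2 :: real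
 assume as: "!!i. i < k ==> 0 < xi i \<and> xi i < 1 \<and> xi i \<notin> (%x. 1 - x) ` N \<and> l < xi i \<and> xi i < r"
  "(\<Sum>i<k. c i) = 0" "(\<Sum>i<k. c i * xi i) = 0" "0 < t1" "t1 < t2" "t2 < T"
 have box [measurable]: "{1-r<..<1-l} \<times> {t1<..<t2} \<in> sets borel" by (intro borel_Times) auto
 have "en (abs(\<Sum>i<k. c i * \<phi> (1 - xi i))) <=
    en ((\<Sum>i<k. abs(c i)) * ((1 - l) - (1 - r)) / (t2 - t1)) * (NN z. ind ({1-r<..<1-l} \<times> {t1<..<t2}) z * en (F z))
    + (\<Sum>i<k. en (abs(c i)) * (NN s. ind {0<..<t2} s * en (F (1 - xi i, s))))"
 proof (rule bound)
  show "(\<Sum>i<k. c i * (1 - xi i)) = 0" using as by (simp add: right_diff_distrib sum_subtractf)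
  fix i assume "i < k"
  then show "0 < 1 - xi i \<and> 1 - xi i < 1 \<and> 1 - xi i \<notin> N \<and> 1 - r < 1 - xi i \<and> 1 - xi i < 1 - l"
   using as(1)[of i] by (force simp: image_iff)
 qed (use as in auto)
 also have "(NN z. ind ({1-r<..<1-l} \<times> {t1<..<t2}) z * en (F z))
  = (NN z. ind ({l<..<r} \<times> {t1<..<t2}) z * en (F (1 - fst z, snd z)))"
  by (subst refl[symmetric]) (measurable, auto simp: indicator_def intro!: nn_integral_cong)
 finally show "en (abs(\<Sum>i<k. c i * \<phi> (1 - xi i))) <=
    en ((\<Sum>i<k. abs(c i)) * (r - l) / (t2 - t1)) * (NN z. ind ({l<..<r} \<times> {t1<..<t2}) z * en (F (1 - fst z, snd z)))
    + (\<Sum>i<k. en (abs(c i)) * (NN s. ind {0<..<t2} s * en (F (1 - fst (xi i, s), snd (xi i, s)))))"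
  by simp
qed (use T F0 q in auto)

lemma lipschitz:
 obtains L where "0 <= L" "!!x y. 0 <= x ==> x <= 1 ==> 0 <= y ==> y <= 1 ==> abs(\<phi> x - \<phi> y) <= L * abs(x - y)"
proof -
 obtain L1 where L1: "!!x y. 0 <= x ==> x <= y ==> y <= 3/4 ==> abs(\<phi> x - \<phi> y) <= L1 * abs(x - y)"
  by (rule lipschitz_left) (rule that)
 interpret m: trace_control "%x. \<phi> (1 - x)" q T "%z. F (1 - fst z, snd z)" "(%x. 1 - x) ` N" by (rule mirror)
 obtain L2 where L2: "!!x y. 0 <= x ==> x <= y ==> y <= 3/4 ==> abs(\<phi> (1 - x) - \<phi> (1 - y)) <= L2 * abs(x - y)"
  by (rule m.lipschitz_left) (rule that)
 define L where "L = max 0 (max L1 L2)"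
 have L: "0 <= L" "L1 <= L" "L2 <= L" by (auto simp: L_def)
 have *: "abs(\<phi> x - \<phi> y) <= L * (y - x)" if "0 <= x" "x <= y" "y <= 1" for x y
 proof -
  have a: "abs(\<phi> x - \<phi> y) <= L * (y - x)" if "0 <= x" "x <= y" "y <= 3/4" for x y
  proof -
   have "abs(\<phi> x - \<phi> y) <= L1 * (y - x)" using L1[OF that] that by simp
   also have "... <= L * (y - x)" using that L by (intro mult_right_mono) auto
   finally show ?thesis .
  qed
  have b: "abs(\<phi> x - \<phi> y) <= L * (y - x)" if "1/4 <= x" "x <= y" "y <= 1" for x y
  proof -
   have "abs(\<phi> x - \<phi> y) <= L2 * (y - x)" using L2[of "1 - y" "1 - x"] that by (simp add: abs_minus_commute)
   also have "... <= L * (y - x)" using that L by (intro mult_right_mono) auto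
   finally show ?thesis .
  qed
  consider "y <= 3/4" | "1/4 <= x" | "x < 1/4" "3/4 < y" by linarith
  thus ?thesis
  proof cases
   case 3
   have "L * (y - x) = L * (1/2 - x) + L * (y - 1/2)" by (simp add: algebra_simps)
   thus ?thesis using a[of x "1/2"] b[of "1/2" y] 3 that by (simp add: abs_le_iff)
  qed (use a b that in auto)
 qed
 show ?thesis
 proof (rule that[OF L(1)])
  fix x y :: real assume "0 <= x" "x <= 1" "0 <= y" "y <= 1"
  then show "abs(\<phi> x - \<phi> y) <= L * abs(x - y)"
   using *[of x y] *[of y x] by (cases "x <= y") (auto simp: abs_minus_commute)
 qed
qed

end

section \<open>Second differences of traces\<close>

lemma ennreal_le_sum4:
 fixes x0 x1 x2 x3 :: ennreal
 assumes "en a <= x0 + (x1 + (x2 + x3))" "0 <= a"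
 shows "en (a / 4) <= x0 \<or> en (a / 4) <= x1 \<or> en (a / 4) <= x2 \<or> en (a / 4) <= x3"
proof (rule ccontr)
 assume "\<not> ?thesis"
 hence lt: "x0 < en (a/4)" "x1 < en (a/4)" "x2 < en (a/4)" "x3 < en (a/4)" by auto
 obtain r0 where r0: "x0 = en r0" "0 <= r0" using lt(1) by (cases x0) auto
 obtain r1 where r1: "x1 = en r1" "0 <= r1" using lt(2) by (cases x1) auto
 obtain r2 where r2: "x2 = en r2" "0 <= r2" using lt(3) by (cases x2) auto
 obtain r3 where r3: "x3 = en r3" "0 <= r3" using lt(4) by (cases x3) auto
 have "r0 < a/4" "r1 < a/4" "r2 < a/4" "r3 < a/4"
  using lt r0 r1 r2 r3 assms(2) by (auto simp: ennreal_less_iff)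
 moreover have "a <= r0 + (r1 + (r2 + r3))"
  using assms r0 r1 r2 r3 by (simp add: ennreal_plus[symmetric] del: ennreal_plus)
 ultimately show False by linarith
qed

lemma ennreal_scale:
 assumes "en a <= en c * Z" "0 <= m" "0 <= a" "0 <= c"
 shows "en (m * a) <= en (m * c) * Z"
proof -
 have "en (m * a) = en m * en a" using assms by (simp add: ennreal_mult)
 also have "... <= en m * (en c * Z)" by (intro mult_left_mono assms) simp
 also have "... = en (m * c) * Z" using assms by (simp add: ennreal_mult mult_ac)
 finally show ?thesis .
qed

lemma ennreal_unscale:
 assumes "en a <= en c * Z" "0 <= a" "0 < c"
 shows "en (a / c) <= Z"
proof -
 have "en (1 / c * a) <= en (1 / c * c) * Z"
  by (rule ennreal_scale) (use assms in auto)
 thus ?thesis using assms by simp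
qed

lemma power_powr: "0 < a ==> (a ^ m) powr x = (a powr x) ^ m" for a x :: real
 by (simp add: powr_realpow[symmetric] powr_powr mult.commute)

context trace_control
begin

lemma line_power:
 assumes "0 <= A" "en A <= (NN s. ind {0<..<H} s * en (F (x, s)))" "0 < H"
 shows "en (A powr q) <= en (H powr (q - 1)) * (NN s. ind {0<..<H} s * en (F (x, s) powr q))"
 using assms F0 q by (intro weighted_jensen) auto

lemma Fq_section_measurable [measurable]:
 "(%x. NN s. en (F (x, s) powr q)) \<in> BM"
proof (rule lborel.borel_measurable_nn_integral)
 have "(%p. en (F p powr q)) \<in> borel_measurable (borel \<Otimes>\<^sub>M lborel)"
  by (subst measurable_cong_sets[OF sets_pair_measure_cong[OF refl sets_lborel] refl]) (simp add: borel_prod)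
 then show "(%(x, s). en (F (x, s) powr q)) \<in> borel_measurable (borel \<Otimes>\<^sub>M lborel)"
  by (simp add: case_prod_beta')
qed

lemma Fq_section_affine:
 assumes "ka ~= 0"
 shows "(NN y. NN s. en (F (a + ka * y, s) powr q)) = en (Fnorm / abs(ka))"
proof -
 have "en Fnorm = (NN x. NN s. en (F (x, s) powr q))"
  unfolding Fnorm(1)[symmetric] by (rule nn_integral_plane) measurable
 also have "... = en (abs(ka)) * (NN y. NN s. en (F (a + ka * y, s) powr q))"
  using assms by (intro nn_integral_real_affine) auto
 finally have eq: "en Fnorm = en (abs(ka)) * (NN y. NN s. en (F (a + ka * y, s) powr q))" (is "_ = _ * ?X") .
 have "en (Fnorm / abs(ka)) = en (1/abs(ka)) * en Fnorm"
  using Fnorm(2) by (simp add: ennreal_mult[symmetric])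
 also have "... = (en (1/abs(ka)) * en (abs(ka))) * ?X" unfolding eq by (simp only: mult.assoc)
 also have "en (1/abs(ka)) * en (abs(ka)) = 1" using assms by (simp add: ennreal_mult[symmetric])
 finally show ?thesis by simp
qed

definition delta :: "real => real" where
 "delta y = \<phi>c y - 3 * \<phi>c (y / 2) + 2 * \<phi>c (y / 4)"

lemma delta_measurable [measurable]: "delta \<in> BM"
 unfolding delta_def by measurable

lemma delta_pointwise:
 assumes y: "0 < y" "y < 1" "y\<^sup>2 < T" and N: "y \<notin> N" "y / 2 \<notin> N" "y / 4 \<notin> N"
 shows "en (abs(delta y) powr q * y powr (2 - 2 * q)) <= en (96 powr q) *
  (en (1 / y) * (NN z. ind ({y/8<..<2*y} \<times> {y\<^sup>2/2<..<y\<^sup>2}) z * en (F z powr q))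
  + ((NN s. en (F (y, s) powr q)) + ((NN s. en (F (y / 2, s) powr q)) + (NN s. en (F (y / 4, s) powr q)))))"
  (is "?L <= _ * (?B + (?Z y + (?Z (y / 2) + ?Z (y / 4))))")
proof -
 have nums: "3 = Suc (Suc (Suc 0))" by simp
 define c where "c i = (if i = 0 then 1 else if i = 1 then - 3 else 2 :: real)" for i :: nat
 define xi where "xi i = (if i = 0 then y else if i = 1 then y / 2 else y / 4)" for i :: nat
 let ?J = "NN z. ind ({y/8<..<2*y} \<times> {y\<^sup>2/2<..<y\<^sup>2}) z * en (F z)"
 let ?G = "%x. NN s. ind {0<..<y\<^sup>2} s * en (F (x, s))"
 let ?K = "%x. NN s. ind {0<..<y\<^sup>2} s * en (F (x, s) powr q)"
 have "en (abs(\<Sum>i<3. c i * \<phi> (xi i))) <= en ((\<Sum>i<3. abs(c i)) * (2 * y - y / 8) / (y\<^sup>2 - y\<^sup>2 / 2)) * ?J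
    + (\<Sum>i<3. en (abs(c i)) * ?G (xi i))"
 proof (rule bound)
  show "(\<Sum>i<3. c i) = 0" "(\<Sum>i<3. c i * xi i) = 0"
   by (simp_all add: nums c_def xi_def field_simps)
 qed (use y N in \<open>auto simp: xi_def\<close>)
 also have "(\<Sum>i<3. c i * \<phi> (xi i)) = delta y"
  using y by (simp add: nums c_def xi_def delta_def \<phi>c(2))
 also have "(\<Sum>i<3. abs(c i)) * (2 * y - y / 8) / (y\<^sup>2 - y\<^sup>2 / 2) = 45 / (2 * y)"
  using y by (simp add: nums c_def power2_eq_square field_simps)
 also have "(\<Sum>i<3. en (abs(c i)) * ?G (xi i)) = ?G y + (3 * ?G (y / 2) + 2 * ?G (y / 4))"
  by (simp add: nums c_def xi_def add.assoc)
 also have "en (45 / (2 * y)) * ?J + (?G y + (3 * ?G (y / 2) + 2 * ?G (y / 4)))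
  <= en (24 / y) * ?J + (3 * ?G y + (3 * ?G (y / 2) + 3 * ?G (y / 4)))"
 proof (intro add_mono mult_right_mono)
  show "en (45 / (2 * y)) <= en (24 / y)" using y by (intro ennreal_leI) (simp add: field_simps)
  have "1 * ?G y <= 3 * ?G y" by (rule mult_right_mono) auto
  then show "?G y <= 3 * ?G y" by simp
 qed auto
 finally have cases: "en (abs(delta y) / 4) <= en (24 / y) * ?J \<or> en (abs(delta y) / 4) <= 3 * ?G y
  \<or> en (abs(delta y) / 4) <= 3 * ?G (y / 2) \<or> en (abs(delta y) / 4) <= 3 * ?G (y / 4)"
  by (rule ennreal_le_sum4) simp
 have box: "?L <= en (96 powr q) * ?B" if J: "en (abs(delta y) / 4) <= en (24 / y) * ?J"
 proof -
  have "en (abs(delta y) / 4 / (24 / y)) <= ?J" by (rule ennreal_unscale[OF J]) (use y in auto)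
  hence J': "en (abs(delta y) * y / 96) <= ?J" by (simp add: field_simps)
  have "en ((abs(delta y) * y / 96) powr q) <= en (((2 * y - y/8) * (y\<^sup>2 - y\<^sup>2/2)) powr (q - 1)) *
   (NN z. ind ({y/8<..<2*y} \<times> {y\<^sup>2/2<..<y\<^sup>2}) z * en (F z powr q))"
   by (rule box_power[OF _ J']) (use y in auto)
  also have "... <= en (y powr (3 * q - 3)) * (NN z. ind ({y/8<..<2*y} \<times> {y\<^sup>2/2<..<y\<^sup>2}) z * en (F z powr q))"
  proof (intro mult_right_mono ennreal_leI)
   have "(2 * y - y/8) * (y\<^sup>2 - y\<^sup>2/2) <= y ^ 3" using y by (simp add: power2_eq_square power3_eq_cube field_simps)
   hence "((2 * y - y/8) * (y\<^sup>2 - y\<^sup>2/2)) powr (q - 1) <= (y ^ 3) powr (q - 1)"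
    using y q by (intro powr_mono2) auto
   also have "... = (y powr 3) powr (q - 1)" using y by simp
   also have "... = y powr (3 * q - 3)" by (simp add: powr_powr algebra_simps)
   finally show "((2 * y - y/8) * (y\<^sup>2 - y\<^sup>2/2)) powr (q - 1) <= y powr (3 * q - 3)" .
  qed auto
  finally have "en ((96 powr q * y powr (2 - 3 * q)) * (abs(delta y) * y / 96) powr q)
   <= en ((96 powr q * y powr (2 - 3 * q)) * y powr (3 * q - 3)) * (NN z. ind ({y/8<..<2*y} \<times> {y\<^sup>2/2<..<y\<^sup>2}) z * en (F z powr q))"
   by (rule ennreal_scale) auto
  moreover have "(96 powr q * y powr (2 - 3 * q)) * (abs(delta y) * y / 96) powr q = abs(delta y) powr q * y powr (2 - 2 * q)"
  proof -
   have "(abs(delta y) * y / 96) powr q = abs(delta y) powr q * y powr q / 96 powr q" using y by (simp add: powr_mult powr_divide)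
   moreover have "y powr (2 - 3 * q) * y powr q = y powr (2 - 2 * q)" by (simp add: powr_add[symmetric])
   ultimately show ?thesis by simp
  qed
  moreover have "(96 powr q * y powr (2 - 3 * q)) * y powr (3 * q - 3) = 96 powr q * (1 / y)"
   using y by (simp add: mult.assoc powr_add[symmetric] powr_minus_divide)
  ultimately have "?L <= en (96 powr q * (1 / y)) * (NN z. ind ({y/8<..<2*y} \<times> {y\<^sup>2/2<..<y\<^sup>2}) z * en (F z powr q))"
   by (simp only:)
  also have "en (96 powr q * (1 / y)) = en (96 powr q) * en (1 / y)"
   using y by (intro ennreal_mult) auto
  finally show ?thesis by (simp only: mult.assoc)
 qed
 have line: "?L <= en (96 powr q) * ?Z x" if J: "en (abs(delta y) / 4) <= 3 * ?G x" for x
 proof -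
  have "en (abs(delta y) / 4) <= en 3 * ?G x" using J by simp
  hence "en (abs(delta y) / 4 / 3) <= ?G x" by (rule ennreal_unscale) auto
  hence J': "en (abs(delta y) / 12) <= ?G x" by simp
  have "en ((abs(delta y) / 12) powr q) <= en ((y\<^sup>2) powr (q - 1)) * ?K x"
   by (rule line_power[OF _ J']) (use y in auto)
  hence "en ((12 powr q * y powr (2 - 2 * q)) * (abs(delta y) / 12) powr q)
   <= en ((12 powr q * y powr (2 - 2 * q)) * (y\<^sup>2) powr (q - 1)) * ?K x"
   by (rule ennreal_scale) auto
  moreover have "(12 powr q * y powr (2 - 2 * q)) * (abs(delta y) / 12) powr q = abs(delta y) powr q * y powr (2 - 2 * q)"
   by (simp add: powr_divide)
  moreover have "(12 powr q * y powr (2 - 2 * q)) * (y\<^sup>2) powr (q - 1) = 12 powr q"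
  proof -
   have "(y\<^sup>2) powr (q - 1) = (y powr 2) powr (q - 1)" using y by simp
   also have "... = y powr (2 * q - 2)" by (simp add: powr_powr algebra_simps)
   finally show ?thesis using y by (simp add: mult.assoc powr_add[symmetric])
  qed
  ultimately have "?L <= en (12 powr q) * ?K x" by simp
  also have "... <= en (96 powr q) * ?Z x"
   using q by (intro mult_mono ennreal_leI powr_mono2 nn_integral_mono) (auto simp: indicator_def)
  finally show ?thesis .
 qed
 from cases show ?thesis
 proof (elim disjE)
  assume a: "en (abs(delta y) / 4) <= en (24 / y) * ?J"
  show ?thesis by (rule order_trans[OF box[OF a] mult_left_mono]) auto
 next
  assume a: "en (abs(delta y) / 4) <= 3 * ?G y"
  show ?thesis by (rule order_trans[OF line[OF a] mult_left_mono]) (auto intro: add_increasing)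
 next
  assume a: "en (abs(delta y) / 4) <= 3 * ?G (y/2)"
  show ?thesis by (rule order_trans[OF line[OF a] mult_left_mono]) (auto intro!: add_increasing)
 next
  assume a: "en (abs(delta y) / 4) <= 3 * ?G (y/4)"
  show ?thesis by (rule order_trans[OF line[OF a] mult_left_mono]) (auto intro!: add_increasing)
 qed
qed

lemma delta_integral:
 assumes y0: "y0 <= 1" "y0\<^sup>2 <= T"
 shows "(NN y. ind {0<..<y0} y * en (abs(delta y) powr q * y powr (2 - 2 * q))) < \<infinity>"
proof -
 let ?box = "%y. {y/8<..<2*y} \<times> {y\<^sup>2/2<..<y\<^sup>2}"
 let ?b = "%z y. ind {0<..<y0} y * (en (1 / y) * (ind (?box y) z * en (F z powr q)))"
 let ?B = "%y. ind {0<..<y0} y * (en (1 / y) * (NN z. ind (?box y) z * en (F z powr q)))"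
 let ?Z = "%x. NN s. en (F (x, s) powr q)"
 have jm: "(%p. ?b (fst p) (snd p)) \<in> borel_measurable (borel :: ((pt) \<times> real) measure)"
 proof -
  have "(%p. ?b (fst p) (snd p)) = (%p. ind {0<..<y0} (snd p) * (en (1 / snd p) *
   (ind {0<..} (fst (fst p) - snd p / 8) * ind {0<..} (2 * snd p - fst (fst p)) * ind {0<..} (snd (fst p) - (snd p)\<^sup>2/2)
    * ind {0<..} ((snd p)\<^sup>2 - snd (fst p)) * en (F (fst p) powr q))))"
   by (auto simp: fun_eq_iff indicator_def)
  also have "... \<in> BM" by measurable
  finally show ?thesis .
 qed
 have Beq: "(%y. NN z. ?b z y) = ?B"
 proof
  fix y :: real
  have [measurable]: "?box y \<in> sets borel" by (intro borel_Times) auto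
  show "(NN z. ?b z y) = ?B y" by (subst nn_integral_cmult, measurable) (subst nn_integral_cmult, measurable)
 qed
 have Bm [measurable]: "?B \<in> BM"
 proof -
  have "(%y. NN z. ?b z y) \<in> BM"
  proof (rule lborel.borel_measurable_nn_integral)
   have "(%p. ?b (fst p) (snd p)) \<circ> (%p. (snd p, fst p)) \<in> borel_measurable (borel :: (real \<times> (pt)) measure)"
    by (rule measurable_comp[OF _ jm]) measurable
   hence "(%p. ?b (snd p) (fst p)) \<in> borel_measurable (borel \<Otimes>\<^sub>M lborel)"
    by (subst measurable_cong_sets[OF sets_pair_measure_cong[OF refl sets_lborel] refl]) (simp add: borel_prod o_def)
   then show "(%(y, z). ?b z y) \<in> borel_measurable (borel \<Otimes>\<^sub>M lborel)" by (simp add: case_prod_beta')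
  qed
  thus ?thesis unfolding Beq .
 qed
 have Bint: "(NN y. ?B y) <= en (15 * Fnorm)"
 proof -
  have "(NN y. ?B y) = (NN z. NN y. ?b z y)"
   unfolding Beq[symmetric] by (rule nn_integral_swap[OF jm])
  also have "... <= (NN z. 15 * en (F z powr q))"
  proof (rule nn_integral_mono)
   fix z :: "pt"
   obtain u t where z: "z = (u, t)" by (cases z)
   show "(NN y. ?b z y) <= 15 * en (F z powr q)"
   proof (cases "0 < u")
    case True
    have "(NN y. ?b z y) <= (NN y. en (2 / u) * en (F z powr q) * ind {u/2<..<8*u} y)"
    using True by (intro nn_integral_mono) (auto simp: z indicator_def field_simps intro!: mult_right_mono ennreal_leI)
    also have "... = en (2 / u) * en (F z powr q) * en (15 / 2 * u)"
    using True by (subst nn_integral_cmult_indicator) auto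
    also have "... = en (2 / u * (15 / 2 * u)) * en (F z powr q)"
    using True by (subst ennreal_mult) (auto simp: mult_ac)
    finally show ?thesis using True by simp
   next
    case False
    have "(NN y. ?b z y) = (\<integral>\<^sup>+y. 0 \<partial>(lborel :: real measure))"
    using False by (intro nn_integral_cong) (auto simp: z indicator_def)
    thus ?thesis by simp
   qed
  qed
  also have "... = en (15 * Fnorm)"
   using Fnorm by (subst nn_integral_cmult) (auto simp: ennreal_mult)
  finally show ?thesis .
 qed
 have h2: "1/2 ~= (0::real)" "1/4 ~= (0::real)" by auto
 have "AE y in lborel. ind {0<..<y0} y * en (abs(delta y) powr q * y powr (2 - 2 * q))
  <= en (96 powr q) * (?B y + (?Z y + (?Z (y / 2) + ?Z (y / 4))))"
  using AE_not_null_affine[OF N one_neq_zero, of 0] AE_not_null_affine[OF N h2(1), of 0] AE_not_null_affine[OF N h2(2), of 0]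
 proof eventually_elim
  case (elim y)
  show ?case
  proof (cases "0 < y \<and> y < y0")
   case True
   have "y\<^sup>2 < y0\<^sup>2" using True by (intro power_strict_mono) auto
   thus ?thesis using delta_pointwise[of y] True elim y0 by simp
  qed auto
 qed
 hence "(NN y. ind {0<..<y0} y * en (abs(delta y) powr q * y powr (2 - 2 * q)))
  <= (NN y. en (96 powr q) * (?B y + (?Z y + (?Z (y / 2) + ?Z (y / 4)))))"
  by (rule nn_integral_mono_AE)
 also have "... = en (96 powr q) * ((NN y. ?B y) + ((NN y. ?Z y) + ((NN y. ?Z (y / 2)) + (NN y. ?Z (y / 4)))))"
 proof -
  have Z2: "(%y. ?Z (y / c)) \<in> BM" for c :: real
   by (rule measurable_compose[OF _ Fq_section_measurable]) auto
  show ?thesis using Z2[of 2] Z2[of 4] by (subst nn_integral_cmult, measurable) (simp add: nn_integral_add)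
 qed
 also have "... <= en (96 powr q) * (en (15 * Fnorm) + (en Fnorm + (en (2 * Fnorm) + en (4 * Fnorm))))"
  using Fq_section_affine[of 1 0] Fq_section_affine[of "1/2" 0] Fq_section_affine[of "1/4" 0]
  by (intro mult_left_mono add_mono Bint) (auto simp: mult.commute)
 also have "... < \<infinity>" by (auto simp: ennreal_mult_less_top)
 finally show ?thesis .
qed

end

context trace_control begin

text \<open>As the derivative vanishes at the end point, a weighted sum of second differences at dyadic scales recovers
the first difference; the sum converges in the weighted norm because q > 3.\<close>
lemma boundary_hardy:
 assumes y0: "y0 <= 1" "y0\<^sup>2 <= T" and d0: "(\<phi> has_real_derivative 0) (at 0 within {0..1})"
 shows "(NN y. ind {0<..<y0} y * en (abs(\<phi>c y - \<phi> 0) powr q * y powr (2 - 2 * q))) < \<infinity>"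
proof -
 define lam where "lam = 2 powr (- (q - 3) / (2 * (q - 1)))"
 define th where "th = 2 powr ((3 - q) / 2)"
 have "lam < 2 powr 0" unfolding lam_def using q by (intro powr_less_mono) (auto simp: divide_neg_pos)
 hence lam: "0 < lam" "lam < 1" by (auto simp: lam_def)
 have "th < 2 powr 0" unfolding th_def using q by (intro powr_less_mono) auto
 hence th: "0 < th" "th < 1" by (auto simp: th_def)
 define b where "b y = \<phi>c y - \<phi> 0" for y
 have [measurable]: "b \<in> BM" unfolding b_def by measurable
 have blim: "(%n. 2 ^ n * b (y / 2 ^ n)) \<longlonglongrightarrow> 0" if y: "0 < y" "y < 1" for y
 proof (rule LIMSEQ_I)
  fix e :: real assume e: "0 < e"
  have "\<forall>e>0. \<exists>d>0. \<forall>x\<in>{0..1}. abs(x) < d \<longrightarrow> abs(\<phi> x - \<phi> 0) <= e * abs(x)"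
   using d0 unfolding has_field_derivative_def has_derivative_within_alt by auto
  from this[rule_format, of "e / 2"] e obtain d where d: "0 < d" "!!x. x \<in> {0..1} ==> abs(x) < d ==> abs(\<phi> x - \<phi> 0) <= e / 2 * abs(x)"
   by (auto simp del: atLeastAtMost_iff)
  obtain n0 where n0: "y / d < 2 ^ n0" using real_arch_pow[of 2 "y / d"] by auto
  show "\<exists>no. \<forall>n\<ge>no. norm (2 ^ n * b (y / 2 ^ n) - 0) < e"
  proof (intro exI allI impI)
   fix n assume "n0 <= n"
   hence "(2::real) ^ n0 <= 2 ^ n" by (intro power_increasing) auto
   hence "y / d < 2 ^ n" using n0 by linarith
   hence yd: "y / 2 ^ n < d" using d by (simp add: field_simps)
   have "y / 2 ^ n <= y / 1" using y by (intro divide_left_mono) auto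
   hence y1: "y / 2 ^ n <= 1" using y by linarith
   hence "abs(b (y / 2 ^ n)) <= e / 2 * (y / 2 ^ n)"
    using d(2)[of "y / 2 ^ n"] yd y by (simp add: b_def \<phi>c(2))
   hence "2 ^ n * abs(b (y / 2 ^ n)) <= 2 ^ n * (e / 2 * (y / 2 ^ n))" by (intro mult_left_mono) auto
   also have "... = e / 2 * y" by simp
   also have "... < e" using y e by (simp add: field_simps)
   finally show "norm (2 ^ n * b (y / 2 ^ n) - 0) < e" by (simp add: abs_mult)
  qed
 qed
 have tele: "(\<Sum>m<n. (2 ^ Suc m - 1) * delta (y / 2 ^ m))
   = b y - (2 ^ Suc n - 1) * b (y / 2 ^ n) + (2 ^ Suc n - 2) * b (y / 2 ^ Suc n)" for n y
 proof (induction n)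
  case (Suc n)
  have dd: "delta (y / 2 ^ n) = b (y / 2 ^ n) - 3 * b (y / 2 ^ Suc n) + 2 * b (y / 2 ^ Suc (Suc n))"
   by (simp add: delta_def b_def field_simps)
  show ?case unfolding sum.lessThan_Suc Suc.IH dd by (simp add: algebra_simps)
 qed simp
 have ser: "en (abs(b y)) <= (\<Sum>m. en (2 ^ Suc m * abs(delta (y / 2 ^ m))))" if y: "0 < y" "y < 1" for y
 proof -
  have "(%n. b y - (2 * (2 ^ n * b (y / 2 ^ n)) - b (y / 2 ^ n)) + (2 ^ Suc n * b (y / 2 ^ Suc n) - 2 * b (y / 2 ^ Suc n)))
    \<longlonglongrightarrow> b y - (2 * 0 - 0) + (0 - 2 * 0)"
  proof (intro tendsto_intros blim y LIMSEQ_Suc[OF blim[OF y]])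
   have "(%n. (1/2) ^ n * (2 ^ n * b (y / 2 ^ n))) \<longlonglongrightarrow> 0 * 0"
    by (intro tendsto_mult blim y LIMSEQ_realpow_zero) auto
   then show bl: "(%n. b (y / 2 ^ n)) \<longlonglongrightarrow> 0"
    by (simp add: mult.assoc[symmetric] power_mult_distrib[symmetric])
   show "(%n. b (y / 2 ^ Suc n)) \<longlonglongrightarrow> 0" by (rule LIMSEQ_Suc[OF bl])
  qed
  hence "(%n. \<Sum>m<n. (2 ^ Suc m - 1) * delta (y / 2 ^ m)) \<longlonglongrightarrow> b y"
   unfolding tele by (simp add: algebra_simps)
  hence "(%n. en (abs(\<Sum>m<n. (2 ^ Suc m - 1) * delta (y / 2 ^ m)))) \<longlonglongrightarrow> en (abs(b y))"
   by (intro tendsto_ennrealI tendsto_rabs)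
  thus ?thesis
  proof (rule LIMSEQ_le_const2, intro exI allI impI)
   fix n
   have "en (abs(\<Sum>m<n. (2 ^ Suc m - 1) * delta (y / 2 ^ m))) <= en (\<Sum>m<n. 2 ^ Suc m * abs(delta (y / 2 ^ m)))"
   proof (intro ennreal_leI order_trans[OF sum_abs] sum_mono)
    fix m
    have "(1::real) <= 2 ^ Suc m" by (rule one_le_power) simp
    then show "abs((2 ^ Suc m - 1) * delta (y / 2 ^ m)) <= 2 ^ Suc m * abs(delta (y / 2 ^ m))"
    unfolding abs_mult by (intro mult_right_mono) auto
   qed
   also have "... = (\<Sum>m<n. en (2 ^ Suc m * abs(delta (y / 2 ^ m))))" by (intro sum_ennreal[symmetric]) auto
   also have "... <= (\<Sum>m. en (2 ^ Suc m * abs(delta (y / 2 ^ m))))" by (rule sum_le_suminf) auto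
   finally show "en (abs(\<Sum>m<n. (2 ^ Suc m - 1) * delta (y / 2 ^ m))) <= (\<Sum>m. en (2 ^ Suc m * abs(delta (y / 2 ^ m))))" .
  qed
 qed
 define C where "C = (1 / (1 - lam)) powr (q - 1)"
 define w where "w m = lam ^ m * (2 ^ Suc m / lam ^ m) powr q" for m
 have w0: "0 <= w m" for m using lam by (simp add: w_def)
 have pt: "en (abs(b y) powr q) <= en C * (\<Sum>m. en (w m * abs(delta (y / 2 ^ m)) powr q))" if y: "0 < y" "y < 1" for y
 proof -
  have "en (abs(b y) powr q) <= en ((1 / (1 - lam)) powr (q - 1)) *
   (\<integral>\<^sup>+m. en (lam ^ m) * en ((2 ^ Suc m * abs(delta (y / 2 ^ m)) / lam ^ m) powr q) \<partial>count_space UNIV)"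
  proof (rule weighted_jensen)
   have "(\<integral>\<^sup>+m. en (lam ^ m) \<partial>count_space UNIV) = en (\<Sum>m. lam ^ m)"
    using lam by (subst nn_integral_count_space_nat, intro suminf_ennreal2) (auto intro: summable_geometric)
   then show "(\<integral>\<^sup>+m. en (lam ^ m) \<partial>count_space UNIV) <= en (1 / (1 - lam))"
    using lam by (simp add: suminf_geometric)
   have "(\<integral>\<^sup>+m. en (lam ^ m) * en (2 ^ Suc m * abs(delta (y / 2 ^ m)) / lam ^ m) \<partial>count_space UNIV)
    = (\<Sum>m. en (2 ^ Suc m * abs(delta (y / 2 ^ m))))"
    using lam by (subst nn_integral_count_space_nat) (simp add: ennreal_mult[symmetric])
   then show "en (abs(b y)) <= (\<integral>\<^sup>+m. en (lam ^ m) * en (2 ^ Suc m * abs(delta (y / 2 ^ m)) / lam ^ m) \<partial>count_space UNIV)"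
    using ser[OF y] by (simp only:)
   show "0 <= 2 ^ Suc m * abs(delta (y / 2 ^ m)) / lam ^ m" for m using lam by simp
  qed (use lam q in simp_all)
  also have "(\<integral>\<^sup>+m. en (lam ^ m) * en ((2 ^ Suc m * abs(delta (y / 2 ^ m)) / lam ^ m) powr q) \<partial>count_space UNIV)
   = (\<Sum>m. en (w m * abs(delta (y / 2 ^ m)) powr q))"
  proof (subst nn_integral_count_space_nat, intro suminf_cong)
   fix m
   have "(2 ^ Suc m * abs(delta (y / 2 ^ m)) / lam ^ m) powr q = (2 ^ Suc m / lam ^ m) powr q * abs(delta (y / 2 ^ m)) powr q"
    using lam by (subst powr_mult[symmetric]) auto
   then show "en (lam ^ m) * en ((2 ^ Suc m * abs(delta (y / 2 ^ m)) / lam ^ m) powr q) = en (w m * abs(delta (y / 2 ^ m)) powr q)"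
    using lam by (simp add: w_def ennreal_mult[symmetric] mult.assoc)
  qed
  finally show ?thesis by (simp add: C_def)
 qed
 let ?I = "NN y. ind {0<..<y0} y * en (abs(delta y) powr q * y powr (2 - 2 * q))"
 let ?t = "%m y. ind {0<..<y0} y * en (y powr (2 - 2 * q) * (w m * abs(delta (y / 2 ^ m)) powr q))"
 have scaled: "(NN y. ?t m y) <= en (2 powr q * th ^ m) * ?I" for m
 proof -
  have t1: "(NN y. ?t m y) = en (abs(2 ^ m)) * (NN u. ?t m (0 + 2 ^ m * u))"
   by (rule nn_integral_real_affine) auto
  have t2: "(NN u. ?t m (0 + 2 ^ m * u)) <=
    (NN u. en ((2 ^ m) powr (2 - 2 * q) * w m) * (ind {0<..<y0} u * en (abs(delta u) powr q * u powr (2 - 2 * q))))"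
  proof (rule nn_integral_mono)
   fix u
   show "?t m (0 + 2 ^ m * u) <= en ((2 ^ m) powr (2 - 2 * q) * w m) * (ind {0<..<y0} u * en (abs(delta u) powr q * u powr (2 - 2 * q)))"
   proof (cases "0 < u \<and> 2 ^ m * u < y0")
    case True
    have "1 * u <= 2 ^ m * u" using True by (intro mult_right_mono one_le_power) auto
    hence "u < y0" using True by linarith
    thus ?thesis using True w0[of m] by (simp add: powr_mult ennreal_mult[symmetric] mult_ac)
   qed (auto simp: indicator_def zero_less_mult_iff)
  qed
  have t3: "(NN u. en ((2 ^ m) powr (2 - 2 * q) * w m) * (ind {0<..<y0} u * en (abs(delta u) powr q * u powr (2 - 2 * q))))
   = en ((2 ^ m) powr (2 - 2 * q) * w m) * ?I" by (rule nn_integral_cmult) measurable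
  have t4: "en (abs(2 ^ m)) * (en ((2 ^ m) powr (2 - 2 * q) * w m) * ?I) = en (2 powr q * th ^ m) * ?I"
  proof -
   have "2 ^ m * ((2 ^ m) powr (2 - 2 * q) * w m) = 2 powr q * th ^ m"
   proof -
    have "w m = lam ^ m * (2 powr q * (2 powr q) ^ m / (lam powr q) ^ m)"
    using lam by (simp add: w_def powr_divide powr_mult power_powr)
    hence "2 ^ m * ((2 ^ m) powr (2 - 2 * q) * w m) = 2 powr q * (2 * 2 powr (2 - 2 * q) * lam * 2 powr q / lam powr q) ^ m"
    by (simp add: power_powr power_mult_distrib power_divide)
    also have "2 * 2 powr (2 - 2 * q) * lam * 2 powr q / lam powr q = th"
    proof -
    have "lam / lam powr q = lam powr (1 - q)" using lam by (simp add: powr_diff)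
    also have "... = 2 powr ((q - 3) / 2)"
    unfolding lam_def powr_powr using q by (intro arg_cong[where f = "(powr) 2"]) (simp add: field_simps)
    finally have l: "lam / lam powr q = 2 powr ((q - 3) / 2)" .
    have "2 * 2 powr (2 - 2 * q) * lam * 2 powr q / lam powr q = 2 powr 1 * 2 powr (2 - 2 * q) * 2 powr q * (lam / lam powr q)" by simp
    also have "... = 2 powr (1 + (2 - 2 * q) + q + (q - 3) / 2)" unfolding l by (simp only: powr_add)
    also have "... = th" unfolding th_def by (intro arg_cong[where f = "(powr) 2"]) (simp add: field_simps)
    finally show ?thesis .
    qed
    finally show ?thesis .
   qed
   thus ?thesis using w0[of m] by (simp add: mult.assoc[symmetric] ennreal_mult[symmetric])
  qed
  show ?thesis unfolding t1 t4[symmetric] by (rule mult_left_mono[OF t2[unfolded t3]]) simp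
 qed
 have "(NN y. ind {0<..<y0} y * en (abs(\<phi>c y - \<phi> 0) powr q * y powr (2 - 2 * q)))
  <= (NN y. en C * (\<Sum>m. ?t m y))"
 proof (rule nn_integral_mono)
  fix y
  show "ind {0<..<y0} y * en (abs(\<phi>c y - \<phi> 0) powr q * y powr (2 - 2 * q)) <= en C * (\<Sum>m. ?t m y)"
  proof (cases "0 < y \<and> y < y0")
   case True
   have "en (abs(b y) powr q * y powr (2 - 2 * q)) = en (y powr (2 - 2 * q)) * en (abs(b y) powr q)"
    by (simp add: ennreal_mult[symmetric] mult.commute)
   also have "... <= en (y powr (2 - 2 * q)) * (en C * (\<Sum>m. en (w m * abs(delta (y / 2 ^ m)) powr q)))"
    using True y0 by (intro mult_left_mono pt) auto
   also have "... = en C * (\<Sum>m. en (y powr (2 - 2 * q)) * en (w m * abs(delta (y / 2 ^ m)) powr q))"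
    by (subst ennreal_suminf_cmult) (simp add: mult_ac)
   finally show ?thesis using True w0 by (simp add: b_def ennreal_mult[symmetric])
  qed simp
 qed
 also have "... = en C * (\<Sum>m. NN y. ?t m y)"
  by (subst nn_integral_cmult, measurable) (subst nn_integral_suminf, measurable)
 also have "... <= en C * (\<Sum>m. en (2 powr q * th ^ m) * ?I)"
  by (intro mult_left_mono suminf_le scaled) auto
 also have "... = en C * (en (\<Sum>m. 2 powr q * th ^ m) * ?I)"
 proof -
  have "(\<Sum>m. en (2 powr q * th ^ m)) = en (\<Sum>m. 2 powr q * th ^ m)"
   using th by (intro suminf_ennreal2) (auto intro!: summable_mult summable_geometric)
  thus ?thesis by (simp only: ennreal_suminf_multc)
 qed
 also have "... < \<infinity>"
  using delta_integral[OF y0] by (auto simp: ennreal_mult_less_top)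
 finally show ?thesis .
qed

end

section \<open>Even reflection and the Besov norm\<close>

text \<open>The map of the line onto [0,1] that folds it at all integers; composing with it is even reflection about both
end points.\<close>
definition fold01 :: "real => real" where
 "fold01 y = abs(y - 2 * of_int (round (y / 2)))"

lemma fold01_le: "fold01 y <= abs(y - 2 * of_int m)"
proof -
 have "abs(y / 2 - of_int (round (y / 2))) <= abs(y / 2 - of_int m)" by (rule round_diff_minimal)
 thus ?thesis unfolding fold01_def by linarith
qed

lemma fold01_eqI:
 assumes "abs(y - 2 * of_int m) <= 1" shows "fold01 y = abs(y - 2 * of_int m)"
proof (cases "round (y / 2) = m")
 case False
 hence "1 <= abs(round (y / 2) - m)" by simp
 hence "1 <= abs(of_int (round (y / 2)) - (of_int m :: real))"
  by (metis of_int_1_le_iff of_int_abs of_int_diff)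
 hence "1 <= fold01 y" unfolding fold01_def using assms by linarith
 thus ?thesis using assms fold01_le[of y m] by linarith
qed (simp add: fold01_def)

lemma fold01_range: "0 <= fold01 y" "fold01 y <= 1"
proof -
 have "abs(y / 2 - of_int (round (y / 2))) <= 1 / 2" using of_int_round_abs_le[of "y/2"] by (simp add: abs_minus_commute)
 then show "0 <= fold01 y" "fold01 y <= 1" unfolding fold01_def by linarith+
qed

lemma fold01_abs: "abs(y) <= 1 ==> fold01 y = abs(y)"
 using fold01_eqI[of y 0] by simp

lemma fold01_minus: "fold01 (- y) = fold01 y"
proof (rule antisym)
 show "fold01 (- y) <= fold01 y"
  using fold01_le[of "- y" "- round (y / 2)"] unfolding fold01_def[of y] by simp
 show "fold01 y <= fold01 (- y)"
  using fold01_le[of y "- round (- y / 2)"] unfolding fold01_def[of "- y"] by simp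
qed

lemma fold01_one_minus: "fold01 (1 - y) = 1 - fold01 y"
proof -
 define m where "m = round (y / 2)"
 define w where "w = y - 2 * of_int m"
 have w: "fold01 y = abs(w)" "abs(w) <= 1" using fold01_range(2)[of y] by (auto simp: fold01_def w_def m_def)
 show ?thesis
 proof (cases "0 <= w")
  case True
  have "1 - y - 2 * of_int (- m) = 1 - w" by (simp add: w_def)
  thus ?thesis using fold01_eqI[of "1 - y" "- m"] w True by simp
 next
  case False
  have "1 - y - 2 * of_int (1 - m) = - 1 - w" by (simp add: w_def)
  thus ?thesis using fold01_eqI[of "1 - y" "1 - m"] w False by simp
 qed
qed

lemma fold01_lipschitz: "abs(fold01 x - fold01 y) <= abs(x - y)"
proof -
 have "fold01 x <= fold01 y + abs(x - y)" for x y
  using fold01_le[of x "round (y / 2)"] unfolding fold01_def[of y] by linarith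
 from this[of x y] this[of y x] show ?thesis by linarith
qed

lemma fold01_continuous: "continuous_on UNIV fold01"
 unfolding continuous_on_iff dist_real_def using fold01_lipschitz le_less_trans by blast

lemma fold01_measurable [measurable]: "fold01 \<in> BM"
 by (rule borel_measurable_continuous_onI[OF fold01_continuous])

lemma nn_integral_powr_tail:
 assumes "0 < a" "1 < p"
 shows "(NN h. ind {a<..} h * en (h powr (- p))) <= en (a powr (1 - p) / (p - 1))"
proof -
 have "((%x. x powr (- p)) has_integral -(a powr (- p + 1)) / (- p + 1)) {a..}"
  using assms by (intro has_integral_powr_to_inf) auto
 hence "(NN h. en (h powr (- p)) * ind {a..} h) = en (-(a powr (- p + 1)) / (- p + 1))"
  by (intro nn_integral_has_integral_lebesgue') auto
 also have "-(a powr (- p + 1)) / (- p + 1) = a powr (1 - p) / (p - 1)"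
  using assms by (simp add: field_simps)
 finally show ?thesis
  by (rule order_trans[rotated, OF eq_refl]) (auto intro!: nn_integral_mono simp: indicator_def)
qed

context trace_control
begin

definition \<psi> :: "real => real" where "\<psi> y = \<phi> (fold01 y)"

lemma \<psi>_eq: "\<psi> y = \<phi>c (fold01 y)"
 using fold01_range by (simp add: \<psi>_def \<phi>c(2))

lemma \<psi>_measurable [measurable]: "\<psi> \<in> BM"
 unfolding \<psi>_eq by measurable

definition D2 :: "real => real => real" where
 "D2 h x = abs(\<psi> (x + h) + \<psi> (x - h) - 2 * \<psi> x) powr q"

lemma D2_measurable: "(%p. D2 (fst p) (snd p)) \<in> BM"
 unfolding D2_def by measurable

lemma D2_measurable' [measurable]: "D2 h \<in> BM"
 unfolding D2_def by measurable

lemma collar_integral: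
 assumes h0: "2 * h0 <= 1" "(2 * h0)\<^sup>2 <= T" and d0: "(\<phi> has_real_derivative 0) (at 0 within {0..1})"
 shows "(NN h. ind {0<..<h0} h * (en (h powr (1 - 2 * q)) *
  (NN x. ind {0<..<h} x * en (D2 h x)))) < \<infinity>"
proof -
 define be where "be y = abs(\<phi>c y - \<phi> 0) powr q" for y
 have [measurable]: "be \<in> BM" unfolding be_def by measurable
 let ?W = "%h. NN y. ind {0<..<2*h} y * en (be y)"
 have inner: "(NN x. ind {0<..<h} x * en (D2 h x)) <= en (3 * 4 powr q) * ?W h"
  if h: "0 < h" "h < h0" for h
 proof -
  have "(NN x. ind {0<..<h} x * en (D2 h x)) <=
   (NN x. en (4 powr q) * (ind {0<..<h} x * en (be (h + 1 * x)) + (ind {0<..<h} x * en (be (h + (-1) * x)) + ind {0<..<h} x * en (be (0 + 1 * x)))))"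
  proof (rule nn_integral_mono)
   fix x
   show "ind {0<..<h} x * en (D2 h x) <= en (4 powr q) * (ind {0<..<h} x * en (be (h + 1 * x)) + (ind {0<..<h} x * en (be (h + (-1) * x)) + ind {0<..<h} x * en (be (0 + 1 * x))))"
   proof (cases "0 < x \<and> x < h")
    case True
    have e: "\<psi> (x + h) = \<phi>c (h + x)" "\<psi> (x - h) = \<phi>c (h - x)" "\<psi> x = \<phi>c x"
    using True h h0 by (auto simp: \<psi>_eq fold01_abs add.commute)
    define m where "m = max (abs(\<phi>c (h + x) - \<phi> 0)) (max (abs(\<phi>c (h - x) - \<phi> 0)) (abs(\<phi>c x - \<phi> 0)))"
    have "abs(\<phi>c (h + x) - \<phi> 0) <= m" "abs(\<phi>c (h - x) - \<phi> 0) <= m" "abs(\<phi>c x - \<phi> 0) <= m" by (simp_all add: m_def)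
    hence "abs(\<psi> (x + h) + \<psi> (x - h) - 2 * \<psi> x) <= 4 * m" unfolding e by linarith
    hence "D2 h x <= (4 * m) powr q" unfolding D2_def using q by (intro powr_mono2) auto
    also have "... = 4 powr q * m powr q" by (simp add: powr_mult m_def)
    also have "m powr q <= be (h + x) + (be (h - x) + be x)"
    by (auto simp: m_def max_def be_def)
    finally have "D2 h x <= 4 powr q * (be (h + x) + (be (h - x) + be x))" by (simp add: mult_left_mono)
    hence "en (D2 h x) <= en (4 powr q * (be (h + x) + (be (h - x) + be x)))" by (rule ennreal_leI)
    also have "... = en (4 powr q) * (en (be (h + x)) + (en (be (h - x)) + en (be x)))"
    by (simp add: ennreal_mult be_def)
    finally show ?thesis using True by simp
   qed simp
  qed
  also have "... = en (4 powr q) * ((NN x. ind {0<..<h} x * en (be (h + 1 * x)))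
   + ((NN x. ind {0<..<h} x * en (be (h + (-1) * x))) + (NN x. ind {0<..<h} x * en (be (0 + 1 * x)))))"
   by (subst nn_integral_cmult, measurable) (subst nn_integral_add, measurable, subst nn_integral_add, measurable)
  also have "... <= en (4 powr q) * (?W h + (?W h + ?W h))"
  proof (intro mult_left_mono add_mono)
   have *: "(NN x. ind {0<..<h} x * en (be (a + c * x))) <= ?W h"
    if c: "abs(c) = 1" "!!x. 0 < x ==> x < h ==> 0 < a + c * x \<and> a + c * x < 2 * h" for a c :: real
   proof -
    have "(NN x. ind {0<..<h} x * en (be (a + c * x)))
    <= (NN x. ind {0<..<2*h} (a + c * x) * en (be (a + c * x)))"
    using c by (intro nn_integral_mono) (auto simp: indicator_def)
    also have "... = en (abs(c)) * (NN x. ind {0<..<2*h} (a + c * x) * en (be (a + c * x)))"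
    using c by simp
    also have "... = ?W h" using c by (intro nn_integral_real_affine[symmetric]) auto
    finally show ?thesis .
   qed
   show "(NN x. ind {0<..<h} x * en (be (h + 1 * x))) <= ?W h"
    "(NN x. ind {0<..<h} x * en (be (h + (-1) * x))) <= ?W h"
    "(NN x. ind {0<..<h} x * en (be (0 + 1 * x))) <= ?W h"
    by (rule *; use h in auto)+
  qed simp
  also have "... = en (4 powr q) * (3 * ?W h)"
  proof -
   have "w + (w + w) = (1 + (1 + 1)) * w" for w :: ennreal by (simp only: distrib_right mult_1)
   thus ?thesis by simp
  qed
  finally show ?thesis by (simp add: ennreal_mult mult_ac)
 qed
 have "(NN h. ind {0<..<h0} h * (en (h powr (1 - 2 * q)) *
  (NN x. ind {0<..<h} x * en (D2 h x))))
  <= (NN h. NN y. ind {0<..<h0} h * (en (h powr (1 - 2 * q)) * (en (3 * 4 powr q) * (ind {0<..<2*h} y * en (be y)))))"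
 proof (rule nn_integral_mono)
  fix h
  show "ind {0<..<h0} h * (en (h powr (1 - 2 * q)) * (NN x. ind {0<..<h} x * en (D2 h x)))
   <= (NN y. ind {0<..<h0} h * (en (h powr (1 - 2 * q)) * (en (3 * 4 powr q) * (ind {0<..<2*h} y * en (be y)))))"
  proof (cases "0 < h \<and> h < h0")
   case True
   have "(NN y. en (h powr (1 - 2 * q)) * (en (3 * 4 powr q) * (ind {0<..<2*h} y * en (be y))))
    = en (h powr (1 - 2 * q)) * (en (3 * 4 powr q) * ?W h)"
    by (subst nn_integral_cmult, measurable) (subst nn_integral_cmult, measurable)
   thus ?thesis using True inner[of h] by (simp add: mult_left_mono)
  qed simp
 qed
 also have "... = (NN y. NN h. ind {0<..<h0} h * (en (h powr (1 - 2 * q)) * (en (3 * 4 powr q) * (ind {0<..<2*h} y * en (be y)))))"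
  by (rule nn_integral_swap, unfold indicator_def of_bool_def greaterThanLessThan_iff, measurable)
 also have "... <= (NN y. en (3 * 4 powr q * (1/2) powr (2 - 2 * q) / (2 * q - 2)) * (ind {0<..<2*h0} y * en (abs(\<phi>c y - \<phi> 0) powr q * y powr (2 - 2 * q))))"
 proof (rule nn_integral_mono)
  fix y
  show "(NN h. ind {0<..<h0} h * (en (h powr (1 - 2 * q)) * (en (3 * 4 powr q) * (ind {0<..<2*h} y * en (be y)))))
   <= en (3 * 4 powr q * (1/2) powr (2 - 2 * q) / (2 * q - 2)) * (ind {0<..<2*h0} y * en (abs(\<phi>c y - \<phi> 0) powr q * y powr (2 - 2 * q)))"
  proof (cases "0 < y \<and> y < 2 * h0")
   case True
   have "(NN h. ind {0<..<h0} h * (en (h powr (1 - 2 * q)) * (en (3 * 4 powr q) * (ind {0<..<2*h} y * en (be y)))))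
    <= (NN h. en (3 * 4 powr q * be y) * (ind {y/2<..} h * en (h powr (- (2 * q - 1)))))"
    using True by (intro nn_integral_mono) (auto simp: indicator_def ennreal_mult be_def mult_ac)
   also have "... = en (3 * 4 powr q * be y) * (NN h. ind {y/2<..} h * en (h powr (- (2 * q - 1))))"
    by (rule nn_integral_cmult) measurable
   also have "... <= en (3 * 4 powr q * be y) * en ((y/2) powr (1 - (2 * q - 1)) / ((2 * q - 1) - 1))"
    using True q by (intro mult_left_mono nn_integral_powr_tail) auto
   also have "... = en (3 * 4 powr q * (1/2) powr (2 - 2 * q) / (2 * q - 2)) * en (be y * y powr (2 - 2 * q))"
   proof -
    have "(y / 2) powr (2 - 2 * q) = (1/2) powr (2 - 2 * q) * y powr (2 - 2 * q)"
    using True by (subst powr_mult[symmetric]) auto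
    hence "3 * 4 powr q * be y * ((y/2) powr (1 - (2 * q - 1)) / ((2 * q - 1) - 1))
    = (3 * 4 powr q * (1/2) powr (2 - 2 * q) / (2 * q - 2)) * (be y * y powr (2 - 2 * q))"
    by (simp add: algebra_simps)
    thus ?thesis using q by (subst (1 2) ennreal_mult[symmetric]) (auto simp: be_def)
   qed
   finally show ?thesis using True by (simp add: be_def)
  next
   case False
   have "(NN h. ind {0<..<h0} h * (en (h powr (1 - 2 * q)) * (en (3 * 4 powr q) * (ind {0<..<2*h} y * en (be y)))))
    = (\<integral>\<^sup>+h. 0 \<partial>(lborel :: real measure))"
    using False by (intro nn_integral_cong) (auto simp: indicator_def)
   thus ?thesis by simp
  qed
 qed
 also have "... = en (3 * 4 powr q * (1/2) powr (2 - 2 * q) / (2 * q - 2)) * (NN y. ind {0<..<2*h0} y * en (abs(\<phi>c y - \<phi> 0) powr q * y powr (2 - 2 * q)))"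
  by (rule nn_integral_cmult) measurable
 also have "... < \<infinity>" using boundary_hardy[OF h0 d0] by (auto simp: ennreal_mult_less_top)
 finally show ?thesis .
qed

definition hardy_const :: real where "hardy_const = ((q - 1) / (q - 2)) powr (q - 1)"

lemma hardy_line:
 assumes A: "0 <= A" "en A <= (NN s. ind {0<..<H} s * en (F (x, s)))" "0 < H"
 shows "en (A powr q) <= en (hardy_const * H powr (q - 2)) * (NN s. ind {0<..<H} s * en (s * F (x, s) powr q))"
proof -
 define e where "e = 1 / (q - 1)"
 have e: "0 < e" "e < 1" using q by (auto simp: e_def)
 define k where "k s = ind {0<..<H} s * en (s powr (- e))" for s
 have "((%x. x powr (- e)) has_integral (H powr (- e + 1) / (- e + 1))) {0..H}"
  using A e by (intro has_integral_powr_from_0) auto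
 hence I: "(NN h. en (h powr (- e)) * ind {0..H} h) = en (H powr (- e + 1) / (- e + 1))"
  by (intro nn_integral_has_integral_lebesgue') auto
 have "en (A powr q) <= en ((H powr (- e + 1) / (- e + 1)) powr (q - 1)) * (NN s. k s * en ((F (x, s) * s powr e) powr q))"
 proof (rule weighted_jensen)
  show "(NN s. k s) <= en (H powr (- e + 1) / (- e + 1))"
   unfolding I[symmetric] k_def by (intro nn_integral_mono) (auto simp: indicator_def)
  have "(NN s. ind {0<..<H} s * en (F (x, s))) = (NN s. k s * en (F (x, s) * s powr e))"
   using F0 by (intro nn_integral_cong) (auto simp: k_def indicator_def ennreal_mult[symmetric] powr_minus field_simps)
  then show "en A <= (NN s. k s * en (F (x, s) * s powr e))" using A by simp
  show "k \<in> borel_measurable lborel" unfolding k_def by measurable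
  show "0 < H powr (- e + 1) / (- e + 1)" using A e by simp
 qed (use F0 q A in auto)
 also have "(H powr (- e + 1) / (- e + 1)) powr (q - 1) = hardy_const * H powr (q - 2)"
 proof -
  have "- e + 1 = (q - 2) / (q - 1)" using q by (simp add: e_def field_simps)
  thus ?thesis using q A by (simp add: hardy_const_def powr_divide powr_powr powr_mult)
 qed
 also have "(NN s. k s * en ((F (x, s) * s powr e) powr q)) = (NN s. ind {0<..<H} s * en (s * F (x, s) powr q))"
 proof (rule nn_integral_cong)
  fix s
  show "k s * en ((F (x, s) * s powr e) powr q) = ind {0<..<H} s * en (s * F (x, s) powr q)"
  proof (cases "0 < s \<and> s < H")
   case True
   have "s powr (- e) * (F (x, s) * s powr e) powr q = (s powr (- e) * s powr (e * q)) * F (x, s) powr q"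
    using F0[of "(x, s)"] by (simp add: powr_mult powr_powr mult_ac)
   also have "s powr (- e) * s powr (e * q) = s powr (e * (q - 1))"
    by (simp add: powr_add[symmetric] algebra_simps)
   also have "e * (q - 1) = 1" using q by (simp add: e_def)
   finally show ?thesis using True by (simp add: k_def ennreal_mult[symmetric])
  qed (auto simp: k_def)
 qed
 finally show ?thesis .
qed

end

context trace_control
begin

definition Gint :: "real => real => ennreal" where
 "Gint h x = (NN s. ind {0<..<2*h\<^sup>2} s * en (s * F (x, s) powr q))"

definition Bint :: "real => real => ennreal" where
 "Bint h x = (NN z. ind ({x-2*h<..<x+2*h} \<times> {h\<^sup>2<..<2*h\<^sup>2}) z * en (F z powr q))"

lemma hardy_const_pos: "0 <= hardy_const" by (simp add: hardy_const_def)

lemma interior_pointwise: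
 assumes h: "0 < h" "2 * h\<^sup>2 < T" and x: "h < x" "x < 1 - h"
  and N: "x + h \<notin> N" "x - h \<notin> N" "x \<notin> N"
 shows "en (D2 h x * h powr (1 - 2 * q)) <= en (256 powr q * (1 + hardy_const)) *
  (en (h powr (-2)) * Bint h x + (en (h powr (-3)) * Gint h (x + h) + (en (h powr (-3)) * Gint h (x - h) + en (h powr (-3)) * Gint h x)))"
  (is "?L <= ?C * _")
proof -
 have nums: "3 = Suc (Suc (Suc 0))" by simp
 define c where "c i = (if i = 0 then 1 else if i = 1 then 1 else - 2 :: real)" for i :: nat
 define xi where "xi i = (if i = 0 then x + h else if i = 1 then x - h else x)" for i :: nat
 define D where "D = abs(\<psi> (x + h) + \<psi> (x - h) - 2 * \<psi> x)"
 let ?J = "NN z. ind ({x-2*h<..<x+2*h} \<times> {h\<^sup>2<..<2*h\<^sup>2}) z * en (F z)"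
 let ?G = "%x. NN s. ind {0<..<2*h\<^sup>2} s * en (F (x, s))"
 have "en (abs(\<Sum>i<3. c i * \<phi> (xi i))) <= en ((\<Sum>i<3. abs(c i)) * ((x + 2 * h) - (x - 2 * h)) / (2 * h\<^sup>2 - h\<^sup>2)) * ?J
    + (\<Sum>i<3. en (abs(c i)) * ?G (xi i))"
 proof (rule bound)
  show "(\<Sum>i<3. c i) = 0" "(\<Sum>i<3. c i * xi i) = 0"
   by (simp_all add: nums c_def xi_def)
 qed (use h x N in \<open>auto simp: xi_def\<close>)
 also have "abs(\<Sum>i<3. c i * \<phi> (xi i)) = D"
  using h x by (simp add: nums c_def xi_def D_def \<psi>_def fold01_abs algebra_simps)
 also have "(\<Sum>i<3. abs(c i)) * ((x + 2 * h) - (x - 2 * h)) / (2 * h\<^sup>2 - h\<^sup>2) = 16 / h"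
  using h by (simp add: nums c_def power2_eq_square field_simps)
 also have "(\<Sum>i<3. en (abs(c i)) * ?G (xi i)) = ?G (x + h) + (?G (x - h) + 2 * ?G x)"
  by (simp add: nums c_def xi_def add.assoc)
 also have "en (16 / h) * ?J + (?G (x + h) + (?G (x - h) + 2 * ?G x))
  <= en (16 / h) * ?J + (2 * ?G (x + h) + (2 * ?G (x - h) + 2 * ?G x))"
 proof -
  have *: "w <= 2 * w" for w :: ennreal
  proof -
   have "1 * w <= 2 * w" by (rule mult_right_mono) auto
   thus ?thesis by simp
  qed
  show ?thesis by (intro add_mono order_refl *)
 qed
 finally have cases: "en (D / 4) <= en (16 / h) * ?J \<or> en (D / 4) <= 2 * ?G (x + h)
  \<or> en (D / 4) <= 2 * ?G (x - h) \<or> en (D / 4) <= 2 * ?G x"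
  by (rule ennreal_le_sum4) (simp add: D_def)
 have D0: "0 <= D" by (simp add: D_def)
 have DD: "D2 h x = D powr q" by (simp add: D2_def D_def)
 have Cbig: "256 powr q <= 256 powr q * (1 + hardy_const)" "256 powr q * hardy_const <= 256 powr q * (1 + hardy_const)"
  using hardy_const_pos by (auto simp: distrib_left)
 have box: "?L <= ?C * (en (h powr (-2)) * Bint h x)" if J: "en (D / 4) <= en (16 / h) * ?J"
 proof -
  have "en (D / 4 / (16 / h)) <= ?J" by (rule ennreal_unscale[OF J]) (use h D0 in auto)
  hence J': "en (D * h / 64) <= ?J" by (simp add: field_simps)
  have "en ((D * h / 64) powr q) <= en ((((x + 2*h) - (x - 2*h)) * (2 * h\<^sup>2 - h\<^sup>2)) powr (q - 1)) * Bint h x"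
   unfolding Bint_def by (rule box_power[OF _ J']) (use h D0 in auto)
  also have "(((x + 2*h) - (x - 2*h)) * (2 * h\<^sup>2 - h\<^sup>2)) powr (q - 1) = 4 powr (q - 1) * h powr (3 * q - 3)"
  proof -
   have e: "((x + 2*h) - (x - 2*h)) * (2 * h\<^sup>2 - h\<^sup>2) = 4 * h powr 3" using h by (simp add: power2_eq_square power3_eq_cube)
   show ?thesis unfolding e powr_mult powr_powr by (simp add: algebra_simps)
  qed
  finally have "en ((64 powr q * h powr (1 - 3 * q)) * (D * h / 64) powr q)
   <= en ((64 powr q * h powr (1 - 3 * q)) * (4 powr (q - 1) * h powr (3 * q - 3))) * Bint h x"
   by (rule ennreal_scale) auto
  also have "(64 powr q * h powr (1 - 3 * q)) * (D * h / 64) powr q = D2 h x * h powr (1 - 2 * q)"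
  proof -
   have "(D * h / 64) powr q = D powr q * h powr q / 64 powr q" using h D0 by (simp add: powr_mult powr_divide)
   moreover have "h powr (1 - 3 * q) * h powr q = h powr (1 - 2 * q)" by (simp add: powr_add[symmetric])
   ultimately show ?thesis by (simp add: DD)
  qed
  also have "(64 powr q * h powr (1 - 3 * q)) * (4 powr (q - 1) * h powr (3 * q - 3)) = (64 powr q * 4 powr (q - 1)) * h powr (-2)"
   using h by (simp add: powr_add[symmetric] mult_ac)
  also have "en ((64 powr q * 4 powr (q - 1)) * h powr (-2)) <= en ((256 powr q * (1 + hardy_const)) * h powr (-2))"
  proof (intro ennreal_leI mult_right_mono)
   have "64 powr q * 4 powr (q - 1) <= 64 powr q * 4 powr q" using q by (intro mult_left_mono powr_mono) auto
   also have "... = 256 powr q" by (simp add: powr_mult[symmetric])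
   finally show "64 powr q * 4 powr (q - 1) <= 256 powr q * (1 + hardy_const)" using Cbig(1) by linarith
  qed simp
  also have "en ((256 powr q * (1 + hardy_const)) * h powr (-2)) = ?C * en (h powr (-2))"
   using hardy_const_pos by (intro ennreal_mult) auto
  finally show ?thesis by (simp add: mult.assoc mult_right_mono)
 qed
 have line: "?L <= ?C * (en (h powr (-3)) * Gint h y)" if J: "en (D / 4) <= 2 * ?G y" for y
 proof -
  have "en (D / 4) <= en 2 * ?G y" using J by simp
  hence "en (D / 4 / 2) <= ?G y" by (rule ennreal_unscale) (use D0 in auto)
  hence J': "en (D / 8) <= ?G y" by simp
  have "en ((D / 8) powr q) <= en (hardy_const * (2 * h\<^sup>2) powr (q - 2)) * Gint h y"
   unfolding Gint_def by (rule hardy_line[OF _ J']) (use h D0 in auto)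
  hence "en ((8 powr q * h powr (1 - 2 * q)) * (D / 8) powr q)
   <= en ((8 powr q * h powr (1 - 2 * q)) * (hardy_const * (2 * h\<^sup>2) powr (q - 2))) * Gint h y"
   by (rule ennreal_scale) (use hardy_const_pos in auto)
  also have "(8 powr q * h powr (1 - 2 * q)) * (D / 8) powr q = D2 h x * h powr (1 - 2 * q)"
   using D0 by (simp add: powr_divide DD)
  also have "(8 powr q * h powr (1 - 2 * q)) * (hardy_const * (2 * h\<^sup>2) powr (q - 2)) = (8 powr q * 2 powr (q - 2) * hardy_const) * h powr (-3)"
  proof -
   have "2 * h\<^sup>2 = 2 * h powr 2" using h by simp
   hence "(2 * h\<^sup>2) powr (q - 2) = 2 powr (q - 2) * h powr (2 * (q - 2))" by (simp only: powr_mult powr_powr)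
   moreover have "h powr (1 - 2 * q) * h powr (2 * (q - 2)) = h powr (-3)" by (simp add: powr_add[symmetric] algebra_simps)
   ultimately show ?thesis by (simp add: mult_ac)
  qed
  also have "en ((8 powr q * 2 powr (q - 2) * hardy_const) * h powr (-3)) <= en ((256 powr q * (1 + hardy_const)) * h powr (-3))"
  proof (intro ennreal_leI mult_right_mono)
   have "8 powr q * 2 powr (q - 2) <= 8 powr q * 32 powr q"
    using q by (intro mult_left_mono order_trans[OF powr_mono powr_mono2]) auto
   also have "... = 256 powr q" by (simp add: powr_mult[symmetric])
   finally have "8 powr q * 2 powr (q - 2) * hardy_const <= 256 powr q * hardy_const"
    using hardy_const_pos by (intro mult_right_mono) auto
   then show "8 powr q * 2 powr (q - 2) * hardy_const <= 256 powr q * (1 + hardy_const)" using Cbig(2) by linarith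
  qed simp
  also have "en ((256 powr q * (1 + hardy_const)) * h powr (-3)) = ?C * en (h powr (-3))"
   using hardy_const_pos by (intro ennreal_mult) auto
  finally show ?thesis by (simp add: mult.assoc mult_right_mono)
 qed
 from cases show ?thesis
 proof (elim disjE)
  assume a: "en (D / 4) <= en (16 / h) * ?J"
  show ?thesis by (rule order_trans[OF box[OF a] mult_left_mono]) auto
 next
  assume a: "en (D / 4) <= 2 * ?G (x + h)"
  show ?thesis by (rule order_trans[OF line[OF a] mult_left_mono]) (auto intro!: add_increasing)
 next
  assume a: "en (D / 4) <= 2 * ?G (x - h)"
  show ?thesis by (rule order_trans[OF line[OF a] mult_left_mono]) (auto intro!: add_increasing)
 next
  assume a: "en (D / 4) <= 2 * ?G x"
  show ?thesis by (rule order_trans[OF line[OF a] mult_left_mono]) (auto intro!: add_increasing)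
 qed
qed

lemma Bint_integral:
 assumes h: "0 < h"
 shows "(%x. Bint h x) \<in> BM"
  and "(NN x. Bint h x) = en (4 * h) * (NN z. ind {h\<^sup>2<..<2*h\<^sup>2} (snd z) * en (F z powr q))"
proof -
 let ?f = "%z x. ind {z - 2*h<..<z + 2*h} x * (ind {h\<^sup>2<..<2*h\<^sup>2} s * en (F (z, s) powr q))"
 define f where "f z x = ind {fst z - 2*h<..<fst z + 2*h} x * (ind {h\<^sup>2<..<2*h\<^sup>2} (snd z) * en (F z powr q))" for z :: "pt" and x
 have Bf: "Bint h x = (NN z. f z x)" for x
  unfolding Bint_def f_def by (intro nn_integral_cong) (auto simp: indicator_def)
 have jm: "(%p. f (fst p) (snd p)) \<in> BM"
  unfolding f_def indicator_def of_bool_def greaterThanLessThan_iff by measurable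
 show "(%x. Bint h x) \<in> BM"
  unfolding Bf
 proof (rule lborel.borel_measurable_nn_integral)
  have "(%p. f (fst p) (snd p)) \<circ> (%p. (snd p, fst p)) \<in> borel_measurable (borel :: (real \<times> (pt)) measure)"
   by (rule measurable_comp[OF _ jm]) measurable
  hence "(%p. f (snd p) (fst p)) \<in> borel_measurable (borel \<Otimes>\<^sub>M lborel)"
   by (subst measurable_cong_sets[OF sets_pair_measure_cong[OF refl sets_lborel] refl]) (simp add: borel_prod o_def)
  then show "(%(x, z). f z x) \<in> borel_measurable (borel \<Otimes>\<^sub>M lborel)" by (simp add: case_prod_beta')
 qed
 have "(NN x. Bint h x) = (NN z. NN x. f z x)"
  unfolding Bf by (rule nn_integral_swap[OF jm])
 also have "... = (NN z. en (4 * h) * (ind {h\<^sup>2<..<2*h\<^sup>2} (snd z) * en (F z powr q)))"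
 proof (rule nn_integral_cong)
  fix z :: "pt"
  have "(NN x. f z x) = (NN x. (ind {h\<^sup>2<..<2*h\<^sup>2} (snd z) * en (F z powr q)) * ind {fst z - 2*h<..<fst z + 2*h} x)"
   unfolding f_def by (intro nn_integral_cong) (auto simp: mult_ac)
  also have "... = (ind {h\<^sup>2<..<2*h\<^sup>2} (snd z) * en (F z powr q)) * en (4 * h)"
   using h by (subst nn_integral_cmult_indicator) auto
  finally show "(NN x. f z x) = en (4 * h) * (ind {h\<^sup>2<..<2*h\<^sup>2} (snd z) * en (F z powr q))"
   by (simp add: mult_ac)
 qed
 also have "... = en (4 * h) * (NN z. ind {h\<^sup>2<..<2*h\<^sup>2} (snd z) * en (F z powr q))"
  by (rule nn_integral_cmult) measurable
 finally show "(NN x. Bint h x) = en (4 * h) * (NN z. ind {h\<^sup>2<..<2*h\<^sup>2} (snd z) * en (F z powr q))" .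
qed

lemma Gint_integral:
 shows "(%x. Gint h (a + x)) \<in> BM"
  and "(NN x. Gint h (a + x)) = (NN z. ind {0<..<2*h\<^sup>2} (snd z) * en (snd z * F z powr q))"
proof -
 have m [measurable]: "Gint h \<in> BM"
  unfolding Gint_def
 proof (rule lborel.borel_measurable_nn_integral)
  have "(%p. ind {0<..<2*h\<^sup>2} (snd p) * en (snd p * F p powr q)) \<in> borel_measurable (borel \<Otimes>\<^sub>M lborel)"
   by (subst measurable_cong_sets[OF sets_pair_measure_cong[OF refl sets_lborel] refl]) (simp add: borel_prod)
  then show "(%(x, s). ind {0<..<2*h\<^sup>2} s * en (s * F (x, s) powr q)) \<in> borel_measurable (borel \<Otimes>\<^sub>M lborel)"
   by (simp add: case_prod_beta')
 qed
 show "(%x. Gint h (a + x)) \<in> BM" by measurable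
 have "(NN z. ind {0<..<2*h\<^sup>2} (snd z) * en (snd z * F z powr q)) = (NN x. Gint h x)"
  unfolding Gint_def by (subst nn_integral_plane) auto
 also have "... = en (abs(1)) * (NN x. Gint h (a + 1 * x))" by (rule nn_integral_real_affine) auto
 finally show "(NN x. Gint h (a + x)) = (NN z. ind {0<..<2*h\<^sup>2} (snd z) * en (snd z * F z powr q))"
  by simp
qed

lemma interior_integral:
 assumes h0: "2 * h0\<^sup>2 <= T"
 shows "(NN h. ind {0<..<h0} h * (en (h powr (1 - 2 * q)) *
  (NN x. ind {h<..<1-h} x * en (D2 h x)))) < \<infinity>"
proof -
 define C where "C = 256 powr q * (1 + hardy_const)"
 have C0: "0 <= C" using hardy_const_pos by (simp add: C_def)
 define g where "g h z = ind {0<..<h0} h * (en (4 * h powr (-1)) * (ind {h\<^sup>2<..<2*h\<^sup>2} (snd z) * en (F z powr q))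
  + en (3 * h powr (-3)) * (ind {0<..<2*h\<^sup>2} (snd z) * en (snd z * F z powr q)))" for h and z :: "pt"
 have gm: "(%p. g (fst p) (snd p)) \<in> BM"
  unfolding g_def indicator_def of_bool_def greaterThanLessThan_iff by measurable
 have gmz [measurable]: "g h \<in> BM" for h
  unfolding g_def by measurable
 have inner: "en (h powr (1 - 2 * q)) * (NN x. ind {h<..<1-h} x * en (D2 h x)) <= en C * (NN z. g h z)"
  if h: "0 < h" "h < h0" for h
 proof -
  have hT: "2 * h\<^sup>2 < T"
  proof -
   have "h\<^sup>2 < h0\<^sup>2" using h by (intro power_strict_mono) auto
   thus ?thesis using h0 by linarith
  qed
  have "en (h powr (1 - 2 * q)) * (NN x. ind {h<..<1-h} x * en (D2 h x))
   = (NN x. ind {h<..<1-h} x * en (D2 h x * h powr (1 - 2 * q)))"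
   by (subst nn_integral_cmult[symmetric]) (auto intro!: nn_integral_cong simp: ennreal_mult D2_def indicator_def mult.commute)
  also have "... <= (NN x. en C * (en (h powr (-2)) * Bint h x + (en (h powr (-3)) * Gint h (h + x) + (en (h powr (-3)) * Gint h (- h + x) + en (h powr (-3)) * Gint h (0 + x)))))"
  proof (rule nn_integral_mono_AE)
   show "AE x in lborel. ind {h<..<1-h} x * en (D2 h x * h powr (1 - 2 * q)) <=
    en C * (en (h powr (-2)) * Bint h x + (en (h powr (-3)) * Gint h (h + x) + (en (h powr (-3)) * Gint h (- h + x) + en (h powr (-3)) * Gint h (0 + x))))"
    using AE_not_null_affine[OF N one_neq_zero, of h] AE_not_null_affine[OF N one_neq_zero, of "-h"] AE_not_null_affine[OF N one_neq_zero, of 0]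
   proof eventually_elim
    case (elim x)
    show ?case
    proof (cases "h < x \<and> x < 1 - h")
    case True
    thus ?thesis using interior_pointwise[OF h(1) hT, of x] elim by (simp add: C_def add.commute)
    qed simp
   qed
  qed
  also have "... = en C * (en (h powr (-2)) * (NN x. Bint h x) + (en (h powr (-3)) * (NN x. Gint h (h + x)) + (en (h powr (-3)) * (NN x. Gint h (- h + x)) + en (h powr (-3)) * (NN x. Gint h (0 + x)))))"
   using Bint_integral(1)[OF h(1)] Gint_integral(1)[of h h] Gint_integral(1)[of h "-h"] Gint_integral(1)[of h 0]
   by (simp add: nn_integral_cmult nn_integral_add)
  also have "... = en C * (NN z. g h z)"
  proof -
   let ?X = "NN z. ind {h\<^sup>2<..<2*h\<^sup>2} (snd z) * en (F z powr q)"
   let ?Y = "NN z. ind {0<..<2*h\<^sup>2} (snd z) * en (snd z * F z powr q)"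
   have g: "(NN z. g h z) = en (4 * h powr (-1)) * ?X + en (3 * h powr (-3)) * ?Y"
    using h unfolding g_def by (simp add: nn_integral_add nn_integral_cmult)
   have 1: "en (h powr (-2)) * (en (4 * h) * ?X) = en (4 * h powr (-1)) * ?X"
   proof -
    have "h powr (-2) * (4 * h) = 4 * (h powr (-2) * h powr 1)" using h by simp
    also have "... = 4 * h powr (-1)" unfolding powr_add[symmetric] by simp
    finally show ?thesis using h by (simp add: mult.assoc[symmetric] ennreal_mult[symmetric])
   qed
   have 2: "en (h powr (-3)) * ?Y + (en (h powr (-3)) * ?Y + en (h powr (-3)) * ?Y) = en (3 * h powr (-3)) * ?Y"
   proof -
    have "w + (w + w) = (1 + (1 + 1)) * w" for w :: ennreal by (simp only: distrib_right mult_1)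
    thus ?thesis by (simp add: ennreal_mult mult.assoc)
   qed
   show ?thesis unfolding Bint_integral(2)[OF h(1)] Gint_integral(2) g 1 2 ..
  qed
  finally show ?thesis .
 qed
 have "(NN h. ind {0<..<h0} h * (en (h powr (1 - 2 * q)) *
  (NN x. ind {h<..<1-h} x * en (D2 h x)))) <= (NN h. en C * (NN z. g h z))"
  using inner by (intro nn_integral_mono) (auto simp: indicator_def)
 also have "... = en C * (NN h. NN z. g h z)"
 proof (rule nn_integral_cmult)
  have "(%p. g (fst p) (snd p)) \<in> borel_measurable (borel \<Otimes>\<^sub>M lborel)"
   using gm by (subst measurable_cong_sets[OF sets_pair_measure_cong[OF refl sets_lborel] refl]) (simp add: borel_prod)
  hence "(%h. NN z. g h z) \<in> BM"
   by (intro lborel.borel_measurable_nn_integral) (simp add: case_prod_beta')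
  then show "(%h. NN z. g h z) \<in> borel_measurable lborel" by simp
 qed
 also have "(NN h. NN z. g h z) = (NN z. NN h. g h z)"
  by (rule nn_integral_swap[OF gm, symmetric])
 also have "en C * (NN z. NN h. g h z) <= en C * (NN z. 11 * en (F z powr q))"
 proof (intro mult_left_mono nn_integral_mono)
  fix z :: "pt"
  define s where "s = snd z"
  show "(NN h. g h z) <= 11 * en (F z powr q)"
  proof (cases "0 < s")
   case True
   let ?P = "en (F z powr q)"
   have "(NN h. g h z) <= (NN h. en (8 / sqrt s) * ?P * ind {0<..<sqrt s} h
    + en (3 * s) * ?P * (ind {sqrt (s/2)<..} h * en (h powr (-3))))"
   proof (rule nn_integral_mono)
    fix h
    show "g h z <= en (8 / sqrt s) * ?P * ind {0<..<sqrt s} h + en (3 * s) * ?P * (ind {sqrt (s/2)<..} h * en (h powr (-3)))"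
    proof (cases "0 < h \<and> h < h0")
    case h: True
    have 1: "en (4 * h powr (-1)) * (ind {h\<^sup>2<..<2*h\<^sup>2} s * ?P) <= en (8 / sqrt s) * ?P * ind {0<..<sqrt s} h"
    proof (cases "h\<^sup>2 < s \<and> s < 2 * h\<^sup>2")
    case c: True
    have "h = sqrt (h\<^sup>2)" using h by simp
    also have "... < sqrt s" using c by (intro real_sqrt_less_mono) auto
    finally have hs: "h < sqrt s" .
    have "s < (2 * h)\<^sup>2" using c zero_le_power2[of h] by (simp add: power_mult_distrib)
    hence "sqrt s < 2 * h" using h by (intro real_less_lsqrt) auto
    hence "4 * h powr (-1) <= 8 / sqrt s" using h True by (simp add: powr_minus field_simps)
    hence "en (4 * h powr (-1)) <= en (8 / sqrt s)" by (rule ennreal_leI)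
    thus ?thesis using c hs h by (simp add: mult_right_mono)
    qed auto
    have 2: "en (3 * h powr (-3)) * (ind {0<..<2*h\<^sup>2} s * en (s * F z powr q)) <= en (3 * s) * ?P * (ind {sqrt (s/2)<..} h * en (h powr (-3)))"
    proof (cases "s < 2 * h\<^sup>2")
    case c: True
    hence "sqrt (s / 2) < h" using h by (intro real_less_lsqrt) auto
    moreover have "en (3 * h powr (-3)) * en (s * F z powr q) = en (3 * s) * ?P * en (h powr (-3))"
    using True by (simp add: ennreal_mult[symmetric] mult_ac)
    ultimately show ?thesis using c True by simp
    qed auto
    show ?thesis using h add_mono[OF 1 2] by (simp add: g_def s_def)
    qed (simp add: g_def)
   qed
   also have "... = en (8 / sqrt s) * ?P * en (sqrt s) + en (3 * s) * ?P * (NN h. ind {sqrt (s/2)<..} h * en (h powr (-3)))"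
    using True by (subst nn_integral_add, simp, simp, subst nn_integral_cmult_indicator, simp, subst nn_integral_cmult) auto
   also have "... <= en (8 / sqrt s) * ?P * en (sqrt s) + en (3 * s) * ?P * en (sqrt (s/2) powr (1 - 3) / (3 - 1))"
    using True by (intro add_left_mono mult_left_mono nn_integral_powr_tail) auto
   also have "... = 11 * ?P"
   proof -
    have n: "8 * ?P = en (8 * F z powr q)" "3 * ?P = en (3 * F z powr q)" by (simp_all add: ennreal_mult)
    have a: "en (8 / sqrt s) * ?P * en (sqrt s) = 8 * ?P"
    unfolding n using True by (simp add: ennreal_mult[symmetric])
    have "sqrt (s/2) powr (1 - 3) / (3 - 1) = 1 / s"
    proof -
    have "sqrt (s/2) powr (1 - 3) = 1 / sqrt (s/2) powr 2" by (simp add: powr_minus_divide)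
    also have "sqrt (s/2) powr 2 = s / 2" using True by (simp add: real_sqrt_divide power_divide)
    finally show ?thesis using True by simp
    qed
    hence b: "en (3 * s) * ?P * en (sqrt (s/2) powr (1 - 3) / (3 - 1)) = 3 * ?P"
    unfolding n using True by (simp add: ennreal_mult[symmetric])
    have "8 * ?P + 3 * ?P = (8 + 3) * ?P" by (simp only: distrib_right)
    thus ?thesis unfolding a b by simp
   qed
   finally show ?thesis .
  next
   case False
   have "(NN h. g h z) = (\<integral>\<^sup>+h. 0 \<partial>(lborel :: real measure))"
   proof (rule nn_integral_cong)
    fix h :: real
    have "\<not> h\<^sup>2 < s" using False zero_le_power2[of h] by linarith
    then show "g h z = 0" using False by (auto simp: g_def s_def indicator_def)
   qed
   thus ?thesis by simp
  qed
 qed simp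
 also have "... = en C * (11 * en Fnorm)"
  by (subst nn_integral_cmult) (auto simp: Fnorm(1))
 also have "... < \<infinity>" by (auto simp: ennreal_mult_less_top)
 finally show ?thesis .
qed

text \<open>Away from the ends the second difference is averaged in the time variable over (h^2, 2 h^2); in the collar of
width h the reflection turns it into first differences at the end point, where the Hardy inequality applies.\<close>
lemma besov:
 assumes d0: "(\<phi> has_real_derivative 0) (at 0 within {0..1})" and d1: "(\<phi> has_real_derivative 0) (at 1 within {0..1})"
 shows "(NN h. ind {0<..} h * (en (h powr (1 - 2 * q)) *
  (NN x. ind {0<..<1} x * en (D2 h x)))) < \<infinity>"
proof -
 interpret m: trace_control "%x. \<phi> (1 - x)" q T "%z. F (1 - fst z, snd z)" "(%x. 1 - x) ` N" by (rule mirror)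
 have md0: "((%x. \<phi> (1 - x)) has_real_derivative 0) (at 0 within {0..1})"
 proof -
  have "((%x. 1 - x) has_real_derivative -1) (at 0 within {0..1})" by (auto intro!: derivative_eq_intros)
  moreover have "(\<phi> has_real_derivative 0) (at (1 - 0) within (%x. 1 - x) ` {0..1})"
  proof -
   have "(%x::real. 1 - x) ` {0..1} = {0..1}" by (auto simp: image_iff intro!: bexI[of _ "1 - _"])
   thus ?thesis using d1 by simp
  qed
  ultimately show ?thesis using DERIV_image_chain[of \<phi> 0 "%x. 1 - x" 0 "{0..1}" "-1"] by (simp add: o_def)
 qed
 have mD2: "m.D2 h x = D2 h (1 - x)" for h x
 proof -
  have "m.\<psi> y = \<psi> (1 - y)" for y by (simp add: m.\<psi>_def \<psi>_def fold01_one_minus)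
  thus ?thesis by (simp add: m.D2_def D2_def add.commute algebra_simps)
 qed
 define h0 where "h0 = min (1/2) (sqrt T / 2)"
 have h0: "0 < h0" "2 * h0 <= 1" "(2 * h0)\<^sup>2 <= T"
 proof -
  show "0 < h0" "2 * h0 <= 1" using T by (auto simp: h0_def)
  have "(2 * h0)\<^sup>2 <= (sqrt T)\<^sup>2" using \<open>0 < h0\<close> by (intro power_mono) (auto simp: h0_def)
  then show "(2 * h0)\<^sup>2 <= T" using T by simp
 qed
 hence "4 * h0\<^sup>2 <= T" by (simp add: power_mult_distrib)
 hence h02: "2 * h0\<^sup>2 <= T" using zero_le_power2[of h0] by linarith
 obtain B where B: "!!y. abs(\<phi>c y) <= B" by (rule \<phi>c_bounded) (rule that)
 have D2B: "D2 h x <= (4 * B) powr q" for h x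
  using B[of "fold01 (x + h)"] B[of "fold01 (x - h)"] B[of "fold01 x"] q unfolding D2_def \<psi>_eq by (intro powr_mono2) auto
 let ?w = "%h. en (h powr (1 - 2 * q))"
 let ?I = "%h. NN x. ind {h<..<1-h} x * en (D2 h x)"
 let ?L = "%h. NN x. ind {0<..<h} x * en (D2 h x)"
 let ?R = "%h. NN x. ind {0<..<h} x * en (m.D2 h x)"
 have meas: "(%h. NN x. ind {a h<..<b h} x * en (d h x)) \<in> BM"
  if [measurable]: "a \<in> BM" "b \<in> BM" "(%p. d (fst p) (snd p)) \<in> BM"
  for a b :: "real => real" and d :: "real => real => real"
 proof -
  have "(%p. ind {a (fst p)<..<b (fst p)} (snd p) * en (d (fst p) (snd p))) \<in> borel_measurable (borel \<Otimes>\<^sub>M lborel)"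
   unfolding indicator_def of_bool_def greaterThanLessThan_iff
   by (subst measurable_cong_sets[OF sets_pair_measure_cong[OF refl sets_lborel] refl]) (unfold borel_prod, measurable)
  thus ?thesis by (intro lborel.borel_measurable_nn_integral) (simp add: case_prod_beta')
 qed
 have [measurable]: "?I \<in> BM" "?L \<in> BM" "?R \<in> BM"
  by (intro meas D2_measurable m.D2_measurable; simp)+
 have "(NN h. ind {0<..} h * (?w h * (NN x. ind {0<..<1} x * en (D2 h x))))
  <= (NN h. ind {0<..<h0} h * (?w h * ?I h) + (ind {0<..<h0} h * (?w h * ?L h) + (ind {0<..<h0} h * (?w h * ?R h)
   + en ((4 * B) powr q) * (ind {h0/2<..} h * en (h powr (- (2 * q - 1)))))))"
 proof (rule nn_integral_mono)
  fix h
  consider "h <= 0" | "0 < h" "h < h0" | "h0 <= h" by linarith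
  then show "ind {0<..} h * (?w h * (NN x. ind {0<..<1} x * en (D2 h x)))
  <= ind {0<..<h0} h * (?w h * ?I h) + (ind {0<..<h0} h * (?w h * ?L h) + (ind {0<..<h0} h * (?w h * ?R h)
   + en ((4 * B) powr q) * (ind {h0/2<..} h * en (h powr (- (2 * q - 1))))))"
  proof cases
   case 2
   have Req: "(NN x. ind {1-h<..<1} x * en (D2 h x)) = ?R h"
   proof -
    have "(NN x. ind {1-h<..<1} x * en (D2 h x)) = en (abs(-1)) * (NN x. ind {1-h<..<1} (1 + (-1) * x) * en (D2 h (1 + (-1) * x)))"
    by (rule nn_integral_real_affine) auto
    also have "... = ?R h" by (auto intro!: nn_integral_cong simp: mD2 indicator_def)
    finally show ?thesis .
   qed
   have "(NN x. ind {0<..<1} x * en (D2 h x)) <=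
    (NN x. ind {h<..<1-h} x * en (D2 h x) + (ind {0<..<h} x * en (D2 h x) + ind {1-h<..<1} x * en (D2 h x)))"
   proof (rule nn_integral_mono_AE)
    show "AE x in lborel. ind {0<..<1} x * en (D2 h x) <= ind {h<..<1-h} x * en (D2 h x) + (ind {0<..<h} x * en (D2 h x) + ind {1-h<..<1} x * en (D2 h x))"
    using AE_lborel_singleton[of h] AE_lborel_singleton[of "1 - h"]
    by eventually_elim (auto simp: indicator_def)
   qed
   also have "... = ?I h + (?L h + ?R h)"
    unfolding Req[symmetric] by (simp add: nn_integral_add)
   finally have "?w h * (NN x. ind {0<..<1} x * en (D2 h x)) <= ?w h * (?I h + (?L h + ?R h))"
    by (rule mult_left_mono) simp
   thus ?thesis using 2 by (simp add: distrib_left add.assoc[symmetric] add_increasing2)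
  next
   case 3
   have "(NN x. ind {0<..<1} x * en (D2 h x)) <= (NN x. en ((4 * B) powr q) * ind {0<..<1::real} x)"
    using D2B by (intro nn_integral_mono) (auto simp: indicator_def intro: ennreal_leI)
   also have "... = en ((4 * B) powr q)" by (subst nn_integral_cmult_indicator) auto
   finally have "?w h * (NN x. ind {0<..<1} x * en (D2 h x)) <= ?w h * en ((4 * B) powr q)"
    by (rule mult_left_mono) simp
   thus ?thesis using 3 h0 by (simp add: mult.commute)
  qed simp
 qed
 also have "... = (NN h. ind {0<..<h0} h * (?w h * ?I h)) + ((NN h. ind {0<..<h0} h * (?w h * ?L h)) + ((NN h. ind {0<..<h0} h * (?w h * ?R h))
   + en ((4 * B) powr q) * (NN h. ind {h0/2<..} h * en (h powr (- (2 * q - 1))))))"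
  by (simp add: nn_integral_add nn_integral_cmult)
 also have "... < \<infinity>"
 proof -
  have "(NN h. ind {h0/2<..} h * en (h powr (- (2 * q - 1)))) < \<infinity>"
   by (rule le_less_trans[OF nn_integral_powr_tail]) (use h0 q in auto)
  thus ?thesis
   using interior_integral[OF h02] collar_integral[OF h0(2,3) d0] m.collar_integral[OF h0(2,3) md0]
   by (auto simp: ennreal_mult_less_top)
 qed
 finally show ?thesis .
qed

end

section \<open>Gaussian averages\<close>

abbreviation gauss :: "real => real" where "gauss \<equiv> std_normal_density"

definition gauss1 :: "real => real" where "gauss1 z = z * gauss z"
definition gauss2 :: "real => real" where "gauss2 z = (z\<^sup>2 - 1) * gauss z"

definition conv :: "(real => real) => real => (real => real) => real => real" where
 "conv k sg g x = (LBINT z. k z * g (x + sg * z))"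

definition heat :: "real => (real => real) => real => real" where
 "heat t g x = conv gauss (sqrt (2 * t)) g x"
definition heat_x :: "real => (real => real) => real => real" where
 "heat_x t g x = conv gauss1 (sqrt (2 * t)) g x / sqrt (2 * t)"
definition heat_xx :: "real => (real => real) => real => real" where
 "heat_xx t g x = conv gauss2 (sqrt (2 * t)) g x / (2 * t)"

lemma gauss_integrable: "Lint gauss" "(LBINT z. gauss z) = 1"
 using integrable_normal_density[of 1 0] integral_normal_density[of 1 0] by auto

lemma gauss_pos: "0 < gauss z" by (simp add: std_normal_density_def)

lemma gauss_abs [simp]: "abs(gauss z) = gauss z" using gauss_pos[of z] by simp

lemma gauss_even: "gauss (- z) = gauss z" by (simp add: std_normal_density_def)

lemma gauss_moments:
 "Lint (%z. gauss z * z ^ k)" "Lint (%z. gauss z * abs(z) ^ k)"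
 by (rule integrable_std_normal_moment integrable_std_normal_moment_abs)+

lemma gauss_second_moment: "(LBINT z. gauss z * z\<^sup>2) = 1"
 using integral_std_normal_moment_even[of 1] by simp

lemma gauss1_integrable: "Lint gauss1" "(LBINT z. gauss1 z) = 0"
 using gauss_moments(1)[of 1] integral_std_normal_moment_odd[of 0] by (simp_all add: gauss1_def[abs_def] mult.commute)

lemma gauss2_integrable: "Lint gauss2" "(LBINT z. gauss2 z) = 0"
proof -
 have e: "gauss2 = (%z. gauss z * z\<^sup>2 - gauss z)" by (auto simp: gauss2_def algebra_simps)
 show "Lint gauss2" "(LBINT z. gauss2 z) = 0"
  unfolding e using gauss_moments(1)[of 2] gauss_integrable gauss_second_moment by auto
qed

lemma gauss_kernels_measurable [measurable]: "gauss1 \<in> BM" "gauss2 \<in> BM"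
 unfolding gauss1_def[abs_def] gauss2_def[abs_def] by measurable

lemma gauss_abs_moment: "(LBINT z. gauss z * abs(z)) <= 1"
proof -
 have "(LBINT z. gauss z * abs(z)) <= (LBINT z. (gauss z + gauss z * z\<^sup>2) / 2)"
 proof (rule integral_mono)
  show "Lint (%z. gauss z * abs(z))" using gauss_moments(2)[of 1] by simp
  show "Lint (%z. (gauss z + gauss z * z\<^sup>2) / 2)"
   using gauss_integrable(1) gauss_moments(1)[of 2] by auto
  fix z :: real
  have "0 <= (abs(z) - 1)\<^sup>2" by simp
  hence "2 * abs(z) <= 1 + z\<^sup>2" by (simp add: power2_eq_square algebra_simps)
  hence "gauss z * (2 * abs(z)) <= gauss z * (1 + z\<^sup>2)" by (intro mult_left_mono) (auto intro: less_imp_le[OF gauss_pos])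
  then show "gauss z * abs(z) <= (gauss z + gauss z * z\<^sup>2) / 2" by (simp add: algebra_simps)
 qed
 also have "... = 1" using gauss_integrable gauss_moments(1)[of 2] gauss_second_moment by simp
 finally show ?thesis .
qed

lemma gauss_DERIV: "(gauss has_real_derivative - gauss1 z) (at z)"
proof -
 have e: "gauss = (%z. 1 / sqrt (2 * pi) * exp (- z\<^sup>2 / 2))" by (auto simp: std_normal_density_def)
 have "((%z. exp (- z\<^sup>2 / 2)) has_real_derivative - z * exp (- z\<^sup>2 / 2)) (at z)"
  by (auto intro!: derivative_eq_intros)
 from DERIV_cmult[OF this, of "1 / sqrt (2 * pi)"] show ?thesis
  unfolding gauss1_def e by (simp add: mult_ac)
qed

lemma gauss1_DERIV: "(gauss1 has_real_derivative - gauss2 z) (at z)"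
 unfolding gauss1_def[abs_def] gauss2_def
 by (auto intro!: derivative_eq_intros gauss_DERIV simp: gauss1_def power2_eq_square algebra_simps)

lemma gauss2_even: "gauss2 (- z) = gauss2 z" by (simp add: gauss2_def gauss_even)

lemma conv_integrable:
 fixes k g :: "real => real"
 assumes "Lint k" "g \<in> BM" "!!y. abs(g y) <= B"
 shows "Lint (%z. k z * g (a + c * z))"
proof (rule ibound[where f = "%z. B * k z"])
 have [measurable]: "g \<in> BM" "k \<in> BM" using assms by auto
 have "0 <= B" using assms(3)[of 0] by simp
 then show "AE z in lborel. norm (k z * g (a + c * z)) <= norm (B * k z)"
  using assms(3) by (auto simp: abs_mult mult.commute[of B] intro!: mult_left_mono)
 show "(%z. k z * g (a + c * z)) \<in> borel_measurable lborel" by measurable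
qed (use assms in auto)

lemma conv_bound:
 assumes "Lint k" "g \<in> BM" "!!y. abs(g y) <= B"
 shows "abs(conv k sg g x) <= B * (LBINT z. abs(k z))"
proof -
 have B: "0 <= B" using assms(3)[of 0] by simp
 have "abs(conv k sg g x) <= (LBINT z. B * abs(k z))"
  unfolding conv_def
  using assms B by (intro integral_abs_bound_integral conv_integrable) (auto simp: abs_mult mult.commute[of B] intro!: mult_left_mono)
 thus ?thesis by simp
qed

lemma heat_bound:
 assumes "g \<in> BM" "!!y. abs(g y) <= B"
 shows "abs(heat t g x) <= B"
 using conv_bound[OF gauss_integrable(1) assms] gauss_integrable(2) by (simp add: heat_def)

subsection \<open>Variation of the Gaussian\<close>

definition envelope :: "real => real" where "envelope z = exp (- z\<^sup>2 / 16)"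
definition env_mass :: real where "env_mass = (LBINT z. envelope z)"

lemma envelope_integrable: "Lint envelope"
proof -
 have "Lint (%z. sqrt (2 * pi * (sqrt 8)\<^sup>2) * normal_density 0 (sqrt 8) z)" by (intro integrable_mult_right integrable_normal_density) simp
 also have "(%z. sqrt (2 * pi * (sqrt 8)\<^sup>2) * normal_density 0 (sqrt 8) z) = envelope"
  by (auto simp: fun_eq_iff envelope_def normal_density_def)
 finally show ?thesis .
qed

lemma env_mass: "0 <= env_mass" unfolding env_mass_def envelope_def by (intro inonneg) simp

lemma gauss_scale: "gauss u <= exp (- u\<^sup>2 / 2)"
proof -
 have "1 <= sqrt (2 * pi)" using pi_gt3 by (simp add: real_le_rsqrt)
 hence "1 / sqrt (2 * pi) <= 1" by (simp add: divide_le_eq)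
 hence "1 / sqrt (2 * pi) * exp (- u\<^sup>2 / 2) <= 1 * exp (- u\<^sup>2 / 2)" by (intro mult_right_mono) auto
 thus ?thesis by (simp add: std_normal_density_def)
qed

lemma gauss12_le: "abs(gauss1 u) <= 4 * exp (- u\<^sup>2 / 4)" "abs(gauss2 u) <= 4 * exp (- u\<^sup>2 / 4)"
proof -
 have e: "exp (- u\<^sup>2 / 2) = exp (- u\<^sup>2 / 4) * exp (- u\<^sup>2 / 4)" by (simp add: exp_add[symmetric])
 have "1 + u\<^sup>2 / 4 <= exp (u\<^sup>2 / 4)" by (rule exp_ge_add_one_self)
 hence "(1 + u\<^sup>2 / 4) * exp (- u\<^sup>2 / 4) <= exp (u\<^sup>2 / 4) * exp (- u\<^sup>2 / 4)" by (intro mult_right_mono) auto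
 also have "... = 1" by (simp add: exp_add[symmetric])
 finally have b1: "(1 + u\<^sup>2 / 4) * exp (- u\<^sup>2 / 4) <= 1" .
 have "(1 + u\<^sup>2) * exp (- u\<^sup>2 / 4) <= (4 * (1 + u\<^sup>2 / 4)) * exp (- u\<^sup>2 / 4)" by (intro mult_right_mono) auto
 also have "... = 4 * ((1 + u\<^sup>2 / 4) * exp (- u\<^sup>2 / 4))" by (simp only: mult.assoc)
 also have "... <= 4 * 1" by (intro mult_left_mono b1) simp
 finally have b: "(1 + u\<^sup>2) * exp (- u\<^sup>2 / 4) <= 4" by simp
 have *: "abs(w) * gauss u <= 4 * exp (- u\<^sup>2 / 4)" if "abs(w) <= 1 + u\<^sup>2" for w
 proof -
  have "abs(w) * gauss u <= (1 + u\<^sup>2) * exp (- u\<^sup>2 / 2)"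
   using that gauss_scale[of u] gauss_pos[of u] by (intro mult_mono) auto
  also have "... = ((1 + u\<^sup>2) * exp (- u\<^sup>2 / 4)) * exp (- u\<^sup>2 / 4)" by (simp only: e mult.assoc)
  also have "... <= 4 * exp (- u\<^sup>2 / 4)" by (intro mult_right_mono b) simp
  finally show ?thesis .
 qed
 have "0 <= (abs(u) - 1)\<^sup>2" by simp
 hence "abs(u) <= 1 + u\<^sup>2" by (simp add: power2_eq_square algebra_simps)
 from *[OF this] show "abs(gauss1 u) <= 4 * exp (- u\<^sup>2 / 4)" by (simp add: gauss1_def abs_mult)
 have "abs(u\<^sup>2 - 1) <= 1 + u\<^sup>2" using zero_le_power2[of u] by (simp add: abs_le_iff)
 from *[OF this] show "abs(gauss2 u) <= 4 * exp (- u\<^sup>2 / 4)" by (simp add: gauss2_def abs_mult)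
qed

lemma exp_shift_le:
 assumes "abs(th) <= 1" shows "4 * exp (- (z + th)\<^sup>2 / 4) <= 8 * envelope z"
proof -
 have "th\<^sup>2 <= 1" using assms by (simp add: abs_square_le_1)
 moreover have "0 <= (z + 2 * th)\<^sup>2" by simp
 hence "z\<^sup>2 / 2 - th\<^sup>2 <= (z + th)\<^sup>2" by (simp add: power2_eq_square algebra_simps)
 ultimately have "- (z + th)\<^sup>2 / 4 <= 1/4 + (- z\<^sup>2 / 16)" using zero_le_power2[of z] by linarith
 hence "exp (- (z + th)\<^sup>2 / 4) <= exp (1/4) * exp (- z\<^sup>2 / 16)" by (simp add: exp_add[symmetric])
 also have "... <= 2 * exp (- z\<^sup>2 / 16)"
 proof (intro mult_right_mono)
  have "exp (1/4::real) <= 1 + 1/4 + (1/4)\<^sup>2" by (rule exp_bound) auto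
  then show "exp (1/4::real) <= 2" by (simp add: power2_eq_square)
 qed simp
 finally show ?thesis by (simp add: envelope_def)
qed

lemma gauss_shift_integrable: "Lint (%z. gauss (z + e))" "(LBINT z. gauss (z + e)) = 1"
 using lborel_integrable_real_affine[OF gauss_integrable(1), of 1 e] lborel_integral_real_affine[of 1 gauss e] gauss_integrable(2)
 by (simp_all add: add.commute)

text \<open>Total variation bounds for translates and dilates of the Gaussian transfer the smoothing of the heat kernel to
sources that are merely bounded.\<close>
lemma gauss_translation:
 "Lint (%z. abs(gauss (z + e) - gauss z))" "(LBINT z. abs(gauss (z + e) - gauss z)) <= (8 * env_mass + 2) * abs(e)"
proof -
 show i: "Lint (%z. abs(gauss (z + e) - gauss z))"
  using gauss_shift_integrable gauss_integrable by auto
 show "(LBINT z. abs(gauss (z + e) - gauss z)) <= (8 * env_mass + 2) * abs(e)"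
 proof (cases "abs(e) <= 1")
  case True
  have "abs(gauss (z + e) - gauss z) <= abs(e) * (8 * envelope z)" for z
  proof (cases "e = 0")
   case False
   have "\<exists>xi. abs(xi) <= abs(e) \<and> gauss (z + e) - gauss z = e * (- gauss1 (z + xi))"
   proof (cases "0 < e")
    case True
    obtain w where "z < w" "w < z + e" "gauss (z + e) - gauss z = (z + e - z) * (- gauss1 w)"
    using MVT2[of z "z + e" gauss "%z. - gauss1 z"] True gauss_DERIV by auto
    thus ?thesis by (intro exI[of _ "w - z"]) auto
   next
    case neg: False
    then obtain w where "z + e < w" "w < z" "gauss z - gauss (z + e) = (z - (z + e)) * (- gauss1 w)"
    using MVT2[of "z + e" z gauss "%z. - gauss1 z"] False gauss_DERIV by auto
    thus ?thesis using neg by (intro exI[of _ "w - z"]) (auto simp: algebra_simps)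
   qed
   then obtain xi where xi: "abs(xi) <= abs(e)" "gauss (z + e) - gauss z = e * (- gauss1 (z + xi))" by blast
   have "abs(gauss1 (z + xi)) <= 8 * envelope z"
    using gauss12_le(1)[of "z + xi"] exp_shift_le[of xi z] xi True by linarith
   thus ?thesis unfolding xi(2) by (simp add: abs_mult mult_left_mono)
  qed simp
  hence "(LBINT z. abs(gauss (z + e) - gauss z)) <= (LBINT z. abs(e) * (8 * envelope z))"
   using i envelope_integrable by (intro integral_mono) auto
  also have "... = 8 * env_mass * abs(e)" by (simp add: env_mass_def)
  finally show ?thesis by (simp add: distrib_right)
 next
  case False
  have "(LBINT z. abs(gauss (z + e) - gauss z)) <= (LBINT z. gauss (z + e) + gauss z)"
   using i gauss_shift_integrable gauss_integrable gauss_pos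
   by (intro integral_mono) (auto simp: abs_le_iff intro: less_imp_le add_nonneg_nonneg)
  also have "... = 2" using gauss_shift_integrable gauss_integrable by simp
  also have "... <= 2 * abs(e)" using False by simp
  also have "... <= (8 * env_mass + 2) * abs(e)" using env_mass by (intro mult_right_mono) auto
  finally show ?thesis .
 qed
qed

lemma gauss_second_difference:
 "Lint (%z. abs(gauss (z + e) + gauss (z - e) - 2 * gauss z))"
 "0 <= e ==> (LBINT z. abs(gauss (z + e) + gauss (z - e) - 2 * gauss z)) <= (8 * env_mass + 4) * e\<^sup>2"
proof -
 show i: "Lint (%z. abs(gauss (z + e) + gauss (z - e) - 2 * gauss z))"
  using gauss_shift_integrable[of e] gauss_shift_integrable[of "-e"] gauss_integrable by auto
 assume e0: "0 <= e"
 show "(LBINT z. abs(gauss (z + e) + gauss (z - e) - 2 * gauss z)) <= (8 * env_mass + 4) * e\<^sup>2"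
 proof (cases "e <= 1")
  case True
  have "abs(gauss (z + e) + gauss (z - e) - 2 * gauss z) <= e\<^sup>2 * (8 * envelope z)" for z
  proof (cases "e = 0")
   case False
   hence ep: "0 < e" using e0 by simp
   have d: "((%w. gauss (w + e) - gauss w) has_real_derivative - gauss1 (w + e) - - gauss1 w) (at w)" for w
    by (auto intro!: derivative_eq_intros DERIV_chain2[of gauss, OF gauss_DERIV] gauss_DERIV)
   obtain w where w: "z - e < w" "w < z" "(gauss (z + e) - gauss z) - (gauss (z - e + e) - gauss (z - e)) = (z - (z - e)) * (- gauss1 (w + e) - - gauss1 w)"
    using MVT2[of "z - e" z "%w. gauss (w + e) - gauss w" "%w. - gauss1 (w + e) - - gauss1 w"] ep d by auto
   obtain v where v: "w < v" "v < w + e" "gauss1 (w + e) - gauss1 w = (w + e - w) * (- gauss2 v)"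
    using MVT2[of w "w + e" gauss1 "%z. - gauss2 z"] ep gauss1_DERIV by auto
   have eq: "gauss (z + e) + gauss (z - e) - 2 * gauss z = e\<^sup>2 * gauss2 v"
   proof -
    have 1: "gauss1 w - gauss1 (w + e) = e * gauss2 v" using v(3) by (simp add: algebra_simps)
    have "gauss (z + e) + gauss (z - e) - 2 * gauss z = e * (gauss1 w - gauss1 (w + e))" using w(3) by simp
    thus ?thesis unfolding 1 by (simp add: power2_eq_square)
   qed
   have "abs(gauss2 (z + (v - z))) <= 8 * envelope z"
    using gauss12_le(2)[of "z + (v - z)"] exp_shift_le[of "v - z" z] w v True by linarith
   thus ?thesis unfolding eq by (simp add: abs_mult mult_left_mono)
  qed simp
  hence "(LBINT z. abs(gauss (z + e) + gauss (z - e) - 2 * gauss z)) <= (LBINT z. e\<^sup>2 * (8 * envelope z))"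
   using i envelope_integrable by (intro integral_mono) auto
  also have "... = 8 * env_mass * e\<^sup>2" by (simp add: env_mass_def)
  finally show ?thesis by (simp add: distrib_right) (smt (verit) zero_le_power2)
 next
  case False
  have "(LBINT z. abs(gauss (z + e) + gauss (z - e) - 2 * gauss z)) <= (LBINT z. gauss (z + e) + gauss (z + (- e)) + 2 * gauss z)"
  proof (rule integral_mono[OF i])
   show "Lint (%z. gauss (z + e) + gauss (z + (- e)) + 2 * gauss z)"
    using gauss_shift_integrable(1)[of e] gauss_shift_integrable(1)[of "-e"] gauss_integrable(1) by auto
   fix z show "abs(gauss (z + e) + gauss (z - e) - 2 * gauss z) <= gauss (z + e) + gauss (z + (- e)) + 2 * gauss z"
    using gauss_pos[of z] gauss_pos[of "z + e"] gauss_pos[of "z - e"] by (simp add: abs_le_iff)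
  qed
  also have "... = 4" using gauss_shift_integrable[of e] gauss_shift_integrable[of "-e"] gauss_integrable by simp
  also have "... <= 4 * e\<^sup>2" using False by (simp add: one_le_power)
  also have "... <= (8 * env_mass + 4) * e\<^sup>2" using env_mass by (intro mult_right_mono) auto
  finally show ?thesis .
 qed
qed

lemma gauss_dilation:
 assumes l: "0 < l" "l <= 1"
 shows "Lint (%z. abs(gauss z - l * gauss (l * z)))" "(LBINT z. abs(gauss z - l * gauss (l * z))) <= (4 * env_mass + 4) * (1 - l)"
proof -
 have gl: "Lint (%z. l * gauss (l * z))" "(LBINT z. l * gauss (l * z)) = 1"
  using lborel_integrable_real_affine[OF gauss_integrable(1), of l 0] lborel_integral_real_affine[of l gauss 0] gauss_integrable(2) l
  by simp_all
 show i: "Lint (%z. abs(gauss z - l * gauss (l * z)))"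
  using gauss_integrable gl by auto
 show "(LBINT z. abs(gauss z - l * gauss (l * z))) <= (4 * env_mass + 4) * (1 - l)"
 proof (cases "1 / 2 <= l")
  case True
  have "abs(gauss z - l * gauss (l * z)) <= (1 - l) * (4 * envelope z)" for z
  proof (cases "l = 1")
   case False
   have d: "((%m. m * gauss (m * z)) has_real_derivative - gauss2 (m * z)) (at m)" for m
    by (auto intro!: derivative_eq_intros DERIV_chain2[of gauss, OF gauss_DERIV] simp: gauss1_def gauss2_def power2_eq_square algebra_simps)
   obtain m where m: "l < m" "m < 1" "1 * gauss (1 * z) - l * gauss (l * z) = (1 - l) * (- gauss2 (m * z))"
    using MVT2[of l 1 "%m. m * gauss (m * z)" "%m. - gauss2 (m * z)"] d False l by auto
   have "1/4 <= m\<^sup>2" using m True power_mono[of "1/2" m 2] by (simp add: power2_eq_square)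
   hence "1/4 * z\<^sup>2 <= m\<^sup>2 * z\<^sup>2" by (intro mult_right_mono) auto
   hence "exp (- (m * z)\<^sup>2 / 4) <= envelope z" by (simp add: envelope_def power_mult_distrib)
   hence "abs(gauss2 (m * z)) <= 4 * envelope z" using gauss12_le(2)[of "m * z"] by linarith
   hence "(1 - l) * abs(gauss2 (m * z)) <= (1 - l) * (4 * envelope z)" using l by (intro mult_left_mono) auto
   thus ?thesis using m(3) l by (simp add: abs_mult)
  qed simp
  hence "(LBINT z. abs(gauss z - l * gauss (l * z))) <= (LBINT z. (1 - l) * (4 * envelope z))"
   using i envelope_integrable by (intro integral_mono) auto
  also have "... = 4 * env_mass * (1 - l)" by (simp add: env_mass_def)
  finally show ?thesis using l by (simp add: distrib_right)
 next
  case False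
  have "(LBINT z. abs(gauss z - l * gauss (l * z))) <= (LBINT z. gauss z + l * gauss (l * z))"
   using i gl gauss_integrable gauss_pos l
   by (intro integral_mono) (auto simp: abs_le_iff intro: less_imp_le add_nonneg_nonneg)
  also have "... = 2" using gl gauss_integrable by simp
  also have "... <= 4 * (1 - l)" using False by simp
  also have "... <= (4 * env_mass + 4) * (1 - l)" using env_mass l by (intro mult_right_mono) auto
  finally show ?thesis .
 qed
qed

definition var_const :: real where "var_const = 8 * env_mass + 4"

lemma var_const: "4 <= var_const" using env_mass by (simp add: var_const_def)

context
 fixes g :: "real => real" assumes g [measurable]: "g \<in> BM" and gb: "!!y. abs(g y) <= 1"
begin

lemma weighted_bound: "Lint (%z. abs(k z)) ==> k \<in> BM ==> abs(LBINT z. k z * g (a + c * z)) <= (LBINT z. abs(k z))"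
 using conv_bound[of k g 1 c a] gb integrable_abs_iff[of k lborel] by (simp add: conv_def)

lemma heat_shift:
 assumes "0 < t" shows "heat t g (x + sqrt (2 * t) * e) = (LBINT z. gauss (z - e) * g (x + sqrt (2 * t) * z))"
proof -
 have "(LBINT z. gauss (z - e) * g (x + sqrt (2 * t) * z)) = abs(1) *\<^sub>R (LBINT z. gauss ((e + 1 * z) - e) * g (x + sqrt (2 * t) * (e + 1 * z)))"
  by (rule lborel_integral_real_affine) simp
 thus ?thesis by (simp add: heat_def conv_def algebra_simps)
qed

lemma heat_lipschitz:
 assumes t: "0 < t" shows "abs(heat t g y - heat t g x) <= var_const * abs(y - x) / sqrt (2 * t)"
proof -
 define e where "e = (y - x) / sqrt (2 * t)"
 have s: "0 < sqrt (2 * t)" using t by simp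
 have y: "y = x + sqrt (2 * t) * e" using s by (simp add: e_def)
 have eq: "heat t g y - heat t g x = (LBINT z. (gauss (z + (- e)) - gauss z) * g (x + sqrt (2 * t) * z))"
  unfolding y heat_shift[OF t] left_diff_distrib
  using conv_integrable[OF gauss_shift_integrable(1)[of "-e"] g gb] conv_integrable[OF gauss_integrable(1) g gb]
  by (simp add: heat_def conv_def)
 have "abs(heat t g y - heat t g x) <= (LBINT z. abs(gauss (z + (- e)) - gauss z))"
  unfolding eq by (rule weighted_bound) (use gauss_translation(1)[of "-e"] in auto)
 hence "abs(heat t g y - heat t g x) <= (8 * env_mass + 2) * abs(e)" using gauss_translation(2)[of "-e"] by simp
 also have "... <= var_const * abs(e)" by (intro mult_right_mono) (auto simp: var_const_def)
 finally show ?thesis using s by (simp add: e_def abs_divide)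
qed

lemma heat_second_difference:
 assumes t: "0 < t" and d: "0 <= d" shows "abs(heat t g (x + d) + heat t g (x - d) - 2 * heat t g x) <= var_const * d\<^sup>2 / (2 * t)"
proof -
 define e where "e = d / sqrt (2 * t)"
 have s: "0 < sqrt (2 * t)" using t by simp
 have e: "0 <= e" using s d by (simp add: e_def)
 have xd: "x + d = x + sqrt (2 * t) * e" "x - d = x + sqrt (2 * t) * (- e)" using s by (simp_all add: e_def)
 note i = conv_integrable[OF gauss_shift_integrable(1)[of "-e"] g gb] conv_integrable[OF gauss_integrable(1) g gb] conv_integrable[OF gauss_shift_integrable(1)[of "e"] g gb]
 have eq: "heat t g (x + d) + heat t g (x - d) - 2 * heat t g x = (LBINT z. (gauss (z + e) + gauss (z - e) - 2 * gauss z) * g (x + sqrt (2 * t) * z))"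
  unfolding xd heat_shift[OF t] left_diff_distrib distrib_right mult.assoc using i
  by (simp add: heat_def conv_def)
 have "abs(heat t g (x + d) + heat t g (x - d) - 2 * heat t g x) <= (LBINT z. abs(gauss (z + e) + gauss (z - e) - 2 * gauss z))"
  unfolding eq by (rule weighted_bound) (use gauss_second_difference(1)[of e] in auto)
 hence "abs(heat t g (x + d) + heat t g (x - d) - 2 * heat t g x) <= var_const * e\<^sup>2"
  using gauss_second_difference(2)[OF e] by (simp add: var_const_def)
 thus ?thesis using t by (simp add: e_def power_divide)
qed

lemma heat_time_continuity:
 assumes t: "0 < r" "r <= r'" shows "abs(heat r g x - heat r' g x) <= var_const * sqrt ((r' - r) / r')"
proof -
 define l where "l = sqrt (r / r')"
 have l: "0 < l" "l <= 1" using t by (auto simp: l_def)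
 have s: "sqrt (2 * r) = l * sqrt (2 * r')" using t by (simp add: l_def real_sqrt_mult real_sqrt_divide)
 have "heat r' g x = abs(l) *\<^sub>R (LBINT z. gauss (0 + l * z) * g (x + sqrt (2 * r') * (0 + l * z)))"
  unfolding heat_def conv_def using l by (intro lborel_integral_real_affine) auto
 also have "... = (LBINT z. (l * gauss (l * z)) * g (x + sqrt (2 * r) * z))"
 proof -
  have "(LBINT z. gauss (0 + l * z) * g (x + sqrt (2 * r') * (0 + l * z))) = (LBINT z. gauss (l * z) * g (x + sqrt (2 * r) * z))"
   unfolding s by (simp add: mult_ac)
  thus ?thesis using l unfolding mult.assoc integral_mult_right_zero by simp
 qed
 finally have h': "heat r' g x = (LBINT z. (l * gauss (l * z)) * g (x + sqrt (2 * r) * z))" .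
 have gl: "Lint (%z. l * gauss (l * z))"
  using lborel_integrable_real_affine[OF gauss_integrable(1), of l 0] l by simp
 have eq: "heat r g x - heat r' g x = (LBINT z. (gauss z - l * gauss (l * z)) * g (x + sqrt (2 * r) * z))"
  unfolding h' left_diff_distrib
  using conv_integrable[OF gl g gb] conv_integrable[OF gauss_integrable(1) g gb]
  by (simp add: heat_def conv_def)
 have "abs(heat r g x - heat r' g x) <= (LBINT z. abs(gauss z - l * gauss (l * z)))"
  unfolding eq by (rule weighted_bound) (use gauss_dilation(1)[OF l] in auto)
 also have "... <= (4 * env_mass + 4) * (1 - l)" by (rule gauss_dilation(2)[OF l])
 also have "... <= var_const * (1 - l)" using l env_mass by (intro mult_right_mono) (auto simp: var_const_def)
 finally have bd: "abs(heat r g x - heat r' g x) <= var_const * (1 - l)" .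
 have "1 - l <= sqrt ((r' - r) / r')"
 proof -
  have "l\<^sup>2 <= l" using l by (simp add: power2_eq_square mult_left_le)
  moreover have l2: "l\<^sup>2 = r / r'" using t by (simp add: l_def)
  ultimately have a: "1 - l <= (r' - r) / r'" using t by (simp add: diff_divide_distrib)
  define w where "w = (r' - r) / r'"
  have w: "0 <= w" "w <= 1" using t by (auto simp: w_def)
  have "w\<^sup>2 <= w" using w by (simp add: power2_eq_square mult_left_le)
  hence "w <= sqrt w" by (rule real_le_rsqrt)
  thus ?thesis using a by (simp add: w_def)
 qed
 hence "var_const * (1 - l) <= var_const * sqrt ((r' - r) / r')" using var_const by (intro mult_left_mono) auto
 thus ?thesis using bd by linarith
qed

end

lemma borel_lborel_pair:
 fixes f :: "'a::second_countable_topology \<times> 'b::euclidean_space => 'c::topological_space"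
 assumes "f \<in> BM" shows "f \<in> borel_measurable (borel \<Otimes>\<^sub>M lborel)"
 using assms by (subst measurable_cong_sets[OF sets_pair_measure_cong[OF refl sets_lborel] refl]) (simp add: borel_prod)

lemma borel_param_integral:
 fixes f :: "'a::second_countable_topology => 'b::euclidean_space => real"
 assumes "(%p. f (fst p) (snd p)) \<in> BM"
 shows "(%a. LINT z|lborel. f a z) \<in> BM"
 using borel_lborel_pair[OF assms] by (intro lborel.borel_measurable_lebesgue_integral) (simp add: case_prod_beta')

lemma borel_param_nn_integral:
 fixes f :: "'a::second_countable_topology => 'b::euclidean_space => ennreal"
 assumes "(%p. f (fst p) (snd p)) \<in> BM"
 shows "(%a. NN z. f a z) \<in> BM"
 using borel_lborel_pair[OF assms] by (intro lborel.borel_measurable_nn_integral) (simp add: case_prod_beta')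

lemma conv_joint_measurable:
 fixes a c :: "'a::second_countable_topology => real"
 assumes [measurable]: "k \<in> BM" "g \<in> BM" "a \<in> BM" "c \<in> BM"
 shows "(%p. conv k (c p) g (a p)) \<in> BM"
 unfolding conv_def by (rule borel_param_integral) measurable

lemma heat_joint_measurable:
 fixes a c :: "'a::second_countable_topology => real"
 assumes [measurable]: "g \<in> BM" "a \<in> BM" "c \<in> BM"
 shows "(%p. heat (c p) g (a p)) \<in> BM"
  "(%p. heat_x (c p) g (a p)) \<in> BM"
  "(%p. heat_xx (c p) g (a p)) \<in> BM"
 unfolding heat_def heat_x_def heat_xx_def
 by (intro borel_measurable_divide conv_joint_measurable; measurable)+

lemma conv_gauss2_symmetric:
 fixes g :: "real => real"
 assumes g: "g \<in> BM" "!!y. abs(g y) <= B"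
 shows "2 * conv gauss2 sg g x = (LBINT z. gauss2 z * (g (x + sg * z) + g (x - sg * z) - 2 * g x))"
  and "Lint (%z. gauss2 z * (g (x + sg * z) + g (x - sg * z) - 2 * g x))"
proof -
 have i1: "Lint (%z. gauss2 z * g (x + sg * z))" by (rule conv_integrable[OF gauss2_integrable(1) g])
 have i2: "Lint (%z. gauss2 z * g (x - sg * z))" using conv_integrable[OF gauss2_integrable(1) g, of x "-sg"] by simp
 have i3: "Lint (%z. gauss2 z * (2 * g x))" using gauss2_integrable by simp
 have r: "(LBINT z. gauss2 z * g (x - sg * z)) = conv gauss2 sg g x"
 proof -
  have "conv gauss2 sg g x = abs(-1) *\<^sub>R (LBINT z. gauss2 (0 + (-1) * z) * g (x + sg * (0 + (-1) * z)))"
   unfolding conv_def by (rule lborel_integral_real_affine) simp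
  thus ?thesis by (simp add: gauss2_even)
 qed
 have e: "(%z. gauss2 z * (g (x + sg * z) + g (x - sg * z) - 2 * g x)) = (%z. gauss2 z * g (x + sg * z) + gauss2 z * g (x - sg * z) - gauss2 z * (2 * g x))"
  by (simp add: algebra_simps)
 show "Lint (%z. gauss2 z * (g (x + sg * z) + g (x - sg * z) - 2 * g x))"
  unfolding e by (intro idiff iadd i1 i2 i3)
 have "(LBINT z. gauss2 z * g (x + sg * z)) = conv gauss2 sg g x" by (simp add: conv_def)
 then show "2 * conv gauss2 sg g x = (LBINT z. gauss2 z * (g (x + sg * z) + g (x - sg * z) - 2 * g x))"
  unfolding e using i1 i2 i3 r gauss2_integrable(2) by simp
qed

lemma gauss2_moment_finite:
 assumes "0 <= p" shows "(NN z. en (abs(gauss2 z) * abs(z) powr p)) < \<infinity>"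
proof -
 define m where "m = nat \<lceil>p\<rceil>"
 have m: "p <= real m" by (simp add: m_def real_nat_ceiling_ge)
 let ?f = "%z. gauss z * abs(z) ^ 0 + gauss z * abs(z) ^ m + gauss z * abs(z) ^ 2 + gauss z * abs(z) ^ (m + 2)"
 have b: "abs(gauss2 z) * abs(z) powr p <= ?f z" for z
 proof -
  have z1: "abs(z) powr p <= 1 + abs(z) ^ m"
  proof (cases "abs(z) <= 1")
   case True
   hence "abs(z) powr p <= 1 powr p" using assms by (intro powr_mono2) auto
   thus ?thesis by (simp add: add_increasing2)
  next
   case False
   hence "abs(z) powr p <= abs(z) powr real m" using m by (intro powr_mono) auto
   thus ?thesis using False by (simp add: powr_realpow)
  qed
  have "abs(z\<^sup>2 - 1) <= 1 + abs(z) ^ 2" using zero_le_power2[of z] by (simp add: abs_le_iff)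
  hence "abs(z\<^sup>2 - 1) * abs(z) powr p <= (1 + abs(z) ^ 2) * (1 + abs(z) ^ m)" using z1 by (intro mult_mono) auto
  hence "gauss z * (abs(z\<^sup>2 - 1) * abs(z) powr p) <= gauss z * ((1 + abs(z) ^ 2) * (1 + abs(z) ^ m))"
   by (intro mult_left_mono less_imp_le[OF gauss_pos])
  also have "... = ?f z" by (simp add: algebra_simps power_add power2_eq_square)
  finally show ?thesis by (simp add: gauss2_def abs_mult mult_ac)
 qed
 have "Lint ?f" by (intro iadd gauss_moments(2))
 hence "(NN z. en (norm (?f z))) < \<infinity>" by (simp only: integrable_iff_bounded)
 moreover have "(NN z. en (abs(gauss2 z) * abs(z) powr p)) <= (NN z. en (norm (?f z)))"
  using b by (intro nn_integral_mono ennreal_leI) (smt (verit) real_norm_def)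
 ultimately show ?thesis by (rule le_less_trans[rotated])
qed

text \<open>As the second derivative kernel is even with mean zero, heat_xx is an average of second differences; the
substitution t = sg^2/2 turns its norm into the Besov integral.\<close>
lemma heat_xx_Lq:
 fixes g :: "real => real"
 assumes g: "g \<in> BM" "!!y. abs(g y) <= B" and q: "1 < q" and T: "0 < T"
  and bes: "(NN h. ind {0<..} h * (en (h powr (1 - 2 * q)) *
  (NN x. ind {0<..<1} x * en (abs(g (x + h) + g (x - h) - 2 * g x) powr q)))) < \<infinity>"
 shows "(NN t. ind {0<..<T} t * (NN x. ind {0<..<1} x * en (abs(heat_xx t g x) powr q))) < \<infinity>"
proof -
 have [measurable]: "g \<in> BM" by (rule g)
 define D where "D h x = abs(g (x + h) + g (x - h) - 2 * g x)" for h x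
 define Ph where "Ph h = (NN x. ind {0<..<1} x * en (D h x powr q))" for h
 define BI where "BI = (NN h. ind {0<..} h * (en (h powr (1 - 2 * q)) * Ph h))"
 have BI: "BI < \<infinity>" using bes by (simp add: BI_def Ph_def D_def)
 have Phm [measurable]: "Ph \<in> BM"
  unfolding Ph_def D_def by (rule borel_param_nn_integral) measurable
 have Pheven: "Ph (abs(h)) = Ph h" for h
  unfolding Ph_def D_def by (cases "0 <= h") (auto simp: algebra_simps)
 define c where "c = (LBINT z. abs(gauss2 z)) + 1"
 have c0: "0 < c" unfolding c_def by (intro add_nonneg_pos inonneg) auto
 have cb: "(NN z. en (abs(gauss2 z))) <= en c"
  using gauss2_integrable(1) by (subst nn_integral_eq_integral) (auto simp: c_def)
 define C where "C = c powr (q - 1)"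
 have pt: "en (abs(heat_xx (sg\<^sup>2 / 2) g x) powr q) <= en (C * sg powr (- 2 * q)) * (NN z. en (abs(gauss2 z)) * en (D (sg * z) x powr q))"
  if sg: "0 < sg" for sg x
 proof -
  define A where "A = 2 * abs(conv gauss2 sg g x)"
  have "en A = en (norm (LBINT z. gauss2 z * (g (x + sg * z) + g (x - sg * z) - 2 * g x)))"
   unfolding conv_gauss2_symmetric(1)[OF g, symmetric] by (simp add: A_def abs_mult)
  also have "... <= (NN z. en (norm (gauss2 z * (g (x + sg * z) + g (x - sg * z) - 2 * g x))))"
   by (rule integral_norm_bound_ennreal[OF conv_gauss2_symmetric(2)[OF g]])
  also have "... = (NN z. en (abs(gauss2 z)) * en (D (sg * z) x))"
   by (intro nn_integral_cong) (simp add: D_def abs_mult ennreal_mult)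
  finally have "en A <= (NN z. en (abs(gauss2 z)) * en (D (sg * z) x))" .
  hence "en (A powr q) <= en (c powr (q - 1)) * (NN z. en (abs(gauss2 z)) * en (D (sg * z) x powr q))"
   using q c0 cb by (intro weighted_jensen) (auto simp: D_def A_def)
  hence s: "en (sg powr (- 2 * q) * A powr q) <= en (sg powr (- 2 * q) * C) * (NN z. en (abs(gauss2 z)) * en (D (sg * z) x powr q))"
   unfolding C_def by (rule ennreal_scale) auto
  have "abs(heat_xx (sg\<^sup>2 / 2) g x) = sg powr (-2) * abs(conv gauss2 sg g x)"
  proof -
   have "sg powr (-2) = 1 / sg\<^sup>2" using sg by (simp add: powr_minus_divide)
   thus ?thesis using sg by (simp add: heat_xx_def abs_divide)
  qed
  also have "... <= sg powr (-2) * A" by (intro mult_left_mono) (auto simp: A_def)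
  finally have "abs(heat_xx (sg\<^sup>2 / 2) g x) powr q <= (sg powr (-2) * A) powr q"
   using q by (intro powr_mono2) auto
  also have "... = sg powr (- 2 * q) * A powr q" by (simp add: powr_mult powr_powr A_def)
  finally have "en (abs(heat_xx (sg\<^sup>2 / 2) g x) powr q) <= en (sg powr (- 2 * q) * A powr q)" by (rule ennreal_leI)
  from order_trans[OF this s] show ?thesis by (simp only: mult.commute[of C])
 qed
 define H where "H t = (NN x. ind {0<..<1} x * en (abs(heat_xx t g x) powr q))" for t
 have [measurable]: "(%p::pt. heat_xx (fst p) g (snd p)) \<in> BM"
  by (rule heat_joint_measurable) measurable
 have Hm [measurable]: "H \<in> BM"
  unfolding H_def by (rule borel_param_nn_integral) measurable
 have Hb: "H (sg\<^sup>2 / 2) <= en (C * sg powr (- 2 * q)) * (NN z. en (abs(gauss2 z)) * Ph (sg * z))" if sg: "0 < sg" for sg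
 proof -
  have [measurable]: "(%p::pt. D (sg * snd p) (fst p)) \<in> BM" "(%z. D (sg * z) x) \<in> BM" "(%x. D (sg * z) x) \<in> BM" for x z
   unfolding D_def by measurable
  have "H (sg\<^sup>2 / 2) <= (NN x. en (C * sg powr (- 2 * q)) * (NN z. ind {0<..<1} x * (en (abs(gauss2 z)) * en (D (sg * z) x powr q))))"
   unfolding H_def using pt[OF sg] by (intro nn_integral_mono) (auto simp: indicator_def)
  also have "... = en (C * sg powr (- 2 * q)) * (NN x. NN z. ind {0<..<1} x * (en (abs(gauss2 z)) * en (D (sg * z) x powr q)))"
  proof (rule nn_integral_cmult)
   have "(%x. NN z. ind {0<..<1} x * (en (abs(gauss2 z)) * en (D (sg * z) x powr q))) \<in> BM"
    by (rule borel_param_nn_integral) measurable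
   then show "(%x. NN z. ind {0<..<1} x * (en (abs(gauss2 z)) * en (D (sg * z) x powr q))) \<in> borel_measurable lborel" by simp
  qed
  also have "(NN x. NN z. ind {0<..<1} x * (en (abs(gauss2 z)) * en (D (sg * z) x powr q)))
   = (NN z. NN x. ind {0<..<1} x * (en (abs(gauss2 z)) * en (D (sg * z) x powr q)))"
   by (rule nn_integral_swap[symmetric]) measurable
  also have "... = (NN z. en (abs(gauss2 z)) * Ph (sg * z))"
   unfolding Ph_def by (intro nn_integral_cong) (subst nn_integral_cmult[symmetric], measurable, simp add: mult_ac)
  finally show ?thesis .
 qed
 define b where "b = sqrt (2 * T)"
 have b: "0 < b" "b\<^sup>2 / 2 = T" using T by (auto simp: b_def)
 have "(NN t. ind {0<..<T} t * H t) <= (\<integral>\<^sup>+t\<in>{0\<^sup>2/2..b\<^sup>2/2}. H t \<partial>lborel)"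
  by (intro nn_integral_mono) (auto simp: b(2) indicator_def)
 also have "... = (\<integral>\<^sup>+sg\<in>{0..b}. H (sg\<^sup>2/2) * en sg \<partial>lborel)"
  by (rule nn_integral_substitution_aux[where g = "%sg. sg\<^sup>2 / 2" and g' = "%sg. sg"])
   (auto intro!: derivative_eq_intros Hm b)
 also have "... <= (NN sg. NN z. ind {0<..} sg * (en (C * sg powr (1 - 2 * q)) * (en (abs(gauss2 z)) * Ph (sg * z))))"
 proof (rule nn_integral_mono)
  fix sg
  show "H (sg\<^sup>2/2) * en sg * ind {0..b} sg <= (NN z. ind {0<..} sg * (en (C * sg powr (1 - 2 * q)) * (en (abs(gauss2 z)) * Ph (sg * z))))"
  proof (cases "0 < sg \<and> sg <= b")
   case True
   have "H (sg\<^sup>2/2) * en sg <= (en (C * sg powr (- 2 * q)) * (NN z. en (abs(gauss2 z)) * Ph (sg * z))) * en sg"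
    using True by (intro mult_right_mono Hb) auto
   also have "... = (en (C * sg powr (- 2 * q)) * en sg) * (NN z. en (abs(gauss2 z)) * Ph (sg * z))" by (simp only: mult_ac)
   also have "en (C * sg powr (- 2 * q)) * en sg = en (C * sg powr (1 - 2 * q))"
   proof -
    have "sg powr (- 2 * q) * sg = sg powr (- 2 * q) * sg powr 1" using True by simp
    also have "... = sg powr (1 - 2 * q)" unfolding powr_add[symmetric] by simp
    finally show ?thesis using True by (simp add: ennreal_mult[symmetric] C_def mult.assoc)
   qed
   also have "en (C * sg powr (1 - 2 * q)) * (NN z. en (abs(gauss2 z)) * Ph (sg * z)) = (NN z. en (C * sg powr (1 - 2 * q)) * (en (abs(gauss2 z)) * Ph (sg * z)))"
    by (rule nn_integral_cmult[symmetric]) measurable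
   finally show ?thesis using True by simp
  qed (auto simp: indicator_def)
 qed
 also have "... = (NN z. NN sg. ind {0<..} sg * (en (C * sg powr (1 - 2 * q)) * (en (abs(gauss2 z)) * Ph (sg * z))))"
  by (rule nn_integral_swap) measurable
 also have "... = (NN z. en C * BI * en (abs(gauss2 z) * abs(z) powr (2 * q - 2)))"
 proof (rule nn_integral_cong_AE)
  show "AE z in lborel. (NN sg. ind {0<..} sg * (en (C * sg powr (1 - 2 * q)) * (en (abs(gauss2 z)) * Ph (sg * z))))
   = en C * BI * en (abs(gauss2 z) * abs(z) powr (2 * q - 2))"
   using AE_lborel_singleton[of 0]
  proof eventually_elim
   case (elim z)
   let ?X = "NN sg. ind {0<..} sg * (en (sg powr (1 - 2 * q)) * Ph (sg * z))"
   have "BI = en (abs(abs(z))) * (NN sg. ind {0<..} (0 + abs(z) * sg) * (en ((0 + abs(z) * sg) powr (1 - 2 * q)) * Ph (0 + abs(z) * sg)))"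
    unfolding BI_def using elim by (intro nn_integral_real_affine) auto
   also have "(NN sg. ind {0<..} (0 + abs(z) * sg) * (en ((0 + abs(z) * sg) powr (1 - 2 * q)) * Ph (0 + abs(z) * sg)))
    = (NN sg. en (abs(z) powr (1 - 2 * q)) * (ind {0<..} sg * (en (sg powr (1 - 2 * q)) * Ph (sg * z))))"
   proof (rule nn_integral_cong)
    fix sg
    show "ind {0<..} (0 + abs(z) * sg) * (en ((0 + abs(z) * sg) powr (1 - 2 * q)) * Ph (0 + abs(z) * sg))
    = en (abs(z) powr (1 - 2 * q)) * (ind {0<..} sg * (en (sg powr (1 - 2 * q)) * Ph (sg * z)))"
    proof (cases "0 < sg")
    case True
    have "Ph (abs(z) * sg) = Ph (sg * z)" using Pheven[of "sg * z"] True by (simp add: abs_mult mult.commute)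
    thus ?thesis using True elim by (simp add: powr_mult ennreal_mult mult.assoc)
    qed (use elim in \<open>auto simp: indicator_def zero_less_mult_iff\<close>)
   qed
   also have "... = en (abs(z) powr (1 - 2 * q)) * ?X" by (rule nn_integral_cmult) measurable
   finally have BX: "BI = en (abs(z)) * (en (abs(z) powr (1 - 2 * q)) * ?X)" by simp
   have one: "en (abs(z) powr (2 * q - 2)) * (en (abs(z)) * en (abs(z) powr (1 - 2 * q))) = 1"
   proof -
    have "abs(z) powr (2 * q - 2) * (abs(z) powr 1 * abs(z) powr (1 - 2 * q)) = 1"
    unfolding powr_add[symmetric] using elim by simp
    thus ?thesis using elim by (simp add: ennreal_mult[symmetric])
   qed
   have "BI * en (abs(z) powr (2 * q - 2)) = (en (abs(z) powr (2 * q - 2)) * (en (abs(z)) * en (abs(z) powr (1 - 2 * q)))) * ?X"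
    unfolding BX by (simp only: mult_ac)
   hence Xeq: "?X = BI * en (abs(z) powr (2 * q - 2))" unfolding one by simp
   have "(NN sg. ind {0<..} sg * (en (C * sg powr (1 - 2 * q)) * (en (abs(gauss2 z)) * Ph (sg * z))))
    = (NN sg. en C * en (abs(gauss2 z)) * (ind {0<..} sg * (en (sg powr (1 - 2 * q)) * Ph (sg * z))))"
    by (intro nn_integral_cong) (simp add: ennreal_mult C_def mult_ac)
   also have "... = en C * en (abs(gauss2 z)) * ?X" by (rule nn_integral_cmult) measurable
   finally show ?case unfolding Xeq by (simp add: ennreal_mult mult_ac)
  qed
 qed
 also have "... = en C * BI * (NN z. en (abs(gauss2 z) * abs(z) powr (2 * q - 2)))"
  by (rule nn_integral_cmult) measurable
 also have "... < \<infinity>"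
  using BI gauss2_moment_finite[of "2 * q - 2"] q by (auto simp: ennreal_mult_less_top)
 finally show ?thesis by (simp add: H_def)
qed

section \<open>Integration by parts\<close>

lemma integral_derivative_zero:
 fixes f f' :: "real => real"
 assumes d: "!!z. (f has_real_derivative f' z) (at z)" and c: "continuous_on UNIV f'"
  and s: "!!z. R < abs(z) ==> f z = 0"
 shows "Lint f'" "(LBINT z. f' z) = 0"
proof -
 define a where "a = abs(R) + 1"
 have s': "f' z = 0" if "a <= abs(z)" for z
 proof -
  have "((%_. 0) has_real_derivative 0) (at z)" by simp
  hence "(f has_real_derivative 0) (at z)"
  proof (rule has_field_derivative_transform_within[where d = 1])
   fix x assume "dist x z < 1"
   hence "R < abs(x)" using that unfolding a_def dist_real_def by linarith
   then show "0 = f x" using s by simp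
  qed auto
  thus ?thesis by (rule DERIV_unique[OF d])
 qed
 have "has_bochner_integral lborel (%z. ind {-a..a} z *\<^sub>R f' z) (f a - f (-a))"
 proof (rule has_bochner_integral_FTC_Icc)
  show "- a <= a" by (simp add: a_def)
  show "(f has_vector_derivative f' x) (at x within {- a..a})" for x
   using d[of x] by (simp add: has_real_derivative_iff_has_vector_derivative has_vector_derivative_at_within)
 qed (use c in \<open>auto intro: continuous_on_subset\<close>)
 moreover have "(%z. ind {-a..a} z *\<^sub>R f' z) = f'"
 proof
  fix z show "ind {-a..a} z *\<^sub>R f' z = f' z"
   using s'[of z] by (cases "z \<in> {-a..a}") auto
 qed
 moreover have "f a = 0" "f (-a) = 0" using s by (auto simp: a_def)
 ultimately show "Lint f'" "(LBINT z. f' z) = 0" by (auto simp: has_bochner_integral_iff)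
qed

lemma kernel_by_parts:
 fixes k k' l l' :: "real => real"
 assumes k: "!!z. (k has_real_derivative k' z) (at z)" "continuous_on UNIV k'" "Lint k" "Lint k'"
  and l: "!!z. (l has_real_derivative l' z) (at z)" "continuous_on UNIV l'" "!!z. z \<notin> {0..1} ==> l z = 0" "!!z. abs(l z) <= B" "!!z. abs(l' z) <= B"
  and sg: "0 < sg"
 shows "sg * (LBINT z. k z * l' (y - sg * z)) = (LBINT z. k' z * l (y - sg * z))"
proof -
 have ck: "continuous_on UNIV k" using k(1) by (auto intro!: continuous_at_imp_continuous_on DERIV_isCont)
 have cl: "continuous_on UNIV l" using l(1) by (auto intro!: continuous_at_imp_continuous_on DERIV_isCont)
 have [measurable]: "l \<in> BM" "l' \<in> BM"
  by (intro borel_measurable_continuous_onI cl l(2))+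
 let ?f = "%z. k z * l (y - sg * z)" and ?f' = "%z. k' z * l (y - sg * z) - sg * (k z * l' (y - sg * z))"
 have d: "(?f has_real_derivative ?f' z) (at z)" for z
  by (auto intro!: derivative_eq_intros k(1) DERIV_chain2[of l, OF l(1)] simp: algebra_simps)
 have c: "continuous_on UNIV ?f'"
  by (intro continuous_intros k(2) ck continuous_on_compose2[OF cl] continuous_on_compose2[OF l(2)]) auto
 have s: "?f z = 0" if "(abs(y) + 1) / sg < abs(z)" for z
 proof -
  have "abs(y) + 1 < sg * abs(z)" using that sg by (simp add: field_simps)
  hence "abs(y) + 1 < abs(sg * z)" using sg by (simp add: abs_mult)
  hence "y - sg * z \<notin> {0..1}" by (auto simp: abs_if split: if_splits)
  thus ?thesis by (simp add: l(3))
 qed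
 have i: "Lint (%z. k' z * l (y - sg * z))" "Lint (%z. k z * l' (y - sg * z))"
  using conv_integrable[where k = k' and g = l and B = B and a = y and c = "-sg"]
   conv_integrable[where k = k and g = l' and B = B and a = y and c = "-sg"] k l by simp_all
 have "(LBINT z. ?f' z) = 0" by (rule integral_derivative_zero(2)[OF d c s])
 thus ?thesis using i by simp
qed

lemma gauss_by_parts:
 fixes l l' :: "real => real"
 assumes l: "!!z. (l has_real_derivative l' z) (at z)" "continuous_on UNIV l'" "!!z. z \<notin> {0..1} ==> l z = 0" "!!z. abs(l z) <= B" "!!z. abs(l' z) <= B"
  and sg: "0 < sg"
 shows "sg * (LBINT z. gauss z * l' (y - sg * z)) = - (LBINT z. gauss1 z * l (y - sg * z))"
  and "sg * (LBINT z. gauss1 z * l' (y - sg * z)) = - (LBINT z. gauss2 z * l (y - sg * z))"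
proof -
 have cg: "continuous_on UNIV gauss"
  by (intro continuous_at_imp_continuous_on ballI DERIV_isCont[OF gauss_DERIV])
 have c: "continuous_on UNIV gauss1" "continuous_on UNIV gauss2"
  unfolding gauss1_def[abs_def] gauss2_def[abs_def] by (intro continuous_intros cg)+
 show "sg * (LBINT z. gauss z * l' (y - sg * z)) = - (LBINT z. gauss1 z * l (y - sg * z))"
  using kernel_by_parts[OF gauss_DERIV _ gauss_integrable(1) _ l sg] c gauss1_integrable by (simp add: continuous_on_minus)
 show "sg * (LBINT z. gauss1 z * l' (y - sg * z)) = - (LBINT z. gauss2 z * l (y - sg * z))"
  using kernel_by_parts[OF gauss1_DERIV _ gauss1_integrable(1) _ l sg] c gauss2_integrable by (simp add: continuous_on_minus)
qed

lemma conv_adjoint: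
 fixes k g l :: "real => real"
 assumes k: "Lint k" and g: "g \<in> BM" "!!y. abs(g y) <= B" and l: "Lint l"
 shows "(LBINT x. l x * conv k sg g x) = (LBINT y. g y * (LBINT z. k z * l (y - sg * z)))"
  and "Lint (%y. g y * (LBINT z. k z * l (y - sg * z)))"
proof -
 have [measurable]: "g \<in> BM" "k \<in> BM" "l \<in> BM"
  using k l g by auto
 have B: "0 <= B" using g(2)[of 0] by simp
 have ls: "Lint (%y. l (y - sg * z))" "(LBINT y. h (y - sg * z)) = (LBINT x. h x)" for z and h :: "real => real"
  using lborel_integrable_real_affine[OF l, of 1 "- sg * z"] lborel_integral_real_affine[of 1 h "- sg * z"] by (simp_all add: algebra_simps)
 have m1: "(%p::pt. l (fst p) * (k (snd p) * g (fst p + sg * snd p))) \<in> BM" by measurable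
 have m2: "(%p::pt. k (fst p) * (l (snd p - sg * fst p) * g (snd p))) \<in> BM" by measurable
 have i1: "integrable (lborel \<Otimes>\<^sub>M lborel) (%(x, z). l x * (k z * g (x + sg * z)))"
 proof (rule lborel_pair.Fubini_integrable)
  show "(%(x, z). l x * (k z * g (x + sg * z))) \<in> borel_measurable (lborel \<Otimes>\<^sub>M lborel)"
   using m1 by (simp add: lborel_prod case_prod_beta')
  have "(%x. LBINT z. norm (l x * (k z * g (x + sg * z)))) \<in> BM"
   by (rule borel_param_integral) measurable
  then show "Lint (%x. LBINT z. norm (case (x, z) of (x, z) => l x * (k z * g (x + sg * z))))"
  proof (intro ibound[OF integrable_mult_left[OF integrable_abs[OF l], of "B * (LBINT z. abs(k z))"]])
   show "AE x in lborel. norm (LBINT z. norm (case (x, z) of (x, z) => l x * (k z * g (x + sg * z)))) <= norm (abs(l x) * (B * (LBINT z. abs(k z))))"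
   proof (rule AE_I2)
    fix x
    have "(LBINT z. abs(k z) * abs(g (x + sg * z))) <= (LBINT z. B * abs(k z))"
    using k B g(2) by (intro integral_mono conv_integrable[where g = "%y. abs(g y)"]) (auto simp: mult.commute[of B] intro!: mult_left_mono)
    then show "norm (LBINT z. norm (case (x, z) of (x, z) => l x * (k z * g (x + sg * z)))) <= norm (abs(l x) * (B * (LBINT z. abs(k z))))"
    using B by (simp add: abs_mult inonneg mult_left_mono)
   qed
  qed simp
  show "AE x in lborel. Lint (%z. case (x, z) of (x, z) => l x * (k z * g (x + sg * z)))"
   using conv_integrable[OF k g] by simp
 qed
 have i2: "integrable (lborel \<Otimes>\<^sub>M lborel) (%(z, y). k z * (l (y - sg * z) * g y))"
 proof (rule lborel_pair.Fubini_integrable)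
  show "(%(z, y). k z * (l (y - sg * z) * g y)) \<in> borel_measurable (lborel \<Otimes>\<^sub>M lborel)"
   using m2 by (simp add: lborel_prod case_prod_beta')
  have inner: "Lint (%y. l (y - sg * z) * g y)" for z
   by (rule ibound[OF integrable_mult_left[OF ls(1)[of z], of B]])
    (use B g in \<open>auto simp: abs_mult intro!: mult_left_mono\<close>)
  have "(%z. LBINT y. norm (k z * (l (y - sg * z) * g y))) \<in> BM"
   by (rule borel_param_integral) measurable
  then show "Lint (%z. LBINT y. norm (case (z, y) of (z, y) => k z * (l (y - sg * z) * g y)))"
  proof (intro ibound[OF integrable_mult_left[OF integrable_abs[OF k], of "B * (LBINT x. abs(l x))"]])
   show "AE z in lborel. norm (LBINT y. norm (case (z, y) of (z, y) => k z * (l (y - sg * z) * g y))) <= norm (abs(k z) * (B * (LBINT x. abs(l x))))"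
   proof (rule AE_I2)
    fix z
    have "(LBINT y. abs(l (y - sg * z)) * abs(g y)) <= (LBINT y. B * abs(l (y - sg * z)))"
    using ls(1)[of z] B g(2) inner[of z] integrable_abs[OF inner[of z]]
    by (intro integral_mono) (auto simp: abs_mult mult.commute[of B] intro!: mult_left_mono)
    also have "... = B * (LBINT x. abs(l x))" using ls(2)[of "%x. abs(l x)" z] by simp
    finally show "norm (LBINT y. norm (case (z, y) of (z, y) => k z * (l (y - sg * z) * g y))) <= norm (abs(k z) * (B * (LBINT x. abs(l x))))"
    using B by (simp add: abs_mult inonneg mult_left_mono)
   qed
  qed simp
  show "AE z in lborel. Lint (%y. case (z, y) of (z, y) => k z * (l (y - sg * z) * g y))"
   using inner by simp
 qed
 have "(LBINT x. l x * conv k sg g x) = (LBINT x. LBINT z. l x * (k z * g (x + sg * z)))"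
  by (simp add: conv_def)
 also have "... = (LBINT z. LBINT x. l x * (k z * g (x + sg * z)))"
  by (rule lborel_pair.Fubini_integral[OF i1, symmetric])
 also have "... = (LBINT z. LBINT y. k z * (l (y - sg * z) * g y))"
 proof (rule integral_cong_refl)
  fix z
  show "(LBINT x. l x * (k z * g (x + sg * z))) = (LBINT y. k z * (l (y - sg * z) * g y))"
   using ls(2)[of "%x. l x * (k z * g (x + sg * z))" z] by (simp add: mult_ac)
 qed
 also have "... = (LBINT y. LBINT z. k z * (l (y - sg * z) * g y))"
  by (rule lborel_pair.Fubini_integral[OF i2, symmetric])
 also have "... = (LBINT y. g y * (LBINT z. k z * l (y - sg * z)))"
  by (rule integral_cong_refl, subst integral_mult_right_zero[symmetric], rule icong) (auto simp: mult_ac)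
 finally show "(LBINT x. l x * conv k sg g x) = (LBINT y. g y * (LBINT z. k z * l (y - sg * z)))" .
 have "Lint (%y. LBINT z. k z * (l (y - sg * z) * g y))"
  by (rule lborel_pair.integrable_snd[OF i2])
 also have "(%y. LBINT z. k z * (l (y - sg * z) * g y)) = (%y. g y * (LBINT z. k z * l (y - sg * z)))"
  by (rule ext, subst integral_mult_right_zero[symmetric], rule icong) (auto simp: mult_ac)
 finally show "Lint (%y. g y * (LBINT z. k z * l (y - sg * z)))" .
qed

locale testfun =
 fixes e ex exx et :: "pt => real" and T :: real
 assumes cont: "continuous_on UNIV e" "continuous_on UNIV ex" "continuous_on UNIV exx" "continuous_on UNIV et"
  and zero: "!!x t. \<not> (0 < x \<and> x < 1 \<and> 0 < t \<and> t < T) ==> e (x, t) = 0 \<and> ex (x, t) = 0 \<and> exx (x, t) = 0 \<and> et (x, t) = 0"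
  and dx: "!!x t. ((%y. e (y, t)) has_real_derivative ex (x, t)) (at x)"
   "!!x t. ((%y. ex (y, t)) has_real_derivative exx (x, t)) (at x)"
  and curve: "!!y z ta r. 0 < r ==> ((%r. e (y - sqrt (2 * r) * z, ta + r)) has_real_derivative
    (et (y - sqrt (2 * r) * z, ta + r) - z / sqrt (2 * r) * ex (y - sqrt (2 * r) * z, ta + r))) (at r)"

lemma interior_cylinder: "interior (cylinder T) = {0<..<1} \<times> {0<..<T}"
 unfolding cylinder_def Omega_def interior_Times
 by simp

lemma partial_zero_off_support:
 assumes "!!z. z \<notin> K ==> f z = 0" "closed K" "z \<notin> K"
 shows "partial_x f z = 0" "partial_t f z = 0"
proof -
 obtain x t where z: "z = (x, t)" by (cases z)
 have o: "open (- K)" using assms by auto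
 have c0: "((%_. 0) has_real_derivative 0) (at w)" for w :: real by simp
 have ox: "open ((%y. (y, t)) -` (- K))" and ot: "open ((%s. (x, s)) -` (- K))"
  by (intro open_vimage o continuous_intros)+
 have "((%y. f (y, t)) has_real_derivative 0) (at x)"
  by (rule has_field_derivative_transform_within_open[OF c0 ox]) (use assms z in auto)
 then show "partial_x f z = 0" using z by (simp add: partial_x_def DERIV_imp_deriv)
 have "((%s. f (x, s)) has_real_derivative 0) (at t)"
  by (rule has_field_derivative_transform_within_open[OF c0 ot]) (use assms z in auto)
 then show "partial_t f z = 0" using z by (simp add: partial_t_def DERIV_imp_deriv)
qed

lemma testfun_intro:
 assumes \<psi>: "\<psi> \<in> test_functions (interior (cylinder T))"
 shows "testfun \<psi> (partial_x \<psi>) (partial_x (partial_x \<psi>)) (partial_t \<psi>) T"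
proof -
 have tc: "times_cont_diff k \<psi>" for k using \<psi> by (auto simp: test_functions_def)
 define K where "K = closure {z. \<psi> z ~= 0}"
 have K: "closed K" "K \<subseteq> {0<..<1} \<times> {0<..<T}" using \<psi> by (auto simp: K_def test_functions_def interior_cylinder)
 have z0: "\<psi> z = 0" if "z \<notin> K" for z
  using that closure_subset[of "{z. \<psi> z ~= 0}"] unfolding K_def by blast
 have z1: "partial_x \<psi> z = 0" "partial_t \<psi> z = 0" if "z \<notin> K" for z
  by (rule partial_zero_off_support[OF z0 K(1) that]; assumption)+
 have z2: "partial_x (partial_x \<psi>) z = 0" if "z \<notin> K" for z
  by (rule partial_zero_off_support(1)[OF z1(1) K(1) that])
 have d0: "\<psi> differentiable_on UNIV" and d1: "partial_x \<psi> differentiable_on UNIV"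
  and dt: "partial_t \<psi> differentiable_on UNIV" and d2: "partial_x (partial_x \<psi>) differentiable_on UNIV"
  using tc[of 3] by (simp_all add: eval_nat_numeral)
 have px: "((%y. f (y, t)) has_real_derivative partial_x f (x, t)) (at x)"
  and pt: "((%s. f (x, s)) has_real_derivative partial_t f (x, t)) (at t)"
  and full: "(f has_derivative (%(a, b). a * partial_x f (x, t) + b * partial_t f (x, t))) (at (x, t))"
  if d: "f differentiable_on UNIV" for f :: "pt => real" and x t
 proof -
  obtain D where D: "(f has_derivative D) (at (x, t))" using d by (auto simp: differentiable_on_def differentiable_def)
  interpret bounded_linear D by (rule has_derivative_bounded_linear[OF D])
  have "((%y. (y, t)) has_derivative (%a. (a, 0))) (at x)" by (auto intro!: derivative_eq_intros)
  from has_derivative_compose[OF this D] have a: "((%y. f (y, t)) has_derivative (%a. D (a, 0))) (at x)" .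
  have "(%a. D (a, 0)) = (*) (D (1, 0))"
  proof
   fix a show "D (a, 0) = D (1, 0) * a" using scaleR[of a "(1, 0)"] by simp
  qed
  hence a': "((%y. f (y, t)) has_real_derivative D (1, 0)) (at x)" using a by (simp add: has_field_derivative_def)
  hence ex: "partial_x f (x, t) = D (1, 0)" by (simp add: partial_x_def DERIV_imp_deriv)
  then show "((%y. f (y, t)) has_real_derivative partial_x f (x, t)) (at x)" using a' by simp
  have "((%s. (x, s)) has_derivative (%a. (0, a))) (at t)" by (auto intro!: derivative_eq_intros)
  from has_derivative_compose[OF this D] have b: "((%s. f (x, s)) has_derivative (%a. D (0, a))) (at t)" .
  have "(%a. D (0, a)) = (*) (D (0, 1))"
  proof
   fix a show "D (0, a) = D (0, 1) * a" using scaleR[of a "(0, 1)"] by simp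
  qed
  hence b': "((%s. f (x, s)) has_real_derivative D (0, 1)) (at t)" using b by (simp add: has_field_derivative_def)
  hence et: "partial_t f (x, t) = D (0, 1)" by (simp add: partial_t_def DERIV_imp_deriv)
  then show "((%s. f (x, s)) has_real_derivative partial_t f (x, t)) (at t)" using b' by simp
  have "D = (%(a, b). a * partial_x f (x, t) + b * partial_t f (x, t))"
  proof
   fix p :: "pt"
   obtain a b where p: "p = (a, b)" by (cases p)
   have "D p = D (a *\<^sub>R (1, 0) + b *\<^sub>R (0, 1))" by (simp add: p)
   also have "... = a * D (1, 0) + b * D (0, 1)" unfolding add scaleR by simp
   finally show "D p = (case p of (a, b) => a * partial_x f (x, t) + b * partial_t f (x, t))" by (simp add: p ex et)
  qed
  then show "(f has_derivative (%(a, b). a * partial_x f (x, t) + b * partial_t f (x, t))) (at (x, t))" using D by simp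
 qed
 show ?thesis
 proof
  show "continuous_on UNIV \<psi>" "continuous_on UNIV (partial_x \<psi>)" "continuous_on UNIV (partial_x (partial_x \<psi>))" "continuous_on UNIV (partial_t \<psi>)"
   using d0 d1 d2 dt by (auto intro: differentiable_imp_continuous_on)
  show "\<psi> (x, t) = 0 \<and> partial_x \<psi> (x, t) = 0 \<and> partial_x (partial_x \<psi>) (x, t) = 0 \<and> partial_t \<psi> (x, t) = 0"
   if "\<not> (0 < x \<and> x < 1 \<and> 0 < t \<and> t < T)" for x t
  proof -
   have "(x, t) \<notin> K" using that K(2) by auto
   thus ?thesis using z0 z1 z2 by blast
  qed
  show "((%y. \<psi> (y, t)) has_real_derivative partial_x \<psi> (x, t)) (at x)" for x t by (rule px[OF d0])
  show "((%y. partial_x \<psi> (y, t)) has_real_derivative partial_x (partial_x \<psi>) (x, t)) (at x)" for x t by (rule px[OF d1])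
  fix y z ta r :: real assume r: "0 < r"
  let ?p = "(y - sqrt (2 * r) * z, ta + r)"
  have s: "((%r. y - sqrt (2 * r) * z) has_real_derivative - z / sqrt (2 * r)) (at r)"
   using r by (auto intro!: derivative_eq_intros simp: field_simps)
  have s2: "((%r. ta + r) has_derivative (%h. h)) (at r)" by (auto intro!: derivative_eq_intros)
  have "((%r. (y - sqrt (2 * r) * z, ta + r)) has_derivative (%h. ((- z / sqrt (2 * r)) * h, h))) (at r)"
   by (rule has_derivative_Pair[OF s[unfolded has_field_derivative_def] s2])
  from has_derivative_compose[OF this full[OF d0]]
  have "((%r. \<psi> (y - sqrt (2 * r) * z, ta + r)) has_derivative
   (%h. (- z / sqrt (2 * r)) * h * partial_x \<psi> ?p + h * partial_t \<psi> ?p)) (at r)" by simp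
  also have "(%h. (- z / sqrt (2 * r)) * h * partial_x \<psi> ?p + h * partial_t \<psi> ?p)
   = (*) (partial_t \<psi> ?p - z / sqrt (2 * r) * partial_x \<psi> ?p)"
   by (auto simp: fun_eq_iff algebra_simps)
  finally show "((%r. \<psi> (y - sqrt (2 * r) * z, ta + r)) has_real_derivative
    (partial_t \<psi> ?p - z / sqrt (2 * r) * partial_x \<psi> ?p)) (at r)"
   by (simp add: has_field_derivative_def)
 qed
qed

section \<open>Iterated integrals\<close>

text \<open>The hypothesis is a bound on the inner absolute integral, as this is what the kernel estimates provide.\<close>
lemma swap_dominated:
 fixes f :: "'a::euclidean_space => 'b::euclidean_space => real"
 assumes f: "(%p. f (fst p) (snd p)) \<in> BM"
  and b: "AE a in lborel. (NN b. en (abs(f a b))) <= en (m a)" and m: "Lint m"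
 shows "integrable (lborel \<Otimes>\<^sub>M lborel) (%(a, b). f a b)"
  "(LBINT a. LBINT b. f a b) = (LBINT b. LBINT a. f a b)"
  "Lint (%a. LBINT b. f a b)"
proof -
 have fm: "(%(a, b). f a b) \<in> borel_measurable (lborel \<Otimes>\<^sub>M lborel)"
  using f by (simp add: lborel_prod case_prod_beta')
 have "(\<integral>\<^sup>+p. en (norm (case p of (a, b) => f a b)) \<partial>(lborel \<Otimes>\<^sub>M lborel)) = (NN a. NN b. en (abs(f a b)))"
  using fm by (subst lborel.nn_integral_fst[symmetric]) (auto simp: case_prod_beta')
 also have "... <= (NN a. en (norm (m a)))"
  using b by (intro nn_integral_mono_AE) (auto elim!: order_trans intro!: ennreal_leI)
 also have "... < \<infinity>" using m by (simp only: integrable_iff_bounded)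
 finally show i: "integrable (lborel \<Otimes>\<^sub>M lborel) (%(a, b). f a b)"
  unfolding integrable_iff_bounded using fm by simp
 show "(LBINT a. LBINT b. f a b) = (LBINT b. LBINT a. f a b)" by (rule lborel_pair.Fubini_integral[OF i, symmetric])
 show "Lint (%a. LBINT b. f a b)" by (rule lborel_pair.integrable_fst[OF i])
qed

lemma plane_iterated:
 fixes F :: "pt => real"
 assumes "Lint F"
 shows "(LBINT z. F z) = (LBINT t. LBINT x. F (x, t))"
proof -
 have "integrable (lborel \<Otimes>\<^sub>M lborel) (case_prod (%x t. F (x, t)))" using assms by (simp add: lborel_prod)
 from lborel_pair.integral_snd[OF this] show ?thesis by (simp add: lborel_prod)
qed

lemma integrable_box:
 fixes F :: "pt => real"
 assumes [measurable]: "F \<in> BM" and b: "!!z. abs(F z) <= M" and z: "!!z. z \<notin> {0..1} \<times> {0..T} ==> F z = 0"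
 shows "Lint F"
proof (rule ibound)
 have c: "{0..1} \<times> {0..T} = (cbox (0, 0) (1, T) :: (pt) set)" unfolding cbox_Pair_eq by simp
 have m: "{0..1::real} \<times> {0..T} \<in> sets lborel" unfolding c by (simp only: sets_lborel borel_closed[OF closed_cbox])
 have f: "emeasure lborel ({0..1::real} \<times> {0..T}) < \<infinity>" unfolding c by (rule emeasure_lborel_cbox_finite)
 show "Lint (%z. ind ({0..1::real} \<times> {0..T}) z * M)"
  by (rule imultl) (rule integrable_real_indicator[OF m f])
 show "AE z in lborel. norm (F z) <= norm (ind ({0..1::real} \<times> {0..T}) z * M)"
 proof (rule AE_I2)
  fix z show "norm (F z) <= norm (ind ({0..1::real} \<times> {0..T}) z * M)"
   using b[of z] z[of z] by (cases "z \<in> {0..1} \<times> {0..T}") auto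
 qed
qed simp

lemma powr_integral:
 fixes a R :: real
 assumes a: "0 < a" and R: "0 <= R"
 shows "has_bochner_integral lborel (%r. ind {0<..<R} r * r powr (a - 1)) (R powr a / a)"
  and "(NN r. ind {0<..<R} r * en (r powr (a - 1))) = en (R powr a / a)"
proof -
 have "((%x. x powr (a - 1)) has_integral (R powr (a - 1 + 1) / (a - 1 + 1))) {0..R}"
  using assms by (intro has_integral_powr_from_0) auto
 hence "((%x. x powr (a - 1)) has_integral (R powr a / a)) {0<..<R}"
  by (simp add: has_integral_Icc_iff_Ioo)
 hence i: "(NN x. ind {0<..<R} x * en (x powr (a - 1))) = en (R powr a / a)"
  using nn_integral_has_integral_lebesgue'[of "{0<..<R}" "%x. x powr (a - 1)"] by (simp add: mult.commute)
 then show "(NN r. ind {0<..<R} r * en (r powr (a - 1))) = en (R powr a / a)" .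
 have "(NN x. en (ind {0<..<R} x * x powr (a - 1))) = (NN x. ind {0<..<R} x * en (x powr (a - 1)))"
  by (intro nn_integral_cong) (auto simp: indicator_def)
 then show "has_bochner_integral lborel (%r. ind {0<..<R} r * r powr (a - 1)) (R powr a / a)"
  using assms i by (intro has_bochner_integral_nn_integral) auto
qed

lemma heat_source_measurable:
 fixes a c d :: "'a::second_countable_topology => real" and h :: "pt => real"
 assumes [measurable]: "h \<in> BM" "a \<in> BM" "c \<in> BM" "d \<in> BM"
 shows "(%p. heat (c p) (%y. h (y, d p)) (a p)) \<in> BM"
  "(%p. heat_x (c p) (%y. h (y, d p)) (a p)) \<in> BM"
  "(%p. heat_xx (c p) (%y. h (y, d p)) (a p)) \<in> BM"
proof -
 have "(%p. conv k (sqrt (2 * c p)) (%y. h (y, d p)) (a p)) \<in> BM" if [measurable]: "k \<in> BM" for k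
  unfolding conv_def by (rule borel_param_integral) measurable
 note [measurable] = this
 show "(%p. heat (c p) (%y. h (y, d p)) (a p)) \<in> BM"
  "(%p. heat_x (c p) (%y. h (y, d p)) (a p)) \<in> BM"
  "(%p. heat_xx (c p) (%y. h (y, d p)) (a p)) \<in> BM"
  unfolding heat_def heat_x_def heat_xx_def by measurable
qed

section \<open>The heat semigroup against test functions\<close>

context testfun
begin

lemma e_measurable [measurable]: "e \<in> BM" "ex \<in> BM" "exx \<in> BM" "et \<in> BM"
 using cont by (auto intro: borel_measurable_continuous_onI)

lemma test_bound: obtains M where "0 <= M" "!!z. abs(e z) <= M" "!!z. abs(ex z) <= M" "!!z. abs(exx z) <= M" "!!z. abs(et z) <= M"
proof -
 have one: "\<exists>M\<ge>0. \<forall>z. abs(f z) <= M" if c: "continuous_on UNIV f" and z: "!!x t. \<not> (0 < x \<and> x < 1 \<and> 0 < t \<and> t < T) ==> f (x, t) = 0"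
  for f :: "pt => real"
 proof -
  have "compact (f ` ({0..1} \<times> {0..T}))"
   by (intro compact_continuous_image compact_Times) (use c in \<open>auto intro: continuous_on_subset\<close>)
  then obtain M where M: "!!v. v \<in> f ` ({0..1} \<times> {0..T}) ==> abs(v) <= M"
   using compact_imp_bounded by (force simp: bounded_iff)
  have "abs(f z) <= abs(M)" for z
  proof (cases z)
   case (Pair x t)
   show ?thesis
   proof (cases "0 < x \<and> x < 1 \<and> 0 < t \<and> t < T")
    case True thus ?thesis using M[of "f z"] Pair by fastforce
   qed (use z Pair in auto)
  qed
  thus ?thesis by (intro exI[of _ "abs(M)"]) auto
 qed
 obtain M1 where M1: "0 <= M1" "!!z. abs(e z) <= M1" using one[OF cont(1)] zero by metis
 obtain M2 where M2: "0 <= M2" "!!z. abs(ex z) <= M2" using one[OF cont(2)] zero by metis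
 obtain M3 where M3: "0 <= M3" "!!z. abs(exx z) <= M3" using one[OF cont(3)] zero by metis
 obtain M4 where M4: "0 <= M4" "!!z. abs(et z) <= M4" using one[OF cont(4)] zero by metis
 show thesis
 proof (rule that[of "M1 + M2 + M3 + M4"])
  fix z
  show "abs(e z) <= M1 + M2 + M3 + M4" "abs(ex z) <= M1 + M2 + M3 + M4" "abs(exx z) <= M1 + M2 + M3 + M4" "abs(et z) <= M1 + M2 + M3 + M4"
   using M1(1) M1(2)[of z] M2(1) M2(2)[of z] M3(1) M3(2)[of z] M4(1) M4(2)[of z] by linarith+
 qed (use M1 M2 M3 M4 in auto)
qed

lemma slice_integrable:
 fixes f :: "pt => real"
 assumes [measurable]: "f \<in> BM" and b: "!!z. abs(f z) <= M" and z: "!!x t. \<not> (0 < x \<and> x < 1 \<and> 0 < t \<and> t < T) ==> f (x, t) = 0"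
 shows "Lint (%x. f (x, t))" "(NN x. en (abs(f (x, t)))) <= en M"
proof -
 have p: "abs(f (x, t)) <= M * ind {0..1} x" for x
  using b[of "(x, t)"] z[of x t] by (cases "x \<in> {0..1}") auto
 show "Lint (%x. f (x, t))"
  by (rule ibound[of _ "%x. M * ind {0..1} x"])
   (use order_trans[OF p abs_ge_self] in \<open>auto intro!: AE_I2\<close>)
 have "(NN x. en (abs(f (x, t)))) <= (NN x. en M * ind {0..1::real} x)"
 proof (rule nn_integral_mono)
  fix x show "en (abs(f (x, t))) <= en M * ind {0..1} x"
   using b[of "(x, t)"] z[of x t] by (cases "x \<in> {0..1}") (auto intro: ennreal_leI)
 qed
 also have "... = en M" by (simp add: nn_integral_cmult)
 finally show "(NN x. en (abs(f (x, t)))) <= en M" .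
qed

lemma heat_slices:
 assumes r: "0 < r" and g: "g \<in> BM" "!!y. abs(g y) <= B"
 shows "(LBINT x. heat r g x * ex (x, t)) = - (LBINT x. heat_x r g x * e (x, t))"
  and "(LBINT x. heat r g x * exx (x, t)) = (LBINT x. heat_xx r g x * e (x, t))"
proof -
 obtain M where M: "0 <= M" "!!z. abs(e z) <= M" "!!z. abs(ex z) <= M" "!!z. abs(exx z) <= M" "!!z. abs(et z) <= M"
  by (rule test_bound) blast
 define sg where "sg = sqrt (2 * r)"
 have sg: "0 < sg" "sg * sg = 2 * r" using r by (auto simp: sg_def)
 have c: "continuous_on UNIV (%x. ex (x, t))" "continuous_on UNIV (%x. exx (x, t))"
  by (rule continuous_on_compose2[OF cont(2)] continuous_on_compose2[OF cont(3)]; auto intro!: continuous_intros)+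
 have z: "e (x, t) = 0" "ex (x, t) = 0" if "x \<notin> {0..1}" for x using zero[of x t] that by auto
 have i: "Lint (%x. e (x, t))" "Lint (%x. ex (x, t))" "Lint (%x. exx (x, t))"
  by (rule slice_integrable(1)[of _ M]; use M zero in auto)+
 note p1 = gauss_by_parts[OF dx(1)[where t = t] c(1) z(1) M(2) M(3) sg(1)]
 note p2 = gauss_by_parts[OF dx(2)[where t = t] c(2) z(2) M(3) M(4) sg(1)]
 note adj = conv_adjoint(1)[OF _ g, of _ _ sg]
 have q1: "(LBINT z. gauss z * ex (y - sg * z, t)) = - (LBINT z. gauss1 z * e (y - sg * z, t)) / sg" for y
  using p1(1)[of y] sg(1) by (simp add: field_simps)
 have q2: "(LBINT z. gauss z * exx (y - sg * z, t)) = (LBINT z. gauss2 z * e (y - sg * z, t)) / (2 * r)" for y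
 proof -
  have "sg * (LBINT z. gauss z * exx (y - sg * z, t)) = - (LBINT z. gauss1 z * ex (y - sg * z, t))"
   by (rule p2(1))
  hence "sg * (sg * (LBINT z. gauss z * exx (y - sg * z, t))) = (LBINT z. gauss2 z * e (y - sg * z, t))"
   using p1(2)[of y] by simp
  hence "(2 * r) * (LBINT z. gauss z * exx (y - sg * z, t)) = (LBINT z. gauss2 z * e (y - sg * z, t))"
   unfolding sg(2)[symmetric] by (simp only: mult.assoc)
  thus ?thesis using r by (simp add: eq_divide_eq mult.commute)
 qed
 have "(LBINT x. ex (x, t) * conv gauss sg g x) = (LBINT y. g y * (- (LBINT z. gauss1 z * e (y - sg * z, t)) / sg))"
  unfolding q1[symmetric] by (rule adj[OF gauss_integrable(1) i(2)])
 also have "... = - (LBINT y. g y * (LBINT z. gauss1 z * e (y - sg * z, t))) / sg" by simp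
 also have "(LBINT y. g y * (LBINT z. gauss1 z * e (y - sg * z, t))) = (LBINT x. e (x, t) * conv gauss1 sg g x)"
  by (rule adj[OF gauss1_integrable(1) i(1), symmetric])
 finally show "(LBINT x. heat r g x * ex (x, t)) = - (LBINT x. heat_x r g x * e (x, t))"
  unfolding heat_def heat_x_def sg_def[symmetric] by (simp add: mult.commute)
 have "(LBINT x. exx (x, t) * conv gauss sg g x) = (LBINT y. g y * ((LBINT z. gauss2 z * e (y - sg * z, t)) / (2 * r)))"
  unfolding q2[symmetric] by (rule adj[OF gauss_integrable(1) i(3)])
 also have "... = (LBINT y. g y * (LBINT z. gauss2 z * e (y - sg * z, t))) / (2 * r)" by simp
 also have "(LBINT y. g y * (LBINT z. gauss2 z * e (y - sg * z, t))) = (LBINT x. e (x, t) * conv gauss2 sg g x)"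
  by (rule adj[OF gauss2_integrable(1) i(1), symmetric])
 finally show "(LBINT x. heat r g x * exx (x, t)) = (LBINT x. heat_xx r g x * e (x, t))"
  unfolding heat_def heat_xx_def sg_def[symmetric] by (simp add: mult.commute)
qed

text \<open>The integrand is, after one integration by parts in z, the r-derivative of e along the curve (y - sqrt (2r) z,
ta + r); it integrates to the value at the starting point. This is the fundamental solution property in dual
form.\<close>
lemma heat_equation_dual_point:
 "(LBINT r. ind {0<..} r * (LBINT z. gauss z * (et (y - sqrt (2 * r) * z, ta + r) + exx (y - sqrt (2 * r) * z, ta + r)))) = - e (y, ta)"
proof -
 obtain M where M: "0 <= M" "!!z. abs(e z) <= M" "!!z. abs(ex z) <= M" "!!z. abs(exx z) <= M" "!!z. abs(et z) <= M"
  by (rule test_bound) blast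
 define R where "R = abs(T) + abs(ta) + 1"
 have R: "0 < R" "!!r. R <= r ==> T <= ta + r" by (auto simp: R_def)
 define P where "P r z = (y - sqrt (2 * r) * z, ta + r)" for r z :: real
 define D where "D r z = et (P r z) - z / sqrt (2 * r) * ex (P r z)" for r z
 have zR: "e (P r z) = 0" "ex (P r z) = 0" "et (P r z) = 0" "exx (P r z) = 0" if "R <= r" for r z
  using zero[of "y - sqrt (2 * r) * z" "ta + r"] R(2)[OF that] by (auto simp: P_def)
 have step1: "(LBINT z. gauss z * (et (P r z) + exx (P r z))) = (LBINT z. gauss z * D r z)" if r: "0 < r" for r
 proof -
  define sg where "sg = sqrt (2 * r)"
  have sg: "0 < sg" using r by (simp add: sg_def)
  have c: "continuous_on UNIV (%x. exx (x, ta + r))"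
   by (rule continuous_on_compose2[OF cont(3)]) (auto intro!: continuous_intros)
  have z: "ex (x, ta + r) = 0" if "x \<notin> {0..1}" for x using zero[of x "ta + r"] that by auto
  have "sg * (LBINT z. gauss z * exx (y - sg * z, ta + r)) = - (LBINT z. gauss1 z * ex (y - sg * z, ta + r))"
   by (rule gauss_by_parts(1)[OF dx(2)[where t = "ta + r"] c z M(3) M(4) sg])
  moreover have "I = - J / sg" if "sg * I = - J" for I J :: real using that sg by (simp add: field_simps)
  ultimately have x: "(LBINT z. gauss z * exx (y - sg * z, ta + r)) = - (LBINT z. gauss1 z * ex (y - sg * z, ta + r)) / sg"
   by blast
  have g: "Lint (%z. k z * f (y - sg * z, ta + r))" if "Lint k" and [measurable]: "f \<in> BM" and "!!z. abs(f z) <= M" for k f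
  proof -
   have m: "(%x. f (x, ta + r)) \<in> BM" by measurable
   have "Lint (%z. k z * f (y + (-sg) * z, ta + r))" by (rule conv_integrable[OF that(1) m that(3)])
   thus ?thesis by simp
  qed
  note i = g[OF gauss_integrable(1) e_measurable(4) M(5)] g[OF gauss_integrable(1) e_measurable(3) M(4)] g[OF gauss1_integrable(1) e_measurable(2) M(3)]
  have "(LBINT z. gauss z * (et (P r z) + exx (P r z))) = (LBINT z. gauss z * et (y - sg * z, ta + r)) + (LBINT z. gauss z * exx (y - sg * z, ta + r))"
   using i by (simp add: P_def sg_def[symmetric] distrib_left)
  also have "... = (LBINT z. gauss z * et (y - sg * z, ta + r)) - (LBINT z. gauss1 z * ex (y - sg * z, ta + r) / sg)"
   unfolding x by simp
  also have "... = (LBINT z. gauss z * et (y - sg * z, ta + r) - gauss1 z * ex (y - sg * z, ta + r) / sg)"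
   by (rule intdiff[symmetric]) (use i in simp_all)
  also have "... = (LBINT z. gauss z * D r z)"
   unfolding D_def P_def sg_def[symmetric]
   by (rule integral_cong_refl) (simp add: gauss1_def algebra_simps)
  finally show ?thesis .
 qed
 define m where "m r = 2 * M * (ind {0<..<R} r + ind {0<..<R} r * r powr (1/2 - 1))" for r
 have mi: "Lint m"
 proof -
  have "Lint (%r. ind {0<..<R} r * r powr (1/2 - 1))"
   by (rule integrable.intros[OF powr_integral(1)]) (use R in auto)
  moreover have "Lint (ind {0<..<R} :: real => real)" using R(1) by (intro integrable_real_indicator) auto
  ultimately show ?thesis unfolding m_def[abs_def] by simp
 qed
 have Db: "abs(D r z) <= M + M * abs(z) * r powr (1/2 - 1)" if r: "0 < r" for r z
 proof -
  have s: "1 / sqrt (2 * r) <= r powr (1/2 - 1)"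
  proof -
   have "r powr (1/2 - 1) = r powr (- (1/2))" by simp
   also have "... = 1 / sqrt r" by (simp only: powr_minus_divide powr_half_sqrt[OF less_imp_le[OF r]])
   finally show ?thesis using frac_le[of 1 1 "sqrt r" "sqrt (2 * r)"] r by simp
  qed
  have "abs(z / sqrt (2 * r) * ex (P r z)) = (abs(z) * abs(ex (P r z))) * (1 / sqrt (2 * r))" using r by (simp add: abs_mult)
  also have "... <= (abs(z) * M) * r powr (1/2 - 1)" by (intro mult_mono s M mult_nonneg_nonneg) (use r M in auto)
  finally have "abs(z / sqrt (2 * r) * ex (P r z)) <= M * abs(z) * r powr (1/2 - 1)" by (simp add: mult_ac)
  thus ?thesis using M(5)[of "P r z"] unfolding D_def by linarith
 qed
 let ?F = "%r z. ind {0<..<R} r * (gauss z * D r z)"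
 have Fm: "(%p::pt. ?F (fst p) (snd p)) \<in> BM" unfolding D_def P_def by measurable
 have bF: "(NN z. en (abs(?F r z))) <= en (m r)" for r
 proof (cases "r \<in> {0<..<R}")
  case True
  define q where "q = r powr (1/2 - 1)"
  have q: "0 <= q" by (simp add: q_def)
  have i: "Lint (%z. gauss z * M + (gauss z * abs(z)) * (M * q))"
   using gauss_moments(2)[of 1] gauss_integrable by (intro iadd integrable_mult_left) simp_all
  have "(NN z. en (abs(?F r z))) <= (NN z. en (gauss z * M + (gauss z * abs(z)) * (M * q)))"
  proof (intro nn_integral_mono ennreal_leI)
   fix z
   have "gauss z * abs(D r z) <= gauss z * (M + M * abs(z) * q)" using Db[of r z] True by (intro mult_left_mono) (auto simp: q_def gauss_pos less_imp_le)
   then show "abs(?F r z) <= gauss z * M + (gauss z * abs(z)) * (M * q)" using True by (simp add: abs_mult algebra_simps)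
  qed
  also have "... = en (LBINT z. gauss z * M + (gauss z * abs(z)) * (M * q))"
   using i by (rule nn_integral_eq_integral) (auto simp: M q intro!: add_nonneg_nonneg mult_nonneg_nonneg less_imp_le[OF gauss_pos])
  also have "(LBINT z. gauss z * M + (gauss z * abs(z)) * (M * q)) = M + (LBINT z. gauss z * abs(z)) * (M * q)"
   using gauss_moments(2)[of 1] gauss_integrable by (subst intadd) (simp_all del: mult_cancel_left2)
  also have "en (M + (LBINT z. gauss z * abs(z)) * (M * q)) <= en (m r)"
  proof (rule ennreal_leI)
   have "(LBINT z. gauss z * abs(z)) * (M * q) <= 1 * (M * q)" using gauss_abs_moment M(1) q by (intro mult_right_mono) auto
   moreover have "m r = 2 * M + 2 * (M * q)" using True R(1) by (simp add: m_def q_def algebra_simps)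
   moreover have "0 <= M * q" using M(1) q by simp
   ultimately show "M + (LBINT z. gauss z * abs(z)) * (M * q) <= m r" using M(1) by linarith
  qed
  finally show ?thesis .
 qed auto
 have ftc: "(LBINT r. ind {0<..<R} r * D r z) = - e (y, ta)" for z
 proof -
  have mD: "(%r. D r z) \<in> BM" unfolding D_def P_def by measurable
  have i: "Lint (%r. ind {0<..<R} r *\<^sub>R D r z)"
  proof (rule ibound[OF iadd[OF integrable_mult_left[of M lborel "ind {0<..<R}"] integrable_mult_left[of "M * abs(z)" lborel "%r. ind {0<..<R} r * r powr (1/2 - 1)"]]])
   show "AE r in lborel. norm (ind {0<..<R} r *\<^sub>R D r z) <= norm (ind {0<..<R} r * M + ind {0<..<R} r * r powr (1/2 - 1) * (M * abs(z)))"
   proof (rule AE_I2)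
    fix r show "norm (ind {0<..<R} r *\<^sub>R D r z) <= norm (ind {0<..<R} r * M + ind {0<..<R} r * r powr (1/2 - 1) * (M * abs(z)))"
    using Db[of r z] M(1) by (cases "r \<in> {0<..<R}") (auto simp: mult_ac)
   qed
  qed (use mD powr_integral(1)[of "1/2" R] R(1) in \<open>auto simp: has_bochner_integral_iff\<close>)
  have "((%r. D r z) has_integral e (P R z) - e (P 0 z)) {0..R}"
  proof (rule fundamental_theorem_of_calculus_interior)
   show "continuous_on {0..R} (%r. e (P r z))"
    unfolding P_def by (rule continuous_on_compose2[OF cont(1)]) (auto intro!: continuous_intros)
   show "((%r. e (P r z)) has_vector_derivative D r z) (at r)" if "r \<in> {0<..<R}" for r
    using curve[of r y z ta] that unfolding D_def P_def by (simp add: has_real_derivative_iff_has_vector_derivative)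
  qed (use R in simp)
  hence "((%r. D r z) has_integral - e (y, ta)) {0<..<R}"
   using zR[of R z] by (simp add: P_def has_integral_Icc_iff_Ioo)
  moreover have "(LINT r:{0<..<R}|lborel. D r z) = integral {0<..<R} (%r. D r z)"
   by (rule set_borel_integral_eq_integral) (unfold set_integrable_def, rule i)
  ultimately show ?thesis by (simp add: set_lebesgue_integral_def integral_unique)
 qed
 have "(LBINT r. ind {0<..} r * (LBINT z. gauss z * (et (P r z) + exx (P r z)))) = (LBINT r. LBINT z. ?F r z)"
 proof (rule integral_cong_refl)
  fix r
  show "ind {0<..} r * (LBINT z. gauss z * (et (P r z) + exx (P r z))) = (LBINT z. ?F r z)"
   using step1[of r] zR[of r] by (cases "0 < r"; cases "r < R") auto
 qed
 also have "... = (LBINT z. LBINT r. ?F r z)" by (rule swap_dominated(2)[OF Fm _ mi]) (use bF in auto)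
 also have "... = (LBINT z. gauss z * (- e (y, ta)))"
 proof (rule integral_cong_refl)
  fix z
  have "(LBINT r. ?F r z) = (LBINT r. gauss z * (ind {0<..<R} r * D r z))" by (simp add: mult_ac)
  then show "(LBINT r. ?F r z) = gauss z * (- e (y, ta))" using ftc[of z] by simp
 qed
 also have "... = - e (y, ta)" using gauss_integrable by simp
 finally show ?thesis by (simp add: P_def)
qed

end

section \<open>Duhamel integrals\<close>

text \<open>With X a derivative of the heat semigroup this is the formal derivative of the Duhamel integral, so that the
three cases share one definition.\<close>
definition duhamel :: "(real => (real => real) => real => real) => (pt => real) => pt => real" where
 "duhamel X h z = (LBINT ta. ind {0<..<snd z} ta * X (snd z - ta) (%y. h (y, ta)) (fst z))"

lemma indicator_upto_measurable:
 fixes a b :: "'a::second_countable_topology => real"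
 assumes [measurable]: "a \<in> BM" "b \<in> BM"
 shows "(%p. ind {0<..<a p} (b p) :: real) \<in> BM"
 unfolding indicator_def of_bool_def greaterThanLessThan_iff by measurable

lemma duhamel_measurable:
 assumes [measurable]: "(%p::(pt)\<times>real. X (snd (fst p) - snd p) (%y. h (y, snd p)) (fst (fst p))) \<in> BM"
 shows "duhamel X h \<in> BM"
proof -
 have [measurable]: "(%p::(pt)\<times>real. ind {0<..<snd (fst p)} (snd p) :: real) \<in> BM"
  by (rule indicator_upto_measurable) measurable
 show ?thesis unfolding duhamel_def[abs_def] by (rule borel_param_integral) measurable
qed

lemma duhamel_bound:
 assumes h: "h \<in> BM" "!!z. abs(h z) <= 1"
 shows "Lint (%ta. ind {0<..<t} ta * heat (t - ta) (%y. h (y, ta)) x)"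
  and "abs(duhamel heat h z) <= abs(snd z)"
proof -
 have [measurable]: "h \<in> BM" by (rule h)
 have hs: "(%y. h (y, ta)) \<in> BM" "!!y. abs(h (y, ta)) <= 1" for ta using h(2) by measurable
 have [measurable]: "(%ta. heat (t - ta) (%y. h (y, ta)) x) \<in> BM" for x t
  by (intro heat_source_measurable h) measurable
 have i: "Lint (ind {0<..<t} :: real => real)" for t
  by (cases "0 <= t") (auto simp: integrable_real_indicator)
 have b: "norm (ind {0<..<t} ta * heat (t - ta) (%y. h (y, ta)) x) <= ind {0<..<t} ta" for ta t x
  using heat_bound[OF hs] by (auto simp: indicator_def)
 show j: "Lint (%ta. ind {0<..<t} ta * heat (t - ta) (%y. h (y, ta)) x)" for t x
  by (rule ibound[OF i[of t]]) (use b in \<open>auto intro!: AE_I2\<close>)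
 have "norm (duhamel heat h z) <= (LBINT ta. norm (ind {0<..<snd z} ta * heat (snd z - ta) (%y. h (y, ta)) (fst z)))"
  unfolding duhamel_def by (rule integral_norm_bound)
 also have "... <= (LBINT ta. ind {0<..<snd z} ta)"
  by (intro integral_mono integrable_norm i j b)
 also have "... <= abs(snd z)" by (cases "0 <= snd z") auto
 finally show "abs(duhamel heat h z) <= abs(snd z)" by simp
qed

context testfun
begin

definition "L z = et z + exx z"

lemma L_props:
 obtains M where "0 <= M" "!!z. abs(L z) <= M" "L \<in> BM"
  "!!x t. \<not> (0 < x \<and> x < 1 \<and> 0 < t \<and> t < T) ==> L (x, t) = 0"
proof -
 obtain M where M: "0 <= M" "!!z. abs(e z) <= M" "!!z. abs(ex z) <= M" "!!z. abs(exx z) <= M" "!!z. abs(et z) <= M"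
  by (rule test_bound) blast
 show thesis
 proof (rule that[of "2 * M"])
  show "abs(L z) <= 2 * M" for z using M(4)[of z] M(5)[of z] unfolding L_def by linarith
  show "L (x, t) = 0" if "\<not> (0 < x \<and> x < 1 \<and> 0 < t \<and> t < T)" for x t using zero[OF that] by (simp add: L_def)
 qed (use M in \<open>auto simp: L_def[abs_def]\<close>)
qed

lemma heat_equation_dual:
 assumes g: "g \<in> BM" "!!y. abs(g y) <= B"
 shows "(LBINT r. ind {0<..} r * (LBINT x. heat r g x * L (x, ta + r))) = - (LBINT y. g y * e (y, ta))"
proof -
 obtain M where M: "0 <= M" "!!z. abs(L z) <= M" and [measurable]: "L \<in> BM"
  and z: "!!x t. \<not> (0 < x \<and> x < 1 \<and> 0 < t \<and> t < T) ==> L (x, t) = 0" by (rule L_props) blast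
 have [measurable]: "g \<in> BM" by (rule g)
 have B: "0 <= B" using g(2)[of 0] by simp
 define R where "R = abs(T) + abs(ta) + 1"
 have R: "0 < R" "!!r. R <= r ==> T <= ta + r" by (auto simp: R_def)
 define K where "K r y = (LBINT z. gauss z * L (y - sqrt (2 * r) * z, ta + r))" for r y
 have Km [measurable]: "(%p::pt. K (fst p) (snd p)) \<in> BM"
  unfolding K_def by (rule borel_param_integral) measurable
 have K0: "K r y = 0" if "R <= r" for r y using z[where t = "ta + r"] R(2)[OF that] by (simp add: K_def)
 have adj: "(LBINT x. heat r g x * L (x, ta + r)) = (LBINT y. g y * K r y)" for r
 proof -
  have i: "Lint (%x. L (x, ta + r))" by (rule slice_integrable(1)[of _ M]) (use M z in auto)
  have "(LBINT x. L (x, ta + r) * conv gauss (sqrt (2 * r)) g x) = (LBINT y. g y * K r y)"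
   unfolding K_def by (rule conv_adjoint(1)[OF gauss_integrable(1) g i])
  thus ?thesis unfolding heat_def by (simp only: mult.commute)
 qed
 let ?F = "%r y. ind {0<..<R} r * (g y * K r y)"
 have bF: "(NN y. en (abs(?F r y))) <= en (ind {0<..<R} r * (B * M))" for r
 proof (cases "r \<in> {0<..<R}")
  case True
  define sg where "sg = sqrt (2 * r)"
  have Kb: "en (abs(g y * K r y)) <= en B * (NN z. en (gauss z) * en (abs(L (y - sg * z, ta + r))))" for y
  proof -
   have m: "(%x. L (x, ta + r)) \<in> BM" by measurable
   have "Lint (%z. gauss z * L (y + (- sg) * z, ta + r))" by (rule conv_integrable[OF gauss_integrable(1) m M(2)])
   hence i: "Lint (%z. gauss z * L (y - sg * z, ta + r))" by simp
   have "en (abs(g y * K r y)) = en (abs(g y)) * en (norm (K r y))" by (simp add: abs_mult ennreal_mult)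
   also have "... <= en B * (NN z. en (norm (gauss z * L (y - sg * z, ta + r))))"
    unfolding K_def sg_def[symmetric] by (intro mult_mono ennreal_leI g integral_norm_bound_ennreal[OF i]) auto
   also have "(NN z. en (norm (gauss z * L (y - sg * z, ta + r)))) = (NN z. en (gauss z) * en (abs(L (y - sg * z, ta + r))))"
    by (intro nn_integral_cong) (simp add: abs_mult ennreal_mult less_imp_le[OF gauss_pos])
   finally show ?thesis .
  qed
  have "(NN y. en (abs(?F r y))) <= (NN y. en B * (NN z. en (gauss z) * en (abs(L (y - sg * z, ta + r)))))"
   using True Kb by (intro nn_integral_mono) simp
  also have "... = en B * (NN y. NN z. en (gauss z) * en (abs(L (y - sg * z, ta + r))))"
  proof (rule nn_integral_cmult)
   have "(%y. NN z. en (gauss z) * en (abs(L (y - sg * z, ta + r)))) \<in> BM"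
    by (rule borel_param_nn_integral) measurable
   then show "(%y. NN z. en (gauss z) * en (abs(L (y - sg * z, ta + r)))) \<in> borel_measurable lborel" by simp
  qed
  also have "(NN y. NN z. en (gauss z) * en (abs(L (y - sg * z, ta + r)))) = (NN z. NN y. en (gauss z) * en (abs(L (y - sg * z, ta + r))))"
   by (rule nn_integral_swap[symmetric]) measurable
  also have "... <= (NN z. en (gauss z) * en M)"
  proof (rule nn_integral_mono)
   fix z' :: real
   have "(NN y. en (abs(L (y, ta + r)))) = en (abs(1)) * (NN y. en (abs(L (- sg * z' + 1 * y, ta + r))))"
    by (rule nn_integral_real_affine) auto
   moreover have "(NN y. en (abs(L (y, ta + r)))) <= en M" by (rule slice_integrable(2)) (use M z in auto)
   ultimately have "(NN y. en (abs(L (y - sg * z', ta + r)))) <= en M" by (simp add: algebra_simps)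
   then show "(NN y. en (gauss z') * en (abs(L (y - sg * z', ta + r)))) <= en (gauss z') * en M"
    by (subst nn_integral_cmult) (auto intro: mult_left_mono)
  qed
  also have "(NN z. en (gauss z) * en M) = en M"
   using gauss_integrable by (simp add: nn_integral_multc nn_integral_eq_integral less_imp_le[OF gauss_pos])
  finally show ?thesis using True B M by (simp add: ennreal_mult mult_left_mono)
 qed auto
 have "(LBINT r. ind {0<..} r * (LBINT x. heat r g x * L (x, ta + r))) = (LBINT r. LBINT y. ?F r y)"
 proof (rule integral_cong_refl)
  fix r show "ind {0<..} r * (LBINT x. heat r g x * L (x, ta + r)) = (LBINT y. ?F r y)"
   unfolding adj using K0[of r] by (cases "0 < r"; cases "r < R") auto
 qed
 also have "... = (LBINT y. LBINT r. ?F r y)"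
  by (rule swap_dominated(2)[where m = "%r. ind {0<..<R} r * (B * M)"]) (use bF R in \<open>measurable, auto\<close>)
 also have "... = (LBINT y. g y * (- e (y, ta)))"
 proof (rule integral_cong_refl)
  fix y
  have "(LBINT r. ?F r y) = (LBINT r. g y * (ind {0<..} r * K r y))"
   by (rule integral_cong_refl) (use K0 in \<open>auto simp: indicator_def not_less\<close>)
  also have "... = g y * (- e (y, ta))"
   unfolding integral_mult_right_zero K_def L_def heat_equation_dual_point ..
  finally show "(LBINT r. ?F r y) = g y * (- e (y, ta))" .
 qed
 also have "... = - (LBINT y. g y * e (y, ta))" by simp
 finally show ?thesis .
qed

lemma initial_dual:
 assumes g: "g \<in> BM" "!!y. abs(g y) <= B"
 shows "(LBINT z. heat (snd z) g (fst z) * L z) = 0"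
proof -
 obtain M where M: "0 <= M" "!!z. abs(L z) <= M" and [measurable]: "L \<in> BM"
  and z: "!!x t. \<not> (0 < x \<and> x < 1 \<and> 0 < t \<and> t < T) ==> L (x, t) = 0" by (rule L_props) blast
 have [measurable]: "(%z::pt. heat (snd z) g (fst z)) \<in> BM"
  by (rule heat_joint_measurable(1)[OF g(1)]) measurable
 have i: "Lint (%z. heat (snd z) g (fst z) * L z)"
 proof (rule integrable_box[where M = "B * M" and T = T])
  show "abs(heat (snd z) g (fst z) * L z) <= B * M" for z
   unfolding abs_mult using heat_bound[OF g, of "snd z" "fst z"] M by (intro mult_mono) (auto intro: order_trans[OF abs_ge_zero])
  show "heat (snd z) g (fst z) * L z = 0" if "z \<notin> {0..1} \<times> {0..T}" for z
   using z[of "fst z" "snd z"] that by (cases z) auto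
 qed measurable
 have "(LBINT z. heat (snd z) g (fst z) * L z) = (LBINT t. LBINT x. heat t g x * L (x, t))"
  by (subst plane_iterated[OF i]) simp
 also have "... = (LBINT r. ind {0<..} r * (LBINT x. heat r g x * L (x, 0 + r)))"
 proof (rule integral_cong_refl)
  fix t show "(LBINT x. heat t g x * L (x, t)) = ind {0<..} t * (LBINT x. heat t g x * L (x, 0 + t))"
   using z[of _ t] by (cases "0 < t") auto
 qed
 also have "... = - (LBINT y. g y * e (y, 0))" by (rule heat_equation_dual[OF g])
 also have "... = 0" using zero[of _ 0] by simp
 finally show ?thesis .
qed

lemma duhamel_dual:
 assumes h: "h \<in> BM" "!!z. abs(h z) <= 1"
 shows "(LBINT z. duhamel heat h z * L z) = - (LBINT z. h z * e z)"
proof -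
 obtain M where M: "0 <= M" "!!z. abs(L z) <= M" and [measurable]: "L \<in> BM"
  and z: "!!x t. \<not> (0 < x \<and> x < 1 \<and> 0 < t \<and> t < T) ==> L (x, t) = 0" by (rule L_props) blast
 obtain M' where M': "0 <= M'" "!!z. abs(e z) <= M'" by (rule test_bound) blast
 have [measurable]: "h \<in> BM" by (rule h)
 have hs: "(%y. h (y, ta)) \<in> BM" "!!y. abs(h (y, ta)) <= 1" for ta using h(2) by measurable
 define V where "V z ta = ind {0<..<snd z} ta * heat (snd z - ta) (%y. h (y, ta)) (fst z)" for z ta
 have Vm [measurable]: "(%p::(pt)\<times>real. V (fst p) (snd p)) \<in> BM"
  unfolding V_def by (intro borel_measurable_times indicator_upto_measurable heat_source_measurable h) measurable
 have Vm2 [measurable]: "(%z. V z ta) \<in> BM" for ta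
  using measurable_compose[OF _ Vm, of "%z. (z, ta)"] by (simp add: borel_prod[symmetric])
 have Vb: "abs(V z ta) <= ind {0<..<snd z} ta" for z ta
  using heat_bound[OF hs] by (auto simp: V_def indicator_def)
 have V1: "abs(V z ta) <= 1" for z ta by (rule order_trans[OF Vb]) (simp add: indicator_def)
 have "(LBINT z. duhamel heat h z * L z) = (LBINT z. LBINT ta. V z ta * L z)"
  by (simp add: duhamel_def V_def)
 also have "... = (LBINT ta. LBINT z. V z ta * L z)"
 proof (rule swap_dominated(2)[where m = "%z. ind ({0..1::real} \<times> {0..T}) z * (abs(T) * M)"])
  show "AE z in lborel. (NN ta. en (abs(V z ta * L z))) <= en (ind ({0..1::real} \<times> {0..T}) z * (abs(T) * M))"
  proof (rule AE_I2)
   fix z' :: "pt"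
   obtain x t where xt: "z' = (x, t)" by (cases z')
   show "(NN ta. en (abs(V z' ta * L z'))) <= en (ind ({0..1} \<times> {0..T}) z' * (abs(T) * M))"
   proof (cases "0 < x \<and> x < 1 \<and> 0 < t \<and> t < T")
    case True
    have "(NN ta. en (abs(V z' ta * L z'))) <= (NN ta. en M * ind {0<..<t} ta)"
    proof (rule nn_integral_mono)
    fix ta
    have "abs(V z' ta * L z') <= ind {0<..<t} ta * M" unfolding abs_mult using Vb[of z' ta] M xt by (intro mult_mono) auto
    then show "en (abs(V z' ta * L z')) <= en M * ind {0<..<t} ta" by (cases "ta \<in> {0<..<t}") (auto intro: ennreal_leI)
    qed
    also have "... = en M * en t" using True by (simp add: nn_integral_cmult)
    also have "... <= en (abs(T) * M)" using True M by (simp add: ennreal_mult[symmetric] mult.commute mult_left_mono ennreal_leI)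
    finally show ?thesis using True xt by simp
   qed (use z xt in auto)
  qed
  show "Lint (%z. ind ({0..1::real} \<times> {0..T}) z * (abs(T) * M))"
  proof (rule integrable_box[where M = "abs(T) * M" and T = T])
   have "{0..1::real} \<times> {0..T} \<in> sets borel" by (intro borel_closed closed_Times) auto
   then show "(%z. ind ({0..1::real} \<times> {0..T}) z * (abs(T) * M)) \<in> BM" by measurable
  qed (use M in \<open>auto simp: indicator_def\<close>)
 qed measurable
 also have "... = (LBINT ta. - (LBINT y. h (y, ta) * e (y, ta)))"
 proof (rule integral_cong_refl)
  fix ta
  have i: "Lint (%z. V z ta * L z)"
  proof (rule integrable_box[where M = "1 * M" and T = T])
   show "abs(V z ta * L z) <= 1 * M" for z unfolding abs_mult using V1 M by (intro mult_mono) auto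
   show "V z ta * L z = 0" if "z \<notin> {0..1} \<times> {0..T}" for z using z[of "fst z" "snd z"] that by (cases z) auto
  qed measurable
  show "(LBINT z. V z ta * L z) = - (LBINT y. h (y, ta) * e (y, ta))"
  proof (cases "0 < ta")
   case True
   let ?G = "%t. ind {0<..} (t - ta) * (LBINT x. heat (t - ta) (%y. h (y, ta)) x * L (x, t))"
   have "(LBINT z. V z ta * L z) = (LBINT t. ?G t)"
    unfolding plane_iterated[OF i] using True by (intro integral_cong_refl) (auto simp: V_def indicator_def)
   also have "... = abs(1) *\<^sub>R (LBINT r. ?G (ta + 1 * r))" by (rule lborel_integral_real_affine) simp
   also have "... = - (LBINT y. h (y, ta) * e (y, ta))" using heat_equation_dual[OF hs, of ta ta] by simp
   finally show ?thesis .
  qed (use zero[of _ ta] in \<open>simp add: V_def indicator_def\<close>)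
 qed
 also have "... = - (LBINT ta. LBINT y. h (y, ta) * e (y, ta))" by simp
 also have "(LBINT ta. LBINT y. h (y, ta) * e (y, ta)) = (LBINT z. h z * e z)"
 proof (rule plane_iterated[symmetric], rule integrable_box[where M = "1 * M'" and T = T])
  show "abs(h z * e z) <= 1 * M'" for z unfolding abs_mult using h M' by (intro mult_mono) auto
  show "h z * e z = 0" if "z \<notin> {0..1} \<times> {0..T}" for z using zero[of "fst z" "snd z"] that by (cases z) auto
 qed measurable
 finally show ?thesis .
qed

text \<open>The derivative may be moved under the Duhamel integral because its kernel is dominated at almost every x.\<close>
lemma duhamel_dual_space:
 fixes X :: "real => (real => real) => real => real"
 assumes h: "h \<in> BM" "!!z. abs(h z) <= 1"
  and slice: "!!r g t. 0 < r ==> g \<in> BM ==> (!!y. abs(g y) <= 1) ==> (LBINT x. heat r g x * f (x, t)) = c * (LBINT x. X r g x * e (x, t))"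
  and f: "f \<in> BM" "!!z. abs(f z) <= M" "!!x t. \<not> (0 < x \<and> x < 1 \<and> 0 < t \<and> t < T) ==> f (x, t) = 0"
  and Xm: "(%p::(pt)\<times>real. X (snd (fst p) - snd p) (%y. h (y, snd p)) (fst (fst p))) \<in> BM"
  and Xb: "!!t. 0 < t ==> t < T ==> AE x in lborel. 0 < x \<longrightarrow> x < 1 \<longrightarrow> (NN ta. ind {0<..<t} ta * en (abs(X (t - ta) (%y. h (y, ta)) x))) <= en (N x t)"
  and N: "!!t. Lint (%x. ind {0<..<1} x * N x t)"
  and W: "Lint (%z. duhamel X h z * e z)"
 shows "(LBINT z. duhamel heat h z * f z) = c * (LBINT z. duhamel X h z * e z)"
proof -
 obtain M' where M': "0 <= M'" "!!z. abs(e z) <= M'" by (rule test_bound) blast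
 have M: "0 <= M" using f(2)[of 0] by simp
 have [measurable]: "h \<in> BM" "f \<in> BM" by (rule h f)+
 have hs: "(%y. h (y, ta)) \<in> BM" "!!y. abs(h (y, ta)) <= 1" for ta using h(2) by measurable
 have dm: "duhamel heat h \<in> BM"
  by (intro duhamel_measurable heat_source_measurable h) measurable
 have i1: "Lint (%z. duhamel heat h z * f z)"
 proof (rule integrable_box[where M = "abs(T) * M" and T = T])
  show "(%z. duhamel heat h z * f z) \<in> BM" using dm by measurable
  show "abs(duhamel heat h z * f z) <= abs(T) * M" for z
  proof (cases z)
   case (Pair x t)
   have "abs(duhamel heat h (x, t)) * abs(f (x, t)) <= abs(T) * M" if "0 < t" "t < T"
    using duhamel_bound(2)[OF h, of "(x, t)"] f(2)[of "(x, t)"] that M by (intro mult_mono) auto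
   thus ?thesis using Pair f(3)[of x t] M by (cases "0 < t \<and> t < T") (auto simp: abs_mult)
  qed
  show "duhamel heat h z * f z = 0" if "z \<notin> {0..1} \<times> {0..T}" for z using f(3)[of "fst z" "snd z"] that by (cases z) auto
 qed
 have "(LBINT x. duhamel heat h (x, t) * f (x, t)) = c * (LBINT x. duhamel X h (x, t) * e (x, t))" for t
 proof (cases "0 < t \<and> t < T")
  case t: True
  let ?H = "%x ta. ind {0<..<t} ta * (heat (t - ta) (%y. h (y, ta)) x * f (x, t))"
  let ?Y = "%x ta. ind {0<..<t} ta * (X (t - ta) (%y. h (y, ta)) x * e (x, t))"
  have hm: "(%p::pt. heat (t - snd p) (%y. h (y, snd p)) (fst p)) \<in> BM"
   by (intro heat_source_measurable h) measurable
  have "(%p::pt. ((fst p, t), snd p)) \<in> borel \<rightarrow>\<^sub>M borel" by (intro borel_measurable_continuous_onI continuous_intros)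
  from measurable_compose[OF this Xm] have Xm': "(%p::pt. X (t - snd p) (%y. h (y, snd p)) (fst p)) \<in> BM" by simp
  have "(LBINT x. duhamel heat h (x, t) * f (x, t)) = (LBINT x. LBINT ta. ?H x ta)"
   by (simp add: duhamel_def mult.assoc[symmetric])
  also have "... = (LBINT ta. LBINT x. ?H x ta)"
  proof (rule swap_dominated(2)[where m = "%x. ind {0<..<1} x * (t * M)"])
   show "AE x in lborel. (NN ta. en (abs(?H x ta))) <= en (ind {0<..<1} x * (t * M))"
   proof (rule AE_I2)
    fix x
    have "(NN ta. en (abs(?H x ta))) <= (NN ta. en (ind {0<..<1} x * M) * ind {0<..<t} ta)"
    proof (rule nn_integral_mono)
    fix ta
    have "abs(heat (t - ta) (%y. h (y, ta)) x) * abs(f (x, t)) <= 1 * M" using heat_bound[OF hs] f(2) by (intro mult_mono) auto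
    then show "en (abs(?H x ta)) <= en (ind {0<..<1} x * M) * ind {0<..<t} ta"
    using f(3)[of x t] by (cases "ta \<in> {0<..<t}"; cases "x \<in> {0<..<1}") (auto simp: abs_mult intro!: ennreal_leI)
    qed
    also have "... = en (ind {0<..<1} x * (t * M))"
    using t M by (subst nn_integral_cmult_indicator) (simp_all add: ennreal_mult[symmetric] mult_ac)
    finally show "(NN ta. en (abs(?H x ta))) <= en (ind {0<..<1} x * (t * M))" .
   qed
   show "(%p. ?H (fst p) (snd p)) \<in> BM"
    by (intro borel_measurable_times indicator_upto_measurable hm) measurable
   show "Lint (%x. ind {0<..<1::real} x * (t * M))"
    by (intro imultl integrable_real_indicator) auto
  qed
  also have "... = (LBINT ta. c * (LBINT x. ?Y x ta))"
  proof (rule integral_cong_refl)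
   fix ta show "(LBINT x. ?H x ta) = c * (LBINT x. ?Y x ta)"
    using slice[OF _ hs, of "t - ta" ta t] by (cases "ta \<in> {0<..<t}") auto
  qed
  also have "... = c * (LBINT ta. LBINT x. ?Y x ta)" by simp
  also have "(LBINT ta. LBINT x. ?Y x ta) = (LBINT x. LBINT ta. ?Y x ta)"
  proof (rule swap_dominated(2)[where m = "%x. ind {0<..<1} x * N x t * M'", symmetric])
   show "AE x in lborel. (NN ta. en (abs(?Y x ta))) <= en (ind {0<..<1} x * N x t * M')"
    using Xb[OF conjunct1[OF t] conjunct2[OF t]]
   proof (eventually_elim)
    case (elim x)
    show ?case
    proof (cases "0 < x \<and> x < 1")
    case True
    have xm: "(%ta. X (t - ta) (%y. h (y, ta)) x) \<in> BM"
    proof -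
    have "(%ta::real. ((x, t), ta)) \<in> borel \<rightarrow>\<^sub>M borel" by (intro borel_measurable_continuous_onI continuous_intros)
    from measurable_compose[OF this Xm] show ?thesis by simp
    qed
    have "(NN ta. en (abs(?Y x ta))) <= (NN ta. en M' * (ind {0<..<t} ta * en (abs(X (t - ta) (%y. h (y, ta)) x))))"
    proof (rule nn_integral_mono)
    fix ta
    have "abs(X (t - ta) (%y. h (y, ta)) x) * abs(e (x, t)) <= M' * abs(X (t - ta) (%y. h (y, ta)) x)"
    using M'(2)[of "(x, t)"] by (subst mult.commute) (intro mult_right_mono; simp)
    then show "en (abs(?Y x ta)) <= en M' * (ind {0<..<t} ta * en (abs(X (t - ta) (%y. h (y, ta)) x)))"
    using M'(1) by (cases "ta \<in> {0<..<t}") (auto simp: abs_mult ennreal_mult[symmetric] intro!: ennreal_leI)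
    qed
    also have "... = en M' * (NN ta. ind {0<..<t} ta * en (abs(X (t - ta) (%y. h (y, ta)) x)))"
    using xm by (intro nn_integral_cmult) measurable
    also have "... <= en M' * en (N x t)" using elim True by (intro mult_left_mono) auto
    also have "... = en (ind {0<..<1} x * N x t * M')" using True M'(1) by (simp add: ennreal_mult' mult.commute)
    finally show ?thesis .
    qed (use zero[of x t] in auto)
   qed
   show "Lint (%x. ind {0<..<1} x * N x t * M')" using N[of t] by (rule imultl)
   show "(%p. ?Y (fst p) (snd p)) \<in> BM"
    by (intro borel_measurable_times indicator_upto_measurable Xm') measurable
  qed
  also have "(LBINT x. LBINT ta. ?Y x ta) = (LBINT x. duhamel X h (x, t) * e (x, t))"
   by (simp add: duhamel_def mult.assoc[symmetric])
  finally show ?thesis .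
 qed (use f(3)[of _ t] zero[of _ t] in simp)
 thus ?thesis unfolding plane_iterated[OF i1] plane_iterated[OF W] by simp
qed

end

section \<open>Bounds in the Lebesgue spaces\<close>

lemma abs_powr_integral:
 fixes a p :: real
 assumes a: "0 <= a" "a <= 1" and p: "0 <= p" "p < 1"
 shows "(NN x. ind {0<..<1} x * en (abs(x - a) powr - p)) <= en (2 / (1 - p))"
proof -
 let ?g = "%r. ind {0<..<1} r * en (r powr - p)"
 have g: "integral\<^sup>N lborel ?g = en (1 / (1 - p))" using powr_integral(2)[of "1 - p" 1] p by simp
 have g1: "(NN x. ?g (x - a)) = en (1 / (1 - p))"
  using nn_integral_real_affine[of ?g 1 "-a"] by (simp add: g[symmetric] algebra_simps)
 have g2: "(NN x. ?g (a - x)) = en (1 / (1 - p))"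
  using nn_integral_real_affine[of ?g "-1" a] by (simp add: g[symmetric] algebra_simps)
 have "(NN x. ind {0<..<1} x * en (abs(x - a) powr - p)) <= (NN x. ?g (x - a) + ?g (a - x))"
 proof (rule nn_integral_mono)
  fix x show "ind {0<..<1} x * en (abs(x - a) powr - p) <= ?g (x - a) + ?g (a - x)"
   using a by (cases x a rule: linorder_cases) (auto simp: indicator_def)
 qed
 also have "... = en (2 / (1 - p))"
  using p by (subst nn_integral_add) (auto simp: g1 g2 ennreal_plus[symmetric] simp del: ennreal_plus)
 finally show ?thesis .
qed

definition gauss2_mass :: real where "gauss2_mass = (LBINT z. abs(gauss2 z) * (1 + abs(z)))"

lemma gauss2_mass_integrable: "Lint (%z. abs(gauss2 z) * (1 + abs(z)))"
proof -
 have "Lint (%z. abs(gauss2 z) * abs(z) powr 1)"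
  unfolding integrable_iff_bounded using gauss2_moment_finite[of 1] by (auto simp: abs_mult)
 hence "Lint (%z. abs(gauss2 z) + abs(gauss2 z) * abs(z) powr 1)"
  using gauss2_integrable(1) by (intro iadd integrable_abs)
 thus ?thesis by (simp add: distrib_left)
qed

lemma gauss2_mass_nonneg: "0 <= gauss2_mass"
 unfolding gauss2_mass_def by (intro inonneg) simp

text \<open>The kernel has mean zero, so only the part of g that differs from c counts; it is seen by the Gaussian at
distance D, and any power of sqrt r / D is gained.\<close>
lemma heat_xx_near_constant:
 fixes C D p r x c :: real
 assumes g: "g \<in> BM" "!!y. abs(g y) <= 1" and r: "0 < r" and D: "0 < D" and C: "0 <= C" and p: "0 < p" "p <= 1"
  and c: "abs(c) <= 1" "!!y. abs(y - x) + C * sqrt r < D ==> g y = c"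
 shows "abs(heat_xx r g x) <= (2 + C) * gauss2_mass * (r powr (p / 2 - 1) * D powr - p)"
proof -
 define sg where "sg = sqrt (2 * r)"
 have s: "0 <= sg" "sg <= 2 * sqrt r" using r by (auto simp: sg_def real_sqrt_mult intro!: mult_right_mono real_le_lsqrt)
 define a where "a = (sqrt r / D) powr p"
 have a: "0 <= a" by (simp add: a_def)
 have b: "abs(g (x + sg * z) - c) <= 2 * ((2 + C) * a) * (1 + abs(z))" for z
 proof (cases "sg * abs(z) + C * sqrt r < D")
  case True
  hence "g (x + sg * z) = c" using s by (intro c) (simp add: abs_mult)
  thus ?thesis using a C by simp
 next
  case False
  define Y where "Y = (2 + C) * (1 + abs(z))"
  have Y1: "1 <= Y" unfolding Y_def using C mult_mono[of 1 "2 + C" 1 "1 + abs(z)"] by simp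
  have "sg * abs(z) <= (2 * sqrt r) * abs(z)" using s by (intro mult_right_mono) auto
  hence "D <= (2 * sqrt r) * abs(z) + C * sqrt r" using False by linarith
  also have "... <= sqrt r * Y"
  proof -
   have "sqrt r * Y - ((2 * sqrt r) * abs(z) + C * sqrt r) = sqrt r * (2 + C * abs(z))" by (simp add: Y_def algebra_simps)
   moreover have "0 <= sqrt r * (2 + C * abs(z))" using C r by simp
   ultimately show ?thesis by linarith
  qed
  finally have "1 <= (sqrt r / D) * Y" using D by (simp add: field_simps)
  hence "1 <= ((sqrt r / D) * Y) powr p" using p by (simp add: ge_one_powr_ge_zero)
  also have "... = a * Y powr p" unfolding a_def by (rule powr_mult)
  also have "... <= a * Y powr 1" using Y1 p a by (intro mult_left_mono powr_mono) auto
  finally have "1 <= a * Y" using Y1 by simp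
  moreover have "abs(g (x + sg * z) - c) <= 2" using g(2)[of "x + sg * z"] c(1) by linarith
  ultimately have "abs(g (x + sg * z) - c) <= 2 * (a * Y)" by linarith
  thus ?thesis by (simp add: Y_def algebra_simps)
 qed
 have i1: "Lint (%z. gauss2 z * g (x + sg * z))" by (rule conv_integrable[OF gauss2_integrable(1) g])
 have "conv gauss2 sg g x = (LBINT z. gauss2 z * g (x + sg * z) - gauss2 z * c)"
  using i1 gauss2_integrable by (simp add: conv_def)
 also have "... = (LBINT z. gauss2 z * (g (x + sg * z) - c))" by (simp only: right_diff_distrib)
 finally have e: "conv gauss2 sg g x = (LBINT z. gauss2 z * (g (x + sg * z) - c))" .
 have i2: "Lint (%z. gauss2 z * (g (x + sg * z) - c))"
  unfolding right_diff_distrib using i1 gauss2_integrable by (intro idiff) auto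
 have "abs(conv gauss2 sg g x) <= (LBINT z. abs(gauss2 z * (g (x + sg * z) - c)))"
  unfolding e by (rule integral_abs_bound)
 also have "... <= (LBINT z. (2 * ((2 + C) * a)) * (abs(gauss2 z) * (1 + abs(z))))"
 proof (rule integral_mono)
  fix z show "abs(gauss2 z * (g (x + sg * z) - c)) <= (2 * ((2 + C) * a)) * (abs(gauss2 z) * (1 + abs(z)))"
   using mult_left_mono[OF b[of z], of "abs(gauss2 z)"] by (simp add: abs_mult mult_ac)
 qed (intro integrable_abs i2 imultr gauss2_mass_integrable)+
 also have "... = 2 * ((2 + C) * a) * gauss2_mass" unfolding gauss2_mass_def by (rule integral_mult_right_zero)
 finally have f: "abs(conv gauss2 sg g x) <= 2 * ((2 + C) * a) * gauss2_mass" .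
 have a2: "a / r = r powr (p / 2 - 1) * D powr - p"
 proof -
  have "a = r powr (p / 2) / D powr p" using r D by (simp add: a_def powr_divide powr_half_sqrt[symmetric] powr_powr)
  moreover have "r powr (p / 2 - 1) = r powr (p / 2) / r" using r powr_diff[of r "p / 2" 1] by simp
  ultimately show ?thesis by (simp add: powr_minus_divide)
 qed
 have "abs(heat_xx r g x) = abs(conv gauss2 sg g x) / (2 * r)" using r by (simp add: heat_xx_def sg_def)
 also have "... <= (2 * ((2 + C) * a) * gauss2_mass) / (2 * r)" using r f by (intro divide_right_mono) auto
 also have "... = (2 + C) * gauss2_mass * (a / r)" by simp
 finally show ?thesis unfolding a2 .
qed

lemma time_power_integral:
 assumes a: "0 < a" and t: "0 <= t"
 shows "(NN ta. ind {0<..<t} ta * en ((t - ta) powr (a - 1))) = en (t powr a / a)"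
proof -
 let ?g = "%r. ind {0<..<t} r * en (r powr (a - 1))"
 have "integral\<^sup>N lborel ?g = en (abs(-1)) * (NN ta. ?g (t + (-1) * ta))" by (rule nn_integral_real_affine) auto
 moreover have "(NN ta. ?g (t + (-1) * ta)) = (NN ta. ind {0<..<t} ta * en ((t - ta) powr (a - 1)))"
  by (intro nn_integral_cong) (auto simp: indicator_def)
 ultimately show ?thesis using powr_integral(2)[OF a t] by simp
qed

lemma Lq_intro:
 fixes f :: "pt => real"
 assumes [measurable]: "f \<in> BM"
  and i: "(NN t. ind {0<..T} t * (NN x. ind {0<..<1} x * en (abs(f (x, t)) powr q))) < \<infinity>"
 shows "(NN z. en (abs(ind (cylinder T) z * f z) powr q)) < \<infinity>" "f \<in> Lq_space q (cylinder T)"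
proof -
 have [measurable]: "cylinder T \<in> sets borel" by (rule cylinder_sets)
 have e: "abs(ind (cylinder T) z * f z) powr q = ind (cylinder T) z * abs(f z) powr q" for z
  by (simp add: indicator_def)
 have m: "(%p::pt. en (abs(ind (cylinder T) (fst p, snd p) * f (fst p, snd p)) powr q)) \<in> BM" by simp
 have "(NN z. en (abs(ind (cylinder T) z * f z) powr q)) = (NN x. NN t. en (abs(ind (cylinder T) (x, t) * f (x, t)) powr q))"
  by (rule nn_integral_plane) measurable
 also have "... = (NN t. NN x. en (abs(ind (cylinder T) (x, t) * f (x, t)) powr q))"
  by (rule nn_integral_swap[OF m, symmetric])
 also have "... = (NN t. ind {0<..T} t * (NN x. ind {0<..<1} x * en (abs(f (x, t)) powr q)))"
 proof (rule nn_integral_cong)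
  fix t show "(NN x. en (abs(ind (cylinder T) (x, t) * f (x, t)) powr q)) = ind {0<..T} t * (NN x. ind {0<..<1} x * en (abs(f (x, t)) powr q))"
   by (cases "t \<in> {0<..T}") (auto simp: cylinder_def Omega_def indicator_def intro!: nn_integral_cong)
 qed
 also note i
 finally show fin: "(NN z. en (abs(ind (cylinder T) z * f z) powr q)) < \<infinity>" .
 have "Lint (%z. abs(ind (cylinder T) z * f z) powr q)"
  unfolding integrable_iff_bounded using fin by simp
 hence "Lint (%z. ind (cylinder T) z *\<^sub>R (abs(f z)) powr q)" unfolding e by simp
 hence "integrable lebesgue (%z. ind (cylinder T) z *\<^sub>R (abs(f z)) powr q)" by (subst integrable_completion) simp_all
 hence "integrable (lebesgue_on (cylinder T)) (%z. abs(f z) powr q)"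
  by (subst integrable_restrict_space) simp_all
 moreover have "f \<in> borel_measurable (lebesgue_on (cylinder T))" by (intro measurable_restrict_space1 measurable_completion) simp
 ultimately show "f \<in> Lq_space q (cylinder T)" by (simp add: Lq_space_def)
qed

lemma slices_finite:
 fixes T C :: real
 assumes "!!t. 0 < t ==> t <= T ==> (F t :: ennreal) <= en C"
 shows "(NN t. ind {0<..T} t * F t) < \<infinity>"
proof -
 have "(NN t. ind {0<..T} t * F t) <= (NN t. en C * ind {0<..T} t)"
  using assms by (intro nn_integral_mono) (auto simp: indicator_def)
 also have "... < \<infinity>" by (cases "0 <= T") (simp_all add: nn_integral_cmult_indicator ennreal_mult_less_top)
 finally show ?thesis .
qed

lemma Lq_bounded:
 fixes f :: "pt => real"
 assumes "f \<in> BM" and b: "!!x t. 0 < x ==> x < 1 ==> 0 < t ==> t <= T ==> abs(f (x, t)) <= C" and q: "0 < q"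
 shows "(NN z. en (abs(ind (cylinder T) z * f z) powr q)) < \<infinity>" "f \<in> Lq_space q (cylinder T)"
proof -
 have "(NN x. ind {0<..<1} x * en (abs(f (x, t)) powr q)) <= en (C powr q)" if t: "0 < t" "t <= T" for t
 proof -
  have "(NN x. ind {0<..<1} x * en (abs(f (x, t)) powr q)) <= (NN x. en (C powr q) * ind {0<..<1::real} x)"
   using b t q by (intro nn_integral_mono) (auto simp: indicator_def intro!: ennreal_leI powr_mono2)
  thus ?thesis by (simp add: nn_integral_cmult)
 qed
 from Lq_intro[OF assms(1) slices_finite[OF this]]
 show "(NN z. en (abs(ind (cylinder T) z * f z) powr q)) < \<infinity>" "f \<in> Lq_space q (cylinder T)" by blast+
qed

lemma Lq_add:
 assumes f: "f \<in> Lq_space q S" and g: "g \<in> Lq_space q S" and q: "1 <= q"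
 shows "(%z. f z + g z) \<in> Lq_space q S"
proof -
 have fm: "f \<in> borel_measurable (lebesgue_on S)" "g \<in> borel_measurable (lebesgue_on S)"
  and fi: "integrable (lebesgue_on S) (%z. abs(f z) powr q)" "integrable (lebesgue_on S) (%z. abs(g z) powr q)"
  using f g by (auto simp: Lq_space_def)
 note [measurable] = fm
 have "integrable (lebesgue_on S) (%z. abs(f z + g z) powr q)"
 proof (rule ibound[of _ "%z. 2 powr q * (abs(f z) powr q + abs(g z) powr q)"])
  show "integrable (lebesgue_on S) (%z. 2 powr q * (abs(f z) powr q + abs(g z) powr q))"
   using fi by (intro imultr iadd)
  show "AE z in lebesgue_on S. norm (abs(f z + g z) powr q) <= norm (2 powr q * (abs(f z) powr q + abs(g z) powr q))"
  proof (rule AE_I2)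
   fix z
   have "abs(f z + g z) <= 2 * max (abs(f z)) (abs(g z))" by linarith
   hence "abs(f z + g z) powr q <= (2 * max (abs(f z)) (abs(g z))) powr q" using q by (intro powr_mono2) auto
   also have "... = 2 powr q * max (abs(f z)) (abs(g z)) powr q" by (rule powr_mult)
   also have "... <= 2 powr q * (abs(f z) powr q + abs(g z) powr q)" by (intro mult_left_mono) (auto simp: max_def)
   finally have "abs(f z + g z) powr q <= 2 powr q * (abs(f z) powr q + abs(g z) powr q)" .
   then show "norm (abs(f z + g z) powr q) <= norm (2 powr q * (abs(f z) powr q + abs(g z) powr q))"
    unfolding real_norm_def abs_of_nonneg[OF powr_ge_zero] by (rule order_trans[OF _ abs_ge_self])
  qed
 qed measurable
 thus ?thesis using fm by (simp add: Lq_space_def)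
qed

lemma heat_x_bound:
 assumes g: "g \<in> BM" "!!y. abs(g y) <= 1" and r: "0 < r"
 shows "abs(heat_x r g x) <= r powr (1/2 - 1)"
proof -
 have m: "(LBINT z. abs(gauss1 z)) <= 1" using gauss_abs_moment by (simp add: gauss1_def abs_mult mult.commute)
 have "abs(conv gauss1 (sqrt (2 * r)) g x) <= 1 * (LBINT z. abs(gauss1 z))" by (rule conv_bound[OF gauss1_integrable(1) g])
 hence "abs(conv gauss1 (sqrt (2 * r)) g x) <= 1" using m by linarith
 hence "abs(heat_x r g x) <= 1 / sqrt (2 * r)" using r by (simp add: heat_x_def divide_right_mono)
 also have "... <= 1 / sqrt r" using frac_le[of 1 1 "sqrt r" "sqrt (2 * r)"] r by simp
 also have "... = r powr (- (1/2))" by (simp only: powr_minus_divide powr_half_sqrt[OF less_imp_le[OF r]])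
 finally show ?thesis by simp
qed

lemma heat_x_lipschitz_bound:
 assumes g: "g \<in> BM" "!!y. abs(g y) <= B" and L: "0 <= L" "!!x y. abs(g x - g y) <= L * abs(x - y)" and r: "0 < r"
 shows "abs(heat_x r g x) <= L"
proof -
 define sg where "sg = sqrt (2 * r)"
 have s: "0 < sg" using r by (simp add: sg_def)
 have i1: "Lint (%z. gauss1 z * g (x + sg * z))" by (rule conv_integrable[OF gauss1_integrable(1) g])
 have "conv gauss1 sg g x = (LBINT z. gauss1 z * g (x + sg * z) - gauss1 z * g x)"
  using i1 gauss1_integrable by (simp add: conv_def)
 also have "... = (LBINT z. gauss1 z * (g (x + sg * z) - g x))" by (simp only: right_diff_distrib)
 finally have e: "conv gauss1 sg g x = (LBINT z. gauss1 z * (g (x + sg * z) - g x))" .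
 have i2: "Lint (%z. gauss1 z * (g (x + sg * z) - g x))"
  unfolding right_diff_distrib using i1 gauss1_integrable by (intro idiff) auto
 have i3: "Lint (%z. gauss z * z\<^sup>2)" using gauss_moments(2)[of 2] by simp
 have "abs(conv gauss1 sg g x) <= (LBINT z. abs(gauss1 z * (g (x + sg * z) - g x)))" unfolding e by (rule integral_abs_bound)
 also have "... <= (LBINT z. (L * sg) * (gauss z * z\<^sup>2))"
 proof (rule integral_mono)
  fix z
  have "abs(gauss1 z) * abs(g (x + sg * z) - g x) <= abs(gauss1 z) * (L * abs(sg * z))"
   using L(2)[of "x + sg * z" x] by (intro mult_left_mono) auto
  also have "... = (L * sg) * (gauss z * (abs(z) * abs(z)))" using s by (simp add: gauss1_def abs_mult mult_ac)
  finally show "abs(gauss1 z * (g (x + sg * z) - g x)) <= (L * sg) * (gauss z * z\<^sup>2)" by (simp add: abs_mult power2_eq_square)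
 qed (intro integrable_abs i2 imultr i3)+
 also have "... = L * sg" using gauss_second_moment by simp
 finally show ?thesis using s by (simp add: heat_x_def sg_def[symmetric] divide_le_eq)
qed

lemma duhamel_le:
 assumes "(NN ta. ind {0<..<t} ta * en (abs(X (t - ta) (%y. h (y, ta)) x))) <= en N" "0 <= N"
 shows "abs(duhamel X h (x, t)) <= N"
proof (cases "Lint (%ta. ind {0<..<t} ta * X (t - ta) (%y. h (y, ta)) x)")
 case True
 have "en (norm (duhamel X h (x, t))) <= (NN ta. en (norm (ind {0<..<t} ta * X (t - ta) (%y. h (y, ta)) x)))"
  unfolding duhamel_def using integral_norm_bound_ennreal[OF True] by simp
 also have "... = (NN ta. ind {0<..<t} ta * en (abs(X (t - ta) (%y. h (y, ta)) x)))"
  by (intro nn_integral_cong) (auto simp: indicator_def)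
 finally have "en (norm (duhamel X h (x, t))) <= en N" using assms(1) by (rule order_trans)
 thus ?thesis using assms(2) by simp
next
 case False thus ?thesis using assms(2) by (simp add: duhamel_def not_integrable_integral_eq)
qed

lemma duhamel_x_bound:
 assumes h: "h \<in> BM" "!!z. abs(h z) <= 1" and t: "0 < t"
 shows "(NN ta. ind {0<..<t} ta * en (abs(heat_x (t - ta) (%y. h (y, ta)) x))) <= en (2 * sqrt t)"
proof -
 have [measurable]: "h \<in> BM" by (rule h)
 have hs: "(%y. h (y, ta)) \<in> BM" "!!y. abs(h (y, ta)) <= 1" for ta using h(2) by measurable
 have "(NN ta. ind {0<..<t} ta * en (abs(heat_x (t - ta) (%y. h (y, ta)) x)))
  <= (NN ta. ind {0<..<t} ta * en ((t - ta) powr (1/2 - 1)))"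
  using heat_x_bound[OF hs] by (intro nn_integral_mono) (auto simp: indicator_def intro!: ennreal_leI)
 also have "... = en (t powr (1/2) / (1/2))" using t by (intro time_power_integral) auto
 also have "t powr (1/2) / (1/2) = 2 * sqrt t" using t by (simp add: powr_half_sqrt)
 finally show ?thesis .
qed

context testfun
begin

lemma test_integrable:
 assumes f: "f \<in> BM" "(NN z. en (abs(ind (cylinder T) z * f z) powr q)) < \<infinity>" "1 <= q"
  and d: "d \<in> BM" "!!z. abs(d z) <= M" "!!x t. \<not> (0 < x \<and> x < 1 \<and> 0 < t \<and> t < T) ==> d (x, t) = 0"
 shows "Lint (%z. f z * d z)" "(LINT z|lebesgue_on (cylinder T). f z * d z) = (LBINT z. f z * d z)"
proof -
 have [measurable]: "cylinder T \<in> sets borel" "f \<in> BM" "d \<in> BM" by (rule cylinder_sets f d)+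
 have 0: "d z = 0" if "z \<notin> cylinder T" for z using d(3)[of "fst z" "snd z"] that by (cases z) (auto simp: cylinder_def Omega_def)
 have "Lint (%z. ind (cylinder T) z * f z)"
  by (rule Lq_integrable[OF _ _ cylinder_sets[of T] emeasure_cylinder_finite f(2,3)]) auto
 hence "Lint (%z. ind (cylinder T) z * f z * M)" by (rule imultl)
 then show "Lint (%z. f z * d z)"
 proof (rule ibound)
  show "AE z in lborel. norm (f z * d z) <= norm (ind (cylinder T) z * f z * M)"
  proof (rule AE_I2)
   fix z
   have "abs(d z) <= abs(M)" using d(2)[of z] by linarith
   then show "norm (f z * d z) <= norm (ind (cylinder T) z * f z * M)"
    using 0[of z] by (cases "z \<in> cylinder T") (auto simp: abs_mult intro!: mult_left_mono)
  qed
 qed measurable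
 have "(LINT z|lebesgue_on (cylinder T). f z * d z) = (LBINT z. ind (cylinder T) z * (f z * d z))"
  by (rule integral_lebesgue_on_borel[OF cylinder_sets]) measurable
 also have "... = (LBINT z. f z * d z)" by (rule integral_cong_refl) (use 0 in \<open>auto simp: indicator_def\<close>)
 finally show "(LINT z|lebesgue_on (cylinder T). f z * d z) = (LBINT z. f z * d z)" .
qed

end

text \<open>The exponent 1/(2q) makes the q-th power of the singular bound integrable. The equation for the time
derivative is obtained by duality, so that no derivative in time is ever computed.\<close>
lemma weak_solution:
 fixes \<psi> s :: "real => real" and h :: "pt => real"
 assumes q: "1 < q" and T: "0 < T"
  and psi: "\<psi> \<in> BM" "!!y. abs(\<psi> y) <= B" "0 <= l" "!!x y. abs(\<psi> x - \<psi> y) <= l * abs(x - y)"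
  and xx: "!!R. 0 < R ==> (NN t. ind {0<..<R} t * (NN x. ind {0<..<1} x * en (abs(heat_xx t \<psi> x) powr q))) < \<infinity>"
  and h: "h \<in> BM" "!!z. abs(h z) <= 1"
  and s: "!!t. 0 < t ==> t <= T ==> 0 <= s t \<and> s t <= 1"
  and K: "0 <= K" "!!x t. 0 < x ==> x < 1 ==> 0 < t ==> t <= T ==> x ~= s t ==>
   (NN ta. ind {0<..<t} ta * en (abs(heat_xx (t - ta) (%y. h (y, ta)) x))) <= en (K * abs(x - s t) powr - (1 / (2 * q)))"
 defines "u \<equiv> %z. heat (snd z) \<psi> (fst z) + duhamel heat h z"
 shows "u \<in> W21 q T"
  and "\<exists>ut \<in> Lq_space q (cylinder T). \<exists>uxx \<in> Lq_space q (cylinder T).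
    weak_t (cylinder T) u ut \<and> weak_xx (cylinder T) u uxx \<and> (\<forall>z. ut z - uxx z = h z)"
proof -
 let ?ex = "%f :: pt => real. (NN z. en (abs(ind (cylinder T) z * f z) powr q)) < \<infinity>"
 define p where "p = 1 / (2 * q)"
 have p: "0 <= p" "p < 1" "p * q = 1 / 2" using q by (auto simp: p_def divide_simps)
 have pq: "- p * q = - (1 / 2)" using p(3) by simp
 have q0: "0 < q" "1 <= q" using q by auto
 define w wx wxx :: "pt => real" where "w z = heat (snd z) \<psi> (fst z)" and "wx z = heat_x (snd z) \<psi> (fst z)" and "wxx z = heat_xx (snd z) \<psi> (fst z)" for z
 have mw: "w \<in> BM" "wx \<in> BM" "wxx \<in> BM"
  unfolding w_def[abs_def] wx_def[abs_def] wxx_def[abs_def] by (intro heat_joint_measurable psi; measurable)+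
 have Xm: "(%p::(pt)\<times>real. heat (snd (fst p) - snd p) (%y. h (y, snd p)) (fst (fst p))) \<in> BM"
  "(%p::(pt)\<times>real. heat_x (snd (fst p) - snd p) (%y. h (y, snd p)) (fst (fst p))) \<in> BM"
  "(%p::(pt)\<times>real. heat_xx (snd (fst p) - snd p) (%y. h (y, snd p)) (fst (fst p))) \<in> BM"
  by (intro heat_source_measurable h; measurable)+
 note mU = duhamel_measurable[OF Xm(1)] duhamel_measurable[OF Xm(2)] duhamel_measurable[OF Xm(3)]
 have "abs(w (x, t)) <= B" for x t using heat_bound[OF psi(1,2)] by (simp add: w_def)
 note qw = Lq_bounded[OF mw(1) this q0(1), where T = T]
 have "abs(wx (x, t)) <= l" if "0 < t" for x t using heat_x_lipschitz_bound[OF psi that] by (simp add: wx_def)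
 note qwx = Lq_bounded[OF mw(2) this q0(1), where T = T]
 have "(NN t. ind {0<..T} t * (NN x. ind {0<..<1} x * en (abs(wxx (x, t)) powr q)))
  <= (NN t. ind {0<..<T + 1} t * (NN x. ind {0<..<1} x * en (abs(heat_xx t \<psi> x) powr q)))"
  by (intro nn_integral_mono) (auto simp: wxx_def indicator_def)
 also have "... < \<infinity>" by (rule xx) (use T in simp)
 finally have "(NN t. ind {0<..T} t * (NN x. ind {0<..<1} x * en (abs(wxx (x, t)) powr q))) < \<infinity>" .
 note qwxx = Lq_intro[OF mw(3) this]
 have "abs(duhamel heat h (x, t)) <= T" if "0 < t" "t <= T" for x t using duhamel_bound(2)[OF h, of "(x, t)"] that by simp
 note qU = Lq_bounded[OF mU(1) this q0(1), where T = T]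
 have "abs(duhamel heat_x h (x, t)) <= 2 * sqrt T" if "0 < t" "t <= T" for x t
 proof -
  have "abs(duhamel heat_x h (x, t)) <= 2 * sqrt t"
   by (rule duhamel_le[where X = heat_x, OF duhamel_x_bound[OF h that(1), of x]]) (use that in simp)
  thus ?thesis using real_sqrt_le_mono[OF that(2)] by linarith
 qed
 note qUx = Lq_bounded[OF mU(2) this q0(1), where T = T]
 have "(NN x. ind {0<..<1} x * en (abs(duhamel heat_xx h (x, t)) powr q)) <= en (K powr q * 4)" if t: "0 < t" "t <= T" for t
 proof -
  have "(NN x. ind {0<..<1} x * en (abs(duhamel heat_xx h (x, t)) powr q))
   <= (NN x. en (K powr q) * (ind {0<..<1} x * en (abs(x - s t) powr - (1/2))))"
  proof (rule nn_integral_mono_AE)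
   show "AE x in lborel. ind {0<..<1} x * en (abs(duhamel heat_xx h (x, t)) powr q) <= en (K powr q) * (ind {0<..<1} x * en (abs(x - s t) powr - (1/2)))"
    using AE_lborel_singleton[of "s t"]
   proof eventually_elim
    case (elim x)
    show ?case
    proof (cases "0 < x \<and> x < 1")
    case True
    have "abs(duhamel heat_xx h (x, t)) <= K * abs(x - s t) powr - p"
    by (rule duhamel_le) (use K(2)[of x t] K(1) True t elim in \<open>auto simp: p_def\<close>)
    hence "abs(duhamel heat_xx h (x, t)) powr q <= (K * abs(x - s t) powr - p) powr q" using q0 by (intro powr_mono2) auto
    also have "... = K powr q * abs(x - s t) powr - (1/2)" unfolding powr_mult powr_powr pq ..
    finally show ?thesis using True by (simp add: ennreal_mult[symmetric] ennreal_leI)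
    qed (auto simp: indicator_def)
   qed
  qed
  also have "... = en (K powr q) * (NN x. ind {0<..<1} x * en (abs(x - s t) powr - (1/2)))"
   by (rule nn_integral_cmult) measurable
  also have "... <= en (K powr q) * en (2 / (1 - 1/2))"
   using s[OF t] by (intro mult_left_mono abs_powr_integral) auto
  also have "... = en (K powr q * 4)" by (simp add: ennreal_mult)
  finally show ?thesis .
 qed
 note qUxx = Lq_intro[OF mU(3) slices_finite[OF this]]
 define ux uxx where "ux z = wx z + duhamel heat_x h z" and "uxx z = wxx z + duhamel heat_xx h z" for z
 define ut where "ut z = uxx z + h z" for z
 have qh: "?ex h" "h \<in> Lq_space q (cylinder T)" by (rule Lq_bounded[OF h(1) h(2) q0(1)])+
 have u: "u = (%z. w z + duhamel heat h z)" by (simp add: u_def w_def[abs_def])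
 have Lu: "u \<in> Lq_space q (cylinder T)" unfolding u by (rule Lq_add[OF qw(2) qU(2) q0(2)])
 have Lx: "ux \<in> Lq_space q (cylinder T)" unfolding ux_def[abs_def] by (rule Lq_add[OF qwx(2) qUx(2) q0(2)])
 have Lxx: "uxx \<in> Lq_space q (cylinder T)" unfolding uxx_def[abs_def] by (rule Lq_add[OF qwxx(2) qUxx(2) q0(2)])
 have Lt: "ut \<in> Lq_space q (cylinder T)" unfolding ut_def[abs_def] by (rule Lq_add[OF Lxx qh(2) q0(2)])
 have weak: "(LINT z|lebesgue_on (cylinder T). u z * partial_x e z) = - (LINT z|lebesgue_on (cylinder T). ux z * e z) \<and>
  (LINT z|lebesgue_on (cylinder T). u z * partial_x (partial_x e) z) = (LINT z|lebesgue_on (cylinder T). uxx z * e z) \<and>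
  (LINT z|lebesgue_on (cylinder T). u z * partial_t e z) = - (LINT z|lebesgue_on (cylinder T). ut z * e z)"
  if te: "e \<in> test_functions (interior (cylinder T))" for e
 proof -
  interpret testfun e "partial_x e" "partial_x (partial_x e)" "partial_t e" T by (rule testfun_intro[OF te])
  let ?ex1 = "partial_x e" and ?e2 = "partial_x (partial_x e)" and ?et = "partial_t e"
  obtain M where M: "0 <= M" "!!z. abs(e z) <= M" "!!z. abs(?ex1 z) <= M" "!!z. abs(?e2 z) <= M" "!!z. abs(?et z) <= M" by (rule test_bound) blast
  obtain M2 where M2: "0 <= M2" "!!z. abs(L z) <= M2" "L \<in> BM"
   "!!x t. \<not> (0 < x \<and> x < 1 \<and> 0 < t \<and> t < T) ==> L (x, t) = 0" by (rule L_props) blast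
  note z0 = zero[THEN conjunct1] and z1 = zero[THEN conjunct2, THEN conjunct1] and z2 = zero[THEN conjunct2, THEN conjunct2, THEN conjunct1] and z3 = zero[THEN conjunct2, THEN conjunct2, THEN conjunct2]
  have split: "Lint (%z. f z * d z) \<and> Lint (%z. g z * d z) \<and>
    (LINT z|lebesgue_on (cylinder T). (f z + g z) * d z) = (LBINT z. f z * d z) + (LBINT z. g z * d z)"
   if f: "f \<in> BM" "?ex f" and g: "g \<in> BM" "?ex g"
    and d: "d \<in> BM" "!!z. abs(d z) <= M'" "!!x t. \<not> (0 < x \<and> x < 1 \<and> 0 < t \<and> t < T) ==> d (x, t) = 0" for f g d M'
  proof -
   note a = test_integrable[OF f q0(2) d] and b = test_integrable[OF g q0(2) d]
   have [measurable]: "cylinder T \<in> sets borel" "f \<in> BM" "g \<in> BM" "d \<in> BM" by (rule cylinder_sets f g d)+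
   have "(LINT z|lebesgue_on (cylinder T). (f z + g z) * d z) = (LBINT z. ind (cylinder T) z * ((f z + g z) * d z))"
    by (rule integral_lebesgue_on_borel[OF cylinder_sets]) measurable
   also have "... = (LBINT z. f z * d z + g z * d z)"
   proof (rule integral_cong_refl)
    fix z show "ind (cylinder T) z * ((f z + g z) * d z) = f z * d z + g z * d z"
    using d(3)[of "fst z" "snd z"] by (cases z; cases "z \<in> cylinder T") (auto simp: cylinder_def Omega_def distrib_right)
   qed
   also have "... = (LBINT z. f z * d z) + (LBINT z. g z * d z)" by (rule intadd[OF a(1) b(1)])
   finally show ?thesis using a(1) b(1) by blast
  qed
  note s0 = split[OF _ _ _ _ e_measurable(1) M(2) z0]
  note sx = s0[OF mw(2) qwx(1) mU(2) qUx(1)] and sxx = s0[OF mw(3) qwxx(1) mU(3) qUxx(1)]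
  note u1 = split[OF mw(1) qw(1) mU(1) qU(1) e_measurable(2) M(3) z1]
  note u2 = split[OF mw(1) qw(1) mU(1) qU(1) e_measurable(3) M(4) z2]
  note u3 = split[OF mw(1) qw(1) mU(1) qU(1) e_measurable(4) M(5) z3]
  have w1: "(LBINT z. w z * ?ex1 z) = - (LBINT z. wx z * e z)"
  proof -
   have "(LBINT x. w (x, t) * ?ex1 (x, t)) = - (LBINT x. wx (x, t) * e (x, t))" for t
    using heat_slices(1)[of t \<psi> B t] psi zero[of _ t] by (cases "0 < t") (auto simp: w_def wx_def)
   thus ?thesis using plane_iterated[OF conjunct1[OF u1]] plane_iterated[OF conjunct1[OF sx]] by simp
  qed
  have w2: "(LBINT z. w z * ?e2 z) = (LBINT z. wxx z * e z)"
  proof -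
   have "(LBINT x. w (x, t) * ?e2 (x, t)) = (LBINT x. wxx (x, t) * e (x, t))" for t
    using heat_slices(2)[of t \<psi> B t] psi zero[of _ t] by (cases "0 < t") (auto simp: w_def wxx_def)
   thus ?thesis using plane_iterated[OF conjunct1[OF u2]] plane_iterated[OF conjunct1[OF sxx]] by simp
  qed
  have U1: "(LBINT z. duhamel heat h z * ?ex1 z) = (-1) * (LBINT z. duhamel heat_x h z * e z)"
  proof (rule duhamel_dual_space[OF h _ e_measurable(2) M(3) z1 Xm(2), where N = "%x t. 2 * sqrt t"])
   show "(LBINT x. heat r g x * ?ex1 (x, t)) = (-1) * (LBINT x. heat_x r g x * e (x, t))"
    if "0 < r" "g \<in> BM" "!!y. abs(g y) <= 1" for r g t using heat_slices(1)[OF that, of t] by simp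
  qed (use duhamel_x_bound[OF h] sx in auto)
  define N where "N x t = (if 0 < t \<and> t <= T then K * abs(x - s t) powr - p else 0)" for x t
  have U2: "(LBINT z. duhamel heat h z * ?e2 z) = 1 * (LBINT z. duhamel heat_xx h z * e z)"
  proof (rule duhamel_dual_space[OF h _ e_measurable(3) M(4) z2 Xm(3), where N = N])
   show "(LBINT x. heat r g x * ?e2 (x, t)) = 1 * (LBINT x. heat_xx r g x * e (x, t))"
    if "0 < r" "g \<in> BM" "!!y. abs(g y) <= 1" for r g t using heat_slices(2)[OF that, of t] by simp
   show "AE x in lborel. 0 < x \<longrightarrow> x < 1 \<longrightarrow> (NN ta. ind {0<..<t} ta * en (abs(heat_xx (t - ta) (%y. h (y, ta)) x))) <= en (N x t)"
    if t: "0 < t" "t < T" for t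
    using AE_lborel_singleton[of "s t"]
   proof eventually_elim
    case (elim x) then show ?case using K(2)[of x t] t by (auto simp: N_def p_def)
   qed
   show "Lint (%x. ind {0<..<1} x * N x t)" for t
   proof (cases "0 < t \<and> t <= T")
    case True
    have "Lint (%x. ind {0<..<1} x * abs(x - s t) powr - p)"
    unfolding integrable_iff_bounded
    proof
    have "(NN x. en (norm (ind {0<..<1} x * abs(x - s t) powr - p))) = (NN x. ind {0<..<1} x * en (abs(x - s t) powr - p))"
    by (intro nn_integral_cong) (auto simp: indicator_def)
    also have "... <= en (2 / (1 - p))" using s[of t] True p by (intro abs_powr_integral) auto
    also have "... < \<infinity>" by simp
    finally show "(NN x. en (norm (ind {0<..<1} x * abs(x - s t) powr - p))) < \<infinity>" .
    qed measurable
    hence "Lint (%x. K * (ind {0<..<1} x * abs(x - s t) powr - p))" by (rule imultr)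
    thus ?thesis using True by (simp add: N_def mult_ac)
   next
    case False hence "N x t = 0" for x by (auto simp: N_def)
    thus ?thesis by simp
   qed
  qed (use sxx in auto)
  note v = split[OF mw(1) qw(1) mU(1) qU(1) M2(3) M2(2) M2(4)]
  have "(LBINT z. w z * L z) = (LBINT z. w z * ?et z) + (LBINT z. w z * ?e2 z)"
   using u2 u3 unfolding L_def distrib_left by (intro intadd) auto
  hence wt: "(LBINT z. w z * ?et z) = - (LBINT z. wxx z * e z)"
   using initial_dual[OF psi(1,2)] w2 unfolding w_def by linarith
  have "(LBINT z. duhamel heat h z * L z) = (LBINT z. duhamel heat h z * ?et z) + (LBINT z. duhamel heat h z * ?e2 z)"
   using u2 u3 unfolding L_def distrib_left by (intro intadd) auto
  hence Ut: "(LBINT z. duhamel heat h z * ?et z) = - (LBINT z. h z * e z) - (LBINT z. duhamel heat_xx h z * e z)"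
   using duhamel_dual[OF h] U2 by linarith
  have h0: "(LINT z|lebesgue_on (cylinder T). ut z * e z) = (LBINT z. wxx z * e z) + (LBINT z. duhamel heat_xx h z * e z) + (LBINT z. h z * e z)"
  proof -
   have mx: "uxx \<in> BM" unfolding uxx_def[abs_def] by (intro borel_measurable_add mw(3) mU(3))
   have [measurable]: "cylinder T \<in> sets borel" "e \<in> BM" by (rule cylinder_sets e_measurable)+
   note c = sxx test_integrable(1)[OF h(1) qh(1) q0(2) e_measurable(1) M(2) z0]
   have "(LINT z|lebesgue_on (cylinder T). ut z * e z) = (LBINT z. ind (cylinder T) z * (ut z * e z))"
    unfolding ut_def by (intro integral_lebesgue_on_borel[OF cylinder_sets] borel_measurable_times borel_measurable_add mx h(1) e_measurable(1))
   also have "... = (LBINT z. wxx z * e z + duhamel heat_xx h z * e z + h z * e z)"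
   proof (rule integral_cong_refl)
    fix z show "ind (cylinder T) z * (ut z * e z) = wxx z * e z + duhamel heat_xx h z * e z + h z * e z"
    using z0[of "fst z" "snd z"] unfolding ut_def uxx_def
    by (cases z; cases "z \<in> cylinder T") (auto simp: cylinder_def Omega_def distrib_right)
   qed
   also have "... = (LBINT z. wxx z * e z) + (LBINT z. duhamel heat_xx h z * e z) + (LBINT z. h z * e z)"
    using c by (simp add: intadd)
   finally show ?thesis .
  qed
  show ?thesis
   using w1 w2 wt U1 U2 Ut h0 u1 u2 u3 sx sxx unfolding u ux_def uxx_def by simp
 qed
 have wt: "weak_t (cylinder T) u ut" and wx': "weak_x (cylinder T) u ux" and wxx': "weak_xx (cylinder T) u uxx"
  unfolding is_weak_deriv_def using weak by simp_all
 show "u \<in> W21 q T"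
  unfolding W21_def using Lu Lt Lx Lxx wt wx' wxx' by blast
 have "ut z - uxx z = h z" for z by (simp add: ut_def)
 then show "\<exists>ut \<in> Lq_space q (cylinder T). \<exists>uxx \<in> Lq_space q (cylinder T).
    weak_t (cylinder T) u ut \<and> weak_xx (cylinder T) u uxx \<and> (\<forall>z. ut z - uxx z = h z)"
  using Lt Lxx wt wxx' by blast
qed

lemma duhamel_difference:
 assumes h: "h \<in> BM" "!!z. abs(h z) <= 1" "k \<in> BM" "!!z. abs(k z) <= 1"
  and a: "0 < a" "0 <= c" "0 <= t"
  and d: "!!ta. 0 < ta ==> ta < t ==> abs(heat (t - ta) (%y. h (y, ta)) x - heat (t - ta) (%y. k (y, ta)) x') <= c * (t - ta) powr (a - 1)"
 shows "abs(duhamel heat h (x, t) - duhamel heat k (x', t)) <= c * (t powr a / a)"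
proof -
 let ?F = "%ta. ind {0<..<t} ta * heat (t - ta) (%y. h (y, ta)) x - ind {0<..<t} ta * heat (t - ta) (%y. k (y, ta)) x'"
 note i = duhamel_bound(1)[OF h(1,2)] duhamel_bound(1)[OF h(3,4)]
 have e: "duhamel heat h (x, t) - duhamel heat k (x', t) = (LBINT ta. ?F ta)"
  unfolding duhamel_def fst_conv snd_conv by (rule intdiff[symmetric, OF i])
 have "en (norm (LBINT ta. ?F ta)) <= (NN ta. en (norm (?F ta)))"
  by (rule integral_norm_bound_ennreal) (intro idiff i)
 also have "... <= (NN ta. en c * (ind {0<..<t} ta * en ((t - ta) powr (a - 1))))"
  using d a by (intro nn_integral_mono) (auto simp: indicator_def ennreal_mult[symmetric] intro!: ennreal_leI)
 also have "... = en c * en (t powr a / a)"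
  unfolding time_power_integral[OF a(1,3), symmetric] by (rule nn_integral_cmult) measurable
 also have "... = en (c * (t powr a / a))" using a by (subst ennreal_mult[symmetric]) auto
 finally show ?thesis unfolding e using a by simp
qed

lemma duhamel_lipschitz:
 assumes h: "h \<in> BM" "!!z. abs(h z) <= 1" and t: "0 <= t"
 shows "abs(duhamel heat h (x, t) - duhamel heat h (x', t)) <= 2 * var_const * sqrt t * abs(x - x')"
proof -
 have [measurable]: "h \<in> BM" by (rule h)
 have hs: "(%y. h (y, ta)) \<in> BM" "!!y. abs(h (y, ta)) <= 1" for ta using h(2) by measurable
 have v: "0 <= var_const" using var_const by linarith
 have "abs(duhamel heat h (x, t) - duhamel heat h (x', t)) <= (var_const * abs(x - x')) * (t powr (1/2) / (1/2))"
 proof (rule duhamel_difference[OF h h _ _ t])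
  fix ta assume ta: "0 < ta" "ta < t"
  have "abs(heat (t - ta) (%y. h (y, ta)) x - heat (t - ta) (%y. h (y, ta)) x') <= var_const * abs(x - x') * (1 / sqrt (2 * (t - ta)))"
   using heat_lipschitz[OF hs, of "t - ta" ta x x'] ta by simp
  also have "... <= var_const * abs(x - x') * (1 / sqrt (t - ta))"
   using frac_le[of 1 1 "sqrt (t - ta)" "sqrt (2 * (t - ta))"] ta v by (intro mult_left_mono) auto
  also have "1 / sqrt (t - ta) = (t - ta) powr (- (1/2))" using ta by (simp only: powr_minus_divide powr_half_sqrt less_imp_le diff_gt_0_iff_gt)
  finally show "abs(heat (t - ta) (%y. h (y, ta)) x - heat (t - ta) (%y. h (y, ta)) x') <= var_const * abs(x - x') * (t - ta) powr (1/2 - 1)"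
   by simp
 qed (use v in auto)
 thus ?thesis using t by (simp add: powr_half_sqrt mult_ac)
qed

text \<open>Old sources are compared with the dilation bound for the Gaussian, recent ones contribute at most the elapsed
time.\<close>
lemma duhamel_time:
 assumes h: "h \<in> BM" "!!z. abs(h z) <= 1" and t: "0 <= t" "t <= t'" "t' <= 1"
 shows "abs(duhamel heat h (x, t') - duhamel heat h (x, t)) <= (2 * var_const + 1) * sqrt (t' - t)"
proof -
 have [measurable]: "h \<in> BM" by (rule h)
 have hs: "(%y. h (y, ta)) \<in> BM" "!!y. abs(h (y, ta)) <= 1" for ta using h(2) by measurable
 have v: "0 <= var_const" using var_const by linarith
 define D where "D = sqrt (t' - t)"
 have D: "0 <= D" "t' - t <= D"
 proof -
  have "(t' - t) * (t' - t) <= (t' - t) * 1" using t by (intro mult_left_mono) auto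
  then show "t' - t <= D" unfolding D_def by (intro real_le_rsqrt) (simp add: power2_eq_square)
 qed (use t in \<open>simp add: D_def\<close>)
 let ?F = "%ta. ind {0<..<t'} ta * heat (t' - ta) (%y. h (y, ta)) x - ind {0<..<t} ta * heat (t - ta) (%y. h (y, ta)) x"
 let ?G = "%ta. en (var_const * D) * (ind {0<..<t} ta * en ((t - ta) powr (1/2 - 1)))"
 note i = duhamel_bound(1)[OF h]
 have e: "duhamel heat h (x, t') - duhamel heat h (x, t) = (LBINT ta. ?F ta)"
  unfolding duhamel_def fst_conv snd_conv by (rule intdiff[symmetric, OF i i])
 have "en (norm (LBINT ta. ?F ta)) <= (NN ta. en (norm (?F ta)))"
  by (rule integral_norm_bound_ennreal) (intro idiff i)
 also have "... <= (NN ta. ?G ta + ind {t..<t'} ta)"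
 proof (rule nn_integral_mono)
  fix ta
  show "en (norm (?F ta)) <= ?G ta + ind {t..<t'} ta"
  proof (cases "0 < ta \<and> ta < t")
   case True
   have "abs(heat (t - ta) (%y. h (y, ta)) x - heat (t' - ta) (%y. h (y, ta)) x) <= var_const * sqrt ((t' - ta - (t - ta)) / (t' - ta))"
    by (rule heat_time_continuity[OF hs]) (use True t in auto)
   also have "... = var_const * D * (1 / sqrt (t' - ta))" by (simp add: D_def real_sqrt_divide)
   also have "... <= var_const * D * (1 / sqrt (t - ta))"
    using frac_le[of 1 1 "sqrt (t - ta)" "sqrt (t' - ta)"] True t v D by (intro mult_left_mono) auto
   also have "1 / sqrt (t - ta) = (t - ta) powr (- (1/2))" using True by (simp only: powr_minus_divide powr_half_sqrt less_imp_le diff_gt_0_iff_gt)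
   finally have "abs(heat (t' - ta) (%y. h (y, ta)) x - heat (t - ta) (%y. h (y, ta)) x) <= var_const * D * (t - ta) powr (1/2 - 1)"
    by (simp add: abs_minus_commute)
   thus ?thesis using True t v D by (simp add: indicator_def ennreal_mult[symmetric] ennreal_leI)
  next
   case False
   thus ?thesis using heat_bound[OF hs, of "t' - ta" ta x] t by (auto simp: indicator_def intro!: ennreal_leI)
  qed
 qed
 also have "... = integral\<^sup>N lborel ?G + en (t' - t)" using t by (subst nn_integral_add) auto
 also have "integral\<^sup>N lborel ?G = en (var_const * D) * en (t powr (1/2) / (1/2))"
  by (subst nn_integral_cmult) (measurable, subst time_power_integral, use t in auto)
 also have "en (var_const * D) * en (t powr (1/2) / (1/2)) + en (t' - t) = en (var_const * D * (2 * sqrt t) + (t' - t))"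
  using v D t by (simp add: ennreal_mult[symmetric] ennreal_plus[symmetric] powr_half_sqrt mult_ac del: ennreal_plus)
 also have "... <= en ((2 * var_const + 1) * D)"
 proof (rule ennreal_leI)
  have "var_const * D * (2 * sqrt t) <= var_const * D * 2" using v D t by (intro mult_left_mono) auto
  then show "var_const * D * (2 * sqrt t) + (t' - t) <= (2 * var_const + 1) * D" using D(2) by (simp add: algebra_simps)
 qed
 finally show ?thesis unfolding e D_def[symmetric] using v D by simp
qed

section \<open>The heat flow of the initial state\<close>

locale lipschitz_state =
 fixes \<psi> :: "real => real" and B L :: real
 assumes psi: "\<psi> \<in> BM" "!!y. abs(\<psi> y) <= B" "0 <= L" "!!x y. abs(\<psi> x - \<psi> y) <= L * abs(x - y)"
begin

lemma heat_difference:
 assumes "!!z. \<psi> (x + sqrt (2 * t) * z) - \<psi> (x' + sqrt (2 * t') * z) <= A + C * z\<^sup>2 + D * abs(z)" "0 <= D"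
 shows "heat t \<psi> x - heat t' \<psi> x' <= A + C + D"
proof -
 note i = conv_integrable[OF gauss_integrable(1) psi(1,2)]
 have j: "Lint (%z. gauss z * z\<^sup>2)" "Lint (%z. gauss z * abs(z))" using gauss_moments(2)[of 2] gauss_moments(2)[of 1] by simp_all
 have "heat t \<psi> x - heat t' \<psi> x' = (LBINT z. gauss z * \<psi> (x + sqrt (2 * t) * z) - gauss z * \<psi> (x' + sqrt (2 * t') * z))"
  unfolding heat_def conv_def by (rule intdiff[symmetric, OF i i])
 also have "... <= (LBINT z. gauss z * A + gauss z * z\<^sup>2 * C + gauss z * abs(z) * D)"
 proof (rule integral_mono)
  fix z show "gauss z * \<psi> (x + sqrt (2 * t) * z) - gauss z * \<psi> (x' + sqrt (2 * t') * z) <= gauss z * A + gauss z * z\<^sup>2 * C + gauss z * abs(z) * D"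
   using mult_left_mono[OF assms(1)[of z] less_imp_le[OF gauss_pos[of z]]] by (simp add: algebra_simps)
 qed (intro idiff iadd imultl i j gauss_integrable)+
 also have "... = A + C + (LBINT z. gauss z * abs(z)) * D"
  using gauss_integrable j gauss_second_moment by simp
 also have "... <= A + C + 1 * D" using assms(2) by (intro add_left_mono mult_right_mono gauss_abs_moment)
 finally show ?thesis by simp
qed

lemma heat_zero: "heat 0 \<psi> x = \<psi> x" using gauss_integrable by (simp add: heat_def conv_def)

lemma heat_state_lipschitz: "abs(heat t \<psi> x - heat t \<psi> x') <= L * abs(x - x')"
proof -
 have "heat t \<psi> x - heat t \<psi> x' <= L * abs(x - x') + 0 + 0" for x x'
 proof (rule heat_difference)
  fix z show "\<psi> (x + sqrt (2 * t) * z) - \<psi> (x' + sqrt (2 * t) * z) <= L * abs(x - x') + 0 * z\<^sup>2 + 0 * abs(z)"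
   using psi(4)[of "x + sqrt (2 * t) * z" "x' + sqrt (2 * t) * z"] by simp
 qed simp
 from this[of x x'] this[of x' x] show ?thesis by (simp add: abs_le_iff abs_minus_commute)
qed

lemma heat_state_time:
 assumes "0 <= t" "t <= t'"
 shows "abs(heat t' \<psi> x - heat t \<psi> x) <= L * sqrt (2 * (t' - t))"
proof -
 define D where "D = sqrt (2 * t') - sqrt (2 * t)"
 have D0: "0 <= D" using assms by (simp add: D_def)
 have D: "D <= sqrt (2 * (t' - t))"
  using sqrt_add_le_add_sqrt[of "2 * t" "2 * (t' - t)"] assms by (simp add: D_def algebra_simps)
 have b: "abs(\<psi> (x + sqrt (2 * t') * z) - \<psi> (x + sqrt (2 * t) * z)) <= 0 + 0 * z\<^sup>2 + (L * D) * abs(z)" for z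
 proof -
  have "(x + sqrt (2 * t') * z) - (x + sqrt (2 * t) * z) = D * z" by (simp add: D_def algebra_simps)
  thus ?thesis using psi(4)[of "x + sqrt (2 * t') * z" "x + sqrt (2 * t) * z"] D0 by (simp add: abs_mult mult_ac)
 qed
 have "heat t' \<psi> x - heat t \<psi> x <= 0 + 0 + L * D" "heat t \<psi> x - heat t' \<psi> x <= 0 + 0 + L * D"
  by (rule heat_difference; use b D0 psi(3) in \<open>auto simp: abs_le_iff\<close>)+
 hence "abs(heat t' \<psi> x - heat t \<psi> x) <= L * D" by linarith
 also have "... <= L * sqrt (2 * (t' - t))" using D psi(3) by (rule mult_left_mono)
 finally show ?thesis .
qed

text \<open>Gaussian mass that leaves the interval of monotonicity costs at most L per unit length and is estimated by the
second moment.\<close>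
lemma heat_state_slope:
 assumes rh: "0 < rh" "0 <= t" and m: "!!x y. b - rh <= x ==> x <= y ==> y <= b + rh ==> m * (y - x) <= \<psi> y - \<psi> x" "0 <= m"
  and x: "b - rh / 2 <= x" "x <= y" "y <= b + rh / 2"
 shows "(m - (m + L) * (8 * t / rh\<^sup>2)) * (y - x) <= heat t \<psi> y - heat t \<psi> x"
proof -
 have "heat t \<psi> x - heat t \<psi> y <= - (m * (y - x)) + ((m + L) * (y - x) * (8 * t / rh\<^sup>2)) + 0"
 proof (rule heat_difference)
  fix z
  let ?sg = "sqrt (2 * t)"
  have q: "0 <= (m + L) * (y - x)" using m(2) psi(3) x by simp
  show "\<psi> (x + ?sg * z) - \<psi> (y + ?sg * z) <= - (m * (y - x)) + ((m + L) * (y - x) * (8 * t / rh\<^sup>2)) * z\<^sup>2 + 0 * abs(z)"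
  proof (cases "abs(?sg * z) <= rh / 2")
   case True
   hence "m * ((y + ?sg * z) - (x + ?sg * z)) <= \<psi> (y + ?sg * z) - \<psi> (x + ?sg * z)" using x by (intro m) (auto simp: abs_le_iff)
   moreover have "0 <= ((m + L) * (y - x) * (8 * t / rh\<^sup>2)) * z\<^sup>2" using q rh by (intro mult_nonneg_nonneg[OF mult_nonneg_nonneg]) auto
   ultimately show ?thesis by simp
  next
   case False
   hence "(rh / 2)\<^sup>2 <= (abs(?sg * z))\<^sup>2" using rh by (intro power_mono) auto
   hence "rh\<^sup>2 / 4 <= 2 * t * z\<^sup>2" using rh by (simp add: power_mult_distrib power_divide)
   hence "1 <= (8 * t / rh\<^sup>2) * z\<^sup>2" using rh by (simp add: field_simps)
   hence "(m + L) * (y - x) * 1 <= (m + L) * (y - x) * ((8 * t / rh\<^sup>2) * z\<^sup>2)" using q by (rule mult_left_mono)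
   moreover have "\<psi> (x + ?sg * z) - \<psi> (y + ?sg * z) <= L * (y - x)"
    using psi(4)[of "x + ?sg * z" "y + ?sg * z"] x by (simp add: abs_le_iff)
   moreover have "(m + L) * (y - x) * 1 = m * (y - x) + L * (y - x)" by (simp add: algebra_simps)
   moreover have "(m + L) * (y - x) * ((8 * t / rh\<^sup>2) * z\<^sup>2) = ((m + L) * (y - x) * (8 * t / rh\<^sup>2)) * z\<^sup>2" by (simp only: mult.assoc)
   ultimately show ?thesis by linarith
  qed
 qed simp
 moreover have e: "(m - (m + L) * k) * (y - x) = m * (y - x) - (m + L) * (y - x) * k" for k by (simp add: algebra_simps)
 ultimately show ?thesis unfolding e by linarith
qed

end

section \<open>Dependence on the interphase boundary\<close>

text \<open>A window of length 2 meets at most three periods of the folding map, hence six intervals.\<close>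
lemma fold_strip_measure:
 assumes "0 <= de" "hi - lo <= de"
 shows "emeasure lborel ({y. lo < fold01 y \<and> fold01 y <= hi} \<inter> {c - 1<..<c + 1}) <= en (6 * de)"
proof -
 define m where "m = round (c / 2)"
 define I where "I k = {2 * of_int k + lo..2 * of_int k + hi} \<union> {2 * of_int k - hi..2 * of_int k - lo}" for k :: int
 have Ib: "emeasure lborel (I k) <= en (2 * de)" for k
 proof -
  have "emeasure lborel (I k) <= emeasure lborel {2 * of_int k + lo..2 * of_int k + hi} + emeasure lborel {2 * of_int k - hi..2 * of_int k - lo}"
   unfolding I_def by (rule emeasure_subadditive) auto
  also have "... <= en de + en de" by (intro add_mono) (cases "lo <= hi"; use assms in \<open>auto intro: ennreal_leI\<close>)+
  finally show ?thesis using assms by (simp add: ennreal_plus[symmetric] del: ennreal_plus)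
 qed
 have "{y. lo < fold01 y \<and> fold01 y <= hi} \<inter> {c - 1<..<c + 1} \<subseteq> I (m - 1) \<union> (I m \<union> I (m + 1))"
 proof
  fix y assume y: "y \<in> {y. lo < fold01 y \<and> fold01 y <= hi} \<inter> {c - 1<..<c + 1}"
  have yc: "c - 1 < y" "y < c + 1" using y by auto
  have "abs(of_int (round (y / 2)) - y / 2) <= 1 / 2" "abs(of_int m - c / 2) <= 1 / 2" unfolding m_def by (rule of_int_round_abs_le)+
  hence "abs(of_int (round (y / 2)) - of_int m) < (2::real)" using yc by linarith
  hence "abs(round (y / 2) - m) < 2" by linarith
  hence "round (y / 2) = m - 1 \<or> round (y / 2) = m \<or> round (y / 2) = m + 1" by linarith
  moreover have "y \<in> I (round (y / 2))" using y by (auto simp: I_def fold01_def abs_if split: if_splits)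
  ultimately show "y \<in> I (m - 1) \<union> (I m \<union> I (m + 1))" by auto
 qed
 hence "emeasure lborel ({y. lo < fold01 y \<and> fold01 y <= hi} \<inter> {c - 1<..<c + 1}) <= emeasure lborel (I (m - 1) \<union> (I m \<union> I (m + 1)))"
  by (intro emeasure_mono) (auto simp: I_def)
 also have "... <= emeasure lborel (I (m - 1)) + (emeasure lborel (I m) + emeasure lborel (I (m + 1)))"
  by (intro order_trans[OF emeasure_subadditive] add_left_mono emeasure_subadditive) (auto simp: I_def)
 also have "... <= en (2 * de) + (en (2 * de) + en (2 * de))" by (intro add_mono Ib)
 also have "... = en (6 * de)" using assms by (simp add: ennreal_plus[symmetric] del: ennreal_plus)
 finally show ?thesis .
qed

text \<open>Dominating the Gaussian by its averages over unit windows reduces the integral over the periodic strip to its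
measure in each window.\<close>
lemma heat_step_difference:
 assumes r: "0 < r" "r <= 1" and de: "abs(a - a') <= de"
 shows "abs(heat r (%y. if fold01 y <= a then 1 else -1) x - heat r (%y. if fold01 y <= a' then 1 else -1) x) <= (36 * de) * r powr (1/2 - 1)"
proof -
 define sg where "sg = sqrt (2 * r)"
 have sg: "0 < sg" "sg <= 2" using r real_sqrt_le_mono[of "2 * r" 4] by (auto simp: sg_def)
 have d0: "0 <= de" using de by linarith
 define A where "A = {y. min a a' < fold01 y \<and> fold01 y <= max a a'}"
 note [measurable] = fold01_measurable
 have Am [measurable]: "A \<in> sets borel" unfolding A_def by measurable
 let ?k = "%a y. if fold01 y <= a then 1 else -1 :: real"
 have km: "?k a \<in> BM" "!!y. abs(?k a y) <= 1" for a by measurable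
 note i = conv_integrable[OF gauss_integrable(1) km]
 have inner: "(NN z. ind {z'-1/2<..<z'+1/2} z * ind A (x + sg * z)) <= en (6 * de / sg)" for z'
 proof -
  define c where "c = x + sg * z'"
  have "en sg * (NN z. ind {z'-1/2<..<z'+1/2} z * ind A (x + sg * z)) <= en (abs(sg)) * (NN z. ind (A \<inter> {c-1<..<c+1}) (x + sg * z))"
  proof (intro mult_mono nn_integral_mono)
   fix z
   have "abs(sg * (z - z')) < 1" if "z' - 1/2 < z" "z < z' + 1/2"
   proof -
    have a: "abs(sg) * abs(z - z') <= 2 * abs(z - z')" using sg by (intro mult_right_mono) auto
    have "abs(z - z') < 1/2" using that by linarith
    thus ?thesis unfolding abs_mult by (intro le_less_trans[OF a]) simp
   qed
   moreover have "x + sg * z - c = sg * (z - z')" by (simp add: c_def algebra_simps)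
   ultimately show "ind {z'-1/2<..<z'+1/2} z * ind A (x + sg * z) <= (ind (A \<inter> {c-1<..<c+1}) (x + sg * z) :: ennreal)"
    by (cases "z' - 1/2 < z \<and> z < z' + 1/2") (auto simp: indicator_def abs_less_iff)
  qed (use sg in auto)
  also have "... = (NN y. ind (A \<inter> {c-1<..<c+1}) y)"
   by (rule nn_integral_real_affine[symmetric]) (use sg in auto)
  also have "... = emeasure lborel (A \<inter> {c-1<..<c+1})" by (rule nn_integral_indicator) simp
  also have "... <= en (6 * de)" unfolding A_def by (rule fold_strip_measure) (use d0 de in auto)
  finally have "en (1 / sg) * (en sg * (NN z. ind {z'-1/2<..<z'+1/2} z * ind A (x + sg * z))) <= en (1 / sg) * en (6 * de)" by (rule mult_left_mono) simp
  thus ?thesis using sg d0 by (simp add: mult.assoc[symmetric] ennreal_mult[symmetric])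
 qed
 have pt: "en (gauss z) <= (NN z'. ind {z'-1/2<..<z'+1/2} z * en (2 * gauss (z' / sqrt 2)))" for z
 proof -
  have "en (gauss z) = (NN z'. en (gauss z) * ind {z-1/2<..<z+1/2} z')"
   by (subst nn_integral_cmult_indicator) auto
  also have "... <= (NN z'. ind {z'-1/2<..<z'+1/2} z * en (2 * gauss (z' / sqrt 2)))"
  proof (rule nn_integral_mono)
   fix z'
   have "gauss z <= 2 * gauss (z' / sqrt 2)" if z: "z - 1/2 < z'" "z' < z + 1/2"
   proof -
    have "z'\<^sup>2 <= (abs(z) + 1/2)\<^sup>2" using z by (intro iffD1[OF abs_le_square_iff]) linarith
    moreover have "0 <= (abs(z) - 1/2)\<^sup>2" by simp
    ultimately have "z'\<^sup>2 <= 2 * z\<^sup>2 + 1/2" by (simp add: power2_eq_square algebra_simps)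
    hence "- (z\<^sup>2 / 2) <= 1/8 - z'\<^sup>2 / 4" by simp
    hence "exp (- (z\<^sup>2 / 2)) <= exp (1/8) * exp (- (z'\<^sup>2 / 4))" unfolding exp_add[symmetric] by simp
    also have "... <= 2 * exp (- (z'\<^sup>2 / 4))"
    using exp_bound[of "1/8"] by (intro mult_right_mono) (auto simp: power2_eq_square)
    finally have "1 / sqrt (2 * pi) * exp (- (z\<^sup>2 / 2)) <= 1 / sqrt (2 * pi) * (2 * exp (- (z'\<^sup>2 / 4)))" by (intro mult_left_mono) auto
    thus ?thesis by (simp add: std_normal_density_def power_divide)
   qed
   then show "en (gauss z) * ind {z-1/2<..<z+1/2} z' <= ind {z'-1/2<..<z'+1/2} z * en (2 * gauss (z' / sqrt 2))"
    by (cases "z - 1/2 < z' \<and> z' < z + 1/2") (auto simp: indicator_def intro!: ennreal_leI)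
  qed
  finally show ?thesis .
 qed
 have im: "(%p. ind {fst p-1/2<..<fst p+1/2} (snd p) :: ennreal) \<in> borel_measurable (borel :: (pt) measure)"
  unfolding indicator_def of_bool_def greaterThanLessThan_iff by measurable
 have im2: "(%z. ind {z'-1/2<..<z'+1/2} z :: ennreal) \<in> BM" "(%z'. ind {z'-1/2<..<z'+1/2} z :: ennreal) \<in> BM" for z z' :: real
  unfolding indicator_def of_bool_def greaterThanLessThan_iff by measurable
 note [measurable] = im im2
 have "(NN z. en (gauss z) * ind A (x + sg * z)) <= (NN z. NN z'. (ind {z'-1/2<..<z'+1/2} z * en (2 * gauss (z' / sqrt 2))) * ind A (x + sg * z))"
 proof (rule nn_integral_mono)
  fix z
  have "(NN z'. (ind {z'-1/2<..<z'+1/2} z * en (2 * gauss (z' / sqrt 2))) * ind A (x + sg * z)) = (NN z'. ind {z'-1/2<..<z'+1/2} z * en (2 * gauss (z' / sqrt 2))) * ind A (x + sg * z)"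
   by (rule nn_integral_multc) measurable
  then show "en (gauss z) * ind A (x + sg * z) <= (NN z'. (ind {z'-1/2<..<z'+1/2} z * en (2 * gauss (z' / sqrt 2))) * ind A (x + sg * z))"
   using pt[of z] by (simp add: mult_right_mono)
 qed
 also have "... = (NN z'. NN z. (ind {z'-1/2<..<z'+1/2} z * en (2 * gauss (z' / sqrt 2))) * ind A (x + sg * z))"
  by (rule nn_integral_swap) measurable
 also have "... <= (NN z'. en (12 * de / sg) * en (gauss (z' / sqrt 2)))"
 proof (rule nn_integral_mono)
  fix z'
  have "(NN z. (ind {z'-1/2<..<z'+1/2} z * en (2 * gauss (z' / sqrt 2))) * ind A (x + sg * z)) = (NN z. en (2 * gauss (z' / sqrt 2)) * (ind {z'-1/2<..<z'+1/2} z * ind A (x + sg * z)))"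
   by (simp only: mult_ac)
  also have "... = en (2 * gauss (z' / sqrt 2)) * (NN z. ind {z'-1/2<..<z'+1/2} z * ind A (x + sg * z))"
   by (rule nn_integral_cmult) measurable
  also have "... <= en (2 * gauss (z' / sqrt 2)) * en (6 * de / sg)" by (intro mult_left_mono inner) simp
  also have "... = en (12 * de / sg) * en (gauss (z' / sqrt 2))"
   using sg d0 less_imp_le[OF gauss_pos] by (simp add: ennreal_mult[symmetric])
  finally show "(NN z. (ind {z'-1/2<..<z'+1/2} z * en (2 * gauss (z' / sqrt 2))) * ind A (x + sg * z)) <= en (12 * de / sg) * en (gauss (z' / sqrt 2))" .
 qed
 also have "... = en (12 * de / sg) * en (sqrt 2)"
 proof -
  have "(NN z. en (gauss (z / sqrt 2))) = en (abs(sqrt 2)) * (NN z. en (gauss ((0 + sqrt 2 * z) / sqrt 2)))"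
   by (rule nn_integral_real_affine) auto
  also have "... = en (sqrt 2)" using gauss_integrable by (simp add: nn_integral_eq_integral less_imp_le[OF gauss_pos])
  finally show ?thesis by (subst nn_integral_cmult) auto
 qed
 finally have N: "(NN z. en (gauss z) * ind A (x + sg * z)) <= en (12 * de / sg * sqrt 2)"
  using sg d0 by (simp add: ennreal_mult[symmetric])
 have e: "heat r (?k a) x - heat r (?k a') x = (LBINT z. gauss z * ?k a (x + sg * z) - gauss z * ?k a' (x + sg * z))"
  unfolding heat_def conv_def sg_def[symmetric] by (rule intdiff[symmetric, OF i i])
 have "en (norm (LBINT z. gauss z * ?k a (x + sg * z) - gauss z * ?k a' (x + sg * z))) <= (NN z. en (norm (gauss z * ?k a (x + sg * z) - gauss z * ?k a' (x + sg * z))))"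
  by (rule integral_norm_bound_ennreal) (intro idiff i)
 also have "... <= (NN z. 2 * (en (gauss z) * ind A (x + sg * z)))"
 proof (rule nn_integral_mono)
  fix z
  have "norm (gauss z * ?k a (x + sg * z) - gauss z * ?k a' (x + sg * z)) = (if x + sg * z \<in> A then 2 * gauss z else 0)"
   using less_imp_le[OF gauss_pos[of z]] by (auto simp: A_def)
  then show "en (norm (gauss z * ?k a (x + sg * z) - gauss z * ?k a' (x + sg * z))) <= 2 * (en (gauss z) * ind A (x + sg * z))"
   using less_imp_le[OF gauss_pos[of z]] by (simp add: ennreal_mult)
 qed
 also have "... = 2 * (NN z. en (gauss z) * ind A (x + sg * z))" by (rule nn_integral_cmult) measurable
 also have "... <= 2 * en (12 * de / sg * sqrt 2)" by (intro mult_left_mono N) simp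
 also have "... = en (2 * (12 * de / sg * sqrt 2))" using sg d0 by (subst ennreal_mult) auto
 finally have "abs(heat r (?k a) x - heat r (?k a') x) <= 2 * (12 * de / sg * sqrt 2)"
  unfolding e using sg d0 by simp
 also have "... = 24 * de * (1 / sqrt r)" using r by (simp add: sg_def real_sqrt_mult)
 also have "... = 24 * de * r powr (- (1/2))" by (simp only: powr_minus_divide powr_half_sqrt[OF less_imp_le[OF r(1)]])
 also have "... <= 36 * de * r powr (1/2 - 1)" using d0 by (simp add: mult_right_mono)
 finally show ?thesis .
qed

text \<open>Interpolating between the trivial bound and the second difference bound leaves a power of r that is integrable
in time and a power of d above 1, enough for a vanishing derivative at the axis of symmetry.\<close>
lemma heat_even_flat:
 assumes g: "g \<in> BM" "!!y. abs(g y) <= 1" and e: "!!y. g (a + y) = g (a - y)" and r: "0 < r" and d: "0 <= d"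
 shows "heat r g (a - d) = heat r g (a + d)"
  "abs(heat r g (a + d) - heat r g a) <= var_const * d powr (3/2) * r powr (1/4 - 1)"
proof -
 have "heat r g (a - d) = abs(-1) *\<^sub>R (LBINT z. gauss (0 + (-1) * z) * g (a - d + sqrt (2 * r) * (0 + (-1) * z)))"
  unfolding heat_def conv_def by (rule lborel_integral_real_affine) simp
 also have "... = heat r g (a + d)"
  using e[of "- d - sqrt (2 * r) * z" for z] by (simp add: heat_def conv_def gauss_even algebra_simps)
 finally show m: "heat r g (a - d) = heat r g (a + d)" .
 let ?X = "abs(heat r g (a + d) - heat r g a)"
 have v: "4 <= var_const" by (rule var_const)
 have 1: "?X <= var_const" using heat_bound[OF g, of r "a + d"] heat_bound[OF g, of r a] v by linarith
 have 2: "?X <= var_const * (d\<^sup>2 / r)"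
 proof -
  have "2 * ?X = abs(heat r g (a + d) + heat r g (a - d) - 2 * heat r g a)"
  proof -
   have "z + z - 2 * w = 2 * (z - w)" for z w :: real by simp
   thus ?thesis unfolding m by (simp only: abs_mult abs_numeral)
  qed
  hence "2 * ?X <= var_const * d\<^sup>2 / (2 * r)" using heat_second_difference[OF g r d, of a] by simp
  moreover have "var_const * d\<^sup>2 / (2 * r) <= 2 * (var_const * (d\<^sup>2 / r))" using v r by (simp add: field_simps)
  ultimately have "2 * ?X <= 2 * (var_const * (d\<^sup>2 / r))" by (rule order_trans)
  thus ?thesis by simp
 qed
 define y where "y = d\<^sup>2 / r"
 have y0: "0 <= y" using r by (simp add: y_def)
 have "?X <= var_const * y powr (3/4)"
 proof (cases "y <= 1")
  case True
  hence "y <= y powr (3/4)" using y0 powr_mono'[of "3/4" 1 y] by simp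
  hence "var_const * y <= var_const * y powr (3/4)" using v by (intro mult_left_mono) auto
  thus ?thesis using 2[folded y_def] by linarith
 next
  case False
  hence "var_const * 1 <= var_const * y powr (3/4)" using v by (intro mult_left_mono ge_one_powr_ge_zero) auto
  thus ?thesis using 1 by linarith
 qed
 also have "y powr (3/4) = d powr (3/2) * r powr (1/4 - 1)"
 proof -
  have "(d\<^sup>2) powr (3/4) = d powr (3/2)" using d by (cases "d = 0") (simp_all add: powr_powr flip: powr_numeral)
  thus ?thesis using r by (simp add: y_def powr_divide powr_minus_divide)
 qed
 finally show "?X <= var_const * d powr (3/2) * r powr (1/4 - 1)" by (simp add: mult.assoc)
qed

lemma derivative_zero_if_flat:
 fixes f :: "real => real"
 assumes "!!y. y \<in> S ==> abs(f y - f a) <= C * abs(y - a) powr (3/2)"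
 shows "(f has_real_derivative 0) (at a within S)"
proof -
 have "((%y. (f y - f a) / (y - a)) \<longlongrightarrow> 0) (at a within S)"
 proof (rule Lim_null_comparison)
  show "\<forall>\<^sub>F y in at a within S. norm ((f y - f a) / (y - a)) <= abs(C) * sqrt (abs(y - a))"
   unfolding eventually_at_filter
  proof (rule always_eventually, intro allI impI)
   fix y assume y: "y ~= a" "y \<in> S"
   have "abs(f y - f a) <= abs(C) * abs(y - a) powr (3/2)"
    using assms[OF y(2)] mult_right_mono[OF abs_ge_self[of C] powr_ge_zero[of "abs(y - a)" "3/2"]] by linarith
   also have "abs(y - a) powr (3/2) = sqrt (abs(y - a)) * abs(y - a)"
    using y powr_add[of "abs(y - a)" "1/2" 1] by (simp add: powr_half_sqrt)
   finally show "norm ((f y - f a) / (y - a)) <= abs(C) * sqrt (abs(y - a))" using y by (simp add: abs_divide field_simps)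
  qed
  have "((%y. abs(C) * sqrt (abs(y - a))) \<longlongrightarrow> abs(C) * sqrt (abs(a - a))) (at a within S)" by (intro tendsto_intros)
  then show "((%y. abs(C) * sqrt (abs(y - a))) \<longlongrightarrow> 0) (at a within S)" by simp
 qed
 thus ?thesis by (simp add: has_field_derivative_iff)
qed

section \<open>The interphase boundary of a family of increasing profiles\<close>

text \<open>The supremum over all times up to t builds the memory of the hysteresis into the curve.\<close>
definition front :: "real set => real => (real => real => real) => real => real" where
 "front J \<alpha> v t = Sup {x \<in> J. \<exists>ta\<in>{0..t}. v x ta <= \<alpha>}"

lemma front_upper:
 assumes "x \<in> {l..r}" "ta \<in> {0..t}" "v x ta <= \<alpha>" shows "x <= front {l..r} \<alpha> v t"
 unfolding front_def by (rule cSup_upper) (use assms in \<open>auto intro: bdd_above_mono[OF bdd_above_Icc[of l r]]\<close>)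

lemma front_range:
 assumes "b \<in> {l..r}" "0 <= t" "v b 0 <= \<alpha>" shows "b <= front {l..r} \<alpha> v t" "front {l..r} \<alpha> v t <= r"
proof -
 show "b <= front {l..r} \<alpha> v t" by (rule front_upper[of _ _ _ 0]) (use assms in auto)
 show "front {l..r} \<alpha> v t <= r" unfolding front_def by (rule cSup_least) (use assms in fastforce)+
qed

text \<open>If the new profile is at most \<open>\<alpha> + \<epsilon>\<close> where the old one had reached
\<open>\<alpha>\<close>, then it is at most \<open>\<alpha>\<close> at distance \<open>\<epsilon> / c\<close>
to the left. Monotonicity, Hoelder continuity and contraction are instances.\<close>
lemma front_le:
 assumes b: "b \<in> {l..r}" "0 <= t'" "v' b 0 <= \<alpha>" "0 <= t" "v b 0 <= \<alpha>" and \<epsilon>: "0 <= \<epsilon>" and c: "0 < c"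
  and slope: "!!x y ta. x \<in> {l..r} ==> y \<in> {l..r} ==> x <= y ==> 0 <= ta ==> ta <= t' ==> c * (y - x) <= v' y ta - v' x ta"
  and close: "!!x ta. x \<in> {l..r} ==> 0 <= ta ==> ta <= t ==> v x ta <= \<alpha> ==> \<exists>ta'\<in>{0..t'}. v' x ta' <= \<alpha> + \<epsilon>"
 shows "front {l..r} \<alpha> v t <= front {l..r} \<alpha> v' t' + \<epsilon> / c"
 unfolding front_def[of _ _ v]
proof (rule cSup_least)
 show "{x \<in> {l..r}. \<exists>ta\<in>{0..t}. v x ta <= \<alpha>} ~= {}" using b by fastforce
 fix x assume "x \<in> {x \<in> {l..r}. \<exists>ta\<in>{0..t}. v x ta <= \<alpha>}"
 then obtain ta where x: "x \<in> {l..r}" and ta: "0 <= ta" "ta <= t" "v x ta <= \<alpha>" by auto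
 obtain ta' where ta': "ta' \<in> {0..t'}" "v' x ta' <= \<alpha> + \<epsilon>" using close[OF x ta] by auto
 have e: "0 <= \<epsilon> / c" using \<epsilon> c by simp
 show "x <= front {l..r} \<alpha> v' t' + \<epsilon> / c"
 proof (cases "b <= x - \<epsilon> / c")
  case True
  hence y: "x - \<epsilon> / c \<in> {l..r}" using b x e by auto
  have "c * (x - (x - \<epsilon> / c)) <= v' x ta' - v' (x - \<epsilon> / c) ta'" by (rule slope) (use y x e ta' in auto)
  hence "v' (x - \<epsilon> / c) ta' <= \<alpha>" using c ta'(2) by simp
  hence "x - \<epsilon> / c <= front {l..r} \<alpha> v' t'" using y ta'(1) by (intro front_upper)
  thus ?thesis by simp
 next
  case False thus ?thesis using front_range(1)[where v = v' and b = b, OF b(1-3)] by linarith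
 qed
qed

lemma front_sides:
 assumes b: "b \<in> {l..r}" "0 <= t" "v b 0 <= \<alpha>" and c: "0 < c"
  and slope: "!!x y ta. x \<in> {l..r} ==> y \<in> {l..r} ==> x <= y ==> 0 <= ta ==> ta <= t ==> c * (y - x) <= v y ta - v x ta"
  and x: "x \<in> {l..r}"
 shows "front {l..r} \<alpha> v t < x ==> 0 <= ta ==> ta <= t ==> \<alpha> < v x ta"
  and "x < front {l..r} \<alpha> v t ==> \<exists>ta\<in>{0..t}. v x ta < \<alpha>"
proof -
 show "\<alpha> < v x ta" if "front {l..r} \<alpha> v t < x" "0 <= ta" "ta <= t"
  using front_upper[of x l r ta t v \<alpha>] that x by force
 assume "x < front {l..r} \<alpha> v t"
 then obtain y ta where y: "y \<in> {l..r}" "x < y" "ta \<in> {0..t}" "v y ta <= \<alpha>"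
  unfolding front_def using bexI[of "%ta. v b ta <= \<alpha>" 0 "{0..t}"] b by (subst (asm) less_cSup_iff) (auto intro: bdd_above_mono[OF bdd_above_Icc[of l r]])
 have "c * (y - x) <= v y ta - v x ta" by (rule slope) (use y x in auto)
 moreover have "0 < c * (y - x)" using c y by simp
 ultimately show "\<exists>ta\<in>{0..t}. v x ta < \<alpha>" using y by (intro bexI[of _ ta]) auto
qed

section \<open>Values of the hysteresis operator\<close>

text \<open>The last switching time exists because the switching times after t0 form a closed set; only the switching
values from t0 on matter.\<close>
lemma hysteresis_value:
 assumes x: "x \<in> Omega" and t: "0 <= t" "t <= T" and c: "continuous_on {0..T} (%ta. u (x, ta))"
  and t0: "t0 \<in> {0..t}" "(x, t0) \<in> switching_set \<alpha> \<beta> T u"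
  and v: "!!ta. t0 <= ta ==> ta <= t ==> (x, ta) \<in> switching_set \<alpha> \<beta> T u ==> switching_value \<alpha> p u (x, ta) = k"
 shows "hysteresis \<alpha> \<beta> T p u (x, t) = k"
proof (cases "(x, t) \<in> switching_set \<alpha> \<beta> T u")
 case True thus ?thesis using v[of t] t0 by (simp add: hysteresis_def)
next
 case False
 let ?S = "{ta \<in> {t0..t}. (x, ta) \<in> switching_set \<alpha> \<beta> T u}"
 have "?S = {t0} \<union> ({ta \<in> {t0..t}. u (x, ta) <= \<alpha>} \<union> {ta \<in> {t0..t}. \<beta> <= u (x, ta)})" if "0 < t0"
  using that t0 t x by (auto simp: switching_set_def cylinder_def)
 moreover have "?S = {0} \<union> ({ta \<in> {0..t}. u (x, ta) <= \<alpha>} \<union> {ta \<in> {0..t}. \<beta> <= u (x, ta)})" if "t0 = 0"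
  using that t0 t x by (auto simp: switching_set_def cylinder_def)
 moreover have "closed ({ta \<in> {t0..t}. u (x, ta) <= \<alpha>} \<union> {ta \<in> {t0..t}. \<beta> <= u (x, ta)})"
  using t0 t by (intro closed_Un continuous_on_closed_Collect_le continuous_on_subset[OF c] continuous_intros) auto
 ultimately have cl: "closed ?S" using t0(1) by (cases "t0 = 0") (auto intro: closed_insert)
 have bd: "bdd_above ?S" by (rule bdd_above_mono[OF bdd_above_Icc[of t0 t]]) auto
 have ne: "?S ~= {}" using t0 by auto
 have m: "Sup ?S \<in> ?S" by (rule closed_contains_Sup[OF ne bd cl])
 have "last_switch \<alpha> \<beta> T u (x, t) = Sup ?S"
  unfolding last_switch_def prod.case
 proof (rule Greatest_equality)
  show "Sup ?S <= t \<and> (x, Sup ?S) \<in> switching_set \<alpha> \<beta> T u" using m by auto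
  show "y <= Sup ?S" if "y <= t \<and> (x, y) \<in> switching_set \<alpha> \<beta> T u" for y
  proof (cases "t0 <= y")
   case True thus ?thesis using that bd by (intro cSup_upper) auto
  next
   case False thus ?thesis using m by auto
  qed
 qed
 thus ?thesis using False v[of "Sup ?S"] m by (simp add: hysteresis_def)
qed

section \<open>The fixed point\<close>

locale free_boundary = lipschitz_state +
 fixes b d rh \<alpha> \<beta> \<epsilon> T :: real
 assumes T: "0 < T" "T <= 1" and rh: "0 < rh" "0 < b - rh" "b + rh < 1" and d: "0 < d"
  and slope: "!!x y. b - rh <= x ==> x <= y ==> y <= b + rh ==> d / 2 * (y - x) <= \<psi> y - \<psi> x"
  and psib: "\<psi> b = \<alpha>" and sym: "!!y. \<psi> (0 + y) = \<psi> (0 - y)" "!!y. \<psi> (1 + y) = \<psi> (1 - y)"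
  and \<epsilon>: "0 < \<epsilon>" and low: "!!x. 0 <= x ==> x <= b + rh / 2 ==> \<psi> x <= \<beta> - \<epsilon>"
  and high: "!!x. b + rh / 2 <= x ==> x <= 1 ==> \<alpha> + \<epsilon> <= \<psi> x"
  and small: "d / 4 <= d / 2 - (d / 2 + L) * (8 * T / rh\<^sup>2) - 2 * var_const * sqrt T"
   "L * sqrt (2 * T) + T < \<epsilon>" "72 * sqrt T <= d / 8" "(L * sqrt 2 + 2 * var_const + 1) * sqrt T <= d / 4 * (rh / 4)"
begin

definition hs :: "(real => real) => pt => real" where "hs s z = (if fold01 (fst z) <= s (snd z) then 1 else -1 :: real)"
definition "v s x ta = heat ta \<psi> x + duhamel heat (hs s) (x, ta)"
definition "H = L * sqrt 2 + 2 * var_const + 1"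
abbreviation "J \<equiv> {b - rh / 2..b + rh / 2}"
abbreviation "c \<equiv> d / 4"
definition "F s t = front J \<alpha> (v s) (max 0 (min T t))"

lemma H: "0 <= H" using psi(3) var_const by (simp add: H_def)

lemma hs:
 assumes [measurable]: "s \<in> BM" shows "hs s \<in> BM" "abs(hs s z) <= 1"
proof -
 have [measurable]: "(%z::pt. fold01 (fst z)) \<in> BM" "(%z::pt. s (snd z)) \<in> BM"
  using fold01_measurable by measurable
 show "hs s \<in> BM" unfolding hs_def[abs_def] by measurable
qed (simp add: hs_def)

lemma v_initial: "v s x 0 = \<psi> x" by (simp add: v_def heat_zero duhamel_def)

context
 fixes s :: "real => real" assumes s: "s \<in> BM"
begin

lemma v_lipschitz: "0 <= ta ==> ta <= T ==> abs(v s x ta - v s y ta) <= (L + 2 * var_const) * abs(x - y)"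
proof -
 assume ta: "0 <= ta" "ta <= T"
 have "abs(duhamel heat (hs s) (x, ta) - duhamel heat (hs s) (y, ta)) <= 2 * var_const * sqrt ta * abs(x - y)"
  by (rule duhamel_lipschitz[OF hs[OF s] ta(1)])
 also have "... <= 2 * var_const * 1 * abs(x - y)" using var_const ta T by (intro mult_right_mono mult_left_mono) auto
 finally show ?thesis using heat_state_lipschitz[of ta x y] unfolding v_def by (simp add: distrib_right)
qed

lemma v_time:
 assumes "0 <= ta" "ta <= ta'" "ta' <= T" shows "abs(v s x ta' - v s x ta) <= H * sqrt (ta' - ta)"
proof -
 have "abs(duhamel heat (hs s) (x, ta') - duhamel heat (hs s) (x, ta)) <= (2 * var_const + 1) * sqrt (ta' - ta)"
  by (rule duhamel_time[OF hs[OF s]]) (use assms T in auto)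
 moreover have "abs(heat ta' \<psi> x - heat ta \<psi> x) <= L * sqrt 2 * sqrt (ta' - ta)"
  using heat_state_time[OF assms(1,2), of x] unfolding real_sqrt_mult[of 2 "ta' - ta"] by (simp only: mult.assoc)
 moreover have "H * sqrt (ta' - ta) = L * sqrt 2 * sqrt (ta' - ta) + (2 * var_const + 1) * sqrt (ta' - ta)" by (simp add: H_def algebra_simps)
 ultimately show ?thesis unfolding v_def by linarith
qed

lemma v_slope:
 assumes "x \<in> J" "y \<in> J" "x <= y" "0 <= ta" "ta <= T" shows "c * (y - x) <= v s y ta - v s x ta"
proof -
 have "(d / 2 - (d / 2 + L) * (8 * ta / rh\<^sup>2)) * (y - x) <= heat ta \<psi> y - heat ta \<psi> x"
  by (rule heat_state_slope[OF rh(1) assms(4) slope]) (use assms d in auto)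
 moreover have "abs(duhamel heat (hs s) (y, ta) - duhamel heat (hs s) (x, ta)) <= 2 * var_const * sqrt ta * (y - x)"
  using duhamel_lipschitz[OF hs[OF s] assms(4), of y x] assms by simp
 moreover have "c * (y - x) <= (d / 2 - (d / 2 + L) * (8 * ta / rh\<^sup>2) - 2 * var_const * sqrt ta) * (y - x)"
 proof (rule mult_right_mono)
  have "(d / 2 + L) * (8 * ta / rh\<^sup>2) <= (d / 2 + L) * (8 * T / rh\<^sup>2)" using assms d psi(3) by (intro mult_left_mono divide_right_mono) auto
  moreover have "2 * var_const * sqrt ta <= 2 * var_const * sqrt T" using assms var_const by (intro mult_left_mono) auto
  ultimately show "c <= d / 2 - (d / 2 + L) * (8 * ta / rh\<^sup>2) - 2 * var_const * sqrt ta" using small(1) by linarith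
 qed (use assms in simp)
 moreover have "(d / 2 - (d / 2 + L) * (8 * ta / rh\<^sup>2) - 2 * var_const * sqrt ta) * (y - x) = (d / 2 - (d / 2 + L) * (8 * ta / rh\<^sup>2)) * (y - x) - 2 * var_const * sqrt ta * (y - x)"
  by (rule left_diff_distrib)
 ultimately show ?thesis unfolding v_def by (simp add: abs_le_iff)
qed

lemma v_close:
 assumes "0 <= ta" "ta <= T" shows "abs(v s x ta - \<psi> x) < \<epsilon>"
proof -
 have "abs(heat ta \<psi> x - \<psi> x) <= L * sqrt (2 * ta)" using heat_state_time[of 0 ta x] assms by (simp add: heat_zero)
 moreover have "L * sqrt (2 * ta) <= L * sqrt (2 * T)" using assms psi(3) by (intro mult_left_mono) auto
 moreover have "abs(duhamel heat (hs s) (x, ta)) <= ta" using duhamel_bound(2)[OF hs[OF s], of "(x, ta)"] assms by simp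
 ultimately show ?thesis using small(2) assms unfolding v_def by linarith
qed

lemma b_in: "b \<in> J" "v s b 0 <= \<alpha>" using rh by (auto simp: v_initial psib)

lemma F_increment:
 assumes "t <= t'" shows "F s t <= F s t'" "F s t' <= F s t + H / c * sqrt (t' - t)"
proof -
 define p where "p = max 0 (min T t)"
 define p' where "p' = max 0 (min T t')"
 have t: "0 <= p" "p <= p'" "p' <= T" "p' - p <= t' - t" using assms T by (auto simp: p_def p'_def)
 have "front J \<alpha> (v s) p <= front J \<alpha> (v s) p' + 0 / c"
 proof (rule front_le[of b])
  show "\<exists>ta'\<in>{0..p'}. v s x ta' <= \<alpha> + 0" if "0 <= ta" "ta <= p" "v s x ta <= \<alpha>" for x ta
   by (rule bexI[of _ ta]) (use that t in auto)
  show "c * (y - x) <= v s y ta - v s x ta" if "x \<in> J" "y \<in> J" "x <= y" "0 <= ta" "ta <= p'" for x y ta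
   by (rule v_slope) (use that t in auto)
 qed (use b_in t d in auto)
 then show "F s t <= F s t'" by (simp add: F_def p_def p'_def)
 have "front J \<alpha> (v s) p' <= front J \<alpha> (v s) p + (H * sqrt (p' - p)) / c"
 proof (rule front_le[of b])
  show "\<exists>ta'\<in>{0..p}. v s x ta' <= \<alpha> + H * sqrt (p' - p)" if "0 <= ta" "ta <= p'" "v s x ta <= \<alpha>" for x ta
  proof (rule bexI[of _ "min ta p"])
   have "abs(v s x ta - v s x (min ta p)) <= H * sqrt (ta - min ta p)" by (rule v_time) (use that t in auto)
   also have "... <= H * sqrt (p' - p)" using that t by (intro mult_left_mono H real_sqrt_le_mono) auto
   finally show "v s x (min ta p) <= \<alpha> + H * sqrt (p' - p)" using that(3) by linarith
  qed (use that t in auto)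
  show "c * (y - x) <= v s y ta - v s x ta" if "x \<in> J" "y \<in> J" "x <= y" "0 <= ta" "ta <= p" for x y ta
   by (rule v_slope) (use that t in auto)
 qed (use b_in t d H in auto)
 also have "(H * sqrt (p' - p)) / c <= H / c * sqrt (t' - t)" using t H d by (simp add: divide_right_mono mult_left_mono)
 finally show "F s t' <= F s t + H / c * sqrt (t' - t)" by (simp add: F_def p_def p'_def)
qed

lemma F_holder: "abs(F s t - F s t') <= H / c * sqrt (abs(t - t'))"
 using F_increment[of t t'] F_increment[of t' t] H d by (cases "t <= t'") auto

lemma F_0: "F s 0 = b"
proof (rule antisym)
 show "F s 0 <= b" unfolding F_def front_def
 proof (rule cSup_least)
  show "{x \<in> J. \<exists>ta\<in>{0..max 0 (min T 0)}. v s x ta <= \<alpha>} ~= {}" using b_in T by (auto intro!: exI[of _ b])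
  fix x assume "x \<in> {x \<in> J. \<exists>ta\<in>{0..max 0 (min T 0)}. v s x ta <= \<alpha>}"
  hence x: "x \<in> J" "\<psi> x <= \<alpha>" using T by (auto simp: v_initial)
  show "x <= b"
  proof (rule ccontr)
   assume "\<not> x <= b"
   hence "d / 2 * (x - b) <= \<psi> x - \<psi> b" by (intro slope) (use x rh in auto)
   moreover have "0 < d / 2 * (x - b)" using \<open>\<not> x <= b\<close> d by (intro mult_pos_pos) auto
   ultimately show False using x psib by linarith
  qed
 qed
 show "b <= F s 0" unfolding F_def by (rule front_range(1)) (use b_in T in auto)
qed

lemma F_range: "b <= F s t" "F s t <= b + rh / 4"
proof -
 show "b <= F s t" unfolding F_def by (rule front_range(1)) (use b_in T in auto)
 define p where "p = max 0 (min T t)"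
 have p: "0 <= p" "p <= T" "F s t = F s p" using T by (auto simp: p_def F_def)
 have "F s t <= F s 0 + H / c * sqrt (p - 0)" unfolding p(3) by (rule F_increment) (rule p(1))
 also have "... <= b + H / c * sqrt T" unfolding F_0 using H d p by (intro add_left_mono mult_left_mono) auto
 also have "H / c * sqrt T <= rh / 4"
  unfolding times_divide_eq_left by (subst pos_divide_le_eq) (use small(4)[folded H_def] d in \<open>auto simp: mult.commute\<close>)
 finally show "F s t <= b + rh / 4" by simp
qed

end

lemma F_contraction:
 assumes s: "s \<in> BM" "s' \<in> BM" and de: "!!t. abs(s t - s' t) <= de"
 shows "abs(F s t - F s' t) <= de / 2"
proof -
 have d0: "0 <= de" using de[of 0] by linarith
 have V: "abs(v s x ta - v s' x ta) <= d / 8 * de" if ta: "0 <= ta" "ta <= T" for x ta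
 proof -
  have "abs(duhamel heat (hs s) (x, ta) - duhamel heat (hs s') (x, ta)) <= (36 * de) * (ta powr (1/2) / (1/2))"
   by (rule duhamel_difference[OF hs[OF s(1)] hs[OF s(2)]])
    (use ta T d0 in \<open>auto simp: hs_def intro!: heat_step_difference[OF _ _ de, simplified]\<close>)
  also have "... = (72 * sqrt ta) * de" using ta by (simp add: powr_half_sqrt)
  also have "... <= (72 * sqrt T) * de" using ta d0 by (intro mult_right_mono) auto
  also have "... <= d / 8 * de" using small(3) d0 by (rule mult_right_mono)
  finally show ?thesis by (simp add: v_def)
 qed
 have one: "F s t <= F s' t + de / 2" if "s \<in> BM" and s': "s' \<in> BM"
  and V: "!!x ta. 0 <= ta ==> ta <= T ==> abs(v s x ta - v s' x ta) <= d / 8 * de" for s s'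
 proof -
  have "F s t <= F s' t + (d / 8 * de) / c" unfolding F_def
  proof (rule front_le[of b])
   show "\<exists>ta'\<in>{0..max 0 (min T t)}. v s' x ta' <= \<alpha> + d / 8 * de" if "0 <= ta" "ta <= max 0 (min T t)" "v s x ta <= \<alpha>" for x ta
   proof -
    have "ta <= T" using that T by (auto simp: max_def min_def split: if_splits)
    hence "v s' x ta <= \<alpha> + d / 8 * de" using V[OF that(1), of x] that(3) by linarith
    thus ?thesis using that by auto
   qed
   show "c * (y - x) <= v s' y ta - v s' x ta" if "x \<in> J" "y \<in> J" "x <= y" "0 <= ta" "ta <= max 0 (min T t)" for x y ta
    by (rule v_slope[OF s']) (use that T in auto)
  qed (use b_in[OF s'] b_in[OF that(1)] d d0 T in auto)
  also have "(d / 8 * de) / c = de / 2" using d by simp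
  finally show ?thesis .
 qed
 have "F s t <= F s' t + de / 2" by (rule one[OF s V])
 moreover have "F s' t <= F s t + de / 2" by (rule one[OF s(2,1)]) (use V in \<open>simp add: abs_minus_commute\<close>)
 ultimately show ?thesis by linarith
qed

lemma F_fixed_point: obtains s where "s \<in> BM" "F s = s"
proof -
 define G where "G s = Bcontfun (F (apply_bcontfun s))" for s :: "real \<Rightarrow>\<^sub>C real"
 have m: "apply_bcontfun s \<in> BM" for s :: "real \<Rightarrow>\<^sub>C real"
  by (intro borel_measurable_continuous_onI) (use apply_bcontfun[of s] in \<open>auto simp: bcontfun_def\<close>)
 have B: "F (apply_bcontfun s) \<in> bcontfun" for s
 proof (rule bcontfun_normI)
  show "continuous_on UNIV (F (apply_bcontfun s))"
  proof (intro continuous_at_imp_continuous_on ballI)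
   fix t
   have "((%t'. F (apply_bcontfun s) t' - F (apply_bcontfun s) t) \<longlongrightarrow> 0) (at t)"
   proof (rule Lim_null_comparison)
    show "\<forall>\<^sub>F t' in at t. norm (F (apply_bcontfun s) t' - F (apply_bcontfun s) t) <= H / c * sqrt (abs(t' - t))"
    using F_holder[OF m] by simp
    have "((%t'. H / c * sqrt (abs(t' - t))) \<longlongrightarrow> H / c * sqrt (abs(t - t))) (at t)" by (intro tendsto_intros) (use d in auto)
    then show "((%t'. H / c * sqrt (abs(t' - t))) \<longlongrightarrow> 0) (at t)" by simp
   qed
   then show "isCont (F (apply_bcontfun s)) t" unfolding isCont_def by (subst LIM_zero_iff[symmetric])
  qed
  show "norm (F (apply_bcontfun s) t) <= 1" for t using F_range[OF m, of s t] rh by simp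
 qed
 have "\<exists>!s. G s = s"
 proof (rule banach_fix_type[of "1/2"])
  show "\<forall>s s'. dist (G s) (G s') <= 1/2 * dist s s'"
  proof (intro allI)
   fix s s'
   have "dist (F (apply_bcontfun s) t) (F (apply_bcontfun s') t) <= 1/2 * dist s s'" for t
    using F_contraction[OF m m, of s s' "dist s s'" t] dist_bounded[of s _ s'] by (simp add: dist_real_def)
   then show "dist (G s) (G s') <= 1/2 * dist s s'" by (intro dist_bound) (simp add: G_def Bcontfun_inverse B)
  qed
 qed auto
 then obtain s where s: "G s = s" by auto
 have "apply_bcontfun (G s) = F (apply_bcontfun s)" unfolding G_def by (rule Bcontfun_inverse[OF B])
 then show thesis using that[OF m[of s]] s by simp
qed

end

section \<open>The solution of the hysteresis problem\<close>

text \<open>The curve itself, where the source and the hysteresis term may differ, is negligible for the equation.\<close>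
lemma graph_null:
 assumes [measurable]: "s \<in> BM"
 shows "AE z in (lborel :: (pt) measure). fst z ~= s (snd z)"
proof -
 define G where "G = {z::pt. fst z = s (snd z)}"
 have [measurable]: "G \<in> sets borel" unfolding G_def by measurable
 have m: "(%p::pt. ind G (fst p, snd p) :: ennreal) \<in> BM" by simp
 have "emeasure lborel G = (NN z. ind G z)" by simp
 also have "... = (NN x. NN t. ind G (x, t))" by (rule nn_integral_plane) measurable
 also have "... = (NN t. NN x. ind G (x, t))" by (rule nn_integral_swap[OF m, symmetric])
 also have "... = (NN t. NN x. ind {s t} x)"
  by (intro nn_integral_cong) (auto simp: G_def indicator_def)
 also have "... = 0" by simp
 finally have "G \<in> null_sets lborel" by (simp add: null_sets_def)
 from AE_not_in[OF this] show ?thesis by (simp add: G_def)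
qed

context free_boundary
begin

text \<open>Near (x, t) the source equals its value there as long as the Gaussian does not reach the curve, which moves by
at most a multiple of sqrt (t - ta).\<close>
lemma duhamel_xx_bound:
 assumes s: "s \<in> BM" "F s = s" and p: "0 < p" "p <= 1" and t: "0 < t" "t <= T" and x: "0 < x" "x < 1" "x ~= s t"
 shows "(NN ta. ind {0<..<t} ta * en (abs(heat_xx (t - ta) (%y. hs s (y, ta)) x))) <= en ((2 + H / c) * gauss2_mass * (2 / p) * abs(x - s t) powr - p)"
proof -
 define A where "A = (2 + H / c) * gauss2_mass * abs(x - s t) powr - p"
 have A: "0 <= A" using H d gauss2_mass_nonneg by (simp add: A_def)
 have b: "abs(heat_xx (t - ta) (%y. hs s (y, ta)) x) <= A * (t - ta) powr (p / 2 - 1)" if ta: "0 < ta" "ta < t" for ta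
 proof -
  have st: "abs(s t - s ta) <= H / c * sqrt (t - ta)" using F_holder[OF s(1), of t ta] ta s(2) by simp
  have "abs(heat_xx (t - ta) (%y. hs s (y, ta)) x) <= (2 + H / c) * gauss2_mass * ((t - ta) powr (p / 2 - 1) * abs(x - s t) powr - p)"
  proof (rule heat_xx_near_constant[where c = "if x <= s t then 1 else -1"])
   show "(%y. hs s (y, ta)) \<in> BM" "!!y. abs(hs s (y, ta)) <= 1" using hs[OF s(1)] by measurable
   show "hs s (y, ta) = (if x <= s t then 1 else -1)" if "abs(y - x) + H / c * sqrt (t - ta) < abs(x - s t)" for y
    using that st fold01_lipschitz[of y x] fold01_abs[of x] x unfolding hs_def fst_conv snd_conv by (simp split: abs_split) linarith
  qed (use ta x p H d in auto)
  thus ?thesis by (simp add: A_def mult_ac)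
 qed
 have "(NN ta. ind {0<..<t} ta * en (abs(heat_xx (t - ta) (%y. hs s (y, ta)) x))) <= (NN ta. en A * (ind {0<..<t} ta * en ((t - ta) powr (p / 2 - 1))))"
  using b A by (intro nn_integral_mono) (auto simp: indicator_def ennreal_mult[symmetric] intro!: ennreal_leI)
 also have "... = en A * en (t powr (p / 2) / (p / 2))"
  by (subst nn_integral_cmult) (measurable, subst time_power_integral, use t p in auto)
 also have "... <= en A * en (2 / p)"
  using t T p powr_mono2[of "p / 2" t 1] by (intro mult_left_mono ennreal_leI) (auto simp: divide_right_mono)
 also have "... = en ((2 + H / c) * gauss2_mass * (2 / p) * abs(x - s t) powr - p)"
 proof -
  have "A * (2 / p) = (2 + H / c) * gauss2_mass * (2 / p) * abs(x - s t) powr - p" unfolding A_def by (simp only: mult_ac)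
  moreover have "en A * en (2 / p) = en (A * (2 / p))" by (rule ennreal_mult[symmetric]) (use A p in auto)
  ultimately show ?thesis by (simp only:)
 qed
 finally show ?thesis .
qed

lemma v_flat:
 assumes s: "s \<in> BM" and t: "0 < t" "t <= T" and a: "a = 0 \<or> a = 1"
 obtains C where "!!y. abs(v s y t - v s a t) <= C * abs(y - a) powr (3/2)"
proof -
 note hsm = hs[OF s]
 have hsl: "(%y. hs s (y, ta)) \<in> BM" "abs(hs s (y, ta)) <= 1" for ta y using hsm by measurable
 have fs: "fold01 (a + y) = fold01 (a - y)" for y using a fold01_minus[of y] fold01_one_minus[of y] fold01_one_minus[of "-y"] by auto
 have ps: "\<psi> (a + y) = \<psi> (a - y)" for y using a sym by auto
 define M where "M = abs(B) + 1"
 have "0 < M" "abs(\<psi> y) <= M" for y using psi(2)[of y] by (auto simp: M_def)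
 hence M: "0 < M" "!!y. abs(\<psi> y / M) <= 1" by (auto simp: abs_divide)
 have hM: "heat t \<psi> x = M * heat t (%y. \<psi> y / M) x" for x
  unfolding heat_def conv_def using M(1) by (subst integral_mult_right_zero[symmetric]) simp
 have one: "abs(v s (a + k * e) t - v s a t) <= ((M * t powr (1/4 - 1) + t powr (1/4) / (1/4)) * var_const) * e powr (3/2)"
  if e: "0 <= e" and k: "k = 1 \<or> k = -1" for e k :: real
 proof -
  have g: "abs(heat r g (a + k * e) - heat r g a) <= var_const * e powr (3/2) * r powr (1/4 - 1)"
   if "g \<in> BM" "!!y. abs(g y) <= 1" "!!y. g (a + y) = g (a - y)" "0 < r" for g r
   using heat_even_flat[OF that e] k by auto
  have "abs(heat t (%y. \<psi> y / M) (a + k * e) - heat t (%y. \<psi> y / M) a) <= var_const * e powr (3/2) * t powr (1/4 - 1)"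
   by (rule g) (use psi(1) M ps t in auto)
  hence "M * abs(heat t (%y. \<psi> y / M) (a + k * e) - heat t (%y. \<psi> y / M) a) <= M * (var_const * e powr (3/2) * t powr (1/4 - 1))"
   using M by (intro mult_left_mono) auto
  moreover have "abs(heat t \<psi> (a + k * e) - heat t \<psi> a) = M * abs(heat t (%y. \<psi> y / M) (a + k * e) - heat t (%y. \<psi> y / M) a)"
   unfolding hM right_diff_distrib[symmetric] abs_mult using M(1) by simp
  moreover have "abs(duhamel heat (hs s) (a + k * e, t) - duhamel heat (hs s) (a, t)) <= (var_const * e powr (3/2)) * (t powr (1/4) / (1/4))"
  proof (rule duhamel_difference[OF hsm hsm])
   show "abs(heat (t - ta) (%y. hs s (y, ta)) (a + k * e) - heat (t - ta) (%y. hs s (y, ta)) a) <= var_const * e powr (3/2) * (t - ta) powr (1/4 - 1)"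
    if "0 < ta" "ta < t" for ta by (rule g[OF hsl]) (use that in \<open>auto simp: hs_def fs\<close>)
  qed (use t var_const in auto)
  ultimately have "abs(v s (a + k * e) t - v s a t) <= M * (var_const * e powr (3/2) * t powr (1/4 - 1)) + (var_const * e powr (3/2)) * (t powr (1/4) / (1/4))"
   unfolding v_def by linarith
  thus ?thesis by (simp add: algebra_simps)
 qed
 show thesis
 proof (rule that)
  fix y show "abs(v s y t - v s a t) <= ((M * t powr (1/4 - 1) + t powr (1/4) / (1/4)) * var_const) * abs(y - a) powr (3/2)"
   using one[of "abs(y - a)" "if a <= y then 1 else -1"] by (cases "a <= y") auto
 qed
qed

lemma v_continuous:
 assumes s: "s \<in> BM"
 shows "continuous_on (UNIV \<times> {0..T}) (%z. v s (fst z) (snd z))"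
 unfolding continuous_on_def
proof
 fix z :: "pt" assume z: "z \<in> UNIV \<times> {0..T}"
 let ?g = "%w. (L + 2 * var_const) * abs(fst w - fst z) + H * sqrt (abs(snd w - snd z))"
 have "((%w. v s (fst w) (snd w) - v s (fst z) (snd z)) \<longlongrightarrow> 0) (at z within UNIV \<times> {0..T})"
 proof (rule Lim_null_comparison)
  show "\<forall>\<^sub>F w in at z within UNIV \<times> {0..T}. norm (v s (fst w) (snd w) - v s (fst z) (snd z)) <= ?g w"
   unfolding eventually_at_filter
  proof (rule always_eventually, intro allI impI)
   fix w :: "pt" assume w: "w \<in> UNIV \<times> {0..T}"
   have "abs(v s (fst w) (snd w) - v s (fst z) (snd w)) <= (L + 2 * var_const) * abs(fst w - fst z)"
    by (rule v_lipschitz[OF s]) (use w in auto)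
   moreover have "abs(v s (fst z) (snd w) - v s (fst z) (snd z)) <= H * sqrt (abs(snd w - snd z))"
   proof (cases "snd z <= snd w")
    case True thus ?thesis using v_time[OF s, of "snd z" "snd w" "fst z"] z w by auto
   next
    case False thus ?thesis using v_time[OF s, of "snd w" "snd z" "fst z"] z w by (auto simp: abs_minus_commute)
   qed
   ultimately show "norm (v s (fst w) (snd w) - v s (fst z) (snd z)) <= ?g w" by simp
  qed
  have "(?g \<longlongrightarrow> ?g z) (at z within UNIV \<times> {0..T})" by (intro tendsto_intros)
  then show "(?g \<longlongrightarrow> 0) (at z within UNIV \<times> {0..T})" by simp
 qed
 then show "((%w. v s (fst w) (snd w)) \<longlongrightarrow> v s (fst z) (snd z)) (at z within UNIV \<times> {0..T})" by (rule Lim_null[THEN iffD2])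
qed

text \<open>Left of the initial boundary phase I is inherited from time 0; between b and s(t) the threshold has been
crossed at a positive time, after which only the upper threshold could switch back.\<close>
lemma v_hysteresis:
 assumes s: "s \<in> BM" "F s = s" and u: "!!x t. u (x, t) = v s x t" and x: "0 < x" "x < 1" and t: "0 <= t" "t <= T"
  and p: "!!x. 0 < x ==> x < b ==> p x = 1" "!!x. b < x ==> x < 1 ==> p x = -1"
 shows "x < s t ==> hysteresis \<alpha> \<beta> T p u (x, t) = 1" "s t < x ==> hysteresis \<alpha> \<beta> T p u (x, t) = -1"
proof -
 have om: "x \<in> Omega" using x by (simp add: Omega_def)
 have ct: "continuous_on {0..T} (%ta. u (x, ta))"
 proof -
  have "continuous_on {0..T} (%ta. v s (fst (x, ta)) (snd (x, ta)))"
   by (rule continuous_on_compose2[OF v_continuous[OF s(1)]]) (auto intro!: continuous_intros)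
  thus ?thesis by (simp add: u)
 qed
 have fr: "s t = front J \<alpha> (v s) t" using fun_cong[OF s(2), of t] t by (simp add: F_def)
 note sides = front_sides[of b "b - rh / 2" "b + rh / 2" t "v s" \<alpha> c x]
 have pre: "b \<in> J" "v s b 0 <= \<alpha>" "0 < c" using b_in[OF s(1)] d by auto
 have sl: "c * (y' - y) <= v s y' ta - v s y ta" if "y \<in> J" "y' \<in> J" "y <= y'" "0 <= ta" "ta <= t" for y y' ta
  by (rule v_slope[OF s(1)]) (use that t in auto)
 have rng: "b <= s t" "s t <= b + rh / 4" using F_range[OF s(1), of t] s(2) by auto
 have z0: "(x, 0) \<in> switching_set \<alpha> \<beta> T u" using om by (simp add: switching_set_def)
 have sw: "switching_value \<alpha> p u (x, 0) = p x" by (simp add: switching_value_def)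
 show "hysteresis \<alpha> \<beta> T p u (x, t) = 1" if xs: "x < s t"
 proof -
  have lb: "u (x, ta) < \<beta>" if "0 <= ta" "ta <= T" for ta
   using v_close[OF s(1) that, of x] low[of x] x xs rng rh unfolding u by linarith
  have pos: "switching_value \<alpha> p u (x, ta) = 1" if "0 < ta" "ta <= t" "(x, ta) \<in> switching_set \<alpha> \<beta> T u" for ta
   using that lb[of ta] t by (auto simp: switching_set_def switching_value_def)
  show ?thesis
  proof (cases "x < b")
   case True
   show ?thesis
    by (rule hysteresis_value[OF om t ct _ z0]) (use t pos sw p(1)[OF x(1) True] in \<open>auto simp: le_less\<close>)
  next
   case False
   hence xJ: "x \<in> J" using xs rng rh by auto
   obtain ta where ta: "ta \<in> {0..t}" "v s x ta < \<alpha>" using sides(2)[OF pre(1) t(1) pre(2,3) sl xJ] xs fr by auto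
   have "0 <= d / 2 * (x - b)" using False d by simp
   also have "... <= \<psi> x - \<psi> b" by (rule slope) (use False xJ rh in auto)
   finally have "ta ~= 0" using ta(2) by (auto simp: v_initial psib)
   hence "(x, ta) \<in> switching_set \<alpha> \<beta> T u" using ta t om by (auto simp: switching_set_def cylinder_def u)
   thus ?thesis
    by (rule hysteresis_value[OF om t ct ta(1)]) (use pos ta(1) \<open>ta ~= 0\<close> in auto)
  qed
 qed
 show "hysteresis \<alpha> \<beta> T p u (x, t) = -1" if xs: "s t < x"
 proof -
  have ab: "\<alpha> < u (x, ta)" if ta: "0 <= ta" "ta <= t" for ta
  proof (cases "x <= b + rh / 2")
   case True
   hence xJ: "x \<in> J" using xs rng rh by auto
   show ?thesis unfolding u using sides(1)[OF pre(1) t(1) pre(2,3) sl xJ _ ta] xs fr by auto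
  next
   case False
   thus ?thesis unfolding u using v_close[OF s(1), of ta x] high[of x] x ta t by linarith
  qed
  have "switching_value \<alpha> p u (x, ta) = -1" if "0 <= ta" "ta <= t" for ta
   using ab[OF that] p(2)[of x] x xs rng by (auto simp: switching_value_def)
  thus ?thesis by (intro hysteresis_value[OF om t ct _ z0]) (use t in auto)
 qed
qed

lemma solution_exists:
 assumes q: "1 < q" and phi: "!!x. 0 < x ==> x < 1 ==> \<psi> x = \<phi> x"
  and xx: "!!R. 0 < R ==> (NN t. ind {0<..<R} t * (NN x. ind {0<..<1} x * en (abs(heat_xx t \<psi> x) powr q))) < \<infinity>"
  and p: "!!x. 0 < x ==> x < b ==> p x = 1" "!!x. b < x ==> x < 1 ==> p x = -1"
 shows "\<exists>u s. hysteresis_solution q \<alpha> \<beta> T \<phi> p u \<and> interphase_boundary \<alpha> \<beta> T p u b s \<and>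
    s ` {0..T} \<subseteq> {0<..<1} \<and> mono_on {0..T} s \<and> holder_on (1/2) {0..T} s"
proof -
 obtain s where s: "s \<in> BM" "F s = s" by (rule F_fixed_point)
 define u where "u z = heat (snd z) \<psi> (fst z) + duhamel heat (hs s) z" for z
 have u: "u (x, t) = v s x t" for x t by (simp add: u_def v_def)
 have rng: "b <= s t" "s t <= b + rh / 4" for t using F_range[OF s(1), of t] s(2) by auto
 define r where "r = 1 / (2 * q)"
 have r: "0 < r" "r <= 1" using q by (auto simp: r_def divide_simps)
 define K where "K = (2 + H / c) * gauss2_mass * (2 / r)"
 have K: "0 <= K" using H d gauss2_mass_nonneg r by (simp add: K_def)
 have sb: "0 <= s t \<and> s t <= 1" for t using rng[of t] rh by auto
 have ws: "u \<in> W21 q T" "\<exists>ut \<in> Lq_space q (cylinder T). \<exists>uxx \<in> Lq_space q (cylinder T).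
    weak_t (cylinder T) u ut \<and> weak_xx (cylinder T) u uxx \<and> (\<forall>z. ut z - uxx z = hs s z)"
  unfolding u_def[abs_def]
  by (rule weak_solution[OF q T(1) psi xx hs[OF s(1)] sb K duhamel_xx_bound[OF s r, folded K_def, unfolded r_def]]; assumption)+
 have hy: "hysteresis \<alpha> \<beta> T p u (x, t) = (if x <= s t then 1 else -1)" if "0 < x" "x < 1" "0 <= t" "t <= T" "x ~= s t" for x t
  using v_hysteresis[where u = u and p = p, OF s u that(1-4) p] that(5) by auto
 obtain ut uxx where w: "ut \<in> Lq_space q (cylinder T)" "uxx \<in> Lq_space q (cylinder T)"
  "weak_t (cylinder T) u ut" "weak_xx (cylinder T) u uxx" "!!z. ut z - uxx z = hs s z" using ws(2) by blast
 have "AE z in lborel. z \<in> cylinder T \<longrightarrow> ut z - uxx z = hysteresis \<alpha> \<beta> T p u z"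
  using graph_null[OF s(1)]
 proof eventually_elim
  case (elim z)
  show ?case
   using hy[of "fst z" "snd z"] elim fold01_abs[of "fst z"] by (cases z) (auto simp: w(5) hs_def cylinder_def Omega_def)
 qed
 hence "AE z in lebesgue. z \<in> cylinder T \<longrightarrow> ut z - uxx z = hysteresis \<alpha> \<beta> T p u z" by (rule AE_completion)
 hence ae: "AE z in lebesgue_on (cylinder T). ut z - uxx z = hysteresis \<alpha> \<beta> T p u z"
  by (subst AE_restrict_space_iff) (use cylinder_sets[of T] in auto)
 have "hysteresis_solution q \<alpha> \<beta> T \<phi> p u"
  unfolding hysteresis_solution_def
 proof (intro conjI ballI)
  show "continuous_on (closure (cylinder T)) u"
   unfolding closure_cylinder[OF T(1)]
   using continuous_on_subset[OF v_continuous[OF s(1)], of "{0..1} \<times> {0..T}"] by (auto simp: u[of "fst z" "snd z" for z, simplified] cong: continuous_on_cong_simp)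
  show "\<exists>ut\<in>Lq_space q (cylinder T). \<exists>uxx\<in>Lq_space q (cylinder T). weak_t (cylinder T) u ut \<and> weak_xx (cylinder T) u uxx \<and>
    (AE z in lebesgue_on (cylinder T). ut z - uxx z = hysteresis \<alpha> \<beta> T p u z)" using w ae by blast
  show "((%y. u (y, t)) has_real_derivative 0) (at x within closure Omega)" if "x \<in> frontier Omega" "t \<in> {0<..T}" for x t
  proof -
   have "x = 0 \<or> x = 1" using that(1) by (auto simp: Omega_def frontier_def)
   from v_flat[OF s(1) _ _ this, of t] that(2) obtain C where "!!y. abs(v s y t - v s x t) <= C * abs(y - x) powr (3/2)" by auto
   thus ?thesis by (intro derivative_zero_if_flat[of _ _ _ C]) (simp add: u)
  qed
  show "u (x, 0) = \<phi> x" if "x \<in> Omega" for x using that phi by (simp add: u v_initial Omega_def)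
 qed (rule ws(1))
 moreover have "interphase_boundary \<alpha> \<beta> T p u b s"
  unfolding interphase_boundary_def
 proof (intro conjI ballI allI impI)
  show "s 0 = b" using F_0[OF s(1)] s(2) by simp
  fix t x assume t: "t \<in> {0..T}"
  show "hysteresis \<alpha> \<beta> T p u (x, t) = 1" if "0 < x \<and> x < s t" using hy[of x t] that t rng[of t] rh by auto
  show "hysteresis \<alpha> \<beta> T p u (x, t) = -1" if "s t < x \<and> x < 1" using hy[of x t] that t rng[of t] rh by auto
 qed
 moreover have "s ` {0..T} \<subseteq> {0<..<1}"
 proof -
  have "0 < s t \<and> s t < 1" for t using rng[of t] rh by linarith
  thus ?thesis by auto
 qed
 moreover have "mono_on {0..T} s" using F_increment(1)[OF s(1)] s(2) by (auto intro!: mono_onI)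
 moreover have "holder_on (1/2) {0..T} s"
  unfolding holder_on_def using F_holder[OF s(1)] s(2) by (intro exI[of _ "H / c"]) (simp add: powr_half_sqrt)
 ultimately show ?thesis by blast
qed

end

theorem mainTheorem1:
  fixes \<alpha> \<beta> q b :: real and \<phi> p :: "real \<Rightarrow> real"
  assumes thresholds: "\<alpha> < 0" "0 < \<beta>"
    and q: "3 < q"
    and phi: "\<phi> \<in> trace_space q"
    and neumann: "(\<phi> has_real_derivative 0) (at 0 within {0..1})"
                 "(\<phi> has_real_derivative 0) (at 1 within {0..1})"
    and b: "0 < b" "b < 1"
    and phase: "initial_phase \<alpha> \<beta> \<phi> p"
    and phase_I: "\<And>x. 0 < x \<Longrightarrow> x < b \<Longrightarrow> p x = 1"
    and phase_II: "\<And>x. b < x \<Longrightarrow> x < 1 \<Longrightarrow> p x = -1"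
    and below: "\<And>x. 0 \<le> x \<Longrightarrow> x < b \<Longrightarrow> \<phi> x < \<beta>"
    and above: "\<And>x. b < x \<Longrightarrow> x \<le> 1 \<Longrightarrow> \<phi> x > \<alpha>"
    and phi_b: "\<phi> b = \<alpha>"
    and dphi_b: "\<exists>d>0. (\<phi> has_real_derivative d) (at b)"
  shows "\<exists>T>0. \<exists>u s. hysteresis_solution q \<alpha> \<beta> T \<phi> p u \<and>
           interphase_boundary \<alpha> \<beta> T p u b s \<and>
           s ` {0..T} \<subseteq> {0<..<1} \<and> mono_on {0..T} s \<and> holder_on (1/2) {0..T} s"
proof -
 have q1: "1 < q" using q by simp
 obtain d where d: "0 < d" "(\<phi> has_real_derivative d) (at b)" using dphi_b by auto
 obtain T0 G N where tr: "trace_control \<phi> q T0 G N"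
  apply (rule trace_bound[OF phi q1])
  subgoal premises prems for T F N by (rule that, rule trace_control.intro) (fact prems q)+
  done
 interpret tc: trace_control \<phi> q T0 G N by (rule tr)
 obtain rh0 where rh0: "0 < rh0" "0 < b - rh0" "b + rh0 < 1"
  "!!x y. b - rh0 <= x ==> x <= y ==> y <= b + rh0 ==> d / 2 * (y - x) <= \<phi> y - \<phi> x"
  by (rule tc.slope_near[OF b d]) (rule that)
 obtain L where L: "0 <= L" "!!x y. 0 <= x ==> x <= 1 ==> 0 <= y ==> y <= 1 ==> abs(\<phi> x - \<phi> y) <= L * abs(x - y)"
  by (rule tc.lipschitz) (rule that)
 define \<psi> where "\<psi> = tc.\<psi>"
 have fold: "\<psi> y = \<phi> (fold01 y)" for y by (simp add: \<psi>_def tc.\<psi>_def)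
 have psi01: "\<psi> x = \<phi> x" if "0 <= x" "x <= 1" for x using that fold01_abs[of x] by (simp add: fold)
 have Lpsi: "abs(\<psi> x - \<psi> y) <= L * abs(x - y)" for x y
 proof -
  have "abs(\<psi> x - \<psi> y) <= L * abs(fold01 x - fold01 y)" unfolding fold by (rule L(2)) (rule fold01_range)+
  also have "... <= L * abs(x - y)" by (rule mult_left_mono[OF fold01_lipschitz L(1)])
  finally show ?thesis .
 qed
 obtain B where B: "!!y. abs(tc.\<phi>c y) <= B" by (rule tc.\<phi>c_bounded) (rule that)
 have ls: "lipschitz_state \<psi> B L"
 proof
  show "\<psi> \<in> BM" unfolding \<psi>_def by (rule tc.\<psi>_measurable)
  show "abs(\<psi> y) <= B" for y using B[of "fold01 y"] unfolding \<psi>_def tc.\<psi>_eq .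
 qed (rule L(1) Lpsi)+
 interpret lipschitz_state \<psi> B L by (rule ls)
 have ab: "\<alpha> < \<beta>" using thresholds by simp
 define rh where "rh = min rh0 ((\<beta> - \<alpha>) / (L + 1))"
 have rh: "0 < rh" "rh <= rh0" "0 < b - rh" "b + rh < 1" using rh0 ab L(1) by (auto simp: rh_def)
 have Lrh: "L * rh <= \<beta> - \<alpha>"
 proof -
  have "L * rh <= (L + 1) * rh" using rh by (intro mult_right_mono) auto
  also have "... <= (L + 1) * ((\<beta> - \<alpha>) / (L + 1))" using L(1) by (intro mult_left_mono) (auto simp: rh_def)
  also have "... = \<beta> - \<alpha>" using L(1) by simp
  finally show ?thesis .
 qed
 have low: "\<phi> x < \<beta>" if "x \<in> {0..b + rh / 2}" for x
 proof (cases "x < b")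
  case False
  have "abs(\<phi> x - \<phi> b) <= L * abs(x - b)" by (rule L(2)) (use that b rh in auto)
  also have "... <= L * (rh / 2)" using that False L(1) by (intro mult_left_mono) auto
  finally show ?thesis using Lrh ab phi_b by linarith
 qed (use below that in auto)
 have "\<exists>m\<in>{0..b + rh / 2}. \<forall>x\<in>{0..b + rh / 2}. \<phi> x <= \<phi> m"
  by (rule continuous_attains_sup) (use b rh tc.cphi in \<open>auto intro: continuous_on_subset\<close>)
 then obtain m1 where m1: "m1 \<in> {0..b + rh / 2}" "!!x. x \<in> {0..b + rh / 2} ==> \<phi> x <= \<phi> m1" by auto
 have "\<exists>m\<in>{b + rh / 2..1}. \<forall>x\<in>{b + rh / 2..1}. \<phi> m <= \<phi> x"
  by (rule continuous_attains_inf) (use b rh tc.cphi in \<open>auto intro: continuous_on_subset\<close>)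
 then obtain m2 where m2: "m2 \<in> {b + rh / 2..1}" "!!x. x \<in> {b + rh / 2..1} ==> \<phi> m2 <= \<phi> x" by auto
 define \<epsilon> where "\<epsilon> = min (\<beta> - \<phi> m1) (\<phi> m2 - \<alpha>)"
 have \<epsilon>: "0 < \<epsilon>" using low[OF m1(1)] above[of m2] m2(1) rh by (auto simp: \<epsilon>_def)
 have lim: "((%T. d / 2 - (d / 2 + L) * (8 * T / rh\<^sup>2) - 2 * var_const * sqrt T) \<longlongrightarrow> d / 2 - (d / 2 + L) * (8 * 0 / rh\<^sup>2) - 2 * var_const * sqrt 0) (at_right 0)"
  "((%T. L * sqrt (2 * T) + T) \<longlongrightarrow> L * sqrt (2 * 0) + 0) (at_right 0)"
  "((%T. 72 * sqrt T) \<longlongrightarrow> 72 * sqrt 0) (at_right 0)"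
  "((%T. (L * sqrt 2 + 2 * var_const + 1) * sqrt T) \<longlongrightarrow> (L * sqrt 2 + 2 * var_const + 1) * sqrt 0) (at_right (0::real))"
  by (intro tendsto_intros; use rh in simp)+
 have "\<forall>\<^sub>F T in at_right 0. T \<in> {0<..<1} \<and> d / 4 < d / 2 - (d / 2 + L) * (8 * T / rh\<^sup>2) - 2 * var_const * sqrt T \<and>
   L * sqrt (2 * T) + T < \<epsilon> \<and> 72 * sqrt T < d / 8 \<and> (L * sqrt 2 + 2 * var_const + 1) * sqrt T < d / 4 * (rh / 4)"
 proof -
  have "0 < d / 4 * (rh / 4)" "0 < d / 8" "d / 4 < d / 2" using d rh by auto
  hence e: "\<forall>\<^sub>F T in at_right 0. d / 4 < d / 2 - (d / 2 + L) * (8 * T / rh\<^sup>2) - 2 * var_const * sqrt T"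
   "\<forall>\<^sub>F T in at_right 0. L * sqrt (2 * T) + T < \<epsilon>" "\<forall>\<^sub>F T in at_right 0. 72 * sqrt T < d / 8"
   "\<forall>\<^sub>F T in at_right 0. (L * sqrt 2 + 2 * var_const + 1) * sqrt T < d / 4 * (rh / 4)"
   using \<epsilon> by (intro order_tendstoD(1)[OF lim(1)] order_tendstoD(2)[OF lim(2)] order_tendstoD(2)[OF lim(3)] order_tendstoD(2)[OF lim(4)]; simp)+
  have "\<forall>\<^sub>F T in at_right 0. T \<in> {0<..<1::real}" by (rule eventually_at_right_real) simp
  with e show ?thesis by eventually_elim blast
 qed
 then obtain T where T: "0 < T" "T < 1" "d / 4 < d / 2 - (d / 2 + L) * (8 * T / rh\<^sup>2) - 2 * var_const * sqrt T"
   "L * sqrt (2 * T) + T < \<epsilon>" "72 * sqrt T < d / 8" "(L * sqrt 2 + 2 * var_const + 1) * sqrt T < d / 4 * (rh / 4)"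
  using eventually_happens'[OF trivial_limit_at_right_real] unfolding greaterThanLessThan_iff by blast
 interpret free_boundary \<psi> B L b d rh \<alpha> \<beta> \<epsilon> T
 proof
  show "d / 2 * (y - x) <= \<psi> y - \<psi> x" if "b - rh <= x" "x <= y" "y <= b + rh" for x y
   using rh0(4)[of x y] psi01[of x] psi01[of y] that rh by simp
  show "\<psi> b = \<alpha>" using psi01[of b] b phi_b by simp
  show "\<psi> (0 + y) = \<psi> (0 - y)" for y using fold01_minus[of y] by (simp add: fold)
  show "\<psi> (1 + y) = \<psi> (1 - y)" for y using fold01_one_minus[of y] fold01_one_minus[of "-y"] fold01_minus[of y] by (simp add: fold)
  show "\<psi> x <= \<beta> - \<epsilon>" if "0 <= x" "x <= b + rh / 2" for x using m1(2)[of x] psi01[of x] that rh by (auto simp: \<epsilon>_def)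
  show "\<alpha> + \<epsilon> <= \<psi> x" if "b + rh / 2 <= x" "x <= 1" for x using m2(2)[of x] psi01[of x] that rh b by (auto simp: \<epsilon>_def)
 qed (use T rh d \<epsilon> in \<open>auto intro: less_imp_le\<close>)
 have "(NN t. ind {0<..<R} t * (NN x. ind {0<..<1} x * en (abs(heat_xx t \<psi> x) powr q))) < \<infinity>" if "0 < R" for R
  by (rule heat_xx_Lq[OF psi(1,2) q1 that]) (use tc.besov[OF neumann] in \<open>simp add: tc.D2_def \<psi>_def\<close>)
 from solution_exists[OF q1 psi01 this phase_I phase_II] show ?thesis using T(1) by auto
qed

end
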